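(* There exists a constant $C_1>0$, independent of $\varepsilon$, such that for all $\varepsilon\in(0,\varepsilon_0]$ $$\|\mathcal R_\varepsilon \mathcal J_\varepsilon-\mathcal J_\varepsilon\mathcal R_0\|_{\mathcal H_0\to\mathcal H_\varepsilon}=\|\widetilde{\mathcal J}_\varepsilon\mathcal R_\varepsilon-\mathcal R_0\widetilde{\mathcal J}_\varepsilon\|_{\mathcal H_\varepsilon\to\mathcal H_0}\le C_1\,\varepsilon^{\min\{\alpha,\,1/2-\beta\}},$$ where $\mathcal R_\varepsilon=(\mathcal A_\varepsilon+\mathrm I)^{-1}$ and $\mathcal R_0=(\mathcal A_0+\mathrm I)^{-1}$.
   Context: Parameters. Fix $-\infty\le\ell_-<0<\ell_+\le\infty$, $\Omega_0=(\ell_-,\ell_+)\subset\mathbb R$, $\alpha>0$, $0<\beta<\tfrac12$, $\gamma>0$, a real-valued $V_0\in L^\infty(\Omega_0)$ with $V_0\ge0$, and $\varepsilon_0>0$ with $\varepsilon_0<\min\{(2\gamma)^{-1/\alpha},|\ell_-|,\ell_+\}$, $\varepsilon_0<\gamma^{-1/(\alpha+1-\beta)}$, $\varepsilon_0<\min\{\gamma,\gamma^{-1}\}$ (so $\varepsilon_0<1$). "Independent of $\varepsilon$" means: depending only on these fixed data. Domain. For $\varepsilon\in(0,\varepsilon_0]$ put $d_\varepsilon=\gamma\varepsilon^{\alpha+1}$, $h_\varepsilon=\varepsilon^\alpha$, $b_\varepsilon=\varepsilon^\beta$, and, writing $\mathbf x=(x_1,x_2)\in\mathbb R^2$, $S_\varepsilon=\Omega_0\times(-\varepsilon,0)$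 (strip), $P_\varepsilon=(-\tfrac{d_\varepsilon}2,\tfrac{d_\varepsilon}2)\times(0,h_\varepsilon)$ (passage), $R_\varepsilon=(-\tfrac{b_\varepsilon}2,\tfrac{b_\varepsilon}2)\times(h_\varepsilon,h_\varepsilon+b_\varepsilon)$ (room), $\Omega_\varepsilon=\operatorname{int}(\overline{S_\varepsilon\cup P_\varepsilon\cup R_\varepsilon})$. Operators. $\mathcal H_\varepsilon=L^2(\Omega_\varepsilon)$; $V_\varepsilon(\mathbf x)=V_0(x_1)$ on $S_\varepsilon$ and $V_\varepsilon=0$ on $P_\varepsilon\cup R_\varepsilon$; $\mathcal A_\varepsilon$ is the non-negative self-adjoint operator in $\mathcal H_\varepsilon$ associated with the closed form $\mathfrak a_\varepsilon[u,v]=\int_{\Omega_\varepsilon}(\nabla u\cdot\overline{\nabla v}+V_\varepsilon u\overline v)\,d\mathbf x$, $\operatorname{dom}(\mathfrak a_\varepsilon)=H^1(\Omega_\varepsilon)$ (i.e. Neumann Laplacian plus $V_\varepsilon$). $\mathcal H_0=L^2(\Omega_0)\oplus\mathbb C$ with $(f,g)_{\mathcal H_0}=\int_{\Omega_0}f_1\overline{g_1}\,dx+f_2\overline{g_2}$; $\mathcal A_0$ is the non-negative self-adjoint operator in $\mathcal H_0$ associated with the closed form $\mathfrak a_0[f,g]=\int_{\Omega_0}(f_1'\overline{g_1'}+V_0f_1\overline{g_1})\,dx+\gamma f_1(0)\overline{g_1(0)}$, $\operatorname{dom}(\mathfrak a_0)=H^1(\Omega_0)\times\mathbb C$. (So $\mathcal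 A_0=\widehat{\mathcal A}_0\oplus 0_{\mathbb C}$, with $\widehat{\mathcal A}_0$ the operator $-d^2/dx^2+V_0$ with a $\delta$-interaction of strength $\gamma$ at $0$ and Neumann conditions at finite endpoints.) Identification operators. $\mathcal J_\varepsilon:\mathcal H_0\to\mathcal H_\varepsilon$: $(\mathcal J_\varepsilon f)(\mathbf x)=\varepsilon^{-1/2}f_1(x_1)$ on $S_\varepsilon$, $=0$ on $P_\varepsilon$, $=b_\varepsilon^{-1}f_2$ on $R_\varepsilon$, for $f=(f_1,f_2)$. $\widetilde{\mathcal J}_\varepsilon:\mathcal H_\varepsilon\to\mathcal H_0$: $(\widetilde{\mathcal J}_\varepsilon u)_1(x_1)=\varepsilon^{-1/2}\int_{-\varepsilon}^0u(x_1,x_2)\,dx_2$ for $x_1\in\Omega_0$, $(\widetilde{\mathcal J}_\varepsilon u)_2=b_\varepsilon^{-1}\int_{R_\varepsilon}u\,d\mathbf x$. $\|\cdot\|_{X\to Y}$ denotes the operator norm. *)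

theory Defs
  imports "HOL-Analysis.Analysis"
begin

section \<open>Lebesgue and Sobolev spaces\<close>

text \<open>
  Elements of an L2 space are represented by functions, not by classes modulo null sets.
  All notions below are invariant under changing a function on a null set.
\<close>

definition L2 :: "'a measure \<Rightarrow> ('a \<Rightarrow> complex) set" where
  "L2 M = {f. f \<in> borel_measurable M \<and> integrable M (\<lambda>x. (cmod (f x))\<^sup>2)}"

definition L2_inner :: "'a measure \<Rightarrow> ('a \<Rightarrow> complex) \<Rightarrow> ('a \<Rightarrow> complex) \<Rightarrow> complex" where
  "L2_inner M f g = (LINT x|M. f x * cnj (g x))"

definition Linf :: "'a measure \<Rightarrow> ('a \<Rightarrow> real) set" where
  "Linf M = {f. f \<in> borel_measurable M \<and> (\<exists>C. AE x in M. \<bar>f x\<bar> \<le> C)}"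

text \<open>Total functions of class \<open>C\<^sup>k\<close>, through iterated partial derivatives.\<close>

primrec Ck :: "nat \<Rightarrow> ('a::euclidean_space \<Rightarrow> complex) \<Rightarrow> bool" where
  "Ck 0 f \<longleftrightarrow> continuous_on UNIV f"
| "Ck (Suc k) f \<longleftrightarrow> (\<forall>x. f differentiable at x) \<and>
     (\<forall>b\<in>Basis. Ck k (\<lambda>x. frechet_derivative f (at x) b))"

definition test_functions :: "'a::euclidean_space set \<Rightarrow> ('a \<Rightarrow> complex) set" where
  "test_functions \<Omega> = {\<phi>. (\<forall>k. Ck k \<phi>) \<and>
     compact (closure {x. \<phi> x \<noteq> 0}) \<and> closure {x. \<phi> x \<noteq> 0} \<subseteq> \<Omega>}"

definition has_weak_deriv ::
  "'a::euclidean_space set \<Rightarrow> 'a \<Rightarrow> ('a \<Rightarrow> complex) \<Rightarrow> ('a \<Rightarrow> complex) \<Rightarrow> bool" where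
  "has_weak_deriv \<Omega> b u w \<longleftrightarrow>
     (\<forall>\<phi>\<in>test_functions \<Omega>.
        (LINT x|lebesgue_on \<Omega>. u x * frechet_derivative \<phi> (at x) b)
        = - (LINT x|lebesgue_on \<Omega>. w x * \<phi> x))"

definition H1 :: "'a::euclidean_space set \<Rightarrow> ('a \<Rightarrow> complex) set" where
  "H1 \<Omega> = {u \<in> L2 (lebesgue_on \<Omega>).
     \<forall>b\<in>Basis. \<exists>w\<in>L2 (lebesgue_on \<Omega>). has_weak_deriv \<Omega> b u w}"

definition weak_deriv ::
  "'a::euclidean_space set \<Rightarrow> 'a \<Rightarrow> ('a \<Rightarrow> complex) \<Rightarrow> 'a \<Rightarrow> complex" where
  "weak_deriv \<Omega> b u = (SOME w. w \<in> L2 (lebesgue_on \<Omega>) \<and> has_weak_deriv \<Omega> b u w)"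

text \<open>
  The value at a point of the continuous representative, which every H1 function
  on an open interval has; the pointwise value of the given representative is irrelevant.
\<close>

definition point_value :: "real set \<Rightarrow> (real \<Rightarrow> complex) \<Rightarrow> real \<Rightarrow> complex" where
  "point_value I f p = (THE c. \<exists>g. continuous_on I g \<and>
     (AE x in lebesgue_on I. f x = g x) \<and> g p = c)"


section \<open>Operators associated with forms, resolvents, operator norms\<close>

text \<open>
  A Hilbert space is given by a set \<open>H\<close> of representatives and its inner product \<open>ip\<close>,
  linear in the first argument.
\<close>

definition ip_norm :: "('h \<Rightarrow> 'h \<Rightarrow> complex) \<Rightarrow> 'h \<Rightarrow> real" where
  "ip_norm ip f = sqrt (Re (ip f f))"

text \<open>
  Graph of the operator associated with the form \<open>a\<close> with domain \<open>D\<close>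
  (first representation theorem).
\<close>

definition form_operator ::
  "'h set \<Rightarrow> ('h \<Rightarrow> 'h \<Rightarrow> complex) \<Rightarrow> 'h set \<Rightarrow> ('h \<Rightarrow> 'h \<Rightarrow> complex) \<Rightarrow> ('h \<times> 'h) set" where
  "form_operator H ip D a = {(u, w). u \<in> D \<and> w \<in> H \<and> (\<forall>v\<in>D. a u v = ip w v)}"

text \<open>
  \<open>u = (A + I)\<^sup>-\<^sup>1 f\<close> means \<open>u \<in> dom A\<close> and \<open>A u = f - u\<close>. Such a \<open>u\<close> is determined up to
  null functions only, hence the choice.
\<close>

definition resolvent :: "('h::minus \<times> 'h) set \<Rightarrow> 'h \<Rightarrow> 'h" where
  "resolvent A f = (SOME u. (u, f - u) \<in> A)"

text \<open>
  The value \<open>\<infinity>\<close> for maps leaving the target space prevents a spurious finite norm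
  arising from the convention that non-integrable functions have integral 0.
\<close>

definition operator_norm ::
  "'h set \<Rightarrow> ('h \<Rightarrow> 'h \<Rightarrow> complex) \<Rightarrow> 'k set \<Rightarrow> ('k \<Rightarrow> 'k \<Rightarrow> complex) \<Rightarrow> ('h \<Rightarrow> 'k) \<Rightarrow> ennreal" where
  "operator_norm H ip K ip' T =
     (if T ` H \<subseteq> K
      then (SUP f\<in>{f \<in> H. ip_norm ip f \<le> 1}. ennreal (ip_norm ip' (T f)))
      else \<infinity>)"


section \<open>The domain\<close>

definition Omega0 :: "ereal \<Rightarrow> ereal \<Rightarrow> real set" where
  "Omega0 lm lp = {x. lm < ereal x \<and> ereal x < lp}"

definition strip :: "ereal \<Rightarrow> ereal \<Rightarrow> real \<Rightarrow> (real \<times> real) set" where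
  "strip lm lp \<epsilon> = Omega0 lm lp \<times> {-\<epsilon><..<0}"

definition passage :: "real \<Rightarrow> real \<Rightarrow> real \<Rightarrow> (real \<times> real) set" where
  "passage \<alpha> \<gamma> \<epsilon> =
     (let d = \<gamma> * \<epsilon> powr (\<alpha> + 1); h = \<epsilon> powr \<alpha>
      in {- d / 2<..<d / 2} \<times> {0<..<h})"

definition room :: "real \<Rightarrow> real \<Rightarrow> real \<Rightarrow> (real \<times> real) set" where
  "room \<alpha> \<beta> \<epsilon> =
     (let h = \<epsilon> powr \<alpha>; b = \<epsilon> powr \<beta>
      in {- b / 2<..<b / 2} \<times> {h<..<h + b})"

definition Omega_eps ::
  "ereal \<Rightarrow> ereal \<Rightarrow> real \<Rightarrow> real \<Rightarrow> real \<Rightarrow> real \<Rightarrow> (real \<times> real) set" where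
  "Omega_eps lm lp \<alpha> \<beta> \<gamma> \<epsilon> =
     interior (closure (strip lm lp \<epsilon> \<union> passage \<alpha> \<gamma> \<epsilon> \<union> room \<alpha> \<beta> \<epsilon>))"


section \<open>The operator on the thin domain\<close>

definition V_eps :: "ereal \<Rightarrow> ereal \<Rightarrow> (real \<Rightarrow> real) \<Rightarrow> real \<Rightarrow> real \<times> real \<Rightarrow> real" where
  "V_eps lm lp V0 \<epsilon> x = (if x \<in> strip lm lp \<epsilon> then V0 (fst x) else 0)"

definition H_eps ::
  "ereal \<Rightarrow> ereal \<Rightarrow> real \<Rightarrow> real \<Rightarrow> real \<Rightarrow> real \<Rightarrow> (real \<times> real \<Rightarrow> complex) set" where
  "H_eps lm lp \<alpha> \<beta> \<gamma> \<epsilon> = L2 (lebesgue_on (Omega_eps lm lp \<alpha> \<beta> \<gamma> \<epsilon>))"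

definition ip_eps ::
  "ereal \<Rightarrow> ereal \<Rightarrow> real \<Rightarrow> real \<Rightarrow> real \<Rightarrow> real \<Rightarrow>
   (real \<times> real \<Rightarrow> complex) \<Rightarrow> (real \<times> real \<Rightarrow> complex) \<Rightarrow> complex" where
  "ip_eps lm lp \<alpha> \<beta> \<gamma> \<epsilon> = L2_inner (lebesgue_on (Omega_eps lm lp \<alpha> \<beta> \<gamma> \<epsilon>))"

definition form_eps ::
  "ereal \<Rightarrow> ereal \<Rightarrow> real \<Rightarrow> real \<Rightarrow> real \<Rightarrow> (real \<Rightarrow> real) \<Rightarrow> real \<Rightarrow>
   (real \<times> real \<Rightarrow> complex) \<Rightarrow> (real \<times> real \<Rightarrow> complex) \<Rightarrow> complex" where
  "form_eps lm lp \<alpha> \<beta> \<gamma> V0 \<epsilon> u v =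
     (let \<Omega> = Omega_eps lm lp \<alpha> \<beta> \<gamma> \<epsilon> in
      LINT x|lebesgue_on \<Omega>.
        (\<Sum>b\<in>Basis. weak_deriv \<Omega> b u x * cnj (weak_deriv \<Omega> b v x))
        + complex_of_real (V_eps lm lp V0 \<epsilon> x) * u x * cnj (v x))"

definition A_eps ::
  "ereal \<Rightarrow> ereal \<Rightarrow> real \<Rightarrow> real \<Rightarrow> real \<Rightarrow> (real \<Rightarrow> real) \<Rightarrow> real \<Rightarrow>
   ((real \<times> real \<Rightarrow> complex) \<times> (real \<times> real \<Rightarrow> complex)) set" where
  "A_eps lm lp \<alpha> \<beta> \<gamma> V0 \<epsilon> =
     form_operator (H_eps lm lp \<alpha> \<beta> \<gamma> \<epsilon>) (ip_eps lm lp \<alpha> \<beta> \<gamma> \<epsilon>)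
       (H1 (Omega_eps lm lp \<alpha> \<beta> \<gamma> \<epsilon>)) (form_eps lm lp \<alpha> \<beta> \<gamma> V0 \<epsilon>)"

definition R_eps ::
  "ereal \<Rightarrow> ereal \<Rightarrow> real \<Rightarrow> real \<Rightarrow> real \<Rightarrow> (real \<Rightarrow> real) \<Rightarrow> real \<Rightarrow>
   (real \<times> real \<Rightarrow> complex) \<Rightarrow> (real \<times> real \<Rightarrow> complex)" where
  "R_eps lm lp \<alpha> \<beta> \<gamma> V0 \<epsilon> = resolvent (A_eps lm lp \<alpha> \<beta> \<gamma> V0 \<epsilon>)"


section \<open>The limit operator\<close>

definition H_zero :: "ereal \<Rightarrow> ereal \<Rightarrow> ((real \<Rightarrow> complex) \<times> complex) set" where
  "H_zero lm lp = L2 (lebesgue_on (Omega0 lm lp)) \<times> UNIV"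

definition ip_zero ::
  "ereal \<Rightarrow> ereal \<Rightarrow> (real \<Rightarrow> complex) \<times> complex \<Rightarrow> (real \<Rightarrow> complex) \<times> complex \<Rightarrow> complex" where
  "ip_zero lm lp f g =
     L2_inner (lebesgue_on (Omega0 lm lp)) (fst f) (fst g) + snd f * cnj (snd g)"

definition form_zero ::
  "ereal \<Rightarrow> ereal \<Rightarrow> real \<Rightarrow> (real \<Rightarrow> real) \<Rightarrow>
   (real \<Rightarrow> complex) \<times> complex \<Rightarrow> (real \<Rightarrow> complex) \<times> complex \<Rightarrow> complex" where
  "form_zero lm lp \<gamma> V0 f g =
     (let \<Omega> = Omega0 lm lp in
      (LINT x|lebesgue_on \<Omega>.
         weak_deriv \<Omega> 1 (fst f) x * cnj (weak_deriv \<Omega> 1 (fst g) x)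
         + complex_of_real (V0 x) * fst f x * cnj (fst g x))
      + complex_of_real \<gamma> * point_value \<Omega> (fst f) 0 * cnj (point_value \<Omega> (fst g) 0))"

definition A_zero ::
  "ereal \<Rightarrow> ereal \<Rightarrow> real \<Rightarrow> (real \<Rightarrow> real) \<Rightarrow>
   (((real \<Rightarrow> complex) \<times> complex) \<times> ((real \<Rightarrow> complex) \<times> complex)) set" where
  "A_zero lm lp \<gamma> V0 =
     form_operator (H_zero lm lp) (ip_zero lm lp)
       (H1 (Omega0 lm lp) \<times> UNIV) (form_zero lm lp \<gamma> V0)"

definition R_zero ::
  "ereal \<Rightarrow> ereal \<Rightarrow> real \<Rightarrow> (real \<Rightarrow> real) \<Rightarrow>
   (real \<Rightarrow> complex) \<times> complex \<Rightarrow> (real \<Rightarrow> complex) \<times> complex" where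
  "R_zero lm lp \<gamma> V0 = resolvent (A_zero lm lp \<gamma> V0)"


section \<open>Identification operators\<close>

definition J_eps ::
  "ereal \<Rightarrow> ereal \<Rightarrow> real \<Rightarrow> real \<Rightarrow> real \<Rightarrow>
   (real \<Rightarrow> complex) \<times> complex \<Rightarrow> (real \<times> real \<Rightarrow> complex)" where
  "J_eps lm lp \<alpha> \<beta> \<epsilon> f = (\<lambda>x.
     if x \<in> strip lm lp \<epsilon> then complex_of_real (\<epsilon> powr (-1/2)) * fst f (fst x)
     else if x \<in> room \<alpha> \<beta> \<epsilon> then complex_of_real (1 / \<epsilon> powr \<beta>) * snd f
     else 0)"

definition Jt_eps ::
  "real \<Rightarrow> real \<Rightarrow> real \<Rightarrow> (real \<times> real \<Rightarrow> complex) \<Rightarrow> (real \<Rightarrow> complex) \<times> complex" where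
  "Jt_eps \<alpha> \<beta> \<epsilon> u =
     (\<lambda>x1. complex_of_real (\<epsilon> powr (-1/2)) * (LINT x2|lebesgue_on {-\<epsilon><..<0}. u (x1, x2)),
      complex_of_real (1 / \<epsilon> powr \<beta>) * (LINT x|lebesgue_on (room \<alpha> \<beta> \<epsilon>). u x))"

end

theory Submission
  imports Defs
begin

text \<open>For \<open>f\<close> in the limit space and \<open>u\<close> on the thin domain put \<open>g = R\<^sub>0 f\<close> and \<open>w = R\<^sub>\<epsilon> u\<close>. The matrix element
  \<open>(J f, w) - (J g, u)\<close> of \<open>R\<^sub>\<epsilon> J - J R\<^sub>0\<close> is evaluated by inserting into the form of \<open>A\<^sub>\<epsilon>\<close> a trial function
  that equals \<open>J g\<close> on strip and room and interpolates linearly across the passage. What is left are integrals over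
  the passage and the point interaction \<open>\<gamma> g\<^sub>1(0) cnj m(0)\<close>, where \<open>m\<close> is the first component of \<open>Jt w\<close>.
  The passage is so small that the terms without division by its length \<open>h\<close> are \<open>O(\<epsilon>\<^sup>\<alpha>)\<close>. The remaining term
  contains the flux of \<open>w\<close> through the passage, which equals \<open>\<gamma> \<epsilon>\<close> times the difference of the averages of \<open>w\<close>
  over the two openings; the upper one is negligible since the room is large, the lower one is
  \<open>\<epsilon>\<^sup>-\<^sup>1\<^sup>/\<^sup>2 m(0)\<close> up to a small error, and this cancels the point interaction.\<close>

subsection \<open>Square integrable functions\<close>

text \<open>Both norms in the claim are suprema of the same matrix elements, because
  \<open>Jt\<close> is the adjoint of \<open>J\<close>; one bilinear bound therefore serves for
  both. The obstacle is the passage, of area d h = \<gamma> \<epsilon>^(2\<alpha>+1). The trial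
  function has size \<epsilon>^(-1/2) there, which gives \<epsilon>^\<alpha>; for its horizontal
  derivative the same needs g' bounded near 0, since square integrability would give only
  \<epsilon>^((\<alpha>-1)/2). Hence the regularity result for the limit problem. The vertical slope
  is of order \<epsilon>^(-1/2) / h, so that Cauchy-Schwarz leaves a term of order 1; it has to be
  paired with the flux of w itself. In the plane the mean of an H1 function over a window of width d
  is not bounded uniformly in d; this loss is kept below a multiple of \<epsilon>^(-\<beta>). The
  second exponent is then 1/2 - \<beta> twice: \<epsilon>^(-1/2) times \<epsilon>^(1-\<beta>) for
  the part with cancellation, and \<epsilon>^(-\<beta>) times \<epsilon>^(1/2) for the value in the
  room, against which nothing cancels.\<close>

definition sqn :: "'a measure \<Rightarrow> ('a \<Rightarrow> complex) \<Rightarrow> real" where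
  "sqn M f = (LINT x|M. (cmod (f x))\<^sup>2)"

lemma sqn_nonneg [simp]: "0 \<le> sqn M f"
  by (simp add: sqn_def)

lemma L2_measurable: "f \<in> L2 M \<Longrightarrow> f \<in> borel_measurable M"
  and L2_integrable: "f \<in> L2 M \<Longrightarrow> integrable M (\<lambda>x. (cmod (f x))\<^sup>2)"
  by (auto simp: L2_def)

lemma L2I:
  "f \<in> borel_measurable M \<Longrightarrow> integrable M (\<lambda>x. (cmod (f x))\<^sup>2) \<Longrightarrow> f \<in> L2 M"
  by (auto simp: L2_def)

lemma L2_bound:
  assumes "f \<in> borel_measurable M" "integrable M g" "\<And>x. x \<in> space M \<Longrightarrow> (cmod (f x))\<^sup>2 \<le> g x"
  shows "f \<in> L2 M"
proof (rule L2I[OF assms(1)])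
  show "integrable M (\<lambda>x. (cmod (f x))\<^sup>2)"
    by (rule Bochner_Integration.integrable_bound[OF assms(2)])
       (use assms in \<open>auto intro!: AE_I2 order_trans[OF _ abs_ge_self]\<close>)
qed

lemma cmod_sum_sq: "(cmod (a + b))\<^sup>2 \<le> 2 * (cmod a)\<^sup>2 + 2 * (cmod b)\<^sup>2"
proof -
  have "(cmod (a + b))\<^sup>2 \<le> (cmod a + cmod b)\<^sup>2"
    by (intro power_mono norm_triangle_ineq) auto
  also have "\<dots> \<le> 2 * (cmod a)\<^sup>2 + 2 * (cmod b)\<^sup>2"
    using sum_squares_bound[of "cmod a" "cmod b"] by (simp add: power2_sum)
  finally show ?thesis .
qed

lemma L2_add:
  assumes "f \<in> L2 M" "g \<in> L2 M" shows "(\<lambda>x. f x + g x) \<in> L2 M"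
  using assms
  by (intro L2_bound[where g = "\<lambda>x. 2 * (cmod (f x))\<^sup>2 + 2 * (cmod (g x))\<^sup>2"] cmod_sum_sq)
     (auto simp: L2_def)

lemma L2_cmult:
  assumes "f \<in> L2 M" shows "(\<lambda>x. c * f x) \<in> L2 M"
  using assms by (auto simp: L2_def norm_mult power_mult_distrib)

lemma L2_lc: "f \<in> L2 M \<Longrightarrow> g \<in> L2 M \<Longrightarrow> (\<lambda>x. f x + c * g x) \<in> L2 M"
  by (intro L2_add L2_cmult)

lemma L2_diff: "f \<in> L2 M \<Longrightarrow> g \<in> L2 M \<Longrightarrow> (\<lambda>x. f x - g x) \<in> L2 M"
  using L2_lc[of f M g "-1"] by simp

lemma L2_zero: "(\<lambda>x. 0) \<in> L2 M"
  by (simp add: L2_def)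

lemma borel_measurable_cnj [measurable (raw)]:
  "f \<in> borel_measurable M \<Longrightarrow> (\<lambda>x. cnj (f x)) \<in> borel_measurable M"
  by (rule measurable_compose[of f M borel cnj]) (auto intro!: borel_measurable_continuous_onI continuous_intros)

lemma L2_cnj: "f \<in> L2 M \<Longrightarrow> (\<lambda>x. cnj (f x)) \<in> L2 M"
  by (auto simp: L2_def)

lemma L2_cong_AE:
  assumes "f \<in> L2 M" "g \<in> borel_measurable M" "AE x in M. f x = g x"
  shows "g \<in> L2 M"
proof (rule L2I[OF assms(2)])
  have "integrable M (\<lambda>x. (cmod (g x))\<^sup>2) \<longleftrightarrow> integrable M (\<lambda>x. (cmod (f x))\<^sup>2)"
    by (rule integrable_cong_AE) (use assms in \<open>auto simp: L2_def\<close>)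
  then show "integrable M (\<lambda>x. (cmod (g x))\<^sup>2)" using assms by (auto simp: L2_def)
qed

lemma sqn_cong_AE:
  assumes "f \<in> borel_measurable M" "g \<in> borel_measurable M" "AE x in M. f x = g x"
  shows "sqn M f = sqn M g"
  unfolding sqn_def by (rule integral_cong_AE) (use assms in auto)

lemma L2_mult_abs_integrable:
  assumes "f \<in> L2 M" "g \<in> L2 M"
  shows "integrable M (\<lambda>x. cmod (f x) * cmod (g x))"
proof -
  have [measurable]: "f \<in> borel_measurable M" "g \<in> borel_measurable M"
    using assms by (auto simp: L2_def)
  have *: "integrable M (\<lambda>x. (cmod (f x))\<^sup>2 + (cmod (g x))\<^sup>2)"
    using assms by (auto simp: L2_def)
  have "cmod (f x) * cmod (g x) \<le> (cmod (f x))\<^sup>2 + (cmod (g x))\<^sup>2" for x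
    using sum_squares_bound[of "cmod (f x)" "cmod (g x)"] mult_nonneg_nonneg[OF norm_ge_zero norm_ge_zero, of "f x" "g x"]
    by linarith
  then show ?thesis
    by (intro Bochner_Integration.integrable_bound[OF *] AE_I2) (auto simp: abs_mult)
qed

lemma L2_mult_integrable:
  assumes "f \<in> L2 M" "g \<in> L2 M"
  shows "integrable M (\<lambda>x. f x * g x)"
proof -
  have [measurable]: "f \<in> borel_measurable M" "g \<in> borel_measurable M"
    using assms by (auto simp: L2_def)
  show ?thesis
    by (rule Bochner_Integration.integrable_bound[OF L2_mult_abs_integrable[OF assms]])
       (auto simp: norm_mult)
qed

lemma L2_inner_integrable:
  "f \<in> L2 M \<Longrightarrow> g \<in> L2 M \<Longrightarrow> integrable M (\<lambda>x. f x * cnj (g x))"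
  using L2_mult_integrable[OF _ L2_cnj] .

lemma L2_abs_Cauchy_Schwarz:
  assumes "f \<in> L2 M" "g \<in> L2 M"
  shows "(LINT x|M. cmod (f x) * cmod (g x)) \<le> sqrt (sqn M f) * sqrt (sqn M g)"
proof -
  have [measurable]: "f \<in> borel_measurable M" "g \<in> borel_measurable M"
    using assms by (auto simp: L2_def)
  define I where "I = (LINT x|M. cmod (f x) * cmod (g x))"
  have I0: "0 \<le> I" unfolding I_def by simp
  have 1: "(\<integral>\<^sup>+x. ennreal (cmod (f x)) * ennreal (cmod (g x)) \<partial>M) = ennreal I"
    using nn_integral_eq_integral[OF L2_mult_abs_integrable[OF assms]]
    by (simp add: I_def ennreal_mult)
  have 2: "(\<integral>\<^sup>+x. (ennreal (cmod (f x)))\<^sup>2 \<partial>M) = ennreal (sqn M f)" if "f \<in> L2 M" for f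
    using nn_integral_eq_integral[OF L2_integrable[OF that]]
    by (simp add: sqn_def ennreal_power)
  have "(ennreal I)\<^sup>2 \<le> ennreal (sqn M f) * ennreal (sqn M g)"
    using Cauchy_Schwarz_nn_integral[of "\<lambda>x. ennreal (cmod (f x))" M "\<lambda>x. ennreal (cmod (g x))"]
    by (simp add: 1 2 assms)
  then have "ennreal (I\<^sup>2) \<le> ennreal (sqn M f * sqn M g)"
    using I0 by (simp add: ennreal_power ennreal_mult)
  then have "I\<^sup>2 \<le> sqn M f * sqn M g" by simp
  then have "I \<le> sqrt (sqn M f * sqn M g)" by (rule real_le_rsqrt)
  then show ?thesis by (simp add: I_def real_sqrt_mult)
qed

lemma L2_Cauchy_Schwarz:
  assumes "f \<in> L2 M" "g \<in> L2 M"
  shows "cmod (LINT x|M. f x * g x) \<le> sqrt (sqn M f) * sqrt (sqn M g)"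
proof -
  have "cmod (LINT x|M. f x * g x) \<le> (LINT x|M. cmod (f x * g x))"
    by (rule integral_norm_bound)
  also have "\<dots> = (LINT x|M. cmod (f x) * cmod (g x))" by (simp add: norm_mult)
  finally show ?thesis using L2_abs_Cauchy_Schwarz[OF assms] by simp
qed

lemma sqn_cnj [simp]: "sqn M (\<lambda>x. cnj (f x)) = sqn M f"
  by (simp add: sqn_def)

lemma L2_inner_bound:
  "f \<in> L2 M \<Longrightarrow> g \<in> L2 M \<Longrightarrow> cmod (L2_inner M f g) \<le> sqrt (sqn M f) * sqrt (sqn M g)"
  unfolding L2_inner_def using L2_Cauchy_Schwarz[OF _ L2_cnj] by fastforce

lemma L2_inner_self: "L2_inner M f f = complex_of_real (sqn M f)"
proof -
  have "L2_inner M f f = (LINT x|M. complex_of_real ((cmod (f x))\<^sup>2))"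
    unfolding L2_inner_def by (intro Bochner_Integration.integral_cong refl) (simp only: complex_norm_square)
  then show ?thesis by (simp add: sqn_def del: of_real_power)
qed

lemma L2_inner_commute: "L2_inner M g f = cnj (L2_inner M f g)"
proof -
  have "cnj (L2_inner M f g) = (LINT x|M. cnj (f x * cnj (g x)))"
    unfolding L2_inner_def by (rule Bochner_Integration.integral_cnj[symmetric])
  then show ?thesis by (simp add: L2_inner_def mult.commute)
qed

lemma L2_inner_lc_left:
  assumes "f \<in> L2 M" "g \<in> L2 M" "h \<in> L2 M"
  shows "L2_inner M (\<lambda>x. f x + c * g x) h = L2_inner M f h + c * L2_inner M g h"
proof -
  have "L2_inner M (\<lambda>x. f x + c * g x) h = (LINT x|M. f x * cnj (h x) + c * (g x * cnj (h x)))"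
    unfolding L2_inner_def by (simp add: algebra_simps)
  also have "\<dots> = L2_inner M f h + c * L2_inner M g h"
    unfolding L2_inner_def using L2_inner_integrable[OF assms(1,3)] L2_inner_integrable[OF assms(2,3)]
    by (subst Bochner_Integration.integral_add) auto
  finally show ?thesis .
qed

lemma L2_inner_cong_AE:
  assumes "f \<in> borel_measurable M" "g \<in> borel_measurable M" "f' \<in> borel_measurable M"
    "g' \<in> borel_measurable M" "AE x in M. f x = f' x" "AE x in M. g x = g' x"
  shows "L2_inner M f g = L2_inner M f' g'"
proof -
  have m: "(\<lambda>x. a x * cnj (b x)) \<in> borel_measurable M"
    if "a \<in> borel_measurable M" "b \<in> borel_measurable M" for a b :: "_ \<Rightarrow> complex"
    using that by (intro borel_measurable_times measurable_compose[of b M borel cnj])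
      (auto intro!: borel_measurable_continuous_onI continuous_intros)
  show ?thesis unfolding L2_inner_def
    by (rule integral_cong_AE) (use assms in \<open>auto intro!: m\<close>)
qed

lemma sqn_lc_le:
  assumes "f \<in> L2 M" "g \<in> L2 M"
  shows "sqn M (\<lambda>x. f x + g x) \<le> 2 * sqn M f + 2 * sqn M g"
proof -
  have "sqn M (\<lambda>x. f x + g x) \<le> (LINT x|M. 2 * (cmod (f x))\<^sup>2 + 2 * (cmod (g x))\<^sup>2)"
    unfolding sqn_def
    by (intro integral_mono L2_integrable L2_add assms cmod_sum_sq) (use assms in \<open>auto simp: L2_def\<close>)
  also have "\<dots> = 2 * sqn M f + 2 * sqn M g"
    unfolding sqn_def using assms by (subst Bochner_Integration.integral_add) (auto simp: L2_def)
  finally show ?thesis .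
qed

lemma sqn_cmult: "sqn M (\<lambda>x. c * f x) = (cmod c)\<^sup>2 * sqn M f"
  by (simp add: sqn_def norm_mult power_mult_distrib)

text \<open>The weights \<open>2\<^sup>n\<close> make the square sum of the increments of a fast subsequence converge
  almost everywhere at a geometric rate, so that no Minkowski inequality is needed.\<close>

lemma L2_complete:
  assumes f: "\<And>n. f n \<in> L2 M"
    and cauchy: "\<And>e. e > 0 \<Longrightarrow> \<exists>N. \<forall>m\<ge>N. \<forall>n\<ge>N. sqn M (\<lambda>x. f m x - f n x) < e"
  obtains g where "g \<in> L2 M" "(\<lambda>n. sqn M (\<lambda>x. f n x - g x)) \<longlonglongrightarrow> 0"
proof -
  have [measurable]: "f n \<in> borel_measurable M" for n using f by (auto simp: L2_def)
  have nn: "(\<integral>\<^sup>+x. ennreal ((cmod (f m x - f n x))\<^sup>2) \<partial>M) = ennreal (sqn M (\<lambda>x. f m x - f n x))" for m n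
    unfolding sqn_def by (rule nn_integral_eq_integral[OF L2_integrable[OF L2_diff[OF f f]]]) simp
  have "\<exists>N. \<forall>m\<ge>N. \<forall>n\<ge>N. sqn M (\<lambda>x. f m x - f n x) < (1/4)^k" for k :: nat
    by (rule cauchy) simp
  then obtain N where N: "\<And>k m n. m \<ge> N k \<Longrightarrow> n \<ge> N k \<Longrightarrow> sqn M (\<lambda>x. f m x - f n x) < (1/4)^k"
    by metis
  \<comment> \<open>The sum dominates every \<open>N i\<close> with i \<le> k, so that
    \<open>r m\<close> lies beyond \<open>N k\<close> whenever k \<le> m, although \<open>N\<close>
    is an arbitrary choice and may fail to be monotone.\<close>
  define r where "r k = k + (\<Sum>i\<le>k. N i)" for k
  have rN: "r m \<ge> N k" if "m \<ge> k" for m k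
  proof -
    have "N k \<le> (\<Sum>i\<le>m. N i)" using that by (intro member_le_sum) auto
    then show ?thesis by (simp add: r_def)
  qed
  define d where "d k x = (2::real)^k * (cmod (f (r (Suc k)) x - f (r k) x))\<^sup>2" for k x
  have [measurable]: "d k \<in> borel_measurable M" for k unfolding d_def by measurable
  have "(\<integral>\<^sup>+x. (\<Sum>k. ennreal (d k x)) \<partial>M) = (\<Sum>k. \<integral>\<^sup>+x. ennreal (d k x) \<partial>M)"
    by (rule nn_integral_suminf) auto
  also have "\<dots> \<le> (\<Sum>k. ennreal ((1/2)^k))"
  proof (intro suminf_le allI summableI)
    fix k
    have "(\<integral>\<^sup>+x. ennreal (d k x) \<partial>M) = ennreal (2^k) * (\<integral>\<^sup>+x. ennreal ((cmod (f (r (Suc k)) x - f (r k) x))\<^sup>2) \<partial>M)"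
      unfolding d_def by (simp add: ennreal_mult nn_integral_cmult)
    also have "\<dots> \<le> ennreal (2^k) * ennreal ((1/4)^k)"
      unfolding nn by (intro mult_left_mono ennreal_leI less_imp_le[OF N[of k]] rN) auto
    also have "\<dots> = ennreal ((1/2)^k)"
      by (simp add: ennreal_mult[symmetric] power_mult_distrib[symmetric])
    finally show "(\<integral>\<^sup>+x. ennreal (d k x) \<partial>M) \<le> ennreal ((1/2)^k)" .
  qed
  also have "\<dots> = ennreal 2"
    by (subst suminf_ennreal2) (auto simp: suminf_geometric)
  finally have "(\<integral>\<^sup>+x. (\<Sum>k. ennreal (d k x)) \<partial>M) \<noteq> \<infinity>"
    using le_less_trans[OF _ ennreal_less_top] by fastforce
  then have "AE x in M. (\<Sum>k. ennreal (d k x)) \<noteq> \<infinity>"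
    by (intro nn_integral_PInf_AE) auto
  then have AEconv: "AE x in M. convergent (\<lambda>k. f (r k) x)"
  proof eventually_elim
    case (elim x)
    then have "summable (\<lambda>k. d k x)"
      by (intro summable_suminf_not_top) (auto simp: d_def)
    then have "(\<lambda>k. d k x) \<longlonglongrightarrow> 0" by (rule summable_LIMSEQ_zero)
    then have "Bseq (\<lambda>k. d k x)" by (intro convergent_imp_Bseq convergentI)
    then obtain C where C: "\<And>k. norm (d k x) \<le> C" unfolding Bseq_def by blast
    have bd: "cmod (f (r (Suc k)) x - f (r k) x) \<le> sqrt C * (sqrt (1/2))^k" for k
    proof -
      have "(2::real)^k * (cmod (f (r (Suc k)) x - f (r k) x))\<^sup>2 \<le> C"
        using C[of k] by (simp add: d_def)
      then have "(cmod (f (r (Suc k)) x - f (r k) x))\<^sup>2 \<le> C * (1/2)^k"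
        by (simp add: field_simps power_one_over)
      then have "cmod (f (r (Suc k)) x - f (r k) x) \<le> sqrt (C * (1/2)^k)"
        by (rule real_le_rsqrt)
      then show ?thesis by (simp add: real_sqrt_mult real_sqrt_power)
    qed
    have "summable (\<lambda>k. f (r (Suc k)) x - f (r k) x)"
      by (rule summable_comparison_test'[where g = "\<lambda>k. sqrt C * (sqrt (1/2))^k" and N = 0])
         (use bd in \<open>auto intro!: summable_mult summable_geometric\<close>)
    then have "convergent (\<lambda>n. \<Sum>k<n. f (r (Suc k)) x - f (r k) x)"
      by (simp add: summable_iff_convergent)
    then have "convergent (\<lambda>n. f (r n) x - f (r 0) x)" using sum_lessThan_telescope[of "\<lambda>n. f (r n) x"] by simp
    then have "convergent (\<lambda>n. (f (r n) x - f (r 0) x) + f (r 0) x)"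
      by (intro convergent_add convergent_const)
    then show ?case by simp
  qed
  define g where "g x = lim (\<lambda>k. f (r k) x)" for x
  have [measurable]: "g \<in> borel_measurable M" unfolding g_def by measurable
  have conv: "AE x in M. (\<lambda>k. f (r k) x) \<longlonglongrightarrow> g x"
    using AEconv by eventually_elim (simp add: g_def convergent_LIMSEQ_iff)
  \<comment> \<open>Fatou's lemma along the almost everywhere convergent subsequence transfers the
    Cauchy bound to the distance from the limit, and it does so for all n beyond \<open>N k\<close>,
    not only for those in the subsequence.\<close>
  have fatou: "(\<integral>\<^sup>+x. ennreal ((cmod (f n x - g x))\<^sup>2) \<partial>M) \<le> ennreal ((1/4)^k)" if n: "n \<ge> N k" for n k
  proof -
    have "(\<integral>\<^sup>+x. ennreal ((cmod (f n x - g x))\<^sup>2) \<partial>M)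
        = (\<integral>\<^sup>+x. liminf (\<lambda>m. ennreal ((cmod (f n x - f (r m) x))\<^sup>2)) \<partial>M)"
    proof (rule nn_integral_cong_AE, use conv in eventually_elim)
      case (elim x)
      then have "(\<lambda>m. ennreal ((cmod (f n x - f (r m) x))\<^sup>2)) \<longlonglongrightarrow> ennreal ((cmod (f n x - g x))\<^sup>2)"
        by (intro tendsto_ennrealI tendsto_intros)
      then show ?case by (rule lim_imp_Liminf[OF sequentially_bot, symmetric])
    qed
    also have "\<dots> \<le> liminf (\<lambda>m. \<integral>\<^sup>+x. ennreal ((cmod (f n x - f (r m) x))\<^sup>2) \<partial>M)"
      by (rule nn_integral_liminf) measurable
    also have "\<dots> \<le> ennreal ((1/4)^k)"
      unfolding nn
      by (intro Liminf_le sequentially_bot eventually_sequentiallyI[of k] ennreal_leI less_imp_le[OF N] n rN)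
    finally show ?thesis .
  qed
  have diff: "(\<lambda>x. f n x - g x) \<in> L2 M" if "n \<ge> N k" for n k
  proof (rule L2I)
    show "integrable M (\<lambda>x. (cmod (f n x - g x))\<^sup>2)"
      using le_less_trans[OF fatou[OF that] ennreal_less_top] by (intro integrableI_bounded) simp_all
  qed simp
  have gL2: "g \<in> L2 M"
    using L2_diff[OF f diff[where n = "N 0" and k = 0], of "N 0"] by simp
  have "(\<lambda>n. sqn M (\<lambda>x. f n x - g x)) \<longlonglongrightarrow> 0"
  proof (rule LIMSEQ_I)
    fix e :: real assume "e > 0"
    then obtain k where k: "(1/4::real)^k < e" using real_arch_pow_inv[of e "1/4"] by force
    have "norm (sqn M (\<lambda>x. f n x - g x) - 0) < e" if "n \<ge> N k" for n
    proof -
      have "ennreal (sqn M (\<lambda>x. f n x - g x)) = (\<integral>\<^sup>+x. ennreal ((cmod (f n x - g x))\<^sup>2) \<partial>M)"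
        unfolding sqn_def
        by (rule nn_integral_eq_integral[symmetric, OF L2_integrable[OF diff[OF that]]]) simp
      then have "ennreal (sqn M (\<lambda>x. f n x - g x)) \<le> ennreal ((1/4)^k)"
        using fatou[OF that] by simp
      then have "sqn M (\<lambda>x. f n x - g x) \<le> (1/4)^k" by simp
      then show ?thesis using k by simp
    qed
    then show "\<exists>no. \<forall>n\<ge>no. norm (sqn M (\<lambda>x. f n x - g x) - 0) < e" by (intro exI[of _ "N k"]) simp
  qed
  then show ?thesis using that gL2 by simp
qed

section \<open>Nonnegative Hermitian forms and the Riesz representation theorem\<close>

text \<open>Along c = -s \<beta> with small s the linear term wins over the quadratic one. The value
  1 / (1 + |q|) for s makes s q < 2, which is what a contradiction requires.\<close>

lemma quadratic_form_zero:
  fixes \<beta> :: complex and q :: real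
  assumes "\<And>c. 0 \<le> 2 * Re (cnj c * \<beta>) + (cmod c)\<^sup>2 * q"
  shows "\<beta> = 0"
proof (rule ccontr)
  assume "\<beta> \<noteq> 0"
  define s where "s = 1 / (1 + \<bar>q\<bar>)"
  have s: "s > 0" "s * q < 2"
    unfolding s_def by (auto simp: field_simps)
  have "Re (cnj (- of_real s * \<beta>) * \<beta>) = - s * (cmod \<beta>)\<^sup>2"
    unfolding cmod_power2 by (simp add: algebra_simps power2_eq_square)
  moreover have "(cmod (- of_real s * \<beta>))\<^sup>2 = s\<^sup>2 * (cmod \<beta>)\<^sup>2"
    using s by (simp add: norm_mult power_mult_distrib)
  ultimately have "0 \<le> 2 * (- s * (cmod \<beta>)\<^sup>2) + s\<^sup>2 * (cmod \<beta>)\<^sup>2 * q"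
    using assms[of "- of_real s * \<beta>"] by simp
  also have "\<dots> = s * (cmod \<beta>)\<^sup>2 * (s * q - 2)" by (simp add: algebra_simps power2_eq_square)
  also have "\<dots> < 0" using s \<open>\<beta> \<noteq> 0\<close> by (intro mult_pos_neg) auto
  finally show False by simp
qed

text \<open>Elements are representatives modulo null functions. The carrier is therefore a bare set,
  \<open>lc u c v\<close> stands for u + c v, and \<open>B\<close> may vanish on nonzero elements.
  No vector space law is postulated for \<open>lc\<close>; only its effect inside \<open>B\<close>
  is known.\<close>

locale hermitian_form =
  fixes D :: "'h set" and lc :: "'h \<Rightarrow> complex \<Rightarrow> 'h \<Rightarrow> 'h" and B :: "'h \<Rightarrow> 'h \<Rightarrow> complex"
  assumes lc_closed: "u \<in> D \<Longrightarrow> v \<in> D \<Longrightarrow> lc u c v \<in> D"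
    and lc_left: "u \<in> D \<Longrightarrow> v \<in> D \<Longrightarrow> w \<in> D \<Longrightarrow> B (lc u c v) w = B u w + c * B v w"
    and hermitian: "u \<in> D \<Longrightarrow> v \<in> D \<Longrightarrow> B v u = cnj (B u v)"
    and nonneg: "u \<in> D \<Longrightarrow> 0 \<le> Re (B u u)"
begin

lemma lc_right:
  assumes "u \<in> D" "v \<in> D" "w \<in> D"
  shows "B w (lc u c v) = B w u + cnj c * B w v"
proof -
  have "B w (lc u c v) = cnj (B (lc u c v) w)"
    using assms lc_closed hermitian by blast
  also have "\<dots> = cnj (B u w) + cnj c * cnj (B v w)" using assms by (simp add: lc_left)
  finally show ?thesis using assms hermitian by metis
qed

lemma expand_square:
  assumes "u \<in> D" "v \<in> D"
  shows "Re (B (lc u c v) (lc u c v)) = Re (B u u) + 2 * Re (cnj c * B u v) + (cmod c)\<^sup>2 * Re (B v v)"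
proof -
  have im: "Im (B v v) = 0" using arg_cong[OF hermitian[OF assms(2,2)], of Im] by simp
  have "B (lc u c v) (lc u c v) = B u u + cnj c * B u v + c * (B v u + cnj c * B v v)"
    using assms by (simp add: lc_left lc_right lc_closed algebra_simps)
  also have "B v u = cnj (B u v)" using assms by (rule hermitian)
  finally show ?thesis using im unfolding cmod_power2 by (simp add: algebra_simps power2_eq_square)
qed

lemma Cauchy_Schwarz:
  assumes "u \<in> D" "v \<in> D"
  shows "(cmod (B u v))\<^sup>2 \<le> Re (B u u) * Re (B v v)"
proof (cases "Re (B v v) = 0")
  case True
  have "B u v = 0"
  proof (rule ccontr)
    assume nz: "B u v \<noteq> 0"
    \<comment> \<open>With this \<open>s\<close> the linear term becomes -2 (B u u + 1), and no
      quadratic term can compensate since B v v = 0.\<close>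
    define s where "s = (Re (B u u) + 1) / (cmod (B u v))\<^sup>2"
    have "0 \<le> Re (B u u) + 2 * Re (cnj (- of_real s * B u v) * B u v)"
      using nonneg[OF lc_closed[OF assms]] expand_square[OF assms, of "- of_real s * B u v"] True
      by (metis add.right_neutral mult_zero_right)
    also have "Re (cnj (- of_real s * B u v) * B u v) = - s * (cmod (B u v))\<^sup>2"
      unfolding cmod_power2 by (simp add: algebra_simps power2_eq_square)
    also have "\<dots> = - (Re (B u u) + 1)" using nz by (simp add: s_def)
    finally show False using nonneg[OF assms(1)] by simp
  qed
  then show ?thesis using True by simp
next
  case False
  define q where "q = Re (B v v)"
  have q: "q > 0" using False nonneg[OF assms(2)] by (simp add: q_def)
  \<comment> \<open>The minimiser of the quadratic polynomial in c that \<open>expand_square\<close>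
    produces.\<close>
  let ?c = "- of_real (1/q) * B u v"
  have "0 \<le> Re (B u u) + 2 * Re (cnj ?c * B u v) + (cmod ?c)\<^sup>2 * q"
    using nonneg[OF lc_closed[OF assms]] expand_square[OF assms, of ?c] by (metis q_def)
  also have "Re (cnj ?c * B u v) = - (cmod (B u v))\<^sup>2 / q"
    unfolding cmod_power2 by (simp add: algebra_simps power2_eq_square add_divide_distrib diff_divide_distrib)
  also have "(cmod ?c)\<^sup>2 = (cmod (B u v))\<^sup>2 / q\<^sup>2"
    using q by (simp add: norm_mult power_mult_distrib norm_divide power_divide)
  finally have "0 \<le> Re (B u u) - (cmod (B u v))\<^sup>2 / q"
    using q by (simp add: power2_eq_square)
  then show ?thesis using q by (simp add: field_simps q_def)
qed

text \<open>Direct method: a minimising sequence of Q v - 2 Re (l v) is Cauchy by the parallelogram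
  identity, and the vanishing of the first variation at its limit is the desired equation.
  Completeness is a hypothesis in terms of sequences because the carrier has only a
  seminorm.\<close>

theorem Riesz_representation:
  fixes l :: "'h \<Rightarrow> complex"
  assumes ne: "D \<noteq> {}" and K: "0 \<le> K"
    and l_lc: "\<And>u v c. u \<in> D \<Longrightarrow> v \<in> D \<Longrightarrow> l (lc u c v) = l u + cnj c * l v"
    and l_bound: "\<And>v. v \<in> D \<Longrightarrow> (cmod (l v))\<^sup>2 \<le> K * Re (B v v)"
    and complete: "\<And>X. (\<And>n. X n \<in> D) \<Longrightarrow>
      (\<And>e. e > 0 \<Longrightarrow> \<exists>N. \<forall>m\<ge>N. \<forall>n\<ge>N. Re (B (lc (X m) (-1) (X n)) (lc (X m) (-1) (X n))) < e) \<Longrightarrow>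
      \<exists>x\<in>D. (\<lambda>n. Re (B (lc (X n) (-1) x) (lc (X n) (-1) x))) \<longlonglongrightarrow> 0"
  shows "\<exists>u\<in>D. \<forall>v\<in>D. B u v = l v"
proof -
  define Q where "Q v = Re (B v v)" for v
  define F where "F v = Q v - 2 * Re (l v)" for v
  \<comment> \<open>Since |l v|^2 \<le> K Q v, the inequality of arithmetic and geometric means
    gives 2 |l v| \<le> K + Q v.\<close>
  have lb: "- K \<le> F v" if "v \<in> D" for v
  proof -
    have "(Re (l v))\<^sup>2 \<le> K * Q v"
      using l_bound[OF that] abs_Re_le_cmod[of "l v"] power_mono[of "\<bar>Re (l v)\<bar>" "cmod (l v)" 2] by (simp add: Q_def)
    moreover have "4 * (K * Q v) \<le> (K + Q v)\<^sup>2"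
      using sum_squares_bound[of K "Q v"] by (simp add: power2_sum)
    ultimately have "(2 * Re (l v))\<^sup>2 \<le> (K + Q v)\<^sup>2" by (simp add: power_mult_distrib)
    then have "2 * Re (l v) \<le> K + Q v"
      using K nonneg[OF that] by (intro power2_le_imp_le[of "2 * Re (l v)" "K + Q v"]) (simp_all add: Q_def)
    then show ?thesis by (simp add: F_def)
  qed
  define m where "m = Inf (F ` D)"
  have bdd: "bdd_below (F ` D)" using lb by (auto intro!: bdd_belowI)
  have m_le: "m \<le> F v" if "v \<in> D" for v
    unfolding m_def using that by (intro cInf_lower bdd) auto
  have near: "\<exists>v\<in>D. F v < m + e" if "e > 0" for e
  proof -
    have "Inf (F ` D) < m + e" using that by (simp add: m_def)
    then show ?thesis using ne by (auto simp: cInf_less_iff bdd)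
  qed
  have "\<exists>v. v \<in> D \<and> F v < m + 1 / Suc n" for n using near[of "1 / Suc n"] by auto
  then obtain X where XD: "\<And>n. X n \<in> D" and XF: "\<And>n. F (X n) < m + 1 / Suc n" by metis
  have F_lc: "F (lc u c v) = F u + 2 * Re (cnj c * (B u v - l v)) + (cmod c)\<^sup>2 * Q v"
    if "u \<in> D" "v \<in> D" for u v c
    using expand_square[OF that, of c] l_lc[OF that, of c]
    by (simp add: F_def Q_def algebra_simps)
  \<comment> \<open>The element u + (v - u) cannot be identified with v, as \<open>lc\<close> obeys
    no laws of its own; \<open>B\<close> and \<open>l\<close>, however, do not distinguish the
    two.\<close>
  have Q_shift: "F (lc u 1 (lc v (-1) u)) = F v" if "u \<in> D" "v \<in> D" for u v
  proof -
    have "B (lc u 1 (lc v (-1) u)) w = B v w" "B w (lc u 1 (lc v (-1) u)) = B w v" if "w \<in> D" for w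
      using \<open>u \<in> D\<close> \<open>v \<in> D\<close> that by (simp_all add: lc_left lc_right lc_closed)
    then have "Q (lc u 1 (lc v (-1) u)) = Q v"
      using that by (simp add: Q_def lc_closed)
    moreover have "l (lc u 1 (lc v (-1) u)) = l v" using that by (simp add: l_lc lc_closed)
    ultimately show ?thesis by (simp add: F_def)
  qed
  \<comment> \<open>The identity behind this is Q (v - u) = 2 F u + 2 F v - 4 F (midpoint); the
    midpoint is a competitor, so its value is at least m.\<close>
  have par: "Q (lc v (-1) u) \<le> 2 * (F u - m) + 2 * (F v - m)" if "u \<in> D" "v \<in> D" for u v
  proof -
    let ?d = "lc v (-1) u"
    have d: "?d \<in> D" using that by (simp add: lc_closed)
    have "F v = F u + 2 * Re (B u ?d - l ?d) + Q ?d"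
      using F_lc[OF that(1) d, of 1] Q_shift[OF that] by simp
    moreover have "F (lc u (1/2) ?d) = F u + Re (B u ?d - l ?d) + Q ?d / 4"
      using F_lc[OF that(1) d, of "1/2"] by (simp add: norm_divide power2_eq_square)
    moreover have "m \<le> F (lc u (1/2) ?d)" using that by (intro m_le lc_closed)
    ultimately show ?thesis by simp
  qed
  have "\<exists>x\<in>D. (\<lambda>n. Re (B (lc (X n) (-1) x) (lc (X n) (-1) x))) \<longlonglongrightarrow> 0"
  proof (rule complete[OF XD])
    fix e :: real assume "e > 0"
    then obtain N where N: "1 / real (Suc N) < e / 4" using nat_approx_posE[of "e/4"] by auto
    have small: "F (X n) - m < e / 4" if "n \<ge> N" for n
    proof -
      have "1 / real (Suc n) \<le> 1 / real (Suc N)" using that by (simp add: frac_le)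
      then show ?thesis using XF[of n] N by simp
    qed
    show "\<exists>N. \<forall>m\<ge>N. \<forall>n\<ge>N. Re (B (lc (X m) (-1) (X n)) (lc (X m) (-1) (X n))) < e"
    proof (intro exI[of _ N] allI impI)
      fix i j assume "N \<le> i" "N \<le> j"
      then show "Re (B (lc (X i) (-1) (X j)) (lc (X i) (-1) (X j))) < e"
        using par[OF XD[of j] XD[of i]] small[of i] small[of j] by (simp add: Q_def)
    qed
  qed
  then obtain x where x: "x \<in> D" and lim: "(\<lambda>n. Q (lc (X n) (-1) x)) \<longlonglongrightarrow> 0"
    unfolding Q_def by blast
  \<comment> \<open>Along the minimising sequence the variation can be negative by at most 1 / (n +
    1). The limit n to infinity uses only that \<open>B (X n) v\<close> converges, which
    Cauchy-Schwarz supplies.\<close>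
  have "0 \<le> 2 * Re (cnj c * (B x v - l v)) + (cmod c)\<^sup>2 * Q v" if v: "v \<in> D" for v c
  proof -
    have "(\<lambda>n. B (lc (X n) (-1) x) v) \<longlonglongrightarrow> 0"
    proof (rule Lim_null_comparison)
      show "\<forall>\<^sub>F n in sequentially. norm (B (lc (X n) (-1) x) v) \<le> sqrt (Q (lc (X n) (-1) x) * Q v)"
        using Cauchy_Schwarz[OF lc_closed[OF XD x] v]
        by (intro always_eventually allI real_le_rsqrt) (auto simp: Q_def)
      show "(\<lambda>n. sqrt (Q (lc (X n) (-1) x) * Q v)) \<longlonglongrightarrow> 0"
        using tendsto_real_sqrt[OF tendsto_mult_right[OF lim, of "Q v"]] by simp
    qed
    then have "(\<lambda>n. B (X n) v - B x v) \<longlonglongrightarrow> 0" using v x XD by (simp add: lc_left)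
    then have Bc: "(\<lambda>n. B (X n) v) \<longlonglongrightarrow> B x v" by (rule LIM_zero_cancel)
    have nn: "0 \<le> 1 / Suc n + 2 * Re (cnj c * (B (X n) v - l v)) + (cmod c)\<^sup>2 * Q v" for n
      using F_lc[OF XD[of n] v, of c] m_le[OF lc_closed[OF XD[of n] v, of c]] XF[of n] by simp
    have lm: "(\<lambda>n. 1 / Suc n + 2 * Re (cnj c * (B (X n) v - l v)) + (cmod c)\<^sup>2 * Q v) \<longlonglongrightarrow>
        0 + 2 * Re (cnj c * (B x v - l v)) + (cmod c)\<^sup>2 * Q v"
      by (intro tendsto_add tendsto_mult tendsto_Re tendsto_diff tendsto_const Bc LIMSEQ_Suc[OF lim_1_over_n])
    show ?thesis using LIMSEQ_le_const[OF lm, of 0] nn by simp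
  qed
  then have "B x v = l v" if "v \<in> D" for v
    using quadratic_form_zero[of "B x v - l v" "Q v"] that by simp
  then show ?thesis using x by blast
qed

end

section \<open>Calculus of the classes \<open>Ck\<close>\<close>

lemma frechet_derivative_eq: "(f has_derivative f') (at x) \<Longrightarrow> frechet_derivative f (at x) = f'"
  by (rule frechet_derivative_at[symmetric])

lemma Ck_continuous: "Ck k f \<Longrightarrow> continuous_on UNIV f"
  by (cases k) (auto intro!: differentiable_imp_continuous_on simp: differentiable_on_def)

lemma Ck_Suc_D: "Ck (Suc k) f \<Longrightarrow> Ck k f"
proof (induction k arbitrary: f)
  case 0 then show ?case using Ck_continuous[of "Suc 0" f] by simp
next
  case (Suc k)
  have "Ck (Suc k) (\<lambda>x. frechet_derivative f (at x) b)" if "b \<in> Basis" for b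
    using Suc.prems that by (subst (asm) Ck.simps(2)) blast
  then show ?case using Suc by auto
qed

lemma Ck_const: "Ck k (\<lambda>x. c)"
proof (induction k arbitrary: c)
  case 0 then show ?case by simp
next
  case (Suc k)
  then show ?case by (simp add: frechet_derivative_eq[OF has_derivative_const])
qed

lemma Ck_add: "Ck k f \<Longrightarrow> Ck k g \<Longrightarrow> Ck k (\<lambda>x. f x + g x)"
proof (induction k arbitrary: f g)
  case 0 then show ?case by (simp add: continuous_on_add)
next
  case (Suc k)
  have "frechet_derivative (\<lambda>x. f x + g x) (at x) b
      = frechet_derivative f (at x) b + frechet_derivative g (at x) b" for x b
    using Suc.prems by (subst frechet_derivative_eq[OF has_derivative_add[OF frechet_derivative_works[THEN iffD1] frechet_derivative_works[THEN iffD1]]]) auto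
  then show ?case using Suc by auto
qed

lemma Ck_mult: "Ck k f \<Longrightarrow> Ck k g \<Longrightarrow> Ck k (\<lambda>x. f x * g x)"
proof (induction k arbitrary: f g)
  case 0 then show ?case by (simp add: continuous_on_mult)
next
  case (Suc k)
  have "frechet_derivative (\<lambda>x. f x * g x) (at x) b
      = f x * frechet_derivative g (at x) b + frechet_derivative f (at x) b * g x" for x b
    using Suc.prems by (subst frechet_derivative_eq[OF has_derivative_mult[OF frechet_derivative_works[THEN iffD1] frechet_derivative_works[THEN iffD1]]]) auto
  then show ?case using Suc.prems by (auto intro!: Ck_add Suc.IH Ck_Suc_D[of k f] Ck_Suc_D[of k g])
qed

lemma Ck_prod: "finite I \<Longrightarrow> (\<And>i. i \<in> I \<Longrightarrow> Ck k (f i)) \<Longrightarrow> Ck k (\<lambda>x. \<Prod>i\<in>I. f i x)"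
  by (induction I rule: finite_induct) (auto intro!: Ck_const Ck_mult)

lemma frechet_derivative_affine:
  fixes f :: "'b::euclidean_space \<Rightarrow> complex" and L :: "'a::euclidean_space \<Rightarrow> 'b"
  assumes "f differentiable at (L x + c)" and "bounded_linear L"
  shows "((\<lambda>x. f (L x + c)) has_derivative (\<lambda>h. frechet_derivative f (at (L x + c)) (L h))) (at x)"
proof -
  have "((\<lambda>x. L x + c) has_derivative L) (at x)"
    using bounded_linear_imp_has_derivative[OF assms(2)] by (auto intro!: derivative_eq_intros)
  then show ?thesis
    by (rule has_derivative_compose) (rule frechet_derivative_works[THEN iffD1, OF assms(1)])
qed

text \<open>If L sends each basis vector to a multiple of a basis vector, a partial derivative of
  the composition is a multiple of one partial derivative of f, and the induction closes. Dilations,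
  coordinate projections (with r = 0 in the lost direction) and embeddings of lines are all of this
  kind.\<close>

lemma Ck_affine:
  fixes f :: "'b::euclidean_space \<Rightarrow> complex" and L :: "'a::euclidean_space \<Rightarrow> 'b"
  assumes "bounded_linear L" and "\<And>b. b \<in> Basis \<Longrightarrow> \<exists>r. \<exists>b'\<in>Basis. L b = r *\<^sub>R b'"
  shows "Ck k f \<Longrightarrow> Ck k (\<lambda>x. f (L x + c))"
proof (induction k arbitrary: f)
  case 0
  have "continuous_on UNIV (\<lambda>x. L x + c)"
    by (intro continuous_intros bounded_linear.continuous_on[OF assms(1)] continuous_on_id)
  then show ?case using 0 continuous_on_compose2[of UNIV f UNIV "\<lambda>x. L x + c"] by simp
next
  case (Suc k)
  have df: "f differentiable at x" for x using Suc.prems by simp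
  note d = frechet_derivative_affine[OF df assms(1)]
  have "Ck k (\<lambda>x. frechet_derivative (\<lambda>x. f (L x + c)) (at x) b)" if b: "b \<in> Basis" for b
  proof -
    obtain r b' where b': "b' \<in> Basis" "L b = r *\<^sub>R b'" using assms(2)[OF b] by blast
    have lin: "linear (frechet_derivative f (at y))" for y
      by (rule linear_frechet_derivative[OF df])
    have "frechet_derivative (\<lambda>x. f (L x + c)) (at x) b
        = complex_of_real r * frechet_derivative f (at (L x + c)) b'" for x
      by (simp add: frechet_derivative_eq[OF d] b' linear_scale[OF lin] scaleR_conv_of_real)
    moreover have "Ck k (\<lambda>x. frechet_derivative f (at x) b')" using Suc.prems b' by simp
    ultimately show ?thesis by (auto intro!: Ck_mult Ck_const Suc.IH)
  qed
  moreover have "(\<lambda>x. f (L x + c)) differentiable at x" for x unfolding differentiable_def by (rule exI, rule d)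
  ultimately show ?case by simp
qed

subsection \<open>Bump functions\<close>

text \<open>The classical exp (-1/x), divided by powers of x: the family over all n is closed under
  differentiation up to linear combinations, so that smoothness follows by one induction on the
  order.\<close>

definition flat :: "nat \<Rightarrow> real \<Rightarrow> real" where
  "flat n x = (if x > 0 then exp (- (1 / x)) / x ^ n else 0)"

lemma flat_tendsto_0: "(flat n \<longlongrightarrow> 0) (at 0)"
proof (rule filterlim_split_at)
  show "(flat n \<longlongrightarrow> 0) (at_left 0)"
    by (rule tendsto_eventually) (auto simp: flat_def eventually_at_filter)
  have "((\<lambda>x. (inverse x) ^ n / exp (inverse x)) \<longlongrightarrow> 0) (at_right (0::real))"
    by (rule filterlim_compose[OF tendsto_power_div_exp_0 filterlim_inverse_at_top_right])
  moreover have "\<forall>\<^sub>F x in at_right (0::real). (inverse x) ^ n / exp (inverse x) = flat n x"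
    unfolding eventually_at_filter
    by (auto intro!: always_eventually simp: flat_def exp_minus field_simps)
  ultimately show "(flat n \<longlongrightarrow> 0) (at_right 0)"
    by (rule Lim_transform_eventually)
qed

text \<open>The only delicate point is the origin, where the difference quotient of
  \<open>flat n\<close> is \<open>flat (Suc n)\<close>, which tends to 0 because the exponential
  beats every power.\<close>

lemma flat_has_derivative:
  "(flat n has_real_derivative (flat (n + 2) x - n * flat (n + 1) x)) (at x)"
proof -
  consider "x > 0" | "x = 0" | "x < 0" by linarith
  then show ?thesis
  proof cases
    case 1
    have "((\<lambda>x. exp (- (1 / x)) * (1 / x) ^ n) has_real_derivative
        exp (- (1 / x)) * (1 / x\<^sup>2) * (1 / x) ^ n - exp (- (1 / x)) * (real n * (1 / x) ^ (n - 1) * (1 / x\<^sup>2))) (at x)"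
      using 1 by (auto intro!: derivative_eq_intros simp: power2_eq_square)
    also have "(\<lambda>x. exp (- (1 / x)) * (1 / x) ^ n) = (\<lambda>x::real. exp (- (1 / x)) / x ^ n)"
      by (simp add: power_inverse divide_inverse)
    also have "exp (- (1 / x)) * (1 / x\<^sup>2) * (1 / x) ^ n - exp (- (1 / x)) * (real n * (1 / x) ^ (n - 1) * (1 / x\<^sup>2))
       = flat (n + 2) x - n * flat (n + 1) x"
      using 1 by (cases n) (simp_all add: flat_def power_inverse power_add power2_eq_square divide_inverse algebra_simps)
    finally have "((\<lambda>x. exp (- (1 / x)) / x ^ n) has_real_derivative (flat (n + 2) x - n * flat (n + 1) x)) (at x)" .
    moreover have "\<forall>\<^sub>F y in nhds x. exp (- (1 / y)) / y ^ n = flat n y"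
      using 1 by (auto simp: eventually_nhds flat_def intro!: exI[of _ "{0<..}"])
    ultimately show ?thesis by (subst DERIV_cong_ev[OF refl _ refl, symmetric])
  next
    case 2
    have "(flat n has_real_derivative 0) (at 0)"
    proof (rule has_field_derivative_iff[THEN iffD2])
      have "\<forall>\<^sub>F y in at 0. flat (Suc n) y = (flat n y - flat n 0) / (y - 0)"
        unfolding eventually_at_filter by (auto intro!: always_eventually simp: flat_def)
      then show "((\<lambda>y. (flat n y - flat n 0) / (y - 0)) \<longlongrightarrow> 0) (at 0)"
        by (rule Lim_transform_eventually[OF flat_tendsto_0])
    qed
    then show ?thesis using 2 by (simp add: flat_def)
  next
    case 3
    have "\<forall>\<^sub>F y in nhds x. 0 = flat n y"
      using 3 by (auto simp: eventually_nhds flat_def intro!: exI[of _ "{..<0}"])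
    moreover have "((\<lambda>_. 0) has_real_derivative (flat (n + 2) x - n * flat (n + 1) x)) (at x)"
      using 3 by (simp add: flat_def)
    ultimately show ?thesis by (subst DERIV_cong_ev[OF refl _ refl, symmetric])
  qed
qed

lemma Ck_flat: "Ck k (\<lambda>x. complex_of_real (flat n x))"
proof (induction k arbitrary: n)
  case 0
  have "isCont (flat n) x" for x by (rule DERIV_isCont[OF flat_has_derivative])
  then show ?case by (auto intro!: continuous_intros simp: continuous_at_imp_continuous_on)
next
  case (Suc k)
  have d: "((\<lambda>x. complex_of_real (flat n x)) has_derivative
     (\<lambda>h. h *\<^sub>R complex_of_real (flat (n + 2) x - n * flat (n + 1) x))) (at x)" for x
    using has_vector_derivative_of_real[OF flat_has_derivative[of n x]]
    unfolding has_vector_derivative_def .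
  have "Ck k (\<lambda>x. complex_of_real (flat (n + 2) x) + of_real (- real n) * complex_of_real (flat (n + 1) x))"
    by (intro Ck_add Ck_mult Ck_const Suc.IH)
  then have "Ck k (\<lambda>x. frechet_derivative (\<lambda>x. complex_of_real (flat n x)) (at x) 1)"
    unfolding frechet_derivative_eq[OF d] by simp
  moreover have "(\<lambda>x. complex_of_real (flat n x)) differentiable at x" for x
    unfolding differentiable_def by (rule exI, rule d)
  ultimately show ?case by simp
qed

text \<open>The factors switch on at a + 1/(n+1) and off at c - 1/(n+1), so the support is compact
  inside the open interval, and their arguments grow with n, so the values tend to 1 inside. The
  arguments are spelled as m x + t to fit \<open>Ck_affine\<close>.\<close>

definition bump :: "nat \<Rightarrow> real \<Rightarrow> real \<Rightarrow> real \<Rightarrow> complex" where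
  "bump n a c x = complex_of_real (flat 0 (real (Suc n) * x + (- real (Suc n) * a - 1)))
                * complex_of_real (flat 0 (- real (Suc n) * x + (real (Suc n) * c - 1)))"

lemma Ck_bump: "Ck k (bump n a c)"
proof -
  have *: "Ck k (\<lambda>x. complex_of_real (flat 0 (m * x + t)))" for m t :: real
    using Ck_affine[OF bounded_linear_mult_right, where f = "\<lambda>x. complex_of_real (flat 0 x)"] Ck_flat by simp
  show ?thesis unfolding bump_def[abs_def] by (intro Ck_mult *)
qed

lemma flat_0_bounds: "0 \<le> flat 0 x" "flat 0 x \<le> 1"
  by (auto simp: flat_def)

lemma cmod_bump_le: "cmod (bump n a c x) \<le> 1"
  using flat_0_bounds by (simp add: bump_def norm_mult mult_le_one)

lemma bump_support:
  assumes "bump n a c x \<noteq> 0" shows "x \<in> {a + 1 / Suc n .. c - 1 / Suc n}"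
proof -
  have "real (Suc n) * x + (- real (Suc n) * a - 1) > 0" "- real (Suc n) * x + (real (Suc n) * c - 1) > 0"
    using assms by (auto simp: bump_def flat_def split: if_splits)
  then have "real (Suc n) * (x - a) > 1" "real (Suc n) * (c - x) > 1" by (simp_all add: algebra_simps del: of_nat_Suc)
  then have "1 / real (Suc n) < x - a" "1 / real (Suc n) < c - x"
    by (simp_all add: pos_divide_less_eq mult.commute del: of_nat_Suc)
  then show ?thesis by (simp del: of_nat_Suc)
qed

lemma flat_tendsto_1: "((\<lambda>n. flat 0 (real (Suc n) * r - 1)) \<longlonglongrightarrow> 1)" if "r > 0" for r :: real
proof -
  have l: "filterlim (\<lambda>n. real (Suc n) * r - 1) at_top sequentially"
    unfolding filterlim_at_top
  proof
    fix Z :: real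
    obtain N where N: "(Z + 1) / r < real N" using reals_Archimedean2 by blast
    have "Z \<le> real (Suc n) * r - 1" if "n \<ge> N" for n
    proof -
      have "(Z + 1) / r < real (Suc n)" using N that by linarith
      then show ?thesis using \<open>r > 0\<close> by (simp add: field_simps)
    qed
    then show "\<forall>\<^sub>F n in sequentially. Z \<le> real (Suc n) * r - 1"
      by (rule eventually_sequentiallyI)
  qed
  have "((\<lambda>x. exp (- (1 / x))) \<longlongrightarrow> 1) (at_top :: real filter)"
  proof -
    have "((\<lambda>x::real. 1 / x) \<longlongrightarrow> 0) at_top"
      by (rule tendsto_divide_0[OF tendsto_const filterlim_at_top_imp_at_infinity[OF filterlim_ident]])
    then have "((\<lambda>x::real. exp (- (1 / x))) \<longlongrightarrow> exp (- 0)) at_top"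
      by (intro tendsto_exp tendsto_minus)
    then show ?thesis by simp
  qed
  then have "((flat 0) \<longlongrightarrow> 1) at_top"
    by (rule Lim_transform_eventually) (auto simp: flat_def intro!: eventually_mono[OF eventually_gt_at_top[of 0]])
  from filterlim_compose[OF this l] show ?thesis .
qed

lemma bump_tendsto: "(\<lambda>n. bump n a c x) \<longlonglongrightarrow> indicator {a<..<c} x"
proof (cases "x \<in> {a<..<c}")
  case True
  have eq: "bump n a c x = complex_of_real (flat 0 (real (Suc n) * (x - a) - 1)) * complex_of_real (flat 0 (real (Suc n) * (c - x) - 1))" for n
    by (simp add: bump_def algebra_simps)
  have "(\<lambda>n. bump n a c x) \<longlonglongrightarrow> complex_of_real 1 * complex_of_real 1"
    unfolding eq using True by (intro tendsto_intros flat_tendsto_1) auto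
  then show ?thesis using True by simp
next
  case False
  have "bump n a c x = 0" for n
  proof (rule ccontr)
    assume "bump n a c x \<noteq> 0"
    from bump_support[OF this] have "a + 1 / real (Suc n) \<le> x" "x \<le> c - 1 / real (Suc n)" by auto
    moreover have "0 < 1 / real (Suc n)" by simp
    ultimately have "a < x" "x < c" by linarith+
    with False show False by simp
  qed
  then show ?thesis using False by simp
qed

subsection \<open>Test functions\<close>

lemma test_functionsI:
  assumes "\<And>k. Ck k \<phi>" "compact K" "K \<subseteq> \<Omega>" "\<And>x. x \<notin> K \<Longrightarrow> \<phi> x = 0"
  shows "\<phi> \<in> test_functions \<Omega>"
proof -
  have "closure {x. \<phi> x \<noteq> 0} \<subseteq> K"
    using assms(2,4) by (intro closure_minimal compact_imp_closed) auto
  moreover from this have "compact (closure {x. \<phi> x \<noteq> 0})"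
    using compact_Int_closed[OF assms(2) closed_closure, of "{x. \<phi> x \<noteq> 0}"] by (simp add: inf.absorb2)
  ultimately show ?thesis using assms by (auto simp: test_functions_def)
qed

lemma test_support:
  assumes "\<phi> \<in> test_functions \<Omega>"
  shows "\<exists>K. compact K \<and> K \<subseteq> \<Omega> \<and> (\<forall>x. x \<notin> K \<longrightarrow> \<phi> x = 0)"
  using assms closure_subset[of "{x. \<phi> x \<noteq> 0}"]
  by (intro exI[of _ "closure {x. \<phi> x \<noteq> 0}"]) (auto simp: test_functions_def)

lemma test_Ck: "\<phi> \<in> test_functions \<Omega> \<Longrightarrow> Ck k \<phi>"
  by (simp add: test_functions_def)

lemma test_differentiable: "\<phi> \<in> test_functions \<Omega> \<Longrightarrow> \<phi> differentiable at x"
  using test_Ck[of \<phi> \<Omega> "Suc 0"] by simp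

lemma test_continuous: "\<phi> \<in> test_functions \<Omega> \<Longrightarrow> continuous_on A \<phi>"
  by (rule continuous_on_subset[OF Ck_continuous[OF test_Ck[of \<phi> \<Omega> 0]]]) auto

lemma test_outside: "\<phi> \<in> test_functions \<Omega> \<Longrightarrow> x \<notin> \<Omega> \<Longrightarrow> \<phi> x = 0"
  using test_support by blast

lemma test_deriv:
  assumes "\<phi> \<in> test_functions \<Omega>" "b \<in> Basis"
  shows "(\<lambda>x. frechet_derivative \<phi> (at x) b) \<in> test_functions \<Omega>"
proof -
  obtain K where K: "compact K" "K \<subseteq> \<Omega>" "\<And>x. x \<notin> K \<Longrightarrow> \<phi> x = 0" using test_support[OF assms(1)] by blast
  have "frechet_derivative \<phi> (at x) b = 0" if "x \<notin> K" for x
  proof -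
    have "(\<phi> has_derivative (\<lambda>_. 0)) (at x)"
      by (rule has_derivative_transform_within_open[OF has_derivative_const[of 0], of "- K"])
         (use K that compact_imp_closed in auto)
    then show ?thesis by (simp add: frechet_derivative_eq)
  qed
  moreover have "Ck k (\<lambda>x. frechet_derivative \<phi> (at x) b)" for k
    using test_Ck[OF assms(1), of "Suc k"] assms(2) by simp
  ultimately show ?thesis using K by (intro test_functionsI[of _ K])
qed

lemma test_mono: "\<phi> \<in> test_functions A \<Longrightarrow> A \<subseteq> B \<Longrightarrow> \<phi> \<in> test_functions B"
  by (auto simp: test_functions_def)

lemma test_lc:
  assumes "\<phi> \<in> test_functions \<Omega>" "\<psi> \<in> test_functions \<Omega>"
  shows "(\<lambda>x. \<phi> x + c * \<psi> x) \<in> test_functions \<Omega>"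
proof -
  obtain K where K: "compact K" "K \<subseteq> \<Omega>" "\<And>x. x \<notin> K \<Longrightarrow> \<phi> x = 0" using test_support[OF assms(1)] by blast
  obtain K' where K': "compact K'" "K' \<subseteq> \<Omega>" "\<And>x. x \<notin> K' \<Longrightarrow> \<psi> x = 0" using test_support[OF assms(2)] by blast
  show ?thesis
  proof (rule test_functionsI[of _ "K \<union> K'"])
    show "Ck k (\<lambda>x. \<phi> x + c * \<psi> x)" for k
      by (rule Ck_add[OF test_Ck[OF assms(1)] Ck_mult[OF Ck_const test_Ck[OF assms(2)]]])
  qed (use K K' in auto)
qed

lemma test_bump:
  assumes "{a<..<c} \<subseteq> I" shows "bump n a c \<in> test_functions I"
proof (rule test_functionsI[of _ "{a + 1 / real (Suc n) .. c - 1 / real (Suc n)}"])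
  have "0 < 1 / real (Suc n)" by simp
  have "{a + 1 / real (Suc n) .. c - 1 / real (Suc n)} \<subseteq> {a<..<c}"
  proof
    fix x assume "x \<in> {a + 1 / real (Suc n) .. c - 1 / real (Suc n)}"
    then have "a + 1 / real (Suc n) \<le> x" "x \<le> c - 1 / real (Suc n)" by simp_all
    with \<open>0 < 1 / real (Suc n)\<close> have "a < x" "x < c" by linarith+
    then show "x \<in> {a<..<c}" by simp
  qed
  then show "{a + 1 / real (Suc n) .. c - 1 / real (Suc n)} \<subseteq> I" using assms by blast
qed (use bump_support[of n a c] in \<open>auto intro!: Ck_bump\<close>)

lemma test_tensor:
  fixes \<phi> \<eta> :: "real \<Rightarrow> complex"
  assumes "\<phi> \<in> test_functions I" "\<eta> \<in> test_functions K" "I \<times> K \<subseteq> \<Omega>"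
  shows "(\<lambda>x. \<phi> (fst x) * \<eta> (snd x)) \<in> test_functions \<Omega>"
proof -
  obtain A where A: "compact A" "A \<subseteq> I" "\<And>x. x \<notin> A \<Longrightarrow> \<phi> x = 0" using test_support[OF assms(1)] by blast
  obtain B where B: "compact B" "B \<subseteq> K" "\<And>x. x \<notin> B \<Longrightarrow> \<eta> x = 0" using test_support[OF assms(2)] by blast
  have 1: "Ck k (\<lambda>x::real\<times>real. \<phi> (fst x + 0))" for k
    by (rule Ck_affine[OF bounded_linear_fst _ test_Ck[OF assms(1)]]) (auto simp: Basis_prod_def)
  have 2: "Ck k (\<lambda>x::real\<times>real. \<eta> (snd x + 0))" for k
    by (rule Ck_affine[OF bounded_linear_snd _ test_Ck[OF assms(2)]]) (auto simp: Basis_prod_def)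
  show ?thesis
  proof (rule test_functionsI[of _ "A \<times> B"])
    show "\<phi> (fst x) * \<eta> (snd x) = 0" if "x \<notin> A \<times> B" for x
      using that A(3) B(3) by (metis mem_Times_iff mult_eq_0_iff)
  qed (use Ck_mult[OF 1 2] A B assms(3) in \<open>auto simp: compact_Times\<close>)
qed

text \<open>Sections of planar test functions are test functions on the sections of the domain. This
  allows the weak derivatives of the trial function to be verified line by line after
  Fubini.\<close>

lemma test_section_fst:
  fixes \<phi> :: "real \<times> real \<Rightarrow> complex"
  assumes "\<phi> \<in> test_functions \<Omega>"
  shows "(\<lambda>s. \<phi> (s, t)) \<in> test_functions {s. (s, t) \<in> \<Omega>}"
proof -
  obtain A where A: "compact A" "A \<subseteq> \<Omega>" "\<And>x. x \<notin> A \<Longrightarrow> \<phi> x = 0" using test_support[OF assms(1)] by blast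
  have L: "bounded_linear (\<lambda>s::real. (s, 0::real))"
    by (intro bounded_linear_Pair bounded_linear_ident bounded_linear_zero)
  have "Ck k (\<lambda>s. \<phi> ((s, 0) + (0, t)))" for k
    by (rule Ck_affine[OF L _ test_Ck[OF assms]]) (auto simp: Basis_prod_def intro!: exI[of _ 1])
  moreover have "compact (fst ` (A \<inter> (UNIV \<times> {t})))"
    by (intro compact_continuous_image continuous_intros compact_Int_closed A(1) closed_Times closed_UNIV closed_singleton)
  moreover have "\<phi> (x, t) = 0" if "x \<notin> fst ` (A \<inter> (UNIV \<times> {t}))" for x
    using that A(3)[of "(x, t)"] by force
  ultimately show ?thesis using A(2)
    by (intro test_functionsI[of _ "fst ` (A \<inter> (UNIV \<times> {t}))"]) auto
qed

lemma test_section_snd: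
  fixes \<phi> :: "real \<times> real \<Rightarrow> complex"
  assumes "\<phi> \<in> test_functions \<Omega>"
  shows "(\<lambda>t. \<phi> (s, t)) \<in> test_functions {t. (s, t) \<in> \<Omega>}"
proof -
  obtain A where A: "compact A" "A \<subseteq> \<Omega>" "\<And>x. x \<notin> A \<Longrightarrow> \<phi> x = 0" using test_support[OF assms(1)] by blast
  have L: "bounded_linear (\<lambda>t::real. (0::real, t))"
    by (intro bounded_linear_Pair bounded_linear_ident bounded_linear_zero)
  have "Ck k (\<lambda>t. \<phi> ((0, t) + (s, 0)))" for k
    by (rule Ck_affine[OF L _ test_Ck[OF assms]]) (auto simp: Basis_prod_def intro!: exI[of _ 1])
  moreover have "compact (snd ` (A \<inter> ({s} \<times> UNIV)))"
    by (intro compact_continuous_image continuous_intros compact_Int_closed A(1) closed_Times closed_UNIV closed_singleton)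
  moreover have "\<phi> (s, x) = 0" if "x \<notin> snd ` (A \<inter> ({s} \<times> UNIV))" for x
    using that A(3)[of "(s, x)"] by force
  ultimately show ?thesis using A(2)
    by (intro test_functionsI[of _ "snd ` (A \<inter> ({s} \<times> UNIV))"]) auto
qed

definition box_bump :: "nat \<Rightarrow> 'a::euclidean_space \<Rightarrow> 'a \<Rightarrow> 'a \<Rightarrow> complex" where
  "box_bump n a c x = (\<Prod>b\<in>Basis. bump n (a \<bullet> b) (c \<bullet> b) (x \<bullet> b))"

lemma test_box_bump:
  assumes "cbox a c \<subseteq> \<Omega>" shows "box_bump n a c \<in> test_functions \<Omega>"
proof (rule test_functionsI[OF _ compact_cbox assms])
  have "Ck k (\<lambda>x::'a. bump n (a \<bullet> b) (c \<bullet> b) (x \<bullet> b + 0))" if "b \<in> Basis" for b k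
    by (rule Ck_affine[OF bounded_linear_inner_left _ Ck_bump]) (use that in \<open>auto simp: inner_Basis\<close>)
  then show "Ck k (box_bump n a c)" for k
    unfolding box_bump_def[abs_def] by (intro Ck_prod) auto
  fix x assume "x \<notin> cbox a c"
  then obtain b where b: "b \<in> Basis" "\<not> (a \<bullet> b \<le> x \<bullet> b \<and> x \<bullet> b \<le> c \<bullet> b)" by (auto simp: mem_box)
  have "bump n (a \<bullet> b) (c \<bullet> b) (x \<bullet> b) = 0"
  proof (rule ccontr)
    assume "bump n (a \<bullet> b) (c \<bullet> b) (x \<bullet> b) \<noteq> 0"
    from bump_support[OF this] have "a \<bullet> b + 1 / Suc n \<le> x \<bullet> b" "x \<bullet> b \<le> c \<bullet> b - 1 / Suc n" by auto
    moreover have "0 < 1 / real (Suc n)" by simp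
    ultimately show False using b(2) by linarith
  qed
  then show "box_bump n a c x = 0" using b(1) by (auto simp: box_bump_def)
qed

lemma cmod_box_bump_le: "cmod (box_bump n a c x) \<le> 1"
  unfolding box_bump_def prod_norm[symmetric] by (rule prod_le_1) (simp add: cmod_bump_le)

lemma box_bump_tendsto: "(\<lambda>n. box_bump n a c x) \<longlonglongrightarrow> indicator (box a c) x"
proof -
  have "(\<lambda>n. box_bump n a c x) \<longlonglongrightarrow> (\<Prod>b\<in>Basis. indicator {a \<bullet> b<..<c \<bullet> b} (x \<bullet> b))"
    unfolding box_bump_def by (intro tendsto_prod bump_tendsto)
  also have "(\<Prod>b\<in>Basis. indicator {a \<bullet> b<..<c \<bullet> b} (x \<bullet> b)) = (indicator (box a c) x :: complex)"
  proof (cases "x \<in> box a c")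
    case True then show ?thesis by (auto simp: mem_box)
  next
    case False
    then obtain b where b: "b \<in> Basis" "x \<bullet> b \<notin> {a \<bullet> b<..<c \<bullet> b}" by (auto simp: mem_box)
    then have "(indicator {a \<bullet> b<..<c \<bullet> b} (x \<bullet> b) :: complex) = 0" by simp
    then show ?thesis using False b(1) by (auto intro!: prod_zero bexI[of _ b])
  qed
  finally show ?thesis .
qed

section \<open>Borel representatives and the fundamental lemma of the calculus of variations\<close>

lemma lebesgue_measurable_AE:
  fixes f g :: "'a::euclidean_space \<Rightarrow> complex"
  assumes "f \<in> borel_measurable borel" "AE x in lborel. x \<in> \<Omega> \<longrightarrow> f x = g x" "\<Omega> \<in> sets borel"
  shows "g \<in> borel_measurable (lebesgue_on \<Omega>)"
proof -
  have "(\<lambda>x. indicator \<Omega> x *\<^sub>R f x) \<in> borel_measurable lebesgue"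
    using assms(1,3) by (auto intro!: measurable_completion)
  moreover have "AE x in lebesgue. indicator \<Omega> x *\<^sub>R f x = indicator \<Omega> x *\<^sub>R g x"
    using assms(2) by (auto simp: AE_completion_iff indicator_def elim!: eventually_mono)
  ultimately have "(\<lambda>x. indicator \<Omega> x *\<^sub>R g x) \<in> borel_measurable lebesgue"
    by (rule borel_measurable_AE)
  then show ?thesis using assms(3)
    by (subst borel_measurable_restrict_space_iff) auto
qed

lemma AE_lebesgue_on:
  assumes "\<Omega> \<in> sets borel"
  shows "(AE x in lebesgue_on \<Omega>. P x) \<longleftrightarrow> (AE x in lborel. x \<in> \<Omega> \<longrightarrow> P x)"
  using assms by (subst AE_restrict_space_iff) (auto simp: AE_completion_iff)

lemma lebesgue_on_integral:
  fixes f F :: "'a::euclidean_space \<Rightarrow> 'b::{banach, second_countable_topology}"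
  assumes "\<Omega> \<in> sets borel" "F \<in> borel_measurable borel" "f \<in> borel_measurable (lebesgue_on \<Omega>)"
    and "AE x in lborel. x \<in> \<Omega> \<longrightarrow> f x = F x" "\<And>x. x \<notin> \<Omega> \<Longrightarrow> F x = 0"
  shows "integrable (lebesgue_on \<Omega>) f \<longleftrightarrow> integrable lborel F"
    and "(LINT x|lebesgue_on \<Omega>. f x) = (LINT x|lborel. F x)"
proof -
  have F: "F \<in> borel_measurable (lebesgue_on \<Omega>)"
    using assms(2) by (auto intro!: measurable_restrict_space1 measurable_completion)
  have ae: "AE x in lebesgue_on \<Omega>. f x = F x" using assms by (simp add: AE_lebesgue_on)
  have ind: "indicator \<Omega> x *\<^sub>R F x = F x" for x using assms(5)[of x] by (cases "x \<in> \<Omega>") auto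
  have "integrable (lebesgue_on \<Omega>) f \<longleftrightarrow> integrable (lebesgue_on \<Omega>) F"
    by (rule integrable_cong_AE[OF assms(3) F ae])
  also have "\<dots> \<longleftrightarrow> integrable lborel F"
    using assms(1,2) by (subst integrable_restrict_space) (auto simp: ind integrable_completion)
  finally show "integrable (lebesgue_on \<Omega>) f \<longleftrightarrow> integrable lborel F" .
  have "(LINT x|lebesgue_on \<Omega>. f x) = (LINT x|lebesgue_on \<Omega>. F x)"
    by (rule integral_cong_AE[OF assms(3) F ae])
  also have "\<dots> = (LINT x|lborel. F x)"
    using assms(1,2) by (subst integral_restrict_space) (auto simp: ind integral_completion)
  finally show "(LINT x|lebesgue_on \<Omega>. f x) = (LINT x|lborel. F x)" .
qed

lemma complex_completion_borel:
  fixes f :: "'a::euclidean_space \<Rightarrow> complex"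
  assumes "f \<in> borel_measurable lebesgue"
  obtains g where "g \<in> borel_measurable borel" "AE x in lborel. f x = g x"
proof -
  have re: "(\<lambda>x. Re (f x)) \<in> borel_measurable lebesgue" and im: "(\<lambda>x. Im (f x)) \<in> borel_measurable lebesgue"
    using assms by auto
  obtain a where a: "a \<in> borel_measurable lborel" "AE x in lborel. Re (f x) = a x"
    using completion_ex_borel_measurable_real[OF re] by blast
  obtain b where b: "b \<in> borel_measurable lborel" "AE x in lborel. Im (f x) = b x"
    using completion_ex_borel_measurable_real[OF im] by blast
  show ?thesis
  proof (rule that)
    show "(\<lambda>x. complex_of_real (a x) + \<i> * complex_of_real (b x)) \<in> borel_measurable borel"
      using a b by simp
    show "AE x in lborel. f x = complex_of_real (a x) + \<i> * complex_of_real (b x)"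
      using a(2) b(2) by eventually_elim (simp add: complex_eq_iff)
  qed
qed

lemma L2_borel_rep:
  fixes u :: "'a::euclidean_space \<Rightarrow> complex"
  assumes "\<Omega> \<in> sets borel" "u \<in> L2 (lebesgue_on \<Omega>)"
  obtains v where "v \<in> borel_measurable borel" "v \<in> L2 lborel" "\<And>x. x \<notin> \<Omega> \<Longrightarrow> v x = 0"
    "AE x in lborel. x \<in> \<Omega> \<longrightarrow> u x = v x"
proof -
  have "(\<lambda>x. indicator \<Omega> x *\<^sub>R u x) \<in> borel_measurable lebesgue"
    using L2_measurable[OF assms(2)] assms(1) by (subst (asm) borel_measurable_restrict_space_iff) auto
  then obtain g where g: "g \<in> borel_measurable borel" "AE x in lborel. indicator \<Omega> x *\<^sub>R u x = g x"
    by (rule complex_completion_borel)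
  define v where "v x = indicator \<Omega> x *\<^sub>R g x" for x
  have v: "v \<in> borel_measurable borel" using g assms by (simp add: v_def[abs_def])
  have ae: "AE x in lborel. x \<in> \<Omega> \<longrightarrow> u x = v x"
    using g(2) by eventually_elim (auto simp: v_def)
  have "integrable (lebesgue_on \<Omega>) (\<lambda>x. (cmod (u x))\<^sup>2) \<longleftrightarrow> integrable lborel (\<lambda>x. (cmod (v x))\<^sup>2)"
  proof (rule lebesgue_on_integral[OF assms(1)])
    show "(\<lambda>x. (cmod (v x))\<^sup>2) \<in> borel_measurable borel" using v by simp
    show "(\<lambda>x. (cmod (u x))\<^sup>2) \<in> borel_measurable (lebesgue_on \<Omega>)" using L2_measurable[OF assms(2)] by simp
    show "AE x in lborel. x \<in> \<Omega> \<longrightarrow> (cmod (u x))\<^sup>2 = (cmod (v x))\<^sup>2" using ae by eventually_elim simp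
  qed (simp add: v_def)
  then have "v \<in> L2 lborel" using assms v by (auto simp: L2_def)
  then show ?thesis by (rule that[OF v _ _ ae]) (simp add: v_def)
qed

text \<open>Boxes are stable under intersection and generate the Borel sets, so a Dynkin argument
  extends the hypothesis to all Borel sets; uniqueness of densities then applies to the real and to
  the imaginary part.\<close>

lemma set_integrals_zero_imp_AE_zero:
  fixes g :: "'a::euclidean_space \<Rightarrow> complex"
  assumes int: "integrable lborel g" and box: "\<And>a b. (LINT x|lborel. indicator (box a b) x *\<^sub>R g x) = 0"
  shows "AE x in lborel. g x = 0"
proof -
  have UN: "(\<Union>n::nat. box (- (real n *\<^sub>R One)) (real n *\<^sub>R One)) = (UNIV :: 'a set)"
    by (rule UN_box_eq_UNIV)
  have inti: "integrable lborel (\<lambda>x. indicator A x *\<^sub>R g x)" if "A \<in> sets borel" for A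
    using integrable_mult_indicator[of A lborel g] int that by simp
  \<comment> \<open>The complement step of the Dynkin argument needs the integral over the whole
    space. It is the limit of integrals over growing boxes.\<close>
  have zero: "(LINT x|lborel. g x) = 0"
  proof -
    have "(\<lambda>n. LINT x|lborel. indicator (box (- (real n *\<^sub>R One)) (real n *\<^sub>R One)) x *\<^sub>R g x) \<longlonglongrightarrow> (LINT x|lborel. g x)"
    proof (rule integral_dominated_convergence[where w = "\<lambda>x. norm (g x)"])
      show "AE x in lborel. (\<lambda>n. indicator (box (- (real n *\<^sub>R One)) (real n *\<^sub>R One)) x *\<^sub>R g x) \<longlonglongrightarrow> g x"
      proof (rule AE_I2)
        fix x :: 'a
        obtain N :: nat where N: "x \<in> box (- (real N *\<^sub>R One)) (real N *\<^sub>R One)" using UN by blast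
        have "x \<in> box (- (real n *\<^sub>R One)) (real n *\<^sub>R One)" if "n \<ge> N" for n
          using N that by (force simp: mem_box)
        then show "(\<lambda>n. indicator (box (- (real n *\<^sub>R One)) (real n *\<^sub>R One)) x *\<^sub>R g x) \<longlonglongrightarrow> g x"
          by (intro tendsto_eventually eventually_sequentiallyI[of N]) simp
      qed
    qed (use int in \<open>auto simp: indicator_def\<close>)
    then show ?thesis unfolding box by (simp add: LIMSEQ_const_iff)
  qed
  have all: "(LINT x|lborel. indicator A x *\<^sub>R g x) = 0" if "A \<in> sets borel" for A
  proof -
    have "Int_stable (range (\<lambda>(a, b). box a b :: 'a set))" by (auto simp: Int_stable_def box_Int_box)
    moreover have "range (\<lambda>(a, b). box a b :: 'a set) \<subseteq> Pow UNIV" by simp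
    moreover have "A \<in> sigma_sets UNIV (range (\<lambda>(a, b). box a b :: 'a set))"
      using that unfolding borel_eq_box by simp
    ultimately show ?thesis
    proof (induction rule: sigma_sets_induct_disjoint)
      case (basic A) then show ?case using box by auto
    next
      case empty then show ?case by simp
    next
      case (compl A)
      then have "A \<in> sets borel" by (simp add: borel_eq_box)
      then have "(LINT x|lborel. g x - indicator A x *\<^sub>R g x) = 0"
        using compl zero int inti by (subst Bochner_Integration.integral_diff) auto
      moreover have "g x - indicator A x *\<^sub>R g x = indicator (UNIV - A) x *\<^sub>R g x" for x
        by (auto simp: indicator_def)
      ultimately show ?case by simp
    next
      case (union A)
      have A: "A i \<in> sets borel" for i using union(2) by (auto simp: borel_eq_box)
      have "(LINT x:(\<Union>i. A i)|lborel. g x) = (\<Sum>i. (LINT x:(A i)|lborel. g x))"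
        by (rule lebesgue_integral_countable_add)
           (use A union(1) inti in \<open>auto simp: disjoint_family_on_def set_integrable_def\<close>)
      then show ?case using union(3) by (simp add: set_lebesgue_integral_def)
    qed
  qed
  have part: "AE x in lborel. h (g x) = 0" if h: "bounded_linear h" for h :: "complex \<Rightarrow> real"
  proof -
    have "AE x in lborel. h (g x) = (\<lambda>_. 0) x"
    proof (rule density_unique_real)
      show "integrable lborel (\<lambda>x. h (g x))" by (rule integrable_bounded_linear[OF h int])
      fix A assume "A \<in> sets (lborel :: 'a measure)"
      then have A: "A \<in> sets borel" by simp
      have "(LINT x:A|lborel. h (g x)) = (LINT x|lborel. h (indicator A x *\<^sub>R g x))"
        unfolding set_lebesgue_integral_def
        by (simp add: linear_scale[OF bounded_linear.linear[OF h]])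
      also have "\<dots> = h (LINT x|lborel. indicator A x *\<^sub>R g x)"
        by (rule integral_bounded_linear[OF h inti[OF A]])
      finally show "(LINT x:A|lborel. h (g x)) = (LINT x:A|lborel. (\<lambda>_. 0) x)"
        using all[OF A] linear_0[OF bounded_linear.linear[OF h]] by simp
    qed simp
    then show ?thesis by simp
  qed
  from part[OF bounded_linear_Re] part[OF bounded_linear_Im] show ?thesis
    by eventually_elim (simp add: complex_eq_iff)
qed

text \<open>The support of \<phi> is covered by finitely many boxes whose closures lie in \<Omega>,
  so that f \<phi> is dominated by a finite sum of integrable functions.\<close>

lemma test_integrable:
  fixes f :: "'a::euclidean_space \<Rightarrow> complex"
  assumes f: "f \<in> borel_measurable borel" and "open \<Omega>"
    and loc: "\<And>a b. cbox a b \<subseteq> \<Omega> \<Longrightarrow> integrable lborel (\<lambda>x. indicator (cbox a b) x *\<^sub>R f x)"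
    and \<phi>: "\<phi> \<in> test_functions \<Omega>"
  shows "integrable lborel (\<lambda>x. f x * \<phi> x)"
proof -
  obtain K where K: "compact K" "K \<subseteq> \<Omega>" "\<And>x. x \<notin> K \<Longrightarrow> \<phi> x = 0" using test_support[OF \<phi>] by blast
  obtain C where C: "\<And>x. cmod (\<phi> x) \<le> C"
  proof -
    have "bounded (\<phi> ` K)"
      by (intro compact_imp_bounded compact_continuous_image test_continuous[OF \<phi>] K)
    then obtain C where "\<And>x. x \<in> K \<Longrightarrow> cmod (\<phi> x) \<le> C" unfolding bounded_iff by blast
    then have "cmod (\<phi> x) \<le> max C 0" for x using K(3)[of x] by (cases "x \<in> K") (auto simp: le_max_iff_disj)
    then show ?thesis using that by blast
  qed
  have [measurable]: "\<phi> \<in> borel_measurable borel"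
    by (intro borel_measurable_continuous_onI test_continuous[OF \<phi>])
  note f[measurable]
  have ex: "\<exists>a b. x \<in> box a b \<and> cbox a b \<subseteq> \<Omega>" if "x \<in> K" for x
  proof -
    have "x \<in> \<Omega>" using that K(2) by blast
    obtain a b where "cbox a b \<subseteq> \<Omega>" "x \<in> box a b"
      by (rule open_contains_cbox[OF \<open>open \<Omega>\<close> \<open>x \<in> \<Omega>\<close>])
    then show ?thesis by blast
  qed
  then obtain a b where ab: "\<And>x. x \<in> K \<Longrightarrow> x \<in> box (a x) (b x) \<and> cbox (a x) (b x) \<subseteq> \<Omega>" by metis
  obtain T where T: "T \<subseteq> K" "finite T" "K \<subseteq> (\<Union>x\<in>T. box (a x) (b x))"
    by (rule compactE_image[OF K(1), of K "\<lambda>x. box (a x) (b x)"]) (use ab in auto)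
  have "integrable lborel (\<lambda>x. \<Sum>y\<in>T. C *\<^sub>R norm (indicator (cbox (a y) (b y)) x *\<^sub>R f x))"
    by (intro Bochner_Integration.integrable_sum integrable_scaleR_right integrable_norm loc) (use ab T in auto)
  then show ?thesis
  proof (rule Bochner_Integration.integrable_bound)
    show "AE x in lborel. norm (f x * \<phi> x) \<le> norm (\<Sum>y\<in>T. C *\<^sub>R norm (indicator (cbox (a y) (b y)) x *\<^sub>R f x))"
    proof (rule AE_I2)
      fix x
      have C0: "0 \<le> C" using C[of x] norm_ge_zero order_trans by blast
      show "norm (f x * \<phi> x) \<le> norm (\<Sum>y\<in>T. C *\<^sub>R norm (indicator (cbox (a y) (b y)) x *\<^sub>R f x))"
      proof (cases "x \<in> K")
        case True
        then obtain y where y: "y \<in> T" "x \<in> box (a y) (b y)" using T by blast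
        have "norm (f x * \<phi> x) \<le> C * norm (f x)" using C[of x] by (simp add: norm_mult mult.commute mult_right_mono)
        also have "\<dots> = C *\<^sub>R norm (indicator (cbox (a y) (b y)) x *\<^sub>R f x)"
          using y box_subset_cbox[of "a y" "b y"] by auto
        also have "\<dots> \<le> (\<Sum>y\<in>T. C *\<^sub>R norm (indicator (cbox (a y) (b y)) x *\<^sub>R f x))"
          using C0 y T by (intro member_le_sum) auto
        finally show ?thesis by simp
      next
        case False
        then show ?thesis using K(3) by simp
      qed
    qed
  qed measurable
qed

text \<open>Bump functions tend to the indicator of a box, hence the integral of f over each box
  whose closure lies in \<Omega> vanishes. This gives f = 0 almost everywhere on such boxes, and
  countably many of them exhaust \<Omega>.\<close>

theorem fundamental_lemma:
  fixes f :: "'a::euclidean_space \<Rightarrow> complex"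
  assumes f: "f \<in> borel_measurable borel" and \<Omega>: "open \<Omega>"
    and loc: "\<And>a b. cbox a b \<subseteq> \<Omega> \<Longrightarrow> integrable lborel (\<lambda>x. indicator (cbox a b) x *\<^sub>R f x)"
    and zero: "\<And>\<phi>. \<phi> \<in> test_functions \<Omega> \<Longrightarrow> (LINT x|lborel. f x * \<phi> x) = 0"
  shows "AE x in lborel. x \<in> \<Omega> \<longrightarrow> f x = 0"
proof -
  note f[measurable]
  have box0: "(LINT x|lborel. indicator (box c d) x *\<^sub>R f x) = 0" if cd: "cbox c d \<subseteq> \<Omega>" for c d
  proof -
    have [measurable]: "box_bump n c d \<in> borel_measurable borel" for n
      by (intro borel_measurable_continuous_onI test_continuous[OF test_box_bump[OF cd]])
    have "(\<lambda>n. LINT x|lborel. f x * box_bump n c d x) \<longlonglongrightarrow> (LINT x|lborel. f x * indicator (box c d) x)"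
    proof (rule integral_dominated_convergence[where w = "\<lambda>x. norm (indicator (cbox c d) x *\<^sub>R f x)"])
      show "integrable lborel (\<lambda>x. norm (indicator (cbox c d) x *\<^sub>R f x))" by (rule integrable_norm[OF loc[OF cd]])
      show "AE x in lborel. (\<lambda>n. f x * box_bump n c d x) \<longlonglongrightarrow> f x * indicator (box c d) x"
        by (intro AE_I2 tendsto_mult tendsto_const box_bump_tendsto)
      show "AE x in lborel. norm (f x * box_bump n c d x) \<le> norm (indicator (cbox c d) x *\<^sub>R f x)" for n
      proof (rule AE_I2)
        fix x
        have "box_bump n c d x = 0" if "x \<notin> cbox c d"
          using test_outside[OF test_box_bump[OF order_refl] that] .
        then show "norm (f x * box_bump n c d x) \<le> norm (indicator (cbox c d) x *\<^sub>R f x)"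
          using cmod_box_bump_le[of n c d x] by (cases "x \<in> cbox c d") (auto simp: norm_mult mult_left_le)
      qed
    qed measurable
    moreover have "(LINT x|lborel. f x * box_bump n c d x) = 0" for n
      by (rule zero[OF test_box_bump[OF cd]])
    ultimately have "(LINT x|lborel. f x * indicator (box c d) x) = 0"
      by (simp add: LIMSEQ_const_iff)
    moreover have "f x * indicator (box c d) x = indicator (box c d) x *\<^sub>R f x" for x
      by (auto simp: indicator_def)
    ultimately show ?thesis by simp
  qed
  have AEbox: "AE x in lborel. x \<in> box a b \<longrightarrow> f x = 0" if ab: "cbox a b \<subseteq> \<Omega>" for a b
  proof -
    define g where "g x = indicator (box a b) x *\<^sub>R f x" for x
    have "integrable lborel g"
    proof -
      have eq: "g = (\<lambda>x. indicator (box a b) x *\<^sub>R (indicator (cbox a b) x *\<^sub>R f x))"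
        using box_subset_cbox[of a b] by (intro ext) (auto simp: g_def indicator_def)
      show ?thesis unfolding eq by (rule integrable_mult_indicator[OF _ loc[OF ab]]) simp
    qed
    moreover have "(LINT x|lborel. indicator (box c d) x *\<^sub>R g x) = 0" for c d
    proof -
      obtain c' d' where cd': "box c d \<inter> box a b = box c' d'" using box_Int_box[of c d a b] by blast
      have eq: "indicator (box c d) x *\<^sub>R g x = indicator (box c' d') x *\<^sub>R f x" for x
        unfolding g_def cd'[symmetric] by (auto simp: indicator_def)
      show ?thesis
      \<comment> \<open>An empty box may have end points far outside \<Omega>, and
        \<open>box0\<close> would not apply. For a nonempty one the closed box is the closure of the
        open one and stays inside \<open>cbox a b\<close>.\<close>
      proof (cases "box c' d' = {}")
        case True then show ?thesis unfolding eq by simp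
      next
        case False
        have "cbox c' d' = closure (box c' d')" using False by (simp add: closure_box)
        also have "\<dots> \<subseteq> cbox a b"
          by (rule closure_minimal) (use cd' box_subset_cbox[of a b] in \<open>auto simp: closed_cbox\<close>)
        finally show ?thesis unfolding eq using box0 ab by blast
      qed
    qed
    ultimately have "AE x in lborel. g x = 0" by (rule set_integrals_zero_imp_AE_zero)
    then show ?thesis by eventually_elim (auto simp: g_def)
  qed
  have "\<exists>\<D>. countable \<D> \<and> \<D> \<subseteq> Pow \<Omega> \<and> (\<forall>X\<in>\<D>. \<exists>a b. X = cbox a b) \<and> \<Union>\<D> = \<Omega>"
  proof (rule open_countable_Union_open_cbox[OF \<Omega>])
    fix \<D> assume "countable \<D>" "\<D> \<subseteq> Pow \<Omega>" "\<And>X. X \<in> \<D> \<Longrightarrow> \<exists>a b. X = cbox a b" "\<Union>\<D> = \<Omega>"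
    then show ?thesis by (intro exI[of _ \<D>] conjI ballI) simp_all
  qed
  then obtain \<D> where D: "countable \<D>" "\<D> \<subseteq> Pow \<Omega>" "\<forall>X\<in>\<D>. \<exists>a b. X = cbox a b" "\<Union>\<D> = \<Omega>"
    by (elim exE conjE)
  have "AE x in lborel. \<forall>X\<in>\<D>. x \<in> X \<longrightarrow> f x = 0"
  proof (subst AE_ball_countable[OF D(1)], intro ballI)
    fix X assume X: "X \<in> \<D>"
    then obtain a b where ab: "X = cbox a b" using D(3) by blast
    then have sub: "cbox a b \<subseteq> \<Omega>" using D(2) X by auto
    have "cbox a b - box a b \<in> null_sets lborel"
      using negligible_frontier_interval[of a b] by (auto simp: negligible_iff_null_sets null_sets_completion_iff)
    from AE_not_in[OF this] AEbox[OF sub] show "AE x in lborel. x \<in> X \<longrightarrow> f x = 0"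
      by eventually_elim (use ab in auto)
  qed
  then show ?thesis by eventually_elim (unfold D(4)[symmetric], blast)
qed

subsection \<open>Weak derivatives\<close>

lemma test_borel: "\<phi> \<in> test_functions \<Omega> \<Longrightarrow> \<phi> \<in> borel_measurable borel"
  by (intro borel_measurable_continuous_onI test_continuous)

lemma test_bounded:
  assumes "\<phi> \<in> test_functions \<Omega>"
  obtains C K where "compact K" "K \<subseteq> \<Omega>" "\<And>x. x \<notin> K \<Longrightarrow> \<phi> x = 0" "0 \<le> C" "\<And>x. cmod (\<phi> x) \<le> C"
proof -
  obtain K where K: "compact K" "K \<subseteq> \<Omega>" "\<And>x. x \<notin> K \<Longrightarrow> \<phi> x = 0"
    using test_support[OF assms] by blast
  have "bounded (\<phi> ` K)"
    by (intro compact_imp_bounded compact_continuous_image test_continuous[OF assms] K(1))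
  then obtain C where C: "\<And>x. x \<in> K \<Longrightarrow> cmod (\<phi> x) \<le> C" unfolding bounded_iff by blast
  have "cmod (\<phi> x) \<le> max C 0" for x using C[of x] K(3)[of x] by (cases "x \<in> K") auto
  then show ?thesis by (intro that[of K "max C 0"] K) auto
qed

lemma test_L2_lborel:
  fixes \<phi> :: "'a::euclidean_space \<Rightarrow> complex"
  assumes "\<phi> \<in> test_functions \<Omega>" shows "\<phi> \<in> L2 lborel"
proof -
  obtain K C where K: "compact K" "K \<subseteq> \<Omega>" "\<And>x. x \<notin> K \<Longrightarrow> \<phi> x = 0" "0 \<le> C" "\<And>x. cmod (\<phi> x) \<le> C"
    using test_bounded[OF assms] by metis
  have "K \<in> sets borel" using K(1) by (simp add: compact_imp_closed)
  moreover have "emeasure lborel K < \<infinity>" by (rule emeasure_compact_finite[OF K(1)])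
  ultimately have "integrable lborel (\<lambda>x. C\<^sup>2 * indicator K x :: real)" by simp
  then show ?thesis
  proof (rule L2_bound[rotated])
    fix x show "(cmod (\<phi> x))\<^sup>2 \<le> C\<^sup>2 * indicator K x"
      using K(3)[of x] K(5)[of x] by (cases "x \<in> K") (auto intro: power_mono)
  qed (use test_borel[OF assms] in simp)
qed

lemma L2_lborel_lebesgue_on:
  fixes v :: "'a::euclidean_space \<Rightarrow> complex"
  assumes "v \<in> borel_measurable borel" "v \<in> L2 lborel" "A \<in> sets borel"
  shows "v \<in> L2 (lebesgue_on A)"
proof (rule L2I)
  show m: "v \<in> borel_measurable (lebesgue_on A)"
    using assms(1) by (auto intro!: measurable_restrict_space1 measurable_completion)
  have "integrable lborel (\<lambda>x. indicator A x *\<^sub>R (cmod (v x))\<^sup>2)"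
    using assms by (intro integrable_mult_indicator L2_integrable) auto
  then show "integrable (lebesgue_on A) (\<lambda>x. (cmod (v x))\<^sup>2)"
    using assms(1,3) by (subst integrable_restrict_space) (auto simp: integrable_completion)
qed

lemma test_L2:
  fixes \<phi> :: "'a::euclidean_space \<Rightarrow> complex"
  shows "\<phi> \<in> test_functions \<Omega> \<Longrightarrow> A \<in> sets borel \<Longrightarrow> \<phi> \<in> L2 (lebesgue_on A)"
  by (rule L2_lborel_lebesgue_on[OF test_borel test_L2_lborel])

lemma L2_set_integrable:
  fixes v :: "'a::euclidean_space \<Rightarrow> complex"
  assumes "v \<in> L2 lborel" "A \<in> sets borel" "emeasure lborel A < \<infinity>"
  shows "integrable lborel (\<lambda>x. indicator A x *\<^sub>R v x)"
proof -
  have "(\<lambda>x. complex_of_real (indicator A x)) \<in> L2 lborel"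
  proof (rule L2I)
    have "(cmod (complex_of_real (indicator A x)))\<^sup>2 = indicator A x" for x :: 'a by (simp add: indicator_def)
    then show "integrable lborel (\<lambda>x. (cmod (complex_of_real (indicator A x)))\<^sup>2)" using assms(2,3) by simp
  qed (use assms(2) in simp)
  from L2_mult_integrable[OF this assms(1)] show ?thesis by (simp add: scaleR_conv_of_real)
qed

lemma lebesgue_on_rep_mult:
  fixes u U F :: "'a::euclidean_space \<Rightarrow> complex"
  assumes "\<Omega> \<in> sets borel" "u \<in> borel_measurable (lebesgue_on \<Omega>)" "U \<in> borel_measurable borel"
    "\<And>x. x \<notin> \<Omega> \<Longrightarrow> U x = 0" "AE x in lborel. x \<in> \<Omega> \<longrightarrow> u x = U x" "F \<in> borel_measurable borel"
  shows "(LINT x|lebesgue_on \<Omega>. u x * F x) = (LINT x|lborel. U x * F x)"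
proof (rule lebesgue_on_integral(2)[OF assms(1)])
  show "(\<lambda>x. U x * F x) \<in> borel_measurable borel" using assms by simp
  have "F \<in> borel_measurable (lebesgue_on \<Omega>)"
    using assms(6) by (auto intro!: measurable_restrict_space1 measurable_completion)
  then show "(\<lambda>x. u x * F x) \<in> borel_measurable (lebesgue_on \<Omega>)" using assms(2) by simp
  show "AE x in lborel. x \<in> \<Omega> \<longrightarrow> u x * F x = U x * F x" using assms(5) by eventually_elim simp
qed (use assms(4) in simp)

lemma sqn_rep:
  fixes u U :: "'a::euclidean_space \<Rightarrow> complex"
  assumes "\<Omega> \<in> sets borel" "u \<in> borel_measurable (lebesgue_on \<Omega>)" "U \<in> borel_measurable borel"
    "\<And>x. x \<notin> \<Omega> \<Longrightarrow> U x = 0" "AE x in lborel. x \<in> \<Omega> \<longrightarrow> u x = U x"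
  shows "sqn (lebesgue_on \<Omega>) u = sqn lborel U"
  unfolding sqn_def
proof (rule lebesgue_on_integral(2)[OF assms(1)])
  show "AE x in lborel. x \<in> \<Omega> \<longrightarrow> (cmod (u x))\<^sup>2 = (cmod (U x))\<^sup>2" using assms(5) by eventually_elim simp
qed (use assms in auto)

text \<open>A Borel representative that vanishes outside the domain turns integrals over
  \<open>lebesgue_on \<Omega>\<close> into integrals against \<open>lborel\<close>, where Fubini's theorem is available.\<close>

definition brep :: "'a::euclidean_space set \<Rightarrow> ('a \<Rightarrow> complex) \<Rightarrow> ('a \<Rightarrow> complex) \<Rightarrow> bool" where
  "brep \<Omega> u U \<longleftrightarrow> U \<in> borel_measurable borel \<and> U \<in> L2 lborel \<and> (\<forall>x. x \<notin> \<Omega> \<longrightarrow> U x = 0) \<and>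
     (AE x in lborel. x \<in> \<Omega> \<longrightarrow> u x = U x)"

lemma brep_ex: "\<Omega> \<in> sets borel \<Longrightarrow> u \<in> L2 (lebesgue_on \<Omega>) \<Longrightarrow> \<exists>U. brep \<Omega> u U"
  using L2_borel_rep[of \<Omega> u] unfolding brep_def by metis

lemma brepD:
  assumes "brep \<Omega> u U"
  shows "U \<in> borel_measurable borel" "U \<in> L2 lborel" "\<And>x. x \<notin> \<Omega> \<Longrightarrow> U x = 0"
    "AE x in lborel. x \<in> \<Omega> \<longrightarrow> u x = U x"
  using assms unfolding brep_def by auto

lemma brep_L2: "brep \<Omega> u U \<Longrightarrow> \<Omega> \<in> sets borel \<Longrightarrow> u \<in> L2 (lebesgue_on \<Omega>)"
  apply (rule L2_cong_AE[of U])
    apply (rule L2_lborel_lebesgue_on[OF brepD(1,2)]; assumption)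
   apply (rule lebesgue_measurable_AE[OF brepD(1)], assumption)
    apply (drule brepD(4), erule eventually_mono, simp)
   apply assumption
  apply (drule brepD(4), simp add: AE_lebesgue_on, erule eventually_mono, simp)
  done

lemma brep_integral:
  assumes "brep \<Omega> u U" "\<Omega> \<in> sets borel" "F \<in> borel_measurable borel"
  shows "(LINT x|lebesgue_on \<Omega>. u x * F x) = (LINT x|lborel. U x * F x)"
  by (rule lebesgue_on_rep_mult[OF assms(2) L2_measurable[OF brep_L2[OF assms(1,2)]] brepD(1,3,4)[OF assms(1)] assms(3)])

lemma brep_sqn:
  assumes "brep \<Omega> u U" "\<Omega> \<in> sets borel"
  shows "sqn (lebesgue_on \<Omega>) u = sqn lborel U"
  by (rule sqn_rep[OF assms(2) L2_measurable[OF brep_L2[OF assms]] brepD(1,3,4)[OF assms(1)]])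

lemma has_weak_deriv_brep:
  assumes "\<Omega> \<in> sets borel" "brep \<Omega> u U" "brep \<Omega> w W" "b \<in> Basis"
  shows "has_weak_deriv \<Omega> b u w \<longleftrightarrow>
    (\<forall>\<phi>\<in>test_functions \<Omega>. (LINT x|lborel. U x * frechet_derivative \<phi> (at x) b) = - (LINT x|lborel. W x * \<phi> x))"
  unfolding has_weak_deriv_def
  by (intro ball_cong refl arg_cong2[where f = "(=)"] arg_cong[where f = uminus]
       brep_integral[OF assms(2,1)] brep_integral[OF assms(3,1)] test_borel[OF test_deriv[OF _ assms(4)]] test_borel)

lemma weak_deriv_unique:
  fixes u w w' :: "'a::euclidean_space \<Rightarrow> complex"
  assumes \<Omega>: "open \<Omega>" and w: "w \<in> L2 (lebesgue_on \<Omega>)" "w' \<in> L2 (lebesgue_on \<Omega>)"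
    and d: "has_weak_deriv \<Omega> b u w" "has_weak_deriv \<Omega> b u w'"
  shows "AE x in lebesgue_on \<Omega>. w x = w' x"
proof -
  have B: "\<Omega> \<in> sets borel" using \<Omega> by simp
  have L: "(\<lambda>x. w x - w' x) \<in> L2 (lebesgue_on \<Omega>)" by (rule L2_diff[OF w])
  obtain v where v: "brep \<Omega> (\<lambda>x. w x - w' x) v" using brep_ex[OF B L] by blast
  have "AE x in lborel. x \<in> \<Omega> \<longrightarrow> v x = 0"
  proof (rule fundamental_lemma[OF brepD(1)[OF v] \<Omega>])
    show "integrable lborel (\<lambda>x. indicator (cbox a b) x *\<^sub>R v x)" for a b
      by (rule L2_set_integrable[OF brepD(2)[OF v] _ emeasure_compact_finite[OF compact_cbox]]) simp
    fix \<phi> :: "'a \<Rightarrow> complex" assume \<phi>: "\<phi> \<in> test_functions \<Omega>"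
    have i: "integrable (lebesgue_on \<Omega>) (\<lambda>x. w x * \<phi> x)" "integrable (lebesgue_on \<Omega>) (\<lambda>x. w' x * \<phi> x)"
      by (intro L2_mult_integrable w test_L2[OF \<phi> B])+
    have "(LINT x|lborel. v x * \<phi> x) = (LINT x|lebesgue_on \<Omega>. (w x - w' x) * \<phi> x)"
      by (rule brep_integral[OF v B test_borel[OF \<phi>], symmetric])
    also have "\<dots> = (LINT x|lebesgue_on \<Omega>. w x * \<phi> x) - (LINT x|lebesgue_on \<Omega>. w' x * \<phi> x)"
      using i by (simp add: left_diff_distrib)
    also have "\<dots> = 0"
      using d \<phi> unfolding has_weak_deriv_def by (metis diff_self minus_equation_iff)
    finally show "(LINT x|lborel. v x * \<phi> x) = 0" .
  qed
  with brepD(4)[OF v] have "AE x in lborel. x \<in> \<Omega> \<longrightarrow> w x = w' x" by eventually_elim simp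
  then show ?thesis using B by (simp add: AE_lebesgue_on)
qed

lemma H1_L2: "u \<in> H1 \<Omega> \<Longrightarrow> u \<in> L2 (lebesgue_on \<Omega>)"
  by (simp add: H1_def)

lemma weak_deriv_works:
  assumes "u \<in> H1 \<Omega>" "b \<in> Basis"
  shows "weak_deriv \<Omega> b u \<in> L2 (lebesgue_on \<Omega>)" "has_weak_deriv \<Omega> b u (weak_deriv \<Omega> b u)"
proof -
  have "\<exists>w. w \<in> L2 (lebesgue_on \<Omega>) \<and> has_weak_deriv \<Omega> b u w" using assms by (auto simp: H1_def)
  from someI_ex[OF this] show "weak_deriv \<Omega> b u \<in> L2 (lebesgue_on \<Omega>)" "has_weak_deriv \<Omega> b u (weak_deriv \<Omega> b u)"
    by (auto simp: weak_deriv_def)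
qed

lemma weak_deriv_AE:
  assumes "open \<Omega>" "w \<in> L2 (lebesgue_on \<Omega>)" "has_weak_deriv \<Omega> b u w"
  shows "weak_deriv \<Omega> b u \<in> L2 (lebesgue_on \<Omega>)" "AE x in lebesgue_on \<Omega>. weak_deriv \<Omega> b u x = w x"
proof -
  have "\<exists>w. w \<in> L2 (lebesgue_on \<Omega>) \<and> has_weak_deriv \<Omega> b u w" using assms by auto
  from someI_ex[OF this] have "weak_deriv \<Omega> b u \<in> L2 (lebesgue_on \<Omega>)" "has_weak_deriv \<Omega> b u (weak_deriv \<Omega> b u)"
    by (auto simp: weak_deriv_def)
  then show "weak_deriv \<Omega> b u \<in> L2 (lebesgue_on \<Omega>)" "AE x in lebesgue_on \<Omega>. weak_deriv \<Omega> b u x = w x"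
    using weak_deriv_unique[OF assms(1)] assms by auto
qed

lemma has_weak_deriv_lc:
  fixes u v :: "'a::euclidean_space \<Rightarrow> complex"
  assumes "open \<Omega>" "b \<in> Basis" and L: "u \<in> L2 (lebesgue_on \<Omega>)" "v \<in> L2 (lebesgue_on \<Omega>)" "u' \<in> L2 (lebesgue_on \<Omega>)" "v' \<in> L2 (lebesgue_on \<Omega>)"
    and d: "has_weak_deriv \<Omega> b u u'" "has_weak_deriv \<Omega> b v v'"
  shows "has_weak_deriv \<Omega> b (\<lambda>x. u x + c * v x) (\<lambda>x. u' x + c * v' x)"
  unfolding has_weak_deriv_def
proof
  fix \<phi> :: "'a \<Rightarrow> complex" assume \<phi>: "\<phi> \<in> test_functions \<Omega>"
  have B: "\<Omega> \<in> sets borel" using assms by simp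
  have lin: "(LINT x|lebesgue_on \<Omega>. (f x + c * g x) * \<psi> x) =
     (LINT x|lebesgue_on \<Omega>. f x * \<psi> x) + c * (LINT x|lebesgue_on \<Omega>. g x * \<psi> x)"
    if "f \<in> L2 (lebesgue_on \<Omega>)" "g \<in> L2 (lebesgue_on \<Omega>)" "\<psi> \<in> L2 (lebesgue_on \<Omega>)" for f g \<psi>
  proof -
    have "(LINT x|lebesgue_on \<Omega>. (f x + c * g x) * \<psi> x) = (LINT x|lebesgue_on \<Omega>. f x * \<psi> x + c * (g x * \<psi> x))"
      by (simp add: algebra_simps)
    also have "\<dots> = (LINT x|lebesgue_on \<Omega>. f x * \<psi> x) + c * (LINT x|lebesgue_on \<Omega>. g x * \<psi> x)"
      using L2_mult_integrable[OF that(1,3)] L2_mult_integrable[OF that(2,3)]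
      by (subst Bochner_Integration.integral_add) auto
    finally show ?thesis .
  qed
  show "(LINT x|lebesgue_on \<Omega>. (u x + c * v x) * frechet_derivative \<phi> (at x) b) =
        - (LINT x|lebesgue_on \<Omega>. (u' x + c * v' x) * \<phi> x)"
    using d \<phi> unfolding lin[OF L(1,2) test_L2[OF test_deriv[OF \<phi> assms(2)] B]] lin[OF L(3,4) test_L2[OF \<phi> B]] has_weak_deriv_def
    by simp
qed

lemma H1_lc:
  assumes "open \<Omega>" "u \<in> H1 \<Omega>" "v \<in> H1 \<Omega>"
  shows "(\<lambda>x. u x + c * v x) \<in> H1 \<Omega>"
    and "b \<in> Basis \<Longrightarrow> AE x in lebesgue_on \<Omega>. weak_deriv \<Omega> b (\<lambda>x. u x + c * v x) x = weak_deriv \<Omega> b u x + c * weak_deriv \<Omega> b v x"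
proof -
  have d: "has_weak_deriv \<Omega> b (\<lambda>x. u x + c * v x) (\<lambda>x. weak_deriv \<Omega> b u x + c * weak_deriv \<Omega> b v x)"
    and l: "(\<lambda>x. weak_deriv \<Omega> b u x + c * weak_deriv \<Omega> b v x) \<in> L2 (lebesgue_on \<Omega>)" if "b \<in> Basis" for b
    by (intro has_weak_deriv_lc[OF assms(1) that] L2_lc weak_deriv_works(1)[OF assms(2) that] weak_deriv_works(1)[OF assms(3) that]
        weak_deriv_works(2)[OF assms(2) that] weak_deriv_works(2)[OF assms(3) that] H1_L2[OF assms(2)] H1_L2[OF assms(3)])+
  show "(\<lambda>x. u x + c * v x) \<in> H1 \<Omega>"
    unfolding H1_def using d l H1_L2[OF assms(2)] H1_L2[OF assms(3)] by (auto intro!: L2_lc)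
  show "AE x in lebesgue_on \<Omega>. weak_deriv \<Omega> b (\<lambda>x. u x + c * v x) x = weak_deriv \<Omega> b u x + c * weak_deriv \<Omega> b v x"
    if "b \<in> Basis" by (rule weak_deriv_AE(2)[OF assms(1) l[OF that] d[OF that]])
qed

lemma L2_limit_integral:
  assumes f: "\<And>n. f n \<in> L2 M" and g: "g \<in> L2 M" and h: "h \<in> L2 M"
    and lim: "(\<lambda>n. sqn M (\<lambda>x. f n x - g x)) \<longlonglongrightarrow> 0"
  shows "(\<lambda>n. LINT x|M. f n x * h x) \<longlonglongrightarrow> (LINT x|M. g x * h x)"
proof (rule LIM_zero_cancel, rule Lim_null_comparison)
  have "(LINT x|M. f n x * h x) - (LINT x|M. g x * h x) = (LINT x|M. (f n x - g x) * h x)" for n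
    using L2_mult_integrable[OF f h] L2_mult_integrable[OF g h] by (simp add: left_diff_distrib)
  then show "\<forall>\<^sub>F n in sequentially. norm ((LINT x|M. f n x * h x) - (LINT x|M. g x * h x))
      \<le> sqrt (sqn M (\<lambda>x. f n x - g x)) * sqrt (sqn M h)"
    using L2_Cauchy_Schwarz[OF L2_diff[OF f g] h] by simp
  show "(\<lambda>n. sqrt (sqn M (\<lambda>x. f n x - g x)) * sqrt (sqn M h)) \<longlonglongrightarrow> 0"
    using tendsto_mult_right[OF tendsto_real_sqrt[OF lim], of "sqrt (sqn M h)"] by simp
qed

text \<open>The defining identity of the weak derivative pairs with one fixed test function at a
  time, and both of its sides are continuous in L2. The limit of the derivatives is therefore a
  derivative of the limit.\<close>

lemma H1_complete:
  fixes X :: "nat \<Rightarrow> 'a::euclidean_space \<Rightarrow> complex"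
  assumes \<Omega>: "open \<Omega>" and X: "\<And>n. X n \<in> H1 \<Omega>"
    and cau: "\<And>e. e > 0 \<Longrightarrow> \<exists>N. \<forall>m\<ge>N. \<forall>n\<ge>N. sqn (lebesgue_on \<Omega>) (\<lambda>x. X m x - X n x) < e"
    and cau': "\<And>b e. b \<in> Basis \<Longrightarrow> e > 0 \<Longrightarrow>
       \<exists>N. \<forall>m\<ge>N. \<forall>n\<ge>N. sqn (lebesgue_on \<Omega>) (\<lambda>x. weak_deriv \<Omega> b (X m) x - weak_deriv \<Omega> b (X n) x) < e"
  shows "\<exists>u\<in>H1 \<Omega>. (\<lambda>n. sqn (lebesgue_on \<Omega>) (\<lambda>x. X n x - u x)) \<longlonglongrightarrow> 0 \<and>
     (\<forall>b\<in>Basis. (\<lambda>n. sqn (lebesgue_on \<Omega>) (\<lambda>x. weak_deriv \<Omega> b (X n) x - weak_deriv \<Omega> b u x)) \<longlonglongrightarrow> 0)"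
proof -
  let ?M = "lebesgue_on \<Omega>"
  have B: "\<Omega> \<in> sets borel" using \<Omega> by simp
  obtain u where u: "u \<in> L2 ?M" "(\<lambda>n. sqn ?M (\<lambda>x. X n x - u x)) \<longlonglongrightarrow> 0"
    using L2_complete[of X, OF H1_L2[OF X] cau] by blast
  have ex: "\<exists>w. w \<in> L2 ?M \<and> (\<lambda>n. sqn ?M (\<lambda>x. weak_deriv \<Omega> b (X n) x - w x)) \<longlonglongrightarrow> 0 \<and> has_weak_deriv \<Omega> b u w"
    if b: "b \<in> Basis" for b
  proof -
    obtain w where w: "w \<in> L2 ?M" "(\<lambda>n. sqn ?M (\<lambda>x. weak_deriv \<Omega> b (X n) x - w x)) \<longlonglongrightarrow> 0"
      using L2_complete[of "\<lambda>n. weak_deriv \<Omega> b (X n)", OF weak_deriv_works(1)[OF X b] cau'[OF b]] by blast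
    have "has_weak_deriv \<Omega> b u w"
      unfolding has_weak_deriv_def
    proof
      fix \<phi> :: "'a \<Rightarrow> complex" assume \<phi>: "\<phi> \<in> test_functions \<Omega>"
      have 1: "(\<lambda>n. LINT x|?M. X n x * frechet_derivative \<phi> (at x) b) \<longlonglongrightarrow> (LINT x|?M. u x * frechet_derivative \<phi> (at x) b)"
        by (rule L2_limit_integral[OF H1_L2[OF X] u(1) test_L2[OF test_deriv[OF \<phi> b] B] u(2)])
      have 2: "(\<lambda>n. LINT x|?M. weak_deriv \<Omega> b (X n) x * \<phi> x) \<longlonglongrightarrow> (LINT x|?M. w x * \<phi> x)"
        by (rule L2_limit_integral[OF weak_deriv_works(1)[OF X b] w(1) test_L2[OF \<phi> B] w(2)])
      have 3: "(LINT x|?M. X n x * frechet_derivative \<phi> (at x) b) = - (LINT x|?M. weak_deriv \<Omega> b (X n) x * \<phi> x)" for n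
        using weak_deriv_works(2)[OF X b] \<phi> unfolding has_weak_deriv_def by blast
      show "(LINT x|?M. u x * frechet_derivative \<phi> (at x) b) = - (LINT x|?M. w x * \<phi> x)"
        using LIMSEQ_unique[OF 1[unfolded 3] tendsto_minus[OF 2]] .
    qed
    then show ?thesis using w by blast
  qed
  have uH: "u \<in> H1 \<Omega>" unfolding H1_def using u(1) ex by blast
  have "(\<lambda>n. sqn ?M (\<lambda>x. weak_deriv \<Omega> b (X n) x - weak_deriv \<Omega> b u x)) \<longlonglongrightarrow> 0" if b: "b \<in> Basis" for b
  proof -
    obtain w where w: "w \<in> L2 ?M" "(\<lambda>n. sqn ?M (\<lambda>x. weak_deriv \<Omega> b (X n) x - w x)) \<longlonglongrightarrow> 0" "has_weak_deriv \<Omega> b u w"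
      using ex[OF b] by blast
    \<comment> \<open>\<open>weak_deriv\<close> is an arbitrary choice among the possible
      derivatives, so it agrees with the limit \<open>w\<close> only almost everywhere.\<close>
    have "sqn ?M (\<lambda>x. weak_deriv \<Omega> b (X n) x - weak_deriv \<Omega> b u x) = sqn ?M (\<lambda>x. weak_deriv \<Omega> b (X n) x - w x)" for n
      by (rule sqn_cong_AE)
         (use weak_deriv_AE[OF \<Omega> w(1,3)] weak_deriv_works(1)[OF X b, of n] w(1) in
           \<open>auto simp: L2_measurable intro!: borel_measurable_diff elim!: eventually_mono\<close>)
    then show ?thesis using w(2) by simp
  qed
  then show ?thesis using uH u(2) by blast
qed

subsection \<open>Fubini's theorem on the plane\<close>

lemma Fubini_plane:
  fixes f :: "real \<times> real \<Rightarrow> complex"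
  assumes "integrable lborel f"
  shows "AE s in lborel. integrable lborel (\<lambda>t. f (s, t))"
    and "integrable lborel (\<lambda>s. LINT t|lborel. f (s, t))"
    and "(LINT x|lborel. f x) = (LINT s|lborel. LINT t|lborel. f (s, t))"
    and "AE t in lborel. integrable lborel (\<lambda>s. f (s, t))"
    and "integrable lborel (\<lambda>t. LINT s|lborel. f (s, t))"
    and "(LINT x|lborel. f x) = (LINT t|lborel. LINT s|lborel. f (s, t))"
proof -
  have f: "integrable (lborel \<Otimes>\<^sub>M lborel) f" using assms by (simp add: lborel_prod)
  have f': "integrable (lborel \<Otimes>\<^sub>M lborel) (case_prod (\<lambda>s t. f (s, t)))" using f by simp
  show "AE s in lborel. integrable lborel (\<lambda>t. f (s, t))"
    "integrable lborel (\<lambda>s. LINT t|lborel. f (s, t))"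
    "(LINT x|lborel. f x) = (LINT s|lborel. LINT t|lborel. f (s, t))"
    using lborel_pair.AE_integrable_fst'[OF f] lborel_pair.integrable_fst'[OF f] lborel_pair.integral_fst'[OF f]
    by (simp_all add: lborel_prod)
  show "AE t in lborel. integrable lborel (\<lambda>s. f (s, t))"
    "integrable lborel (\<lambda>t. LINT s|lborel. f (s, t))"
    "(LINT x|lborel. f x) = (LINT t|lborel. LINT s|lborel. f (s, t))"
    using lborel_pair.AE_integrable_snd[OF f'] lborel_pair.integrable_snd[OF f'] lborel_pair.integral_snd[OF f']
    by (simp_all add: lborel_prod)
qed

lemma measurable_plane:
  assumes "f \<in> borel_measurable borel" "g \<in> borel_measurable borel"
  shows "(\<lambda>z::real\<times>real. f (fst z)) \<in> borel_measurable borel" "(\<lambda>z::real\<times>real. g (snd z)) \<in> borel_measurable borel"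
proof -
  have "(fst :: real \<times> real \<Rightarrow> real) \<in> borel_measurable borel" "(snd :: real \<times> real \<Rightarrow> real) \<in> borel_measurable borel"
    by (auto intro!: borel_measurable_continuous_onI continuous_intros)
  then show "(\<lambda>z::real\<times>real. f (fst z)) \<in> borel_measurable borel" "(\<lambda>z::real\<times>real. g (snd z)) \<in> borel_measurable borel"
    using assms by (auto intro: measurable_compose)
qed

lemma section_measurable:
  fixes f :: "real \<times> real \<Rightarrow> complex"
  assumes "f \<in> borel_measurable borel"
  shows "(\<lambda>t. f (s, t)) \<in> borel_measurable borel" "(\<lambda>s. f (s, t)) \<in> borel_measurable borel"
proof -
  have "(\<lambda>t. (s, t)) \<in> borel_measurable borel" "(\<lambda>s. (s, t)) \<in> borel_measurable borel"
    by (auto intro!: borel_measurable_continuous_onI continuous_intros)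
  then show "(\<lambda>t. f (s, t)) \<in> borel_measurable borel" "(\<lambda>s. f (s, t)) \<in> borel_measurable borel"
    using assms by (auto intro: measurable_compose)
qed

lemma tensor_integrable:
  fixes f g :: "real \<Rightarrow> complex"
  assumes "integrable lborel f" "integrable lborel g"
  shows "integrable lborel (\<lambda>z. f (fst z) * g (snd z))"
proof -
  have m: "f \<in> borel_measurable borel" "g \<in> borel_measurable borel" using assms by auto
  have "integrable (lborel \<Otimes>\<^sub>M lborel) (\<lambda>z. f (fst z) * g (snd z))"
  proof (rule lborel_pair.Fubini_integrable)
    show "(\<lambda>z. f (fst z) * g (snd z)) \<in> borel_measurable (lborel \<Otimes>\<^sub>M lborel)"
      using measurable_plane[OF m] by (simp add: lborel_prod)
    show "integrable lborel (\<lambda>x. LINT y|lborel. norm (f (fst (x, y)) * g (snd (x, y))))"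
      using integrable_norm[OF assms(1)] by (simp add: norm_mult)
    show "AE x in lborel. integrable lborel (\<lambda>y. f (fst (x, y)) * g (snd (x, y)))"
      using assms(2) by simp
  qed
  then show ?thesis by (simp add: lborel_prod)
qed

subsection \<open>Primitives\<close>

lemma test_dv:
  fixes \<phi> :: "real \<Rightarrow> complex"
  shows "\<phi> \<in> test_functions I \<Longrightarrow> (\<lambda>x. frechet_derivative \<phi> (at x) 1) \<in> test_functions I"
  by (rule test_deriv) simp_all

lemma test_has_vector_derivative:
  fixes \<phi> :: "real \<Rightarrow> complex"
  assumes "\<phi> \<in> test_functions I"
  shows "(\<phi> has_vector_derivative frechet_derivative \<phi> (at x) 1) (at x within S)"
proof -
  let ?D = "frechet_derivative \<phi> (at x)"
  have d: "(\<phi> has_derivative ?D) (at x)"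
    using test_differentiable[OF assms] frechet_derivative_works by blast
  have "?D h = h *\<^sub>R ?D 1" for h
    using linear_scale[OF has_derivative_linear[OF d], of h 1] by simp
  then have "?D = (\<lambda>h. h *\<^sub>R ?D 1)" by blast
  then have "(\<phi> has_vector_derivative ?D 1) (at x)" using d unfolding has_vector_derivative_def by simp
  then show ?thesis by (rule has_vector_derivative_at_within)
qed

lemma test_integral_deriv:
  fixes \<phi> :: "real \<Rightarrow> complex"
  assumes "\<phi> \<in> test_functions I" "a \<le> b"
  shows "(LINT x|lborel. indicator {a..b} x *\<^sub>R frechet_derivative \<phi> (at x) 1) = \<phi> b - \<phi> a"
  by (rule integral_FTC_Icc[OF assms(2) test_has_vector_derivative[OF assms(1)] test_continuous[OF test_dv[OF assms(1)]]])

text \<open>The difference of the two indicators makes this the oriented integral from p to x, for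
  either order of the two points.\<close>

definition prim :: "(real \<Rightarrow> complex) \<Rightarrow> real \<Rightarrow> real \<Rightarrow> complex" where
  "prim w p x = (LINT t|lborel. (indicator {p..x} t - indicator {x..p} t) *\<^sub>R w t)"

lemma L2_Icc_integrable: "w \<in> L2 lborel \<Longrightarrow> integrable lborel (\<lambda>t. indicator {a..b::real} t *\<^sub>R w t)"
  using L2_set_integrable[of w "{a..b}"] emeasure_compact_finite[of "{a..b}"] by simp

lemma prim_diff:
  assumes w: "w \<in> L2 lborel" and "x \<le> y"
  shows "prim w p y - prim w p x = (LINT t|lborel. indicator {x..y} t *\<^sub>R w t)"
proof -
  have i: "integrable lborel (\<lambda>t. (indicator {a..b} t - indicator {c..d} t) *\<^sub>R w t)" for a b c d
    using L2_Icc_integrable[OF w, of a b] L2_Icc_integrable[OF w, of c d] by (simp add: scaleR_diff_left)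
  have "prim w p y - prim w p x = (LINT t|lborel. (indicator {p..y} t - indicator {y..p} t) *\<^sub>R w t - (indicator {p..x} t - indicator {x..p} t) *\<^sub>R w t)"
    unfolding prim_def by (rule Bochner_Integration.integral_diff[symmetric, OF i i])
  also have "\<dots> = (LINT t|lborel. indicator {x..y} t *\<^sub>R w t)"
  proof (rule integral_cong_AE)
    show "AE t in lborel. (indicator {p..y} t - indicator {y..p} t) *\<^sub>R w t - (indicator {p..x} t - indicator {x..p} t) *\<^sub>R w t
        = indicator {x..y} t *\<^sub>R w t"
      using AE_lborel_singleton[of x] AE_lborel_singleton[of y] AE_lborel_singleton[of p]
    proof eventually_elim
      case (elim t)
      have "indicator {p..y} t - indicator {y..p} t - (indicator {p..x} t - indicator {x..p} t) = (indicator {x..y} t :: real)"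
        using elim \<open>x \<le> y\<close> by (auto simp: indicator_def)
      then show ?case by (simp add: scaleR_diff_left[symmetric])
    qed
  qed (use i L2_Icc_integrable[OF w] in auto)
  finally show ?thesis .
qed

lemma indicator_integral_bound:
  assumes w: "w \<in> L2 lborel" and "x \<le> y"
  shows "cmod (LINT t|lborel. indicator {x..y} t *\<^sub>R w t) \<le> sqrt (y - x) * sqrt (sqn lborel w)"
proof -
  have L: "(\<lambda>t. complex_of_real (indicator {x..y} t)) \<in> L2 lborel" and s: "sqn lborel (\<lambda>t. complex_of_real (indicator {x..y} t)) = y - x"
  proof -
    have eq: "(\<lambda>t. (cmod (complex_of_real (indicator {x..y} t)))\<^sup>2) = indicator {x..y}" by (auto simp: indicator_def)
    show "(\<lambda>t. complex_of_real (indicator {x..y} t)) \<in> L2 lborel"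
    proof (rule L2I)
      show "integrable lborel (\<lambda>t. (cmod (complex_of_real (indicator {x..y} t)))\<^sup>2)"
        unfolding eq using emeasure_compact_finite[of "{x..y}"] by simp
    qed simp
    show "sqn lborel (\<lambda>t. complex_of_real (indicator {x..y} t)) = y - x"
      unfolding sqn_def eq using \<open>x \<le> y\<close> by simp
  qed
  show ?thesis using L2_Cauchy_Schwarz[OF L w] by (simp add: s scaleR_conv_of_real)
qed

lemma prim_Hoelder:
  assumes w: "w \<in> L2 lborel"
  shows "cmod (prim w p y - prim w p x) \<le> sqrt \<bar>y - x\<bar> * sqrt (sqn lborel w)"
proof (cases "x \<le> y")
  case True then show ?thesis using indicator_integral_bound[OF w True] prim_diff[OF w True] by simp
next
  case False
  then show ?thesis using indicator_integral_bound[OF w, of y x] prim_diff[OF w, of y x]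
    by (simp add: norm_minus_commute)
qed

lemma Hoelder_continuous:
  fixes g :: "real \<Rightarrow> complex"
  assumes "\<And>x y. cmod (g y - g x) \<le> sqrt \<bar>y - x\<bar> * C"
  shows "continuous_on UNIV g"
proof (intro continuous_at_imp_continuous_on ballI)
  fix x
  have "((\<lambda>y. g y - g x) \<longlongrightarrow> 0) (at x)"
  proof (rule Lim_null_comparison)
    show "\<forall>\<^sub>F y in at x. norm (g y - g x) \<le> sqrt \<bar>y - x\<bar> * C" using assms by (intro always_eventually) simp
    have "((\<lambda>y. sqrt \<bar>y - x\<bar> * C) \<longlongrightarrow> sqrt \<bar>x - x\<bar> * C) (at x)" by (intro tendsto_intros)
    then show "((\<lambda>y. sqrt \<bar>y - x\<bar> * C) \<longlongrightarrow> 0) (at x)" by simp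
  qed
  then show "isCont g x" unfolding isCont_def by (rule LIM_zero_cancel)
qed

lemma prim_continuous: "w \<in> L2 lborel \<Longrightarrow> continuous_on UNIV (prim w p)"
  by (rule Hoelder_continuous[OF prim_Hoelder])

lemma continuous_test_integrable:
  fixes f :: "'a::euclidean_space \<Rightarrow> complex"
  assumes "continuous_on UNIV f" "\<phi> \<in> test_functions \<Omega>"
  shows "integrable lborel (\<lambda>x. f x * \<phi> x)"
  by (rule test_integrable[of f UNIV \<phi>])
     (use assms test_mono[OF assms(2)] in \<open>auto intro!: borel_measurable_continuous_onI borel_integrable_compact continuous_on_subset[OF assms(1)]\<close>)

text \<open>Since w is merely in L2, its primitive need not be differentiable. Instead Fubini's
  theorem on the triangle t \<le> x leaves the fundamental theorem of calculus to the smooth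
  function \<phi>.\<close>

lemma prim_by_parts:
  assumes w: "w \<in> L2 lborel" and wb: "w \<in> borel_measurable borel" and \<phi>: "\<phi> \<in> test_functions I"
  shows "(LINT x|lborel. prim w p x * frechet_derivative \<phi> (at x) 1) = - (LINT x|lborel. w x * \<phi> x)"
proof -
  obtain K where K: "compact K" "\<And>x. x \<notin> K \<Longrightarrow> \<phi> x = 0" using test_support[OF \<phi>] by blast
  obtain K' where K': "compact K'" "\<And>x. x \<notin> K' \<Longrightarrow> frechet_derivative \<phi> (at x) 1 = 0"
    using test_support[OF test_dv[OF \<phi>]] by blast
  have "bounded (K \<union> K')" using K K' by (simp add: compact_imp_bounded)
  then obtain r where r: "\<And>x. x \<in> K \<union> K' \<Longrightarrow> \<bar>x\<bar> \<le> r" unfolding bounded_iff by auto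
  \<comment> \<open>The margin 1 places the supports of \<phi> and of its derivative strictly inside
    [a, b], so \<phi> vanishes at both end points.\<close>
  define a b where "a = - \<bar>r\<bar> - 1" and "b = \<bar>r\<bar> + 1"
  have ab: "a \<le> b" by (simp add: a_def b_def)
  have out: "x \<notin> K \<and> x \<notin> K'" if "\<not> (a < x \<and> x < b)" for x
    using r[of x] that by (auto simp: a_def b_def)
  let ?d = "\<lambda>x. frechet_derivative \<phi> (at x) 1"
  note d = test_dv[OF \<phi>]
  have dB[measurable]: "?d \<in> borel_measurable borel" by (rule test_borel[OF d])
  note wb[measurable]
  have z: "\<phi> x = 0" "?d x = 0" if "\<not> (a < x \<and> x < b)" for x using K(2) K'(2) out[OF that] by auto
  define G where "G x = (LINT t|lborel. indicator {a..x} t *\<^sub>R w t)" for x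
  have split: "prim w p x * ?d x = prim w p a * (indicator {a..b} x *\<^sub>R ?d x) + indicator {a..b} x *\<^sub>R (G x * ?d x)" for x
  proof (cases "a < x \<and> x < b")
    case True
    then have "prim w p x = prim w p a + G x" using prim_diff[OF w, of a x p] by (simp add: G_def algebra_simps)
    then show ?thesis using True by (simp add: algebra_simps)
  qed (simp add: z)
  have int_d: "integrable lborel (\<lambda>x. indicator {a..b} x *\<^sub>R ?d x)"
    using borel_integrable_compact[OF compact_Icc test_continuous[OF d]] .
  have int_w: "integrable lborel (\<lambda>x. indicator {a..b} x *\<^sub>R w x)" by (rule L2_Icc_integrable[OF w])
  \<comment> \<open>The first coordinate is x, the second is t. Integration over t produces the
    primitive, integration over x produces \<phi> b - \<phi> t = - \<phi> t.\<close>
  define f where "f z = (if a \<le> snd z \<and> snd z \<le> fst z \<and> fst z \<le> b then 1 else 0 :: real) *\<^sub>R (w (snd z) * ?d (fst z))" for z :: "real \<times> real"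
  have fB: "f \<in> borel_measurable borel"
  proof -
    have [measurable]: "(\<lambda>z::real\<times>real. w (snd z)) \<in> borel_measurable borel" "(\<lambda>z::real\<times>real. ?d (fst z)) \<in> borel_measurable borel"
      using measurable_plane[OF dB wb] by auto
    have [measurable]: "(fst :: real \<times> real \<Rightarrow> real) \<in> borel_measurable borel" "(snd :: real \<times> real \<Rightarrow> real) \<in> borel_measurable borel"
      by (auto intro!: borel_measurable_continuous_onI continuous_intros)
    show ?thesis unfolding f_def[abs_def] by measurable
  qed
  have f: "integrable lborel f"
  proof (rule Bochner_Integration.integrable_bound[OF tensor_integrable[OF int_d int_w]])
    show "f \<in> borel_measurable lborel" using fB by simp
    show "AE z in lborel. norm (f z) \<le> norm (indicator {a..b} (fst z) *\<^sub>R ?d (fst z) * (indicator {a..b} (snd z) *\<^sub>R w (snd z)))"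
      by (intro AE_I2) (auto simp: f_def norm_mult mult.commute)
  qed
  have in1: "(LINT t|lborel. f (x, t)) = indicator {a..b} x *\<^sub>R (G x * ?d x)" for x
  proof -
    have "f (x, t) = indicator {a..b} x *\<^sub>R ((indicator {a..x} t *\<^sub>R w t) * ?d x)" for t
      by (auto simp: f_def indicator_def)
    then show ?thesis by (simp only: G_def integral_scaleR_right integral_mult_left_zero)
  qed
  have in2: "(LINT x|lborel. f (x, t)) = - (w t * \<phi> t)" for t
  proof (cases "a \<le> t \<and> t \<le> b")
    case True
    then have "f (x, t) = w t * (indicator {t..b} x *\<^sub>R ?d x)" for x
      by (auto simp: f_def indicator_def)
    then have "(LINT x|lborel. f (x, t)) = w t * (\<phi> b - \<phi> t)"
      using test_integral_deriv[OF \<phi>, of t b] True by (simp only: integral_mult_right_zero)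
    then show ?thesis using z(1)[of b] by simp
  next
    case False
    then have "f (x, t) = 0" for x by (auto simp: f_def)
    moreover have "\<phi> t = 0" using False z(1)[of t] by linarith
    ultimately show ?thesis by simp
  qed
  have "(LINT x|lborel. prim w p x * ?d x) =
      (LINT x|lborel. prim w p a * (indicator {a..b} x *\<^sub>R ?d x)) + (LINT x|lborel. indicator {a..b} x *\<^sub>R (G x * ?d x))"
    unfolding split by (rule Bochner_Integration.integral_add[OF integrable_mult_right[OF int_d] Fubini_plane(2)[OF f, unfolded in1]])
  also have "(LINT x|lborel. prim w p a * (indicator {a..b} x *\<^sub>R ?d x)) = 0"
    unfolding integral_mult_right_zero test_integral_deriv[OF \<phi> ab] using z(1)[of a] z(1)[of b] by simp
  also have "(LINT x|lborel. indicator {a..b} x *\<^sub>R (G x * ?d x)) = - (LINT t|lborel. w t * \<phi> t)"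
    using Fubini_plane(3)[OF f] Fubini_plane(6)[OF f] by (simp add: in1 in2)
  finally show ?thesis by simp
qed

lemma prim_has_vector_derivative:
  assumes w: "w \<in> L2 lborel" and c: "continuous_on UNIV w"
  shows "(prim w p has_vector_derivative w x) (at x)"
proof -
  have eq: "prim w p u = prim w p (x - 1) + integral {x - 1..u} w" if "u \<in> {x - 1..x + 1}" for u
  proof -
    have "(LINT t|lborel. indicator {x - 1..u} t *\<^sub>R w t) = integral {x - 1..u} w"
      using set_borel_integral_eq_integral(2)[of "{x - 1..u}" w] L2_Icc_integrable[OF w, of "x - 1" u]
      by (simp add: set_integrable_def set_lebesgue_integral_def)
    then show ?thesis using prim_diff[OF w, of "x - 1" u p] that by (simp add: algebra_simps)
  qed
  have "((\<lambda>u. prim w p (x - 1) + integral {x - 1..u} w) has_vector_derivative 0 + w x) (at x within {x - 1..x + 1})"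
    by (intro has_vector_derivative_add has_vector_derivative_const integral_has_vector_derivative
        continuous_on_subset[OF c]) auto
  then have "((\<lambda>u. prim w p (x - 1) + integral {x - 1..u} w) has_vector_derivative w x) (at x)"
    by (simp add: at_within_Icc_at)
  then show ?thesis
    by (rule has_vector_derivative_transform_within_open[of _ _ _ "{x - 1<..<x + 1}"]) (auto intro!: eq[symmetric])
qed

lemma interval_hull_compact:
  fixes I :: "real set"
  assumes "is_interval I" "p \<in> I" "compact K" "K \<subseteq> I"
  obtains a b where "a \<le> b" "{a..b} \<subseteq> I" "K \<subseteq> {a..b}"
proof -
  have c: "compact (insert p K)" "insert p K \<noteq> {}" using assms by auto
  obtain a where a: "a \<in> insert p K" "\<And>x. x \<in> insert p K \<Longrightarrow> a \<le> x" using compact_attains_inf[OF c] by blast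
  obtain b where b: "b \<in> insert p K" "\<And>x. x \<in> insert p K \<Longrightarrow> x \<le> b" using compact_attains_sup[OF c] by blast
  have "{a..b} \<subseteq> I"
  proof
    fix x assume x: "x \<in> {a..b}"
    have ab: "a \<in> I" "b \<in> I" using a(1) b(1) assms(2,4) by blast+
    from x have "a \<le> x" "x \<le> b" by simp_all
    then show "x \<in> I" by (rule mem_is_interval_1_I[OF assms(1) ab])
  qed
  moreover have "a \<le> b" using a(2)[OF b(1)] .
  moreover have "K \<subseteq> {a..b}"
  proof
    fix x assume "x \<in> K"
    then have "x \<in> insert p K" by simp
    from a(2)[OF this] b(2)[OF this] show "x \<in> {a..b}" by simp
  qed
  ultimately show ?thesis by (intro that)
qed

text \<open>The primitive is constant on either side of the support of \<zeta>; the vanishing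
  integral makes the constant 0 on the right as well, and the support stays compact.\<close>

lemma test_primitive:
  fixes \<zeta> :: "real \<Rightarrow> complex"
  assumes I: "is_interval I" "p \<in> I" and \<zeta>: "\<zeta> \<in> test_functions I" and 0: "(LINT x|lborel. \<zeta> x) = 0"
  obtains \<psi> where "\<psi> \<in> test_functions I" "\<And>x. frechet_derivative \<psi> (at x) 1 = \<zeta> x"
proof -
  obtain K where K: "compact K" "K \<subseteq> I" "\<And>x. x \<notin> K \<Longrightarrow> \<zeta> x = 0" using test_support[OF \<zeta>] by blast
  obtain a b where ab: "a \<le> b" "{a..b} \<subseteq> I" "K \<subseteq> {a..b}" using interval_hull_compact[OF I K(1,2)] by blast
  have z: "\<zeta> x = 0" if "x \<notin> {a..b}" for x using K(3)[of x] ab(3) that by blast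
  define \<psi> where "\<psi> = prim \<zeta> a"
  note L = test_L2_lborel[OF \<zeta>]
  have d: "(\<psi> has_derivative (\<lambda>h. h *\<^sub>R \<zeta> x)) (at x)" for x
    using prim_has_vector_derivative[OF L test_continuous[OF \<zeta>]] by (simp add: \<psi>_def has_vector_derivative_def)
  have fd: "frechet_derivative \<psi> (at x) h = h *\<^sub>R \<zeta> x" for x h
    using frechet_derivative_eq[OF d[of x]] by simp
  have diff: "\<psi> differentiable at x" for x unfolding differentiable_def by (rule exI, rule d)
  have "Ck k \<psi>" for k
  proof (cases k)
    case 0
    then show ?thesis using prim_continuous[OF L] by (simp add: \<psi>_def)
  next
    case (Suc n)
    then show ?thesis using diff test_Ck[OF \<zeta>, of n] by (simp add: fd)
  qed
  moreover have "\<psi> x = 0" if "x \<notin> {a..b}" for x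
  proof (cases "x < a")
    case True
    have "\<psi> x = integral\<^sup>L lborel (\<lambda>t::real. 0)" unfolding \<psi>_def prim_def
    proof (rule integral_cong_AE)
      show "AE t in lborel. (indicator {a..x} t - indicator {x..a} t) *\<^sub>R \<zeta> t = 0"
        using AE_lborel_singleton[of a] by eventually_elim (use True z in \<open>auto simp: indicator_def\<close>)
    qed (use test_borel[OF \<zeta>] in auto)
    then show ?thesis by simp
  next
    case False
    then have x: "x > b" using that by auto
    have "\<psi> x = (LINT t|lborel. \<zeta> t)" unfolding \<psi>_def prim_def
      by (rule Bochner_Integration.integral_cong) (use x z ab(1) in \<open>auto simp: indicator_def\<close>)
    then show ?thesis using 0 by simp
  qed
  ultimately have "\<psi> \<in> test_functions I" using ab(2) by (intro test_functionsI[of _ "{a..b}"]) auto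
  then show ?thesis using that fd by simp
qed

lemma test_unit_mass:
  fixes I :: "real set"
  assumes "open I" "p \<in> I"
  obtains \<theta> where "\<theta> \<in> test_functions I" "(LINT x|lborel. \<theta> x) = 1"
proof -
  obtain e where e: "e > 0" "cball p e \<subseteq> I" using open_contains_cball assms by blast
  have sub: "{p - e<..<p + e} \<subseteq> I" using e by (auto simp: cball_def dist_real_def subset_iff)
  have [measurable]: "bump n (p - e) (p + e) \<in> borel_measurable borel" for n
    by (rule test_borel[OF test_bump[OF sub]])
  have "(\<lambda>n. LINT x|lborel. bump n (p - e) (p + e) x) \<longlonglongrightarrow> (LINT x|lborel. indicator {p - e<..<p + e} x)"
  proof (rule integral_dominated_convergence[where w = "indicator {p - e..p + e}"])
    show "integrable lborel (indicator {p - e..p + e} :: real \<Rightarrow> real)"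
      using emeasure_compact_finite[of "{p - e..p + e}"] by simp
    show "AE x in lborel. norm (bump n (p - e) (p + e) x) \<le> indicator {p - e..p + e} x" for n
    proof (rule AE_I2)
      fix x
      have "bump n (p - e) (p + e) x = 0" if "x \<notin> {p - e..p + e}"
        using test_outside[OF test_bump[OF order_refl], of x "p - e" "p + e" n] that by auto
      then show "norm (bump n (p - e) (p + e) x) \<le> indicator {p - e..p + e} x"
        using cmod_bump_le[of n "p - e" "p + e" x] by (cases "x \<in> {p - e..p + e}") auto
    qed
  qed (auto intro: bump_tendsto)
  moreover have "(LINT x|lborel. indicator {p - e<..<p + e} x :: complex) = complex_of_real (2 * e)"
  proof -
    have "(LINT x|lborel. indicator {p - e<..<p + e} x :: complex) = (LINT x|lborel. complex_of_real (indicator {p - e<..<p + e} x))"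
      by (rule Bochner_Integration.integral_cong) (auto simp: indicator_def)
    also have "\<dots> = complex_of_real (LINT x|lborel. indicator {p - e<..<p + e} x)"
      by (rule integral_complex_of_real)
    also have "(LINT x|lborel. indicator {p - e<..<p + e} x :: real) = 2 * e" using e by simp
    finally show ?thesis .
  qed
  ultimately have lim: "(\<lambda>n. LINT x|lborel. bump n (p - e) (p + e) x) \<longlonglongrightarrow> complex_of_real (2 * e)" by simp
  have "complex_of_real (2 * e) \<noteq> 0" using e by simp
  from tendsto_imp_eventually_ne[OF lim this] obtain n where n: "(LINT x|lborel. bump n (p - e) (p + e) x) \<noteq> 0"
    using eventually_happens'[OF sequentially_bot] by blast
  let ?c = "1 / (LINT x|lborel. bump n (p - e) (p + e) x)"
  have "(\<lambda>x. 0 + ?c * bump n (p - e) (p + e) x) \<in> test_functions I"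
    by (rule test_lc[OF _ test_bump[OF sub]]) (rule test_functionsI[of _ "{}"], auto intro: Ck_const)
  moreover have "(LINT x|lborel. 0 + ?c * bump n (p - e) (p + e) x) = 1" using n by simp
  ultimately show ?thesis using that by blast
qed

text \<open>Every test function is a multiple of the fixed \<theta> of mass 1 plus one of mass 0,
  and the latter is a derivative by \<open>test_primitive\<close>. Hence v acts on test functions as
  the constant c = \<integral> v \<theta>, and the fundamental lemma applies to v - c.\<close>

lemma du_Bois_Reymond:
  fixes v :: "real \<Rightarrow> complex"
  assumes I: "open I" "is_interval I" "p \<in> I" and v: "v \<in> borel_measurable borel"
    and loc: "\<And>a b. integrable lborel (\<lambda>x. indicator {a..b} x *\<^sub>R v x)"
    and zero: "\<And>\<psi>. \<psi> \<in> test_functions I \<Longrightarrow> (LINT x|lborel. v x * frechet_derivative \<psi> (at x) 1) = 0"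
  obtains c where "AE x in lborel. x \<in> I \<longrightarrow> v x = c"
proof -
  obtain \<theta> where \<theta>: "\<theta> \<in> test_functions I" "(LINT x|lborel. \<theta> x) = 1" using test_unit_mass[OF I(1,3)] by blast
  define c where "c = (LINT x|lborel. v x * \<theta> x)"
  have int: "integrable lborel (\<lambda>x. v x * \<phi> x)" if "\<phi> \<in> test_functions I" for \<phi>
    by (rule test_integrable[OF v I(1) _ that]) (use loc in \<open>simp add: cbox_interval\<close>)
  have int1: "integrable lborel \<phi>" if "\<phi> \<in> test_functions I" for \<phi> :: "real \<Rightarrow> complex"
    using continuous_test_integrable[OF continuous_on_const[of UNIV 1] that] by simp
  have "AE x in lborel. x \<in> I \<longrightarrow> v x - c = 0"
  proof (rule fundamental_lemma[OF _ I(1)])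
    show "(\<lambda>x. v x - c) \<in> borel_measurable borel" using v by simp
    show "integrable lborel (\<lambda>x. indicator (cbox a b) x *\<^sub>R (v x - c))" for a b :: real
    proof -
      have "integrable lborel (\<lambda>x. indicator {a..b} x *\<^sub>R v x - indicator {a..b} x *\<^sub>R c)"
        by (intro Bochner_Integration.integrable_diff loc integrable_scaleR_left)
           (use emeasure_compact_finite[of "{a..b}"] in simp)
      then show ?thesis by (simp add: scaleR_diff_right cbox_interval)
    qed
    fix \<phi> :: "real \<Rightarrow> complex" assume \<phi>: "\<phi> \<in> test_functions I"
    define m where "m = (LINT x|lborel. \<phi> x)"
    have \<zeta>: "(\<lambda>x. \<phi> x + (- m) * \<theta> x) \<in> test_functions I" by (rule test_lc[OF \<phi> \<theta>(1)])
    have "(LINT x|lborel. \<phi> x + (- m) * \<theta> x) = 0"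
      using int1[OF \<phi>] int1[OF \<theta>(1)] \<theta>(2) by (subst Bochner_Integration.integral_add) (auto simp: m_def)
    from test_primitive[OF I(2,3) \<zeta> this] obtain \<psi> where
      \<psi>: "\<psi> \<in> test_functions I" "\<And>x. frechet_derivative \<psi> (at x) 1 = \<phi> x + (- m) * \<theta> x" by blast
    have "0 = (LINT x|lborel. v x * (\<phi> x + (- m) * \<theta> x))" using zero[OF \<psi>(1)] by (simp only: \<psi>(2))
    also have "\<dots> = (LINT x|lborel. v x * \<phi> x + (- m) * (v x * \<theta> x))" by (simp add: algebra_simps)
    also have "\<dots> = (LINT x|lborel. v x * \<phi> x) - m * c"
      using int[OF \<phi>] int[OF \<theta>(1)] by (subst Bochner_Integration.integral_add) (auto simp: c_def)
    finally have e: "(LINT x|lborel. v x * \<phi> x) = m * c" by simp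
    have "(LINT x|lborel. (v x - c) * \<phi> x) = (LINT x|lborel. v x * \<phi> x - c * \<phi> x)" by (simp add: algebra_simps)
    also have "\<dots> = (LINT x|lborel. v x * \<phi> x) - c * m"
      using int[OF \<phi>] int1[OF \<phi>] by (subst Bochner_Integration.integral_diff) (auto simp: m_def)
    finally show "(LINT x|lborel. (v x - c) * \<phi> x) = 0" using e by simp
  qed
  then show ?thesis by (intro that[of c]) simp
qed

text \<open>Integration by parts shows that U minus the primitive of W has weak derivative 0, so
  that the two differ by a constant on the interval.\<close>

lemma weak_deriv_primitive:
  fixes U W :: "real \<Rightarrow> complex"
  assumes I: "open I" "is_interval I" "p \<in> I"
    and U: "U \<in> borel_measurable borel" "U \<in> L2 lborel" and W: "W \<in> borel_measurable borel" "W \<in> L2 lborel"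
    and d: "\<And>\<phi>. \<phi> \<in> test_functions I \<Longrightarrow> (LINT x|lborel. U x * frechet_derivative \<phi> (at x) 1) = - (LINT x|lborel. W x * \<phi> x)"
  obtains g where "continuous_on UNIV g" "AE x in lborel. x \<in> I \<longrightarrow> U x = g x"
    "\<And>x y. x \<le> y \<Longrightarrow> g y - g x = (LINT t|lborel. indicator {x..y} t *\<^sub>R W t)"
proof -
  have pc: "continuous_on UNIV (prim W p)" by (rule prim_continuous[OF W(2)])
  have "\<exists>c. AE x in lborel. x \<in> I \<longrightarrow> U x - prim W p x = c"
  proof (rule du_Bois_Reymond[OF I])
    show "(\<lambda>x. U x - prim W p x) \<in> borel_measurable borel"
      using U(1) borel_measurable_continuous_onI[OF pc] by simp
    show "integrable lborel (\<lambda>x. indicator {a..b} x *\<^sub>R (U x - prim W p x))" for a b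
      unfolding scaleR_diff_right
      by (intro Bochner_Integration.integrable_diff L2_Icc_integrable[OF U(2)] borel_integrable_compact continuous_on_subset[OF pc]) auto
    fix \<psi> assume \<psi>: "\<psi> \<in> test_functions I"
    have "(LINT x|lborel. (U x - prim W p x) * frechet_derivative \<psi> (at x) 1)
       = (LINT x|lborel. U x * frechet_derivative \<psi> (at x) 1) - (LINT x|lborel. prim W p x * frechet_derivative \<psi> (at x) 1)"
      using L2_mult_integrable[OF U(2) test_L2_lborel[OF test_dv[OF \<psi>]]] continuous_test_integrable[OF pc test_dv[OF \<psi>]]
      by (simp add: left_diff_distrib)
    then show "(LINT x|lborel. (U x - prim W p x) * frechet_derivative \<psi> (at x) 1) = 0"
      using d[OF \<psi>] prim_by_parts[OF W(2,1) \<psi>, of p] by simp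
  qed blast
  then obtain c where c: "AE x in lborel. x \<in> I \<longrightarrow> U x - prim W p x = c" by blast
  show ?thesis
  proof (rule that[of "\<lambda>x. c + prim W p x"])
    show "continuous_on UNIV (\<lambda>x. c + prim W p x)" by (intro continuous_intros pc)
    show "AE x in lborel. x \<in> I \<longrightarrow> U x = c + prim W p x" using c by eventually_elim (simp add: algebra_simps)
  qed (use prim_diff[OF W(2)] in simp)
qed

lemma H1_interval_rep:
  fixes I :: "real set"
  assumes I: "open I" "is_interval I" "p \<in> I" and u: "u \<in> L2 (lebesgue_on I)"
    and w: "w \<in> L2 (lebesgue_on I)" and d: "has_weak_deriv I 1 u w" and W: "brep I w W"
  obtains g where "continuous_on UNIV g" "AE x in lborel. x \<in> I \<longrightarrow> u x = g x"
    "\<And>x y. x \<le> y \<Longrightarrow> g y - g x = (LINT t|lborel. indicator {x..y} t *\<^sub>R W t)"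
proof -
  have B: "I \<in> sets borel" using I by simp
  obtain U where U: "brep I u U" using brep_ex[OF B u] by blast
  note d' = has_weak_deriv_brep[OF B U W, of 1, THEN iffD1, OF _ d]
  obtain g where g: "continuous_on UNIV g" "AE x in lborel. x \<in> I \<longrightarrow> U x = g x"
    "\<And>x y. x \<le> y \<Longrightarrow> g y - g x = (LINT t|lborel. indicator {x..y} t *\<^sub>R W t)"
    by (rule weak_deriv_primitive[OF I brepD(1,2)[OF U] brepD(1,2)[OF W]]) (use d' in auto)
  have "AE x in lborel. x \<in> I \<longrightarrow> u x = g x" using brepD(4)[OF U] g(2) by eventually_elim simp
  then show ?thesis using that g by blast
qed

lemma continuous_AE_eq:
  fixes g h :: "real \<Rightarrow> complex"
  assumes "open I" "continuous_on I g" "continuous_on I h" "AE x in lborel. x \<in> I \<longrightarrow> g x = h x" "p \<in> I"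
  shows "g p = h p"
proof (rule ccontr)
  assume "g p \<noteq> h p"
  have "continuous_on I (\<lambda>x. g x - h x)" by (intro continuous_intros assms)
  then have "open ((\<lambda>x. g x - h x) -` (- {0}) \<inter> I)"
    using continuous_open_preimage[of I "\<lambda>x. g x - h x" "- {0}"] assms(1) by (simp add: Int_commute open_Compl)
  moreover have "p \<in> (\<lambda>x. g x - h x) -` (- {0}) \<inter> I" using \<open>g p \<noteq> h p\<close> assms(5) by simp
  ultimately obtain e where e: "e > 0" "ball p e \<subseteq> (\<lambda>x. g x - h x) -` (- {0}) \<inter> I"
    using open_contains_ball by blast
  have "AE x in lborel. x \<notin> ball p e" using assms(4) by eventually_elim (use e(2) in auto)
  then have "emeasure lborel (ball p e) = 0" by (subst (asm) AE_iff_null_sets[symmetric]) (auto simp: null_sets_def)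
  moreover have "ball p e = {p - e<..<p + e}" by (auto simp: ball_def dist_real_def)
  ultimately show False using e(1) by simp
qed

text \<open>The description in \<open>point_value\<close> is well defined because continuous
  functions that agree almost everywhere on an open set agree everywhere on it.\<close>

lemma point_value_eq:
  assumes "open I" "continuous_on I g" "AE x in lborel. x \<in> I \<longrightarrow> u x = g x" "p \<in> I"
  shows "point_value I u p = g p"
  unfolding point_value_def
proof (rule the_equality)
  have B: "I \<in> sets borel" using assms by simp
  show "\<exists>h. continuous_on I h \<and> (AE x in lebesgue_on I. u x = h x) \<and> h p = g p"
    using assms B by (intro exI[of _ g]) (simp add: AE_lebesgue_on)
  fix c assume "\<exists>h. continuous_on I h \<and> (AE x in lebesgue_on I. u x = h x) \<and> h p = c"
  then obtain h where h: "continuous_on I h" "AE x in lebesgue_on I. u x = h x" "h p = c" by blast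
  then have "AE x in lborel. x \<in> I \<longrightarrow> u x = h x" using B by (simp add: AE_lebesgue_on)
  with assms(3) have "AE x in lborel. x \<in> I \<longrightarrow> h x = g x" by eventually_elim auto
  from continuous_AE_eq[OF assms(1) h(1) assms(2) this assms(4)] h(3) show "c = g p" by simp
qed

subsection \<open>Resolvents of Schroedinger type forms\<close>

lemma Linf_mult_L2:
  assumes "V \<in> borel_measurable M" "AE x in M. \<bar>V x\<bar> \<le> C" "u \<in> L2 M"
  shows "(\<lambda>x. complex_of_real (V x) * u x) \<in> L2 M"
proof -
  have [measurable]: "V \<in> borel_measurable M" "u \<in> borel_measurable M" using assms L2_measurable by auto
  show ?thesis
  proof (rule L2I)
    have "integrable M (\<lambda>x. C\<^sup>2 * (cmod (u x))\<^sup>2)" using L2_integrable[OF assms(3)] by simp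
    then show "integrable M (\<lambda>x. (cmod (complex_of_real (V x) * u x))\<^sup>2)"
    proof (rule Bochner_Integration.integrable_bound)
      show "AE x in M. norm ((cmod (complex_of_real (V x) * u x))\<^sup>2) \<le> norm (C\<^sup>2 * (cmod (u x))\<^sup>2)"
        using assms(2)
      proof eventually_elim
        case (elim x)
        then have "\<bar>V x\<bar>\<^sup>2 \<le> C\<^sup>2" by (intro power_mono) auto
        then show ?case by (simp add: norm_mult power_mult_distrib mult_right_mono)
      qed
    qed measurable
  qed measurable
qed

text \<open>Common frame for both operators: in the limit problem \<open>T\<close> is the value at 0
  with strength \<gamma>, on the thin domain both are 0. \<open>T_bound\<close> makes the form
  continuous in the H1 norm, so that completeness of H1 becomes completeness in the form
  norm.\<close>

locale schroedinger_form =
  fixes \<Omega> :: "'a::euclidean_space set" and V :: "'a \<Rightarrow> real" and C :: real and \<gamma> :: real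
    and T :: "('a \<Rightarrow> complex) \<Rightarrow> complex" and c1 :: real
  assumes open_domain: "open \<Omega>"
    and V_measurable: "V \<in> borel_measurable (lebesgue_on \<Omega>)"
    and V_bounds: "AE x in lebesgue_on \<Omega>. 0 \<le> V x \<and> V x \<le> C"
    and \<gamma>_nonneg: "0 \<le> \<gamma>" and C_nonneg: "0 \<le> C"
    and T_lc: "u \<in> H1 \<Omega> \<Longrightarrow> v \<in> H1 \<Omega> \<Longrightarrow> T (\<lambda>x. u x + c * v x) = T u + c * T v"
    and T_bound: "u \<in> H1 \<Omega> \<Longrightarrow> (cmod (T u))\<^sup>2 \<le>
      c1 * (sqn (lebesgue_on \<Omega>) u + (\<Sum>b\<in>Basis. sqn (lebesgue_on \<Omega>) (weak_deriv \<Omega> b u)))"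
begin

abbreviation "M \<equiv> lebesgue_on \<Omega>"
abbreviation "D \<equiv> weak_deriv \<Omega>"

lemma V_mult_L2: "u \<in> L2 M \<Longrightarrow> (\<lambda>x. complex_of_real (V x) * u x) \<in> L2 M"
  by (rule Linf_mult_L2[OF V_measurable, of C]) (use V_bounds in \<open>auto elim: eventually_mono\<close>)

definition form :: "('a \<Rightarrow> complex) \<Rightarrow> ('a \<Rightarrow> complex) \<Rightarrow> complex" where
  "form u v = (\<Sum>b\<in>Basis. L2_inner M (D b u) (D b v))
     + L2_inner M (\<lambda>x. complex_of_real (V x) * u x) v + complex_of_real \<gamma> * T u * cnj (T v)"

text \<open>The form of A + I. It dominates the square of the H1 norm, and the resolvent equation
  reads \<open>form1 u v = L2_inner M f v\<close>.\<close>

definition form1 :: "('a \<Rightarrow> complex) \<Rightarrow> ('a \<Rightarrow> complex) \<Rightarrow> complex" where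
  "form1 u v = form u v + L2_inner M u v"

definition energy :: "('a \<Rightarrow> complex) \<Rightarrow> real" where
  "energy u = sqn M u + (\<Sum>b\<in>Basis. sqn M (D b u))"

lemma V_inner_self:
  assumes "u \<in> L2 M"
  shows "0 \<le> Re (L2_inner M (\<lambda>x. complex_of_real (V x) * u x) u)"
    and "Re (L2_inner M (\<lambda>x. complex_of_real (V x) * u x) u) \<le> C * sqn M u"
proof -
  have i: "integrable M (\<lambda>x. complex_of_real (V x) * u x * cnj (u x))"
    by (rule L2_inner_integrable[OF V_mult_L2[OF assms] assms])
  have eq: "Re (complex_of_real (V x) * u x * cnj (u x)) = V x * (cmod (u x))\<^sup>2" for x
    unfolding cmod_power2 by (simp add: power2_eq_square algebra_simps)
  have "Re (L2_inner M (\<lambda>x. complex_of_real (V x) * u x) u) = (LINT x|M. Re (complex_of_real (V x) * u x * cnj (u x)))"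
    unfolding L2_inner_def by (rule integral_Re[symmetric, OF i])
  then have R: "Re (L2_inner M (\<lambda>x. complex_of_real (V x) * u x) u) = (LINT x|M. V x * (cmod (u x))\<^sup>2)"
    by (simp only: eq)
  have i': "integrable M (\<lambda>x. V x * (cmod (u x))\<^sup>2)" using integrable_Re[OF i] by (simp only: eq)
  show "0 \<le> Re (L2_inner M (\<lambda>x. complex_of_real (V x) * u x) u)"
    unfolding R by (rule integral_nonneg_AE) (use V_bounds in \<open>auto elim: eventually_mono\<close>)
  have "(LINT x|M. V x * (cmod (u x))\<^sup>2) \<le> (LINT x|M. C * (cmod (u x))\<^sup>2)"
  proof (rule integral_mono_AE[OF i'])
    show "AE x in M. V x * (cmod (u x))\<^sup>2 \<le> C * (cmod (u x))\<^sup>2"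
      using V_bounds by eventually_elim (simp add: mult_right_mono)
  qed (use L2_integrable[OF assms] in simp)
  then show "Re (L2_inner M (\<lambda>x. complex_of_real (V x) * u x) u) \<le> C * sqn M u"
    unfolding R by (simp add: sqn_def)
qed

lemma V_inner_sym: "L2_inner M (\<lambda>x. complex_of_real (V x) * v x) u = cnj (L2_inner M (\<lambda>x. complex_of_real (V x) * u x) v)"
proof -
  have "cnj (L2_inner M (\<lambda>x. complex_of_real (V x) * u x) v) = (LINT x|M. cnj (complex_of_real (V x) * u x * cnj (v x)))"
    unfolding L2_inner_def by (rule Bochner_Integration.integral_cnj[symmetric])
  also have "\<dots> = L2_inner M (\<lambda>x. complex_of_real (V x) * v x) u"
    unfolding L2_inner_def by (simp add: mult_ac)
  finally show ?thesis by simp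
qed

lemma form_self:
  assumes "u \<in> H1 \<Omega>"
  shows "Re (form u u) = (\<Sum>b\<in>Basis. sqn M (D b u)) + Re (L2_inner M (\<lambda>x. complex_of_real (V x) * u x) u) + \<gamma> * (cmod (T u))\<^sup>2"
proof -
  have "Re (complex_of_real \<gamma> * T u * cnj (T u)) = \<gamma> * (cmod (T u))\<^sup>2"
    unfolding cmod_power2 by (simp add: power2_eq_square algebra_simps)
  then show ?thesis by (simp add: form_def L2_inner_self)
qed

lemma form_hermitian: "form v u = cnj (form u v)"
proof -
  have "(\<Sum>b\<in>Basis. L2_inner M (D b v) (D b u)) = cnj (\<Sum>b\<in>Basis. L2_inner M (D b u) (D b v))"
    unfolding cnj_sum by (rule sum.cong[OF refl L2_inner_commute])
  moreover have "complex_of_real \<gamma> * T v * cnj (T u) = cnj (complex_of_real \<gamma> * T u * cnj (T v))" by simp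
  ultimately show ?thesis unfolding form_def using V_inner_sym[of v u] by simp
qed

lemma form1_hermitian: "form1 v u = cnj (form1 u v)"
  unfolding form1_def by (simp add: form_hermitian[of v u] L2_inner_commute[of M v u])

lemma form_lc:
  assumes "u \<in> H1 \<Omega>" "v \<in> H1 \<Omega>" "w \<in> H1 \<Omega>"
  shows "form (\<lambda>x. u x + c * v x) w = form u w + c * form v w"
proof -
  have 1: "L2_inner M (D b (\<lambda>x. u x + c * v x)) (D b w) = L2_inner M (D b u) (D b w) + c * L2_inner M (D b v) (D b w)"
    if b: "b \<in> Basis" for b
  proof -
    note L = weak_deriv_works(1)[OF assms(1) b] weak_deriv_works(1)[OF assms(2) b] weak_deriv_works(1)[OF assms(3) b]
      weak_deriv_works(1)[OF H1_lc(1)[OF open_domain assms(1,2), of c] b]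
    have "L2_inner M (D b (\<lambda>x. u x + c * v x)) (D b w) = L2_inner M (\<lambda>x. D b u x + c * D b v x) (D b w)"
      by (rule L2_inner_cong_AE) (use L L2_lc[OF L(1,2), of c] H1_lc(2)[OF open_domain assms(1,2) b] in \<open>auto intro: L2_measurable\<close>)
    then show ?thesis by (simp add: L2_inner_lc_left[OF L(1-3)])
  qed
  have 2: "L2_inner M (\<lambda>x. complex_of_real (V x) * (u x + c * v x)) w
     = L2_inner M (\<lambda>x. complex_of_real (V x) * u x) w + c * L2_inner M (\<lambda>x. complex_of_real (V x) * v x) w"
    using L2_inner_lc_left[OF V_mult_L2[OF H1_L2[OF assms(1)]] V_mult_L2[OF H1_L2[OF assms(2)]] H1_L2[OF assms(3)], of c]
    by (simp add: algebra_simps)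
  show ?thesis unfolding form_def 2 T_lc[OF assms(1,2)]
    by (simp add: 1 sum.distrib sum_distrib_left algebra_simps cong: sum.cong)
qed

lemma form1_lc:
  assumes "u \<in> H1 \<Omega>" "v \<in> H1 \<Omega>" "w \<in> H1 \<Omega>"
  shows "form1 (\<lambda>x. u x + c * v x) w = form1 u w + c * form1 v w"
  unfolding form1_def form_lc[OF assms] L2_inner_lc_left[OF H1_L2[OF assms(1)] H1_L2[OF assms(2)] H1_L2[OF assms(3)]]
  by (simp add: algebra_simps)

lemma form1_self: "Re (form1 u u) = Re (form u u) + sqn M u"
  by (simp add: form1_def L2_inner_self)

lemma energy_le_form1: "u \<in> H1 \<Omega> \<Longrightarrow> energy u + \<gamma> * (cmod (T u))\<^sup>2 \<le> Re (form1 u u)"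
  using V_inner_self(1)[OF H1_L2, of u] by (simp add: form1_self form_self energy_def)

lemma energy_nonneg: "0 \<le> energy u"
  by (simp add: energy_def sum_nonneg)

lemma form1_nonneg: "u \<in> H1 \<Omega> \<Longrightarrow> 0 \<le> Re (form1 u u)"
  using energy_le_form1[of u] energy_nonneg[of u] mult_nonneg_nonneg[OF \<gamma>_nonneg zero_le_power2[of "cmod (T u)"]] by linarith

lemma form1_le_energy:
  assumes "u \<in> H1 \<Omega>" shows "Re (form1 u u) \<le> (1 + C + \<gamma> * c1) * energy u"
proof -
  have "C * sqn M u \<le> C * energy u"
    by (intro mult_left_mono C_nonneg) (simp add: energy_def sum_nonneg)
  moreover have "\<gamma> * (cmod (T u))\<^sup>2 \<le> \<gamma> * (c1 * energy u)"
    using T_bound[OF assms] by (intro mult_left_mono \<gamma>_nonneg) (simp add: energy_def)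
  ultimately show ?thesis
    using V_inner_self(2)[OF H1_L2[OF assms]] by (simp add: form1_self form_self[OF assms] energy_def algebra_simps)
qed

lemma energy_diff:
  assumes "u \<in> H1 \<Omega>" "v \<in> H1 \<Omega>"
  shows "energy (\<lambda>x. u x + (-1) * v x) = sqn M (\<lambda>x. u x - v x) + (\<Sum>b\<in>Basis. sqn M (\<lambda>x. D b u x - D b v x))"
proof -
  have "sqn M (D b (\<lambda>x. u x + (-1) * v x)) = sqn M (\<lambda>x. D b u x - D b v x)" if b: "b \<in> Basis" for b
  proof (rule sqn_cong_AE)
    note L = weak_deriv_works(1)[OF assms(1) b] weak_deriv_works(1)[OF assms(2) b]
      weak_deriv_works(1)[OF H1_lc(1)[OF open_domain assms, of "-1"] b]
    show "D b (\<lambda>x. u x + (-1) * v x) \<in> borel_measurable M" by (rule L2_measurable[OF L(3)])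
    show "(\<lambda>x. D b u x - D b v x) \<in> borel_measurable M" by (rule L2_measurable[OF L2_diff[OF L(1,2)]])
    show "AE x in M. D b (\<lambda>x. u x + (-1) * v x) x = D b u x - D b v x"
      using H1_lc(2)[OF open_domain assms b, of "-1"] by eventually_elim simp
  qed
  then show ?thesis unfolding energy_def by (simp cong: sum.cong)
qed

sublocale hermitian_form "H1 \<Omega>" "\<lambda>u c v x. u x + c * v x" form1
  by unfold_locales (auto intro!: H1_lc(1) open_domain form1_lc form1_hermitian form1_nonneg)

text \<open>The Riesz theorem with \<open>form1\<close> as scalar product. The form norm and the H1
  norm control each other (\<open>energy_le_form1\<close> and \<open>form1_le_energy\<close>), so
  form-Cauchy sequences converge by \<open>H1_complete\<close>.\<close>

theorem resolvent_exists:
  assumes f: "f \<in> L2 M"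
  shows "\<exists>u\<in>H1 \<Omega>. \<forall>v\<in>H1 \<Omega>. form1 u v = L2_inner M f v"
proof (rule Riesz_representation[where K = "sqn M f"])
  have "(\<lambda>x. 0) \<in> H1 \<Omega>"
    unfolding H1_def by (auto intro!: L2_zero bexI[of _ "\<lambda>x. 0"] simp: has_weak_deriv_def)
  then show "H1 \<Omega> \<noteq> {}" by blast
  show "L2_inner M f (\<lambda>x. u x + c * v x) = L2_inner M f u + cnj c * L2_inner M f v"
    if "u \<in> H1 \<Omega>" "v \<in> H1 \<Omega>" for u v c
    using L2_inner_lc_left[OF H1_L2[OF that(1)] H1_L2[OF that(2)] f, of c]
    by (simp add: L2_inner_commute[of M f])
  show "(cmod (L2_inner M f v))\<^sup>2 \<le> sqn M f * Re (form1 v v)" if v: "v \<in> H1 \<Omega>" for v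
  proof -
    have "(cmod (L2_inner M f v))\<^sup>2 \<le> (sqrt (sqn M f) * sqrt (sqn M v))\<^sup>2"
      by (intro power_mono L2_inner_bound f H1_L2 v) simp
    also have "\<dots> = sqn M f * sqn M v" by (simp add: power_mult_distrib)
    also have "sqn M v \<le> Re (form1 v v)"
      using energy_le_form1[OF v] mult_nonneg_nonneg[OF \<gamma>_nonneg zero_le_power2[of "cmod (T v)"]]
        sum_nonneg[of Basis "\<lambda>b. sqn M (D b v)", OF sqn_nonneg]
      unfolding energy_def by linarith
    finally show ?thesis by (simp add: mult_left_mono)
  qed
  fix X assume X: "\<And>n::nat. X n \<in> H1 \<Omega>"
    and cau: "\<And>e. 0 < e \<Longrightarrow> \<exists>N. \<forall>m\<ge>N. \<forall>n\<ge>N. Re (form1 (\<lambda>x. X m x + - 1 * X n x) (\<lambda>x. X m x + - 1 * X n x)) < e"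
  have le: "sqn M (\<lambda>x. X m x - X n x) \<le> Re (form1 (\<lambda>x. X m x + - 1 * X n x) (\<lambda>x. X m x + - 1 * X n x))"
    "b \<in> Basis \<Longrightarrow> sqn M (\<lambda>x. D b (X m) x - D b (X n) x) \<le> Re (form1 (\<lambda>x. X m x + - 1 * X n x) (\<lambda>x. X m x + - 1 * X n x))" for m n b
  proof -
    have "energy (\<lambda>x. X m x + - 1 * X n x) \<le> Re (form1 (\<lambda>x. X m x + - 1 * X n x) (\<lambda>x. X m x + - 1 * X n x))"
      using energy_le_form1[OF H1_lc(1)[OF open_domain X[of m] X[of n], of "-1"]]
       mult_nonneg_nonneg[OF \<gamma>_nonneg zero_le_power2[of "cmod (T (\<lambda>x. X m x + - 1 * X n x))"]] by linarith
    then have *: "sqn M (\<lambda>x. X m x - X n x) + (\<Sum>b\<in>Basis. sqn M (\<lambda>x. D b (X m) x - D b (X n) x))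
      \<le> Re (form1 (\<lambda>x. X m x + - 1 * X n x) (\<lambda>x. X m x + - 1 * X n x))"
      unfolding energy_diff[OF X X] .
    have s: "0 \<le> (\<Sum>b\<in>Basis. sqn M (\<lambda>x. D b (X m) x - D b (X n) x))" by (simp add: sum_nonneg)
    show "sqn M (\<lambda>x. X m x - X n x) \<le> Re (form1 (\<lambda>x. X m x + - 1 * X n x) (\<lambda>x. X m x + - 1 * X n x))"
      using * s by linarith
    assume b: "b \<in> Basis"
    have "sqn M (\<lambda>x. D b (X m) x - D b (X n) x) \<le> (\<Sum>b\<in>Basis. sqn M (\<lambda>x. D b (X m) x - D b (X n) x))"
      using b by (intro member_le_sum) auto
    then show "sqn M (\<lambda>x. D b (X m) x - D b (X n) x) \<le> Re (form1 (\<lambda>x. X m x + - 1 * X n x) (\<lambda>x. X m x + - 1 * X n x))"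
      using * sqn_nonneg[of M "\<lambda>x. X m x - X n x"] by linarith
  qed
  have cau1: "\<exists>N. \<forall>m\<ge>N. \<forall>n\<ge>N. sqn M (\<lambda>x. X m x - X n x) < e" if "e > 0" for e
    using cau[OF that] le(1) le_less_trans by blast
  have cau2: "\<exists>N. \<forall>m\<ge>N. \<forall>n\<ge>N. sqn M (\<lambda>x. D b (X m) x - D b (X n) x) < e" if "b \<in> Basis" "e > 0" for b e
    using cau[OF that(2)] le(2)[OF that(1)] le_less_trans by blast
  obtain u where u: "u \<in> H1 \<Omega>" "(\<lambda>n. sqn M (\<lambda>x. X n x - u x)) \<longlonglongrightarrow> 0"
     "\<And>b. b \<in> Basis \<Longrightarrow> (\<lambda>n. sqn M (\<lambda>x. D b (X n) x - D b u x)) \<longlonglongrightarrow> 0"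
    using H1_complete[of \<Omega> X, OF open_domain X cau1 cau2] by blast
  have "(\<lambda>n. Re (form1 (\<lambda>x. X n x + - 1 * u x) (\<lambda>x. X n x + - 1 * u x))) \<longlonglongrightarrow> 0"
  proof (rule Lim_null_comparison)
    show "\<forall>\<^sub>F n in sequentially. norm (Re (form1 (\<lambda>x. X n x + - 1 * u x) (\<lambda>x. X n x + - 1 * u x)))
       \<le> (1 + C + \<gamma> * c1) * energy (\<lambda>x. X n x + (-1) * u x)"
    proof (intro always_eventually allI)
      fix n
      note H = H1_lc(1)[OF open_domain X[of n] u(1), of "-1"]
      show "norm (Re (form1 (\<lambda>x. X n x + - 1 * u x) (\<lambda>x. X n x + - 1 * u x)))
       \<le> (1 + C + \<gamma> * c1) * energy (\<lambda>x. X n x + (-1) * u x)"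
        using form1_le_energy[OF H] form1_nonneg[OF H] unfolding real_norm_def by linarith
    qed
    have "(\<lambda>n. (1 + C + \<gamma> * c1) * energy (\<lambda>x. X n x + (-1) * u x)) \<longlonglongrightarrow> (1 + C + \<gamma> * c1) * (0 + (\<Sum>b\<in>(Basis::'a set). 0))"
      unfolding energy_diff[OF X u(1)] by (intro tendsto_intros u)
    then show "(\<lambda>n. (1 + C + \<gamma> * c1) * energy (\<lambda>x. X n x + (-1) * u x)) \<longlonglongrightarrow> 0" by simp
  qed
  then show "\<exists>x\<in>H1 \<Omega>. (\<lambda>n. Re (form1 (\<lambda>xa. X n xa + - 1 * x xa) (\<lambda>xa. X n xa + - 1 * x xa))) \<longlonglongrightarrow> 0"
    using u(1) by blast
qed simp

text \<open>Testing the equation with u itself bounds the energy by |f| |u|. As |u|^2 is part of the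
  energy, |u| \<le> |f| follows, and this is inserted into the first bound.\<close>

lemma energy_estimate:
  assumes f: "f \<in> L2 M" and u: "u \<in> H1 \<Omega>" and eq: "form1 u u = L2_inner M f u"
  shows "energy u + \<gamma> * (cmod (T u))\<^sup>2 \<le> sqn M f"
proof -
  define x where "x = sqrt (sqn M u)"
  define y where "y = sqrt (sqn M f)"
  have le: "energy u + \<gamma> * (cmod (T u))\<^sup>2 \<le> y * x"
  proof -
    have "energy u + \<gamma> * (cmod (T u))\<^sup>2 \<le> Re (form1 u u)" by (rule energy_le_form1[OF u])
    also have "\<dots> \<le> cmod (L2_inner M f u)" unfolding eq by (rule complex_Re_le_cmod)
    also have "\<dots> \<le> y * x" unfolding x_def y_def by (rule L2_inner_bound[OF f H1_L2[OF u]])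
    finally show ?thesis .
  qed
  have x2: "x\<^sup>2 = sqn M u" "y\<^sup>2 = sqn M f" "0 \<le> x" "0 \<le> y" by (simp_all add: x_def y_def)
  have "x\<^sup>2 \<le> energy u + \<gamma> * (cmod (T u))\<^sup>2"
    using mult_nonneg_nonneg[OF \<gamma>_nonneg zero_le_power2[of "cmod (T u)"]]
      sum_nonneg[of Basis "\<lambda>b. sqn M (D b u)", OF sqn_nonneg]
    unfolding energy_def x2 by linarith
  with le have "x * x \<le> y * x" by (simp add: power2_eq_square)
  then have "x \<le> y" using x2(3,4) by (cases "x = 0") (auto simp: mult_le_cancel_right)
  then have "y * x \<le> y * y" using x2 by (intro mult_left_mono) auto
  then show ?thesis using le x2 by (simp add: power2_eq_square)
qed

end

subsection \<open>The limit operator\<close>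

lemma Omega0_open: "open (Omega0 lm lp)"
proof -
  have "open {x. lm < ereal x}" "open {x. ereal x < lp}"
    by (intro open_Collect_less continuous_intros continuous_on_ereal)+
  from open_Int[OF this] show ?thesis by (simp add: Omega0_def Int_def)
qed

lemma Omega0_interval: "is_interval (Omega0 lm lp)"
  unfolding is_interval_1 Omega0_def
  by (auto intro: less_le_trans[of lm "ereal _" "ereal _"] le_less_trans[of "ereal _" "ereal _" lp])

lemma Omega0_0: "lm < 0 \<Longrightarrow> 0 < lp \<Longrightarrow> 0 \<in> Omega0 lm lp"
  by (simp add: Omega0_def zero_ereal_def[symmetric])

lemma sqn_Linf_mult:
  assumes "V \<in> borel_measurable M" "AE x in M. \<bar>V x\<bar> \<le> C" "u \<in> L2 M"
  shows "sqn M (\<lambda>x. complex_of_real (V x) * u x) \<le> C\<^sup>2 * sqn M u"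
proof -
  have "sqn M (\<lambda>x. complex_of_real (V x) * u x) \<le> (LINT x|M. C\<^sup>2 * (cmod (u x))\<^sup>2)"
    unfolding sqn_def
  proof (rule integral_mono_AE)
    show "AE x in M. (cmod (complex_of_real (V x) * u x))\<^sup>2 \<le> C\<^sup>2 * (cmod (u x))\<^sup>2"
      using assms(2)
    proof eventually_elim
      case (elim x)
      then have "\<bar>V x\<bar>\<^sup>2 \<le> C\<^sup>2" by (intro power_mono) auto
      then show ?case by (simp add: norm_mult power_mult_distrib mult_right_mono)
    qed
  qed (use L2_integrable[OF Linf_mult_L2[OF assms]] L2_integrable[OF assms(3)] in auto)
  then show ?thesis by (simp add: sqn_def)
qed

text \<open>The inequality |g p|^2 \<le> 2 |g x|^2 + 2 \<delta> Q holds for every x in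
  [p, p + \<delta>]; averaging it over that interval gives the claim.\<close>

lemma trace_bound:
  fixes U g :: "real \<Rightarrow> complex"
  assumes \<delta>: "\<delta> > 0" and U: "U \<in> L2 lborel" "U \<in> borel_measurable borel"
    and H: "\<And>y. y \<in> {p..p + \<delta>} \<Longrightarrow> cmod (g p - g y) \<le> sqrt \<delta> * sqrt Q" and Q: "0 \<le> Q"
    and ae: "AE x in lborel. x \<in> {p<..<p + \<delta>} \<longrightarrow> U x = g x"
  shows "(cmod (g p))\<^sup>2 \<le> 2 / \<delta> * sqn lborel U + 2 * \<delta> * Q"
proof -
  have ind: "integrable lborel (\<lambda>x. indicator {p..p + \<delta>} x * c :: real)" for c
    using emeasure_compact_finite[of "{p..p + \<delta>}"] by simp
  have "\<delta> * (cmod (g p))\<^sup>2 = (LINT x|lborel. indicator {p..p + \<delta>} x * (cmod (g p))\<^sup>2)"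
    using \<delta> by simp
  also have "\<dots> \<le> (LINT x|lborel. 2 * (cmod (U x))\<^sup>2 + indicator {p..p + \<delta>} x * (2 * \<delta> * Q))"
  proof (rule integral_mono_AE)
    show "AE x in lborel. indicator {p..p + \<delta>} x * (cmod (g p))\<^sup>2 \<le> 2 * (cmod (U x))\<^sup>2 + indicator {p..p + \<delta>} x * (2 * \<delta> * Q)"
      using ae AE_lborel_singleton[of p] AE_lborel_singleton[of "p + \<delta>"]
    proof eventually_elim
      case (elim x)
      show ?case
      proof (cases "x \<in> {p..p + \<delta>}")
        case True
        then have eq: "U x = g x" using elim by auto
        have "(cmod (g p))\<^sup>2 = (cmod (g x + (g p - g x)))\<^sup>2" by simp
        also have "\<dots> \<le> 2 * (cmod (g x))\<^sup>2 + 2 * (cmod (g p - g x))\<^sup>2" by (rule cmod_sum_sq)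
        also have "(cmod (g p - g x))\<^sup>2 \<le> (sqrt \<delta> * sqrt Q)\<^sup>2" by (intro power_mono H True) simp
        also have "\<dots> = \<delta> * Q" using \<delta> Q by (simp add: power_mult_distrib)
        finally show ?thesis using True eq by simp
      qed simp
    qed
    show "integrable lborel (\<lambda>x. 2 * (cmod (U x))\<^sup>2 + indicator {p..p + \<delta>} x * (2 * \<delta> * Q))"
      by (intro Bochner_Integration.integrable_add integrable_mult_right L2_integrable[OF U(1)] ind)
  qed (rule ind)
  also have "\<dots> = 2 * sqn lborel U + \<delta> * (2 * \<delta> * Q)"
    using L2_integrable[OF U(1)] ind[of "2 * \<delta> * Q"] \<delta>
    by (subst Bochner_Integration.integral_add) (auto simp: sqn_def)
  finally have "\<delta> * (cmod (g p))\<^sup>2 \<le> \<delta> * (2 / \<delta> * sqn lborel U + 2 * \<delta> * Q)"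
    using \<delta> by (simp add: algebra_simps)
  then show ?thesis using \<delta> by (simp add: mult_le_cancel_left)
qed

lemma Ck_cnj: "Ck k f \<Longrightarrow> Ck k (\<lambda>x. cnj (f x))"
proof (induction k arbitrary: f)
  case 0 then show ?case by (auto intro: continuous_intros)
next
  case (Suc k)
  have d: "((\<lambda>x. cnj (f x)) has_derivative (\<lambda>h. cnj (frechet_derivative f (at x) h))) (at x)" for x
    using Suc.prems by (intro has_derivative_cnj frechet_derivative_works[THEN iffD1]) simp
  have "(\<lambda>x. cnj (f x)) differentiable at x" for x unfolding differentiable_def by (rule exI, rule d)
  then show ?case using Suc by (simp add: frechet_derivative_eq[OF d])
qed

lemma test_cnj: "\<phi> \<in> test_functions \<Omega> \<Longrightarrow> (\<lambda>x. cnj (\<phi> x)) \<in> test_functions \<Omega>"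
  by (simp add: test_functions_def Ck_cnj)

lemma test_deriv_cnj:
  assumes "\<phi> \<in> test_functions \<Omega>"
  shows "frechet_derivative (\<lambda>x. cnj (\<phi> x)) (at x) b = cnj (frechet_derivative \<phi> (at x) b)"
proof -
  have "((\<lambda>x. cnj (\<phi> x)) has_derivative (\<lambda>h. cnj (frechet_derivative \<phi> (at x) h))) (at x)"
    by (intro has_derivative_cnj frechet_derivative_works[THEN iffD1] test_differentiable[OF assms])
  then show ?thesis by (simp add: frechet_derivative_eq)
qed

lemma brep_test:
  assumes "\<phi> \<in> test_functions \<Omega>" shows "brep \<Omega> \<phi> \<phi>"
  unfolding brep_def using test_borel[OF assms] test_L2_lborel[OF assms] test_outside[OF assms] by auto

lemma test_deriv_integral_zero:
  fixes \<psi> :: "real \<Rightarrow> complex"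
  assumes "\<psi> \<in> test_functions I"
  shows "(LINT x|lborel. frechet_derivative \<psi> (at x) 1) = 0"
proof -
  obtain K where K: "compact K" "\<And>x. x \<notin> K \<Longrightarrow> \<psi> x = 0" using test_support[OF assms] by blast
  obtain K' where K': "compact K'" "\<And>x. x \<notin> K' \<Longrightarrow> frechet_derivative \<psi> (at x) 1 = 0"
    using test_support[OF test_dv[OF assms]] by blast
  have "bounded (K \<union> K')" using K K' by (simp add: compact_imp_bounded)
  then obtain r where r: "\<And>x. x \<in> K \<union> K' \<Longrightarrow> \<bar>x\<bar> \<le> r" unfolding bounded_iff by auto
  have z: "\<psi> x = 0" "frechet_derivative \<psi> (at x) 1 = 0" if "\<bar>x\<bar> \<ge> \<bar>r\<bar> + 1" for x
    using r[of x] K(2)[of x] K'(2)[of x] that by fastforce+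
  have "frechet_derivative \<psi> (at x) 1 = indicator {- \<bar>r\<bar> - 1..\<bar>r\<bar> + 1} x *\<^sub>R frechet_derivative \<psi> (at x) 1" for x
    using z(2)[of x] by (cases "x \<in> {- \<bar>r\<bar> - 1..\<bar>r\<bar> + 1}") auto
  then have "(LINT x|lborel. frechet_derivative \<psi> (at x) 1)
     = (LINT x|lborel. indicator {- \<bar>r\<bar> - 1..\<bar>r\<bar> + 1} x *\<^sub>R frechet_derivative \<psi> (at x) 1)"
    by (intro Bochner_Integration.integral_cong refl)
  also have "\<dots> = \<psi> (\<bar>r\<bar> + 1) - \<psi> (- \<bar>r\<bar> - 1)" by (rule test_integral_deriv[OF assms]) simp
  finally show ?thesis using z(1)[of "\<bar>r\<bar> + 1"] z(1)[of "- \<bar>r\<bar> - 1"] by simp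
qed

text \<open>The distributional derivative of the Heaviside function is the point mass at 0.\<close>

lemma test_half_line:
  fixes \<psi> :: "real \<Rightarrow> complex"
  assumes "\<psi> \<in> test_functions I"
  shows "(LINT x|lborel. indicator {0..} x *\<^sub>R frechet_derivative \<psi> (at x) 1) = - \<psi> 0"
proof -
  obtain K where K: "compact K" "\<And>x. x \<notin> K \<Longrightarrow> \<psi> x = 0" using test_support[OF assms] by blast
  obtain K' where K': "compact K'" "\<And>x. x \<notin> K' \<Longrightarrow> frechet_derivative \<psi> (at x) 1 = 0"
    using test_support[OF test_dv[OF assms]] by blast
  have "bounded (K \<union> K')" using K K' by (simp add: compact_imp_bounded)
  then obtain r where r: "\<And>x. x \<in> K \<union> K' \<Longrightarrow> \<bar>x\<bar> \<le> r" unfolding bounded_iff by auto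
  have z: "\<psi> x = 0" "frechet_derivative \<psi> (at x) 1 = 0" if "\<bar>x\<bar> \<ge> \<bar>r\<bar> + 1" for x
    using r[of x] K(2)[of x] K'(2)[of x] that by fastforce+
  have "indicator {0..} x *\<^sub>R frechet_derivative \<psi> (at x) 1 = indicator {0..\<bar>r\<bar> + 1} x *\<^sub>R frechet_derivative \<psi> (at x) 1" for x
    using z(2)[of x] by (cases "x \<in> {0..\<bar>r\<bar> + 1}") (auto simp: indicator_def)
  then have "(LINT x|lborel. indicator {0..} x *\<^sub>R frechet_derivative \<psi> (at x) 1)
     = (LINT x|lborel. indicator {0..\<bar>r\<bar> + 1} x *\<^sub>R frechet_derivative \<psi> (at x) 1)"
    by (intro Bochner_Integration.integral_cong refl)
  also have "\<dots> = \<psi> (\<bar>r\<bar> + 1) - \<psi> 0" by (rule test_integral_deriv[OF assms]) simp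
  finally show ?thesis using z(1)[of "\<bar>r\<bar> + 1"] by simp
qed

text \<open>Here \<phi> = \<phi> 0 + \<open>prim\<close> of its derivative, so
  \<open>prim_by_parts\<close> yields the weak derivative, the constant contributing 0.\<close>

lemma test_H1:
  fixes \<phi> :: "real \<Rightarrow> complex"
  assumes "open I" "\<phi> \<in> test_functions I"
  shows "\<phi> \<in> H1 I" "has_weak_deriv I 1 \<phi> (\<lambda>x. frechet_derivative \<phi> (at x) 1)"
proof -
  have B: "I \<in> sets borel" using assms by simp
  note d = test_dv[OF assms(2)]
  let ?w = "\<lambda>x. frechet_derivative \<phi> (at x) 1"
  have L: "?w \<in> L2 lborel" by (rule test_L2_lborel[OF d])
  have p0: "prim ?w 0 0 = 0" by (simp add: prim_def)
  have eq: "\<phi> x = \<phi> 0 + prim ?w 0 x" for x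
  proof (cases "0 \<le> x")
    case True
    then show ?thesis using test_integral_deriv[OF assms(2) True] prim_diff[OF L True, of 0] p0 by simp
  next
    case False
    then have le: "x \<le> 0" by simp
    have "prim ?w 0 0 - prim ?w 0 x = \<phi> 0 - \<phi> x" using test_integral_deriv[OF assms(2) le] prim_diff[OF L le, of 0] by simp
    then show ?thesis using p0 by (simp add: algebra_simps)
  qed
  show *: "has_weak_deriv I 1 \<phi> ?w"
  proof (subst has_weak_deriv_brep[OF B brep_test[OF assms(2)] brep_test[OF d]])
    show "\<forall>\<psi>\<in>test_functions I. (LINT x|lborel. \<phi> x * frechet_derivative \<psi> (at x) 1) = - (LINT x|lborel. ?w x * \<psi> x)"
    proof
      fix \<psi> :: "real \<Rightarrow> complex" assume \<psi>: "\<psi> \<in> test_functions I"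
      have "(LINT x|lborel. \<phi> x * frechet_derivative \<psi> (at x) 1)
        = (LINT x|lborel. \<phi> 0 * frechet_derivative \<psi> (at x) 1 + prim ?w 0 x * frechet_derivative \<psi> (at x) 1)"
        by (subst eq) (simp add: algebra_simps)
      also have "\<dots> = (LINT x|lborel. \<phi> 0 * frechet_derivative \<psi> (at x) 1) + (LINT x|lborel. prim ?w 0 x * frechet_derivative \<psi> (at x) 1)"
        by (rule Bochner_Integration.integral_add[OF continuous_test_integrable[OF continuous_on_const test_dv[OF \<psi>]]
            continuous_test_integrable[OF prim_continuous[OF L] test_dv[OF \<psi>]]])
      also have "(LINT x|lborel. \<phi> 0 * frechet_derivative \<psi> (at x) 1) = 0"
        by (simp only: integral_mult_right_zero test_deriv_integral_zero[OF \<psi>] mult_zero_right)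
      finally show "(LINT x|lborel. \<phi> x * frechet_derivative \<psi> (at x) 1) = - (LINT x|lborel. ?w x * \<psi> x)"
        using prim_by_parts[OF L test_borel[OF d] \<psi>, of 0] by simp
    qed
  qed simp
  show "\<phi> \<in> H1 I"
    unfolding H1_def using * test_L2[OF assms(2) B] test_L2[OF d B] by auto
qed

text \<open>The radius \<delta> is a fixed neighbourhood of the origin inside the interval.
  Constants formed in this locale may depend on it but cannot depend on \<epsilon>; in the end
  \<epsilon>0 takes its place.\<close>

locale limit_problem =
  fixes lm lp :: ereal and V0 :: "real \<Rightarrow> real" and C \<gamma> \<delta> :: real
  assumes lm: "lm < 0" and lp: "0 < lp" and \<gamma>: "0 < \<gamma>" and C: "0 \<le> C" and \<delta>: "0 < \<delta>"
    and V0_measurable: "V0 \<in> borel_measurable (lebesgue_on (Omega0 lm lp))"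
    and V0_bounds: "AE x in lebesgue_on (Omega0 lm lp). 0 \<le> V0 x \<and> V0 x \<le> C"
    and \<delta>_sub: "{-\<delta>..\<delta>} \<subseteq> Omega0 lm lp"
begin

abbreviation "I \<equiv> Omega0 lm lp"
abbreviation "M0 \<equiv> lebesgue_on I"
abbreviation "D0 \<equiv> weak_deriv I 1"

lemma I_open: "open I" and I_interval: "is_interval I" and I_0: "0 \<in> I" and I_borel: "I \<in> sets borel"
  using Omega0_open Omega0_interval Omega0_0[OF lm lp] by auto

lemma H1_rep:
  assumes "u \<in> H1 I"
  shows "\<exists>g. continuous_on UNIV g \<and> (AE x in lborel. x \<in> I \<longrightarrow> u x = g x) \<and>
    (\<forall>p\<in>I. point_value I u p = g p) \<and> (\<forall>x y. cmod (g y - g x) \<le> sqrt \<bar>y - x\<bar> * sqrt (sqn M0 (D0 u)))"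
proof -
  have b: "(1::real) \<in> Basis" by simp
  obtain W where W: "brep I (D0 u) W" using brep_ex[OF I_borel weak_deriv_works(1)[OF assms b]] by blast
  obtain g where g: "continuous_on UNIV g" "AE x in lborel. x \<in> I \<longrightarrow> u x = g x"
    "\<And>x y. x \<le> y \<Longrightarrow> g y - g x = (LINT t|lborel. indicator {x..y} t *\<^sub>R W t)"
    using H1_interval_rep[OF I_open I_interval I_0 H1_L2[OF assms] weak_deriv_works[OF assms b] W] by blast
  have hoe: "cmod (g y - g x) \<le> sqrt \<bar>y - x\<bar> * sqrt (sqn M0 (D0 u))" for x y
  proof (cases "x \<le> y")
    case True
    then show ?thesis using indicator_integral_bound[OF brepD(2)[OF W] True] g(3)[OF True] by (simp add: brep_sqn[OF W I_borel])
  next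
    case False
    then have le: "y \<le> x" by simp
    show ?thesis using indicator_integral_bound[OF brepD(2)[OF W] le] g(3)[OF le] le
      by (simp add: brep_sqn[OF W I_borel] norm_minus_commute)
  qed
  show ?thesis
    using g(1,2) point_value_eq[OF I_open continuous_on_subset[OF g(1)] g(2)] hoe by (intro exI[of _ g] conjI ballI allI) auto
qed

lemma point_value_lc:
  assumes "u \<in> H1 I" "v \<in> H1 I"
  shows "point_value I (\<lambda>x. u x + c * v x) 0 = point_value I u 0 + c * point_value I v 0"
proof -
  obtain g where g: "continuous_on UNIV g" "AE x in lborel. x \<in> I \<longrightarrow> u x = g x" "point_value I u 0 = g 0"
    using H1_rep[OF assms(1)] I_0 by blast
  obtain h where h: "continuous_on UNIV h" "AE x in lborel. x \<in> I \<longrightarrow> v x = h x" "point_value I v 0 = h 0"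
    using H1_rep[OF assms(2)] I_0 by blast
  have "point_value I (\<lambda>x. u x + c * v x) 0 = g 0 + c * h 0"
  proof (rule point_value_eq[OF I_open _ _ I_0])
    show "continuous_on I (\<lambda>x. g x + c * h x)"
      by (intro continuous_intros continuous_on_subset[OF g(1)] continuous_on_subset[OF h(1)]) auto
    show "AE x in lborel. x \<in> I \<longrightarrow> u x + c * v x = g x + c * h x" using g(2) h(2) by eventually_elim simp
  qed
  then show ?thesis using g h by simp
qed

lemma point_value_bound:
  assumes "u \<in> H1 I"
  shows "(cmod (point_value I u 0))\<^sup>2 \<le> (2 / \<delta> + 2 * \<delta>) * (sqn M0 u + sqn M0 (D0 u))"
proof -
  obtain g where g: "continuous_on UNIV g" "AE x in lborel. x \<in> I \<longrightarrow> u x = g x" "point_value I u 0 = g 0"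
    "\<And>x y. cmod (g y - g x) \<le> sqrt \<bar>y - x\<bar> * sqrt (sqn M0 (D0 u))"
    using H1_rep[OF assms] I_0 by blast
  obtain U where U: "brep I u U" using brep_ex[OF I_borel H1_L2[OF assms]] by blast
  have "(cmod (g 0))\<^sup>2 \<le> 2 / \<delta> * sqn lborel U + 2 * \<delta> * sqn M0 (D0 u)"
  proof (rule trace_bound[OF \<delta> brepD(2,1)[OF U]])
    show "cmod (g 0 - g y) \<le> sqrt \<delta> * sqrt (sqn M0 (D0 u))" if "y \<in> {0..0 + \<delta>}" for y
    proof -
      have "sqrt \<bar>0 - y\<bar> \<le> sqrt \<delta>" using that by simp
      then show ?thesis using g(4)[of 0 y] mult_right_mono[of "sqrt \<bar>0 - y\<bar>" "sqrt \<delta>" "sqrt (sqn M0 (D0 u))"]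
        by (meson order_trans real_sqrt_ge_zero sqn_nonneg)
    qed
    show "AE x in lborel. x \<in> {0<..<0 + \<delta>} \<longrightarrow> U x = g x"
      using brepD(4)[OF U] g(2)
    proof eventually_elim
      case (elim x)
      show ?case
      proof
        assume x: "x \<in> {0<..<0 + \<delta>}"
        then have "x \<in> I" using \<delta>_sub \<delta> by auto
        then show "U x = g x" using elim by simp
      qed
    qed
  qed simp
  also have "sqn lborel U = sqn M0 u" using brep_sqn[OF U I_borel] by simp
  also have "2 / \<delta> * sqn M0 u + 2 * \<delta> * sqn M0 (D0 u) \<le> (2 / \<delta> + 2 * \<delta>) * (sqn M0 u + sqn M0 (D0 u))"
    using \<delta> by (simp add: algebra_simps)
  finally show ?thesis using g(3) by simp
qed

sublocale schroedinger_form I V0 C \<gamma> "\<lambda>u. point_value I u 0" "2 / \<delta> + 2 * \<delta>"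
  using \<delta> \<gamma> point_value_bound
  by unfold_locales (auto intro: I_open V0_measurable C point_value_lc eventually_mono[OF V0_bounds])

lemma form_zero_eq:
  assumes "u \<in> H1 I" "v \<in> H1 I"
  shows "form_zero lm lp \<gamma> V0 (u, a) (v, b) = form u v"
proof -
  have b: "(1::real) \<in> Basis" by simp
  have "(LINT x|M0. D0 u x * cnj (D0 v x) + complex_of_real (V0 x) * u x * cnj (v x))
    = L2_inner M0 (D0 u) (D0 v) + L2_inner M0 (\<lambda>x. complex_of_real (V0 x) * u x) v"
    unfolding L2_inner_def
    by (rule Bochner_Integration.integral_add[OF L2_inner_integrable[OF weak_deriv_works(1)[OF assms(1) b] weak_deriv_works(1)[OF assms(2) b]]
       L2_inner_integrable[OF V_mult_L2[OF H1_L2[OF assms(1)]] H1_L2[OF assms(2)]]])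
  then show ?thesis by (simp add: form_zero_def form_def Let_def)
qed

text \<open>The form has no term in the second component, so the operator is 0 there and the
  equation for A + I reduces to \<open>snd u = snd f\<close>. The free scalar b in the test pair
  separates this from the equation for the first component.\<close>

lemma A_zero_iff:
  assumes "f \<in> H_zero lm lp"
  shows "(u, f - u) \<in> A_zero lm lp \<gamma> V0 \<longleftrightarrow>
    fst u \<in> H1 I \<and> snd u = snd f \<and> (\<forall>v\<in>H1 I. form1 (fst u) v = L2_inner M0 (fst f) v)"
proof -
  have f: "fst f \<in> L2 M0" using assms by (auto simp: H_zero_def)
  have ip: "L2_inner M0 (fst f - fst u) v = L2_inner M0 (fst f) v - L2_inner M0 (fst u) v" if "fst u \<in> H1 I" "v \<in> H1 I" for v
    using L2_inner_lc_left[OF f H1_L2[OF that(1)] H1_L2[OF that(2)], of "-1"] by (simp add: fun_diff_def)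
  have d: "(u, f - u) \<in> A_zero lm lp \<gamma> V0 \<longleftrightarrow> fst u \<in> H1 I \<and> f - u \<in> H_zero lm lp \<and>
     (\<forall>v\<in>H1 I. \<forall>b. form_zero lm lp \<gamma> V0 u (v, b) = ip_zero lm lp (f - u) (v, b))"
    unfolding A_zero_def form_operator_def by (cases u) auto
  show ?thesis
  proof
    assume "(u, f - u) \<in> A_zero lm lp \<gamma> V0"
    then have u: "fst u \<in> H1 I" and e: "\<And>v b. v \<in> H1 I \<Longrightarrow> form_zero lm lp \<gamma> V0 u (v, b) = ip_zero lm lp (f - u) (v, b)"
      unfolding d by auto
    have e': "form (fst u) v = L2_inner M0 (fst f) v - L2_inner M0 (fst u) v + (snd f - snd u) * cnj b" if "v \<in> H1 I" for v b
      using e[OF that, of b] form_zero_eq[OF u that, of "snd u" b] by (simp add: ip_zero_def ip[OF u that])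
    \<comment> \<open>The left side of \<open>e'\<close> is independent of b; comparing b = 0 with b
      = 1 isolates the scalar equation.\<close>
    have "snd f - snd u = 0" using e'[OF u, of 0] e'[OF u, of 1] by simp
    then show "fst u \<in> H1 I \<and> snd u = snd f \<and> (\<forall>v\<in>H1 I. form1 (fst u) v = L2_inner M0 (fst f) v)"
      using u e'[of _ 0] by (simp add: form1_def)
  next
    assume a: "fst u \<in> H1 I \<and> snd u = snd f \<and> (\<forall>v\<in>H1 I. form1 (fst u) v = L2_inner M0 (fst f) v)"
    have "f - u \<in> H_zero lm lp" using L2_diff[OF f H1_L2, of "fst u"] a
      by (cases f; cases u) (auto simp: H_zero_def fun_diff_def)
    moreover have "form_zero lm lp \<gamma> V0 u (v, b) = ip_zero lm lp (f - u) (v, b)" if v: "v \<in> H1 I" for v b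
    proof -
      have uH: "fst u \<in> H1 I" using a by blast
      have "form_zero lm lp \<gamma> V0 u (v, b) = form (fst u) v"
        using form_zero_eq[OF uH v, of "snd u" b] unfolding prod.collapse .
      also have "\<dots> = L2_inner M0 (fst f) v - L2_inner M0 (fst u) v" using a v unfolding form1_def by (metis add_diff_cancel_right')
      finally show ?thesis using a by (simp add: ip_zero_def ip v)
    qed
    ultimately show "(u, f - u) \<in> A_zero lm lp \<gamma> V0" unfolding d using a by blast
  qed
qed

lemma R_zero_works:
  assumes "f \<in> H_zero lm lp"
  shows "fst (R_zero lm lp \<gamma> V0 f) \<in> H1 I" "snd (R_zero lm lp \<gamma> V0 f) = snd f"
    "v \<in> H1 I \<Longrightarrow> form1 (fst (R_zero lm lp \<gamma> V0 f)) v = L2_inner M0 (fst f) v"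
proof -
  have f: "fst f \<in> L2 M0" using assms by (auto simp: H_zero_def)
  obtain u where u: "u \<in> H1 I" "\<And>v. v \<in> H1 I \<Longrightarrow> form1 u v = L2_inner M0 (fst f) v"
    using resolvent_exists[OF f] by blast
  have "((u, snd f), f - (u, snd f)) \<in> A_zero lm lp \<gamma> V0"
    unfolding A_zero_iff[OF assms] using u by simp
  then have "(R_zero lm lp \<gamma> V0 f, f - R_zero lm lp \<gamma> V0 f) \<in> A_zero lm lp \<gamma> V0"
    unfolding R_zero_def resolvent_def by (rule someI)
  then show "fst (R_zero lm lp \<gamma> V0 f) \<in> H1 I" "snd (R_zero lm lp \<gamma> V0 f) = snd f"
    "v \<in> H1 I \<Longrightarrow> form1 (fst (R_zero lm lp \<gamma> V0 f)) v = L2_inner M0 (fst f) v"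
    unfolding A_zero_iff[OF assms] by auto
qed

text \<open>The derivative of a solution is the sum of a continuous function and the jump \<open>\<gamma> u(0)\<close>
  at the origin; this is where the delta interaction becomes visible.\<close>

lemma solution_derivative:
  assumes f: "f \<in> L2 M0" and u: "u \<in> H1 I" and eq: "\<And>v. v \<in> H1 I \<Longrightarrow> form1 u v = L2_inner M0 f v"
    and Q: "brep I (\<lambda>x. (complex_of_real (V0 x) * u x + u x) + (-1) * f x) Q"
  obtains c where "AE x in lborel. x \<in> I \<longrightarrow>
    D0 u x = c + prim Q 0 x + complex_of_real (indicator {0..} x) * (complex_of_real \<gamma> * point_value I u 0)"
proof -
  have b: "(1::real) \<in> Basis" by simp
  define \<tau> where "\<tau> = complex_of_real \<gamma> * point_value I u 0"
  obtain P where P: "brep I (D0 u) P" using brep_ex[OF I_borel weak_deriv_works(1)[OF u b]] by blast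
  note PB = brepD(1)[OF P] and PL = brepD(2)[OF P] and QB = brepD(1)[OF Q] and QL = brepD(2)[OF Q]
  have Vu: "(\<lambda>x. complex_of_real (V0 x) * u x) \<in> L2 M0" by (rule V_mult_L2[OF H1_L2[OF u]])
  \<comment> \<open>In the sense of distributions this is P' = Q + \<tau> times the point mass at 0.
    The form is antilinear in its second argument, hence it is tested with the conjugate of
    \<phi>.\<close>
  have weak: "(LINT x|lborel. P x * frechet_derivative \<phi> (at x) 1) = - (LINT x|lborel. Q x * \<phi> x) - \<tau> * \<phi> 0"
    if \<phi>: "\<phi> \<in> test_functions I" for \<phi>
  proof -
    let ?\<psi> = "\<lambda>x. cnj (\<phi> x)"
    note t = test_cnj[OF \<phi>]
    note \<psi>H = test_H1(1)[OF I_open t]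
    have pv: "point_value I ?\<psi> 0 = cnj (\<phi> 0)"
      by (rule point_value_eq[OF I_open test_continuous[OF t] _ I_0]) simp
    have D\<psi>: "AE x in M0. D0 ?\<psi> x = cnj (frechet_derivative \<phi> (at x) 1)"
      using weak_deriv_AE(2)[OF I_open test_L2[OF test_dv[OF t] I_borel] test_H1(2)[OF I_open t]]
      by (simp add: test_deriv_cnj[OF \<phi>])
    have dL: "(\<lambda>x. cnj (frechet_derivative \<phi> (at x) 1)) \<in> L2 M0" by (rule L2_cnj[OF test_L2[OF test_dv[OF \<phi>] I_borel]])
    have "L2_inner M0 (D0 u) (D0 ?\<psi>) = L2_inner M0 (D0 u) (\<lambda>x. cnj (frechet_derivative \<phi> (at x) 1))"
      by (rule L2_inner_cong_AE)
        (use weak_deriv_works(1)[OF u b] weak_deriv_works(1)[OF \<psi>H b] dL D\<psi> in \<open>auto intro: L2_measurable\<close>)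
    also have "\<dots> = (LINT x|M0. D0 u x * frechet_derivative \<phi> (at x) 1)" by (simp add: L2_inner_def)
    also have "\<dots> = (LINT x|lborel. P x * frechet_derivative \<phi> (at x) 1)"
      by (rule brep_integral[OF P I_borel test_borel[OF test_dv[OF \<phi>]]])
    finally have 1: "L2_inner M0 (D0 u) (D0 ?\<psi>) = (LINT x|lborel. P x * frechet_derivative \<phi> (at x) 1)" .
    have \<psi>L: "?\<psi> \<in> L2 M0" by (rule H1_L2[OF \<psi>H])
    have "L2_inner M0 (\<lambda>x. (complex_of_real (V0 x) * u x + u x) + (-1) * f x) ?\<psi>
      = L2_inner M0 (\<lambda>x. complex_of_real (V0 x) * u x) ?\<psi> + L2_inner M0 u ?\<psi> - L2_inner M0 f ?\<psi>"
      using L2_inner_lc_left[OF L2_add[OF Vu H1_L2[OF u]] f \<psi>L, of "-1"] L2_inner_lc_left[OF Vu H1_L2[OF u] \<psi>L, of 1] by simp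
    moreover have "L2_inner M0 (\<lambda>x. (complex_of_real (V0 x) * u x + u x) + (-1) * f x) ?\<psi> = (LINT x|lborel. Q x * \<phi> x)"
      using brep_integral[OF Q I_borel test_borel[OF \<phi>]] by (simp add: L2_inner_def)
    ultimately have 2: "L2_inner M0 (\<lambda>x. complex_of_real (V0 x) * u x) ?\<psi> + L2_inner M0 u ?\<psi> - L2_inner M0 f ?\<psi> = (LINT x|lborel. Q x * \<phi> x)" by simp
    have "form1 u ?\<psi> = L2_inner M0 f ?\<psi>" by (rule eq[OF \<psi>H])
    then have 3: "L2_inner M0 (D0 u) (D0 ?\<psi>) + L2_inner M0 (\<lambda>x. complex_of_real (V0 x) * u x) ?\<psi> + \<tau> * \<phi> 0 + L2_inner M0 u ?\<psi> = L2_inner M0 f ?\<psi>"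
      by (simp add: form1_def form_def pv \<tau>_def)
    show ?thesis unfolding 1[symmetric] 2[symmetric] 3[symmetric] by simp
  qed
  have pc: "continuous_on UNIV (prim Q 0)" by (rule prim_continuous[OF QL])
  \<comment> \<open>Subtracting the primitive of Q and a step of height \<tau> removes both parts of
    the distributional derivative of P, and a constant remains.\<close>
  have "\<exists>c. AE x in lborel. x \<in> I \<longrightarrow> P x - prim Q 0 x - complex_of_real (indicator {0..} x) * \<tau> = c"
  proof (rule du_Bois_Reymond[OF I_open I_interval I_0])
    show "(\<lambda>x. P x - prim Q 0 x - complex_of_real (indicator {0..} x) * \<tau>) \<in> borel_measurable borel"
      using PB borel_measurable_continuous_onI[OF pc] by simp
    show "integrable lborel (\<lambda>x. indicator {a..b} x *\<^sub>R (P x - prim Q 0 x - complex_of_real (indicator {0..} x) * \<tau>))" for a b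
    proof -
      have "integrable lborel (\<lambda>x. indicator ({a..b} \<inter> {0..}) x *\<^sub>R \<tau>)"
        by (intro integrable_scaleR_left) (use emeasure_compact_finite[of "{a..b} \<inter> {0..}"] in \<open>simp add: compact_Int_closed\<close>)
      moreover have "indicator {a..b} x *\<^sub>R (complex_of_real (indicator {0..} x) * \<tau>) = indicator ({a..b} \<inter> {0..}) x *\<^sub>R \<tau>" for x
        by (auto simp: indicator_def)
      ultimately have "integrable lborel (\<lambda>x. indicator {a..b} x *\<^sub>R (complex_of_real (indicator {0..} x) * \<tau>))" by simp
      then show ?thesis unfolding scaleR_diff_right
        by (intro Bochner_Integration.integrable_diff[OF Bochner_Integration.integrable_diff[OF L2_Icc_integrable[OF PL]
              borel_integrable_compact[OF compact_Icc continuous_on_subset[OF pc]]]]) auto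
    qed
    fix \<psi> assume \<psi>: "\<psi> \<in> test_functions I"
    let ?d = "\<lambda>x. frechet_derivative \<psi> (at x) 1"
    note d = test_dv[OF \<psi>]
    have i1: "integrable lborel (\<lambda>x. P x * ?d x)" by (rule L2_mult_integrable[OF PL test_L2_lborel[OF d]])
    have i2: "integrable lborel (\<lambda>x. prim Q 0 x * ?d x)" by (rule continuous_test_integrable[OF pc d])
    have "integrable lborel ?d" using continuous_test_integrable[OF continuous_on_const[of UNIV 1] d] by simp
    then have i3: "integrable lborel (\<lambda>x. indicator {0..} x *\<^sub>R ?d x)" by (intro integrable_mult_indicator) auto
    have "(LINT x|lborel. (P x - prim Q 0 x - complex_of_real (indicator {0..} x) * \<tau>) * ?d x)
       = (LINT x|lborel. P x * ?d x - prim Q 0 x * ?d x - \<tau> * (indicator {0..} x *\<^sub>R ?d x))"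
      by (simp add: algebra_simps scaleR_conv_of_real)
    also have "\<dots> = (LINT x|lborel. P x * ?d x) - (LINT x|lborel. prim Q 0 x * ?d x) - \<tau> * (LINT x|lborel. indicator {0..} x *\<^sub>R ?d x)"
      unfolding Bochner_Integration.integral_diff[OF Bochner_Integration.integrable_diff[OF i1 i2] integrable_mult_right[OF i3]]
        Bochner_Integration.integral_diff[OF i1 i2] integral_mult_right_zero ..
    also have "\<dots> = 0"
      unfolding weak[OF \<psi>] prim_by_parts[OF QL QB \<psi>] test_half_line[OF \<psi>] by (simp add: algebra_simps)
    finally show "(LINT x|lborel. (P x - prim Q 0 x - complex_of_real (indicator {0..} x) * \<tau>) * ?d x) = 0" .
  qed blast
  then obtain c where c: "AE x in lborel. x \<in> I \<longrightarrow> P x - prim Q 0 x - complex_of_real (indicator {0..} x) * \<tau> = c" by blast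
  have "AE x in lborel. x \<in> I \<longrightarrow> D0 u x = c + prim Q 0 x + complex_of_real (indicator {0..} x) * \<tau>"
    using c brepD(4)[OF P] by eventually_elim (auto simp: algebra_simps)
  then show ?thesis by (intro that) (simp add: \<tau>_def)
qed

text \<open>Three squares with factor 3 each: the value of the continuous part at -\<delta>, its
  oscillation, and the jump. The number 4 C^2 + 6 bounds the square of the norm of V u + u - f
  relative to f; the arithmetic gives 12 in place of 18, which is rounded up.\<close>

definition deriv_const :: real where
  "deriv_const = 6 / \<delta> + 18 * \<delta> * (4 * C\<^sup>2 + 6) + 3 * \<gamma>"

text \<open>Up to the jump, the derivative is Hoelder continuous of order 1/2, because V u + u - f
  is in L2. This pointwise bound is what makes integrals of the derivative over a passage of tiny
  width small.\<close>

lemma solution_derivative_bound: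
  assumes f: "f \<in> L2 M0" and u: "u \<in> H1 I" and eq: "\<And>v. v \<in> H1 I \<Longrightarrow> form1 u v = L2_inner M0 f v"
  shows "AE x in lborel. x \<in> {-\<delta><..<\<delta>} \<longrightarrow> (cmod (D0 u x))\<^sup>2 \<le> deriv_const * sqn M0 f"
proof -
  have b: "(1::real) \<in> Basis" by simp
  define F where "F = sqn M0 f"
  have F0: "0 \<le> F" by (simp add: F_def)
  have en: "sqn M0 u + sqn M0 (D0 u) + \<gamma> * (cmod (point_value I u 0))\<^sup>2 \<le> F"
    using energy_estimate[OF f u eq[OF u]] by (simp add: energy_def F_def)
  have pv0: "0 \<le> \<gamma> * (cmod (point_value I u 0))\<^sup>2" using \<gamma> by simp
  have su: "sqn M0 u \<le> F" and sd: "sqn M0 (D0 u) \<le> F" and sT: "\<gamma> * (cmod (point_value I u 0))\<^sup>2 \<le> F"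
    using en pv0 sqn_nonneg[of M0 u] sqn_nonneg[of M0 "D0 u"] by linarith+
  have Vb: "AE x in M0. \<bar>V0 x\<bar> \<le> C" using V0_bounds by eventually_elim auto
  have Vu: "(\<lambda>x. complex_of_real (V0 x) * u x) \<in> L2 M0" by (rule V_mult_L2[OF H1_L2[OF u]])
  have qL: "(\<lambda>x. (complex_of_real (V0 x) * u x + u x) + (-1) * f x) \<in> L2 M0"
    by (intro L2_add L2_cmult Vu H1_L2[OF u] f)
  obtain Q where Q: "brep I (\<lambda>x. (complex_of_real (V0 x) * u x + u x) + (-1) * f x) Q" using brep_ex[OF I_borel qL] by blast
  have "sqn M0 (\<lambda>x. (complex_of_real (V0 x) * u x + u x) + (-1) * f x)
      \<le> 2 * sqn M0 (\<lambda>x. complex_of_real (V0 x) * u x + u x) + 2 * sqn M0 (\<lambda>x. (-1) * f x)"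
    by (rule sqn_lc_le[OF L2_add[OF Vu H1_L2[OF u]] L2_cmult[OF f]])
  also have "sqn M0 (\<lambda>x. (-1) * f x) = F" by (simp add: sqn_def F_def)
  also have "2 * sqn M0 (\<lambda>x. complex_of_real (V0 x) * u x + u x) + 2 * F \<le> 2 * (2 * (C\<^sup>2 * F) + 2 * F) + 2 * F"
  proof (intro add_right_mono mult_left_mono)
    have "sqn M0 (\<lambda>x. complex_of_real (V0 x) * u x + u x) \<le> 2 * sqn M0 (\<lambda>x. complex_of_real (V0 x) * u x) + 2 * sqn M0 u"
      by (rule sqn_lc_le[OF Vu H1_L2[OF u]])
    also have "\<dots> \<le> 2 * (C\<^sup>2 * F) + 2 * F"
      by (intro add_mono mult_left_mono su order_trans[OF sqn_Linf_mult[OF V0_measurable Vb H1_L2[OF u]]]) simp_all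
    finally show "sqn M0 (\<lambda>x. complex_of_real (V0 x) * u x + u x) \<le> 2 * (C\<^sup>2 * F) + 2 * F" .
  qed simp
  finally have sq: "sqn lborel Q \<le> (4 * C\<^sup>2 + 6) * F" unfolding brep_sqn[OF Q I_borel] by (simp add: algebra_simps)
  define K where "K = (4 * C\<^sup>2 + 6) * F"
  have K0: "0 \<le> K" using F0 by (simp add: K_def)
  obtain c where c: "AE x in lborel. x \<in> I \<longrightarrow>
    D0 u x = c + prim Q 0 x + complex_of_real (indicator {0..} x) * (complex_of_real \<gamma> * point_value I u 0)"
    using solution_derivative[OF f u eq Q] by blast
  define h where "h x = c + prim Q 0 x" for x
  have hH: "cmod (h y - h x) \<le> sqrt \<bar>y - x\<bar> * sqrt K" for x y
  proof -
    have "cmod (h y - h x) \<le> sqrt \<bar>y - x\<bar> * sqrt (sqn lborel Q)"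
      using prim_Hoelder[OF brepD(2)[OF Q], of 0 y x] by (simp add: h_def)
    also have "\<dots> \<le> sqrt \<bar>y - x\<bar> * sqrt K" using sq by (intro mult_left_mono) (auto simp: K_def)
    finally show ?thesis .
  qed
  obtain P where P: "brep I (D0 u) P" using brep_ex[OF I_borel weak_deriv_works(1)[OF u b]] by blast
  \<comment> \<open>On (-\<delta>, 0) the step has not yet occurred, so D0 u coincides with the
    continuous function \<open>h\<close>, and averaging to the right of -\<delta> controls
    \<open>h (-\<delta>)\<close>.\<close>
  have "(cmod (h (-\<delta>)))\<^sup>2 \<le> 2 / \<delta> * sqn lborel P + 2 * \<delta> * K"
  proof (rule trace_bound[OF \<delta> brepD(2,1)[OF P] _ K0])
    show "cmod (h (- \<delta>) - h y) \<le> sqrt \<delta> * sqrt K" if "y \<in> {- \<delta>..- \<delta> + \<delta>}" for y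
    proof -
      have "sqrt \<bar>- \<delta> - y\<bar> * sqrt K \<le> sqrt \<delta> * sqrt K" using that K0 by (intro mult_right_mono) auto
      then show ?thesis using hH[of "-\<delta>" y] by linarith
    qed
    show "AE x in lborel. x \<in> {- \<delta><..<- \<delta> + \<delta>} \<longrightarrow> P x = h x"
      using c brepD(4)[OF P]
    proof eventually_elim
      case (elim x)
      show ?case
      proof
        assume x: "x \<in> {- \<delta><..<- \<delta> + \<delta>}"
        then have "x \<in> I" using \<delta>_sub \<delta> by auto
        then show "P x = h x" using elim x by (simp add: h_def)
      qed
    qed
  qed
  also have "sqn lborel P \<le> F" using sd brep_sqn[OF P I_borel] by simp
  finally have h0: "(cmod (h (-\<delta>)))\<^sup>2 \<le> 2 / \<delta> * F + 2 * \<delta> * K" using \<delta> by (simp add: mult_left_mono divide_right_mono)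
  have sT': "(cmod (complex_of_real \<gamma> * point_value I u 0))\<^sup>2 \<le> \<gamma> * F"
  proof -
    have "(cmod (complex_of_real \<gamma> * point_value I u 0))\<^sup>2 = \<gamma> * (\<gamma> * (cmod (point_value I u 0))\<^sup>2)"
      using \<gamma> by (simp add: norm_mult power_mult_distrib power2_eq_square)
    also have "\<dots> \<le> \<gamma> * F" using \<gamma> sT by (intro mult_left_mono) auto
    finally show ?thesis .
  qed
  show ?thesis using c
  proof eventually_elim
    case (elim x)
    show ?case
    proof
      assume x: "x \<in> {-\<delta><..<\<delta>}"
      then have "x \<in> I" using \<delta>_sub by auto
      let ?j = "complex_of_real (indicator {0..} x) * (complex_of_real \<gamma> * point_value I u 0)"
      have D: "D0 u x = h (-\<delta>) + (h x - h (-\<delta>)) + ?j" using elim \<open>x \<in> I\<close> by (simp add: h_def)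
      have "cmod (h x - h (-\<delta>)) \<le> sqrt (2 * \<delta>) * sqrt K"
      proof -
        have "sqrt \<bar>x - - \<delta>\<bar> * sqrt K \<le> sqrt (2 * \<delta>) * sqrt K" using x K0 by (intro mult_right_mono) auto
        then show ?thesis using hH[of x "-\<delta>"] by linarith
      qed
      then have h1: "(cmod (h x - h (-\<delta>)))\<^sup>2 \<le> 2 * \<delta> * K"
        using power_mono[of "cmod (h x - h (-\<delta>))" "sqrt (2 * \<delta>) * sqrt K" 2] \<delta> K0 by (simp add: power_mult_distrib)
      have j: "(cmod ?j)\<^sup>2 \<le> \<gamma> * F" using sT' F0 \<gamma> by (cases "x \<ge> 0") auto
      have "(cmod (D0 u x))\<^sup>2 \<le> (cmod (h (-\<delta>)) + cmod (h x - h (-\<delta>)) + cmod ?j)\<^sup>2"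
        unfolding D by (intro power_mono order_trans[OF norm_triangle_ineq] add_right_mono norm_triangle_ineq) auto
      also have "\<dots> \<le> 3 * (cmod (h (-\<delta>)))\<^sup>2 + 3 * (cmod (h x - h (-\<delta>)))\<^sup>2 + 3 * (cmod ?j)\<^sup>2"
      proof -
        have "(a + b + c)\<^sup>2 \<le> 3 * a\<^sup>2 + 3 * b\<^sup>2 + 3 * c\<^sup>2" for a b c :: real
          using sum_squares_bound[of a b] sum_squares_bound[of b c] sum_squares_bound[of a c]
          by (simp add: power2_eq_square algebra_simps)
        then show ?thesis .
      qed
      also have "\<dots> \<le> 3 * (2 / \<delta> * F + 2 * \<delta> * K) + 3 * (2 * \<delta> * K) + 3 * (\<gamma> * F)"
        by (intro add_mono mult_left_mono h0 h1 j) simp_all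
      also have "\<dots> = (6 / \<delta> + 12 * \<delta> * (4 * C\<^sup>2 + 6) + 3 * \<gamma>) * F" by (simp add: K_def algebra_simps)
      also have "\<dots> \<le> deriv_const * F"
        using F0 \<delta> by (intro mult_right_mono) (auto simp: deriv_const_def intro!: mult_right_mono)
      finally show "(cmod (D0 u x))\<^sup>2 \<le> deriv_const * sqn M0 f" by (simp add: F_def)
    qed
  qed
qed

end

subsection \<open>Marginals and averages over rectangles\<close>

lemma AE_fst_plane:
  assumes "AE s in lborel. P s" shows "AE x in (lborel :: (real \<times> real) measure). P (fst x)"
proof -
  obtain N where N: "{s \<in> space lborel. \<not> P s} \<subseteq> N" "emeasure lborel N = 0" "N \<in> sets lborel"
    using AE_E[OF assms] by blast
  have "N \<times> UNIV \<in> null_sets (lborel :: (real \<times> real) measure)"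
  proof (rule null_setsI)
    have "emeasure (lborel \<Otimes>\<^sub>M lborel) (N \<times> (UNIV :: real set)) = emeasure lborel N * emeasure lborel (UNIV :: real set)"
      using N by (intro lborel.emeasure_pair_measure_Times) auto
    then show "emeasure (lborel :: (real \<times> real) measure) (N \<times> UNIV) = 0" using N by (simp add: lborel_prod)
    have "N \<times> (UNIV :: real set) \<in> sets (lborel \<Otimes>\<^sub>M lborel)" using N by (intro pair_measureI) auto
    then show "N \<times> UNIV \<in> sets (lborel :: (real \<times> real) measure)" unfolding lborel_prod .
  qed
  from AE_not_in[OF this] show ?thesis by eventually_elim (use N(1) in \<open>auto simp: mem_Times_iff\<close>)
qed

lemma swap_plane:
  fixes f :: "real \<times> real \<Rightarrow> complex"
  assumes "f \<in> borel_measurable borel"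
  shows "(\<lambda>x. f (snd x, fst x)) \<in> borel_measurable borel"
    and "(LINT x|lborel. f (snd x, fst x)) = (LINT x|lborel. f x)"
    and "integrable lborel f \<Longrightarrow> integrable lborel (\<lambda>x. f (snd x, fst x))"
proof -
  have "(\<lambda>x::real\<times>real. (snd x, fst x)) \<in> borel_measurable borel"
    by (auto intro!: borel_measurable_continuous_onI continuous_intros)
  then show "(\<lambda>x. f (snd x, fst x)) \<in> borel_measurable borel" using assms by (rule measurable_compose)
  have "f \<in> borel_measurable (lborel \<Otimes>\<^sub>M lborel)" using assms by (simp add: lborel_prod)
  from lborel_pair.integral_product_swap[OF this] show "(LINT x|lborel. f (snd x, fst x)) = (LINT x|lborel. f x)"
    by (simp add: lborel_prod case_prod_unfold)
  assume "integrable lborel f"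
  then have "integrable (lborel \<Otimes>\<^sub>M lborel) f" by (simp add: lborel_prod)
  from lborel_pair.integrable_product_swap[OF this] show "integrable lborel (\<lambda>x. f (snd x, fst x))"
    by (simp add: lborel_prod case_prod_unfold)
qed

lemma Fubini_plane_real:
  fixes f :: "real \<times> real \<Rightarrow> real"
  assumes "integrable lborel f"
  shows "AE s in lborel. integrable lborel (\<lambda>t. f (s, t))"
    and "integrable lborel (\<lambda>s. LINT t|lborel. f (s, t))"
    and "(LINT x|lborel. f x) = (LINT s|lborel. LINT t|lborel. f (s, t))"
proof -
  have f: "integrable (lborel \<Otimes>\<^sub>M lborel) f" using assms by (simp add: lborel_prod)
  show "AE s in lborel. integrable lborel (\<lambda>t. f (s, t))"
    "integrable lborel (\<lambda>s. LINT t|lborel. f (s, t))"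
    "(LINT x|lborel. f x) = (LINT s|lborel. LINT t|lborel. f (s, t))"
    using lborel_pair.AE_integrable_fst'[OF f] lborel_pair.integrable_fst'[OF f] lborel_pair.integral_fst'[OF f]
    by (simp_all add: lborel_prod)
qed

lemma tensor_L2:
  fixes F G :: "real \<Rightarrow> complex"
  assumes "F \<in> L2 lborel" "G \<in> L2 lborel"
  shows "(\<lambda>x. F (fst x) * G (snd x)) \<in> L2 lborel"
proof (rule L2I)
  have m: "F \<in> borel_measurable borel" "G \<in> borel_measurable borel" using L2_measurable[OF assms(1)] L2_measurable[OF assms(2)] by auto
  show "(\<lambda>x. F (fst x) * G (snd x)) \<in> borel_measurable lborel" using measurable_plane[OF m] by simp
  have "integrable lborel (\<lambda>x. complex_of_real ((cmod (F (fst x)))\<^sup>2) * complex_of_real ((cmod (G (snd x)))\<^sup>2))"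
    by (rule tensor_integrable[of "\<lambda>x. complex_of_real ((cmod (F x))\<^sup>2)" "\<lambda>x. complex_of_real ((cmod (G x))\<^sup>2)"])
       (intro integrable_of_real L2_integrable assms)+
  then have "integrable lborel (\<lambda>x. Re (complex_of_real ((cmod (F (fst x)))\<^sup>2) * complex_of_real ((cmod (G (snd x)))\<^sup>2)))"
    by (rule integrable_Re)
  then show "integrable lborel (\<lambda>x. (cmod (F (fst x) * G (snd x)))\<^sup>2)"
    by (simp add: norm_mult power_mult_distrib del: of_real_power flip: of_real_mult)
qed

lemma indicator_L2:
  fixes A :: "'a::euclidean_space set"
  assumes "A \<in> sets borel" "emeasure lborel A < \<infinity>"
  shows "(\<lambda>x. complex_of_real (indicator A x)) \<in> L2 lborel"
    and "sqn lborel (\<lambda>x. complex_of_real (indicator A x)) = measure lborel A"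
proof -
  have eq: "(\<lambda>t. (cmod (complex_of_real (indicator A t)))\<^sup>2) = indicator A" by (auto simp: indicator_def)
  show "(\<lambda>x. complex_of_real (indicator A x)) \<in> L2 lborel"
  proof (rule L2I)
    show "integrable lborel (\<lambda>t. (cmod (complex_of_real (indicator A t)))\<^sup>2)" unfolding eq using assms by simp
  qed (use assms(1) in simp)
  show "sqn lborel (\<lambda>x. complex_of_real (indicator A x)) = measure lborel A" unfolding sqn_def eq by simp
qed

lemma indicator_Ioo_L2: "(\<lambda>x. complex_of_real (indicator {a<..<b::real} x)) \<in> L2 lborel"
proof (rule indicator_L2(1))
  show "emeasure lborel {a<..<b} < \<infinity>" by (cases "a \<le> b") auto
qed simp

lemma L2_indicator_mult:
  fixes W :: "'a::euclidean_space \<Rightarrow> complex"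
  assumes "W \<in> L2 lborel" "A \<in> sets borel"
  shows "(\<lambda>x. indicator A x *\<^sub>R W x) \<in> L2 lborel" "sqn lborel (\<lambda>x. indicator A x *\<^sub>R W x) \<le> sqn lborel W"
proof -
  have i: "integrable lborel (\<lambda>x. (cmod (indicator A x *\<^sub>R W x))\<^sup>2)"
  proof (rule Bochner_Integration.integrable_bound[OF L2_integrable[OF assms(1)]])
    show "(\<lambda>x. (cmod (indicator A x *\<^sub>R W x))\<^sup>2) \<in> borel_measurable lborel" using L2_measurable[OF assms(1)] assms(2) by simp
    show "AE x in lborel. norm ((cmod (indicator A x *\<^sub>R W x))\<^sup>2) \<le> norm ((cmod (W x))\<^sup>2)"
      by (intro AE_I2) (auto simp: indicator_def)
  qed
  then show "(\<lambda>x. indicator A x *\<^sub>R W x) \<in> L2 lborel" using L2_measurable[OF assms(1)] assms(2) by (intro L2I) auto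
  show "sqn lborel (\<lambda>x. indicator A x *\<^sub>R W x) \<le> sqn lborel W"
    unfolding sqn_def by (intro integral_mono i L2_integrable assms) (auto simp: indicator_def)
qed

text \<open>Marginal of W over the strip with second coordinate in (k1, k2). It is left without
  normalisation; for (-\<epsilon>, 0) and up to the factor \<open>c1\<close> it is the first
  component of \<open>Jt\<close>.\<close>

definition mg :: "real \<Rightarrow> real \<Rightarrow> (real \<times> real \<Rightarrow> complex) \<Rightarrow> real \<Rightarrow> complex" where
  "mg k1 k2 W s = (LINT t|lborel. indicator {k1<..<k2} t *\<^sub>R W (s, t))"

lemma L2_sections:
  fixes W :: "real \<times> real \<Rightarrow> complex"
  assumes "W \<in> L2 lborel"
  shows "AE s in lborel. (\<lambda>t. W (s, t)) \<in> L2 lborel"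
proof -
  have m: "W \<in> borel_measurable borel" using L2_measurable[OF assms] by simp
  show ?thesis using Fubini_plane_real(1)[OF L2_integrable[OF assms]]
    by eventually_elim (rule L2I, use section_measurable[OF m] in auto)
qed

lemma mg_measurable:
  assumes "W \<in> borel_measurable borel" shows "mg k1 k2 W \<in> borel_measurable borel"
proof -
  have "(\<lambda>x. indicator {k1<..<k2} (snd x) *\<^sub>R W x) \<in> borel_measurable borel"
    using measurable_plane(2)[where f = "indicator {k1<..<k2} :: real \<Rightarrow> real" and g = "indicator {k1<..<k2} :: real \<Rightarrow> real"] assms
    by (intro borel_measurable_scaleR) simp_all
  then have "(\<lambda>(s, t). indicator {k1<..<k2} t *\<^sub>R W (s, t)) \<in> borel_measurable (borel \<Otimes>\<^sub>M lborel)"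
    by (simp add: case_prod_unfold borel_prod[symmetric] cong: measurable_cong_sets)
  then have "(\<lambda>s. LINT t|lborel. indicator {k1<..<k2} t *\<^sub>R W (s, t)) \<in> borel_measurable borel"
    by (intro lborel.borel_measurable_lebesgue_integral) simp
  then show ?thesis by (simp add: mg_def[abs_def])
qed

lemma mg_pointwise:
  assumes "(\<lambda>t. W (s, t)) \<in> L2 lborel" "k1 \<le> k2"
  shows "(cmod (mg k1 k2 W s))\<^sup>2 \<le> (k2 - k1) * (LINT t|lborel. (cmod (W (s, t)))\<^sup>2)"
proof -
  have "cmod (mg k1 k2 W s) \<le> sqrt (k2 - k1) * sqrt (sqn lborel (\<lambda>t. W (s, t)))"
    using L2_Cauchy_Schwarz[OF indicator_Ioo_L2 assms(1), of k1 k2] indicator_L2(2)[of "{k1<..<k2}"] assms(2)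
    by (simp add: mg_def scaleR_conv_of_real)
  then have "(cmod (mg k1 k2 W s))\<^sup>2 \<le> (sqrt (k2 - k1) * sqrt (sqn lborel (\<lambda>t. W (s, t))))\<^sup>2"
    by (intro power_mono) auto
  then show ?thesis using assms(2) by (simp add: power_mult_distrib sqn_def)
qed

lemma mg_L2:
  assumes "W \<in> L2 lborel" "k1 \<le> k2"
  shows "mg k1 k2 W \<in> L2 lborel" "sqn lborel (mg k1 k2 W) \<le> (k2 - k1) * sqn lborel W"
proof -
  have m: "W \<in> borel_measurable borel" using L2_measurable[OF assms(1)] by simp
  note F = Fubini_plane_real[OF L2_integrable[OF assms(1)]]
  have i: "integrable lborel (\<lambda>s. (k2 - k1) * (LINT t|lborel. (cmod (W (s, t)))\<^sup>2))" using F(2) by simp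
  have ae: "AE s in lborel. (cmod (mg k1 k2 W s))\<^sup>2 \<le> (k2 - k1) * (LINT t|lborel. (cmod (W (s, t)))\<^sup>2)"
    using L2_sections[OF assms(1)] by eventually_elim (rule mg_pointwise[OF _ assms(2)])
  have "integrable lborel (\<lambda>s. (cmod (mg k1 k2 W s))\<^sup>2)"
  proof (rule Bochner_Integration.integrable_bound[OF i])
    show "AE s in lborel. norm ((cmod (mg k1 k2 W s))\<^sup>2) \<le> norm ((k2 - k1) * (LINT t|lborel. (cmod (W (s, t)))\<^sup>2))"
      using ae by eventually_elim auto
  qed (use mg_measurable[OF m] in simp)
  then show L: "mg k1 k2 W \<in> L2 lborel" using mg_measurable[OF m] by (intro L2I) auto
  have "sqn lborel (mg k1 k2 W) \<le> (LINT s|lborel. (k2 - k1) * (LINT t|lborel. (cmod (W (s, t)))\<^sup>2))"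
    unfolding sqn_def by (rule integral_mono_AE[OF L2_integrable[OF L] i ae])
  also have "\<dots> = (k2 - k1) * sqn lborel W" unfolding sqn_def F(3) by simp
  finally show "sqn lborel (mg k1 k2 W) \<le> (k2 - k1) * sqn lborel W" .
qed

lemma mg_integral:
  assumes "W \<in> L2 lborel" "F \<in> L2 lborel"
  shows "(LINT x|lborel. F (fst x) * complex_of_real (indicator {k1<..<k2} (snd x)) * W x) = (LINT s|lborel. F s * mg k1 k2 W s)"
    and "integrable lborel (\<lambda>x. F (fst x) * complex_of_real (indicator {k1<..<k2} (snd x)) * W x)"
proof -
  show i: "integrable lborel (\<lambda>x. F (fst x) * complex_of_real (indicator {k1<..<k2} (snd x)) * W x)"
    by (rule L2_mult_integrable[OF tensor_L2[OF assms(2) indicator_Ioo_L2] assms(1)])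
  have "(LINT t|lborel. F s * complex_of_real (indicator {k1<..<k2} t) * W (s, t)) = F s * mg k1 k2 W s" for s
    unfolding mg_def by (simp add: scaleR_conv_of_real mult.assoc)
  then show "(LINT x|lborel. F (fst x) * complex_of_real (indicator {k1<..<k2} (snd x)) * W x) = (LINT s|lborel. F s * mg k1 k2 W s)"
    using Fubini_plane(3)[OF i] by simp
qed

text \<open>The differentiation is tangential to the two sides of the rectangle that are parallel to
  the first axis, so cut-offs in the second variable may tend to the indicator function.\<close>

lemma mg_weak_deriv:
  assumes W: "W0 \<in> L2 lborel" "W1 \<in> L2 lborel"
    and d: "\<And>\<phi> \<eta>. \<phi> \<in> test_functions A \<Longrightarrow> \<eta> \<in> test_functions {k1<..<k2} \<Longrightarrow>
      (LINT x|lborel. W0 x * (frechet_derivative \<phi> (at (fst x)) 1 * \<eta> (snd x))) = - (LINT x|lborel. W1 x * (\<phi> (fst x) * \<eta> (snd x)))"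
    and \<phi>: "\<phi> \<in> test_functions A"
  shows "(LINT s|lborel. mg k1 k2 W0 s * frechet_derivative \<phi> (at s) 1) = - (LINT s|lborel. mg k1 k2 W1 s * \<phi> s)"
proof -
  have lim: "(\<lambda>n. LINT x|lborel. W x * (\<psi> (fst x) * bump n k1 k2 (snd x))) \<longlonglongrightarrow> (LINT s|lborel. mg k1 k2 W s * \<psi> s)"
    if W: "W \<in> L2 lborel" and \<psi>: "\<psi> \<in> test_functions A" for W \<psi>
  proof -
    have Wm: "W \<in> borel_measurable borel" using L2_measurable[OF W] by simp
    have pm: "(\<lambda>x::real\<times>real. \<psi> (fst x)) \<in> borel_measurable borel" by (rule measurable_plane(1)[OF test_borel[OF \<psi>] test_borel[OF \<psi>]])
    have bm: "(\<lambda>x::real\<times>real. bump n k1 k2 (snd x)) \<in> borel_measurable borel" for n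
      by (rule measurable_plane(2)[OF test_borel[OF \<psi>] test_borel[OF test_bump[OF order_refl]]])
    have im: "(\<lambda>x::real\<times>real. complex_of_real (indicator {k1<..<k2} (snd x))) \<in> borel_measurable borel"
      by (rule measurable_plane(2)[OF test_borel[OF \<psi>]]) simp
    note i = mg_integral[OF W test_L2_lborel[OF \<psi>], of k1 k2]
    have "(\<lambda>n. LINT x|lborel. W x * (\<psi> (fst x) * bump n k1 k2 (snd x))) \<longlonglongrightarrow>
       (LINT x|lborel. \<psi> (fst x) * complex_of_real (indicator {k1<..<k2} (snd x)) * W x)"
    proof (rule integral_dominated_convergence[where w = "\<lambda>x. norm (\<psi> (fst x) * complex_of_real (indicator {k1<..<k2} (snd x)) * W x)"])
      show "integrable lborel (\<lambda>x. norm (\<psi> (fst x) * complex_of_real (indicator {k1<..<k2} (snd x)) * W x))"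
        by (rule integrable_norm[OF i(2)])
      show "AE x in lborel. (\<lambda>n. W x * (\<psi> (fst x) * bump n k1 k2 (snd x))) \<longlonglongrightarrow> \<psi> (fst x) * complex_of_real (indicator {k1<..<k2} (snd x)) * W x"
      proof (rule AE_I2)
        fix x :: "real \<times> real"
        have "(\<lambda>n. W x * (\<psi> (fst x) * bump n k1 k2 (snd x))) \<longlonglongrightarrow> W x * (\<psi> (fst x) * indicator {k1<..<k2} (snd x))"
          by (intro tendsto_mult tendsto_const bump_tendsto)
        then show "(\<lambda>n. W x * (\<psi> (fst x) * bump n k1 k2 (snd x))) \<longlonglongrightarrow> \<psi> (fst x) * complex_of_real (indicator {k1<..<k2} (snd x)) * W x"
          by (cases "snd x \<in> {k1<..<k2}") (simp_all add: mult_ac)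
      qed
      show "AE x in lborel. norm (W x * (\<psi> (fst x) * bump n k1 k2 (snd x))) \<le> norm (\<psi> (fst x) * complex_of_real (indicator {k1<..<k2} (snd x)) * W x)" for n
      proof (rule AE_I2)
        fix x :: "real \<times> real"
        have "norm (bump n k1 k2 (snd x)) \<le> indicator {k1<..<k2} (snd x)"
          using cmod_bump_le[of n k1 k2 "snd x"] test_outside[OF test_bump[OF order_refl], of "snd x" k1 k2 n]
          by (cases "snd x \<in> {k1<..<k2}") auto
        then have "norm (W x) * norm (\<psi> (fst x)) * norm (bump n k1 k2 (snd x)) \<le> norm (W x) * norm (\<psi> (fst x)) * indicator {k1<..<k2} (snd x)"
          by (intro mult_left_mono) auto
        then show "norm (W x * (\<psi> (fst x) * bump n k1 k2 (snd x))) \<le> norm (\<psi> (fst x) * complex_of_real (indicator {k1<..<k2} (snd x)) * W x)"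
          by (simp add: norm_mult mult_ac)
      qed
    qed (use Wm pm bm im in auto)
    also have "(LINT x|lborel. \<psi> (fst x) * complex_of_real (indicator {k1<..<k2} (snd x)) * W x) = (LINT s|lborel. mg k1 k2 W s * \<psi> s)"
      unfolding i(1) by (simp add: mult.commute)
    finally show ?thesis .
  qed
  have e: "(LINT x|lborel. W0 x * (frechet_derivative \<phi> (at (fst x)) 1 * bump n k1 k2 (snd x)))
     = - (LINT x|lborel. W1 x * (\<phi> (fst x) * bump n k1 k2 (snd x)))" for n
    by (rule d[OF \<phi> test_bump[OF order_refl]])
  show ?thesis
    by (rule LIMSEQ_unique[OF lim[OF W(1) test_dv[OF \<phi>]] tendsto_minus[OF lim[OF W(2) \<phi>], folded e]])
qed

text \<open>The mean over a rectangle, written through the marginal because the estimates are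
  one-dimensional. \<open>avg_plane\<close> gives the form that is symmetric in the two
  variables.\<close>

definition avg :: "real \<Rightarrow> real \<Rightarrow> real \<Rightarrow> real \<Rightarrow> (real \<times> real \<Rightarrow> complex) \<Rightarrow> complex" where
  "avg a1 a2 k1 k2 W = (LINT s|lborel. indicator {a1<..<a2} s *\<^sub>R mg k1 k2 W s) / complex_of_real ((a2 - a1) * (k2 - k1))"

text \<open>A weak derivative in the first variable, tested with products only. This is all that
  marginals require, and it can be stated for functions with exchanged coordinates, where it
  expresses a vertical derivative.\<close>

definition rect_deriv :: "real \<Rightarrow> real \<Rightarrow> real \<Rightarrow> real \<Rightarrow> (real \<times> real \<Rightarrow> complex) \<Rightarrow> (real \<times> real \<Rightarrow> complex) \<Rightarrow> bool" where
  "rect_deriv a1 a2 k1 k2 W0 W1 \<longleftrightarrow> W0 \<in> L2 lborel \<and> W1 \<in> L2 lborel \<and>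
    (\<forall>\<phi>\<in>test_functions {a1<..<a2}. \<forall>\<eta>\<in>test_functions {k1<..<k2}.
      (LINT x|lborel. W0 x * (frechet_derivative \<phi> (at (fst x)) 1 * \<eta> (snd x))) = - (LINT x|lborel. W1 x * (\<phi> (fst x) * \<eta> (snd x))))"

lemma rect_deriv_rep:
  assumes "rect_deriv a1 a2 k1 k2 W0 W1" "a1 < a2" "k1 < k2"
  shows "\<exists>g. continuous_on UNIV g \<and> (AE s in lborel. s \<in> {a1<..<a2} \<longrightarrow> mg k1 k2 W0 s = g s) \<and>
    (\<forall>x y. x \<le> y \<longrightarrow> g y - g x = (LINT t|lborel. indicator {x..y} t *\<^sub>R mg k1 k2 W1 t)) \<and>
    (\<forall>x y. cmod (g y - g x) \<le> sqrt \<bar>y - x\<bar> * sqrt ((k2 - k1) * sqn lborel W1))"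
proof -
  have W: "W0 \<in> L2 lborel" "W1 \<in> L2 lborel" using assms by (auto simp: rect_deriv_def)
  have m: "W0 \<in> borel_measurable borel" "W1 \<in> borel_measurable borel" using L2_measurable[OF W(1)] L2_measurable[OF W(2)] by auto
  have k: "k1 \<le> k2" using assms by simp
  obtain p where p: "p \<in> {a1<..<a2}" using dense[OF assms(2)] by auto
  have d: "(LINT s|lborel. mg k1 k2 W0 s * frechet_derivative \<phi> (at s) 1) = - (LINT s|lborel. mg k1 k2 W1 s * \<phi> s)"
    if "\<phi> \<in> test_functions {a1<..<a2}" for \<phi>
    by (rule mg_weak_deriv[OF W _ that]) (use assms(1) in \<open>auto simp: rect_deriv_def\<close>)
  have iv: "is_interval {a1<..<a2}" by simp
  obtain g where g: "continuous_on UNIV g" "AE s in lborel. s \<in> {a1<..<a2} \<longrightarrow> mg k1 k2 W0 s = g s"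
    "\<And>x y. x \<le> y \<Longrightarrow> g y - g x = (LINT t|lborel. indicator {x..y} t *\<^sub>R mg k1 k2 W1 t)"
    using weak_deriv_primitive[OF open_greaterThanLessThan iv p mg_measurable[OF m(1)] mg_L2(1)[OF W(1) k] mg_measurable[OF m(2)] mg_L2(1)[OF W(2) k] d]
    by blast
  have b: "cmod (g y - g x) \<le> sqrt \<bar>y - x\<bar> * sqrt ((k2 - k1) * sqn lborel W1)" if le: "x \<le> y" for x y
  proof -
    have "cmod (g y - g x) \<le> sqrt (y - x) * sqrt (sqn lborel (mg k1 k2 W1))"
      unfolding g(3)[OF le] by (rule indicator_integral_bound[OF mg_L2(1)[OF W(2) k] le])
    also have "\<dots> \<le> sqrt (y - x) * sqrt ((k2 - k1) * sqn lborel W1)"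
      using le by (intro mult_left_mono real_sqrt_le_mono mg_L2(2)[OF W(2) k]) auto
    finally show ?thesis using le by simp
  qed
  have "cmod (g y - g x) \<le> sqrt \<bar>y - x\<bar> * sqrt ((k2 - k1) * sqn lborel W1)" for x y
    using b[of x y] b[of y x] by (cases "x \<le> y") (auto simp: norm_minus_commute abs_minus_commute)
  then show ?thesis using g by (intro exI[of _ g]) auto
qed

lemma interval_average_bound:
  fixes g :: "real \<Rightarrow> complex"
  assumes "a1 < a2" "continuous_on UNIV g" "\<And>x. x \<in> {a1<..<a2} \<Longrightarrow> cmod (g x - c) \<le> B"
    and ae: "AE s in lborel. s \<in> {a1<..<a2} \<longrightarrow> f s = g s" and f: "f \<in> borel_measurable borel"
  shows "cmod ((LINT s|lborel. indicator {a1<..<a2} s *\<^sub>R f s) / complex_of_real (a2 - a1) - c) \<le> B"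
proof -
  have gm: "g \<in> borel_measurable borel" by (rule borel_measurable_continuous_onI[OF assms(2)])
  have ig: "integrable lborel (\<lambda>s. indicator {a1<..<a2} s *\<^sub>R g s)"
  proof -
    have eq: "(\<lambda>s. indicator {a1<..<a2} s *\<^sub>R g s) = (\<lambda>s. indicator {a1<..<a2} s *\<^sub>R (indicator {a1..a2} s *\<^sub>R g s))"
      by (intro ext) (auto simp: indicator_def)
    show ?thesis unfolding eq
      by (intro integrable_mult_indicator borel_integrable_compact continuous_on_subset[OF assms(2)]) auto
  qed
  have ic: "integrable lborel (\<lambda>s. indicator {a1<..<a2} s *\<^sub>R c)" for c :: "'b::{banach, second_countable_topology}"
    using assms(1) by (intro integrable_scaleR_left) simp
  have e1: "(LINT s|lborel. indicator {a1<..<a2} s *\<^sub>R f s) = (LINT s|lborel. indicator {a1<..<a2} s *\<^sub>R g s)"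
    by (rule integral_cong_AE) (use f gm ae in \<open>auto elim!: eventually_mono simp: indicator_def\<close>)
  have e2: "(LINT s|lborel. indicator {a1<..<a2} s *\<^sub>R c) = complex_of_real (a2 - a1) * c"
    using assms(1) by (simp add: scaleR_conv_of_real)
  have e3: "(LINT s|lborel. indicator {a1<..<a2} s *\<^sub>R (g s - c))
     = (LINT s|lborel. indicator {a1<..<a2} s *\<^sub>R g s) - (LINT s|lborel. indicator {a1<..<a2} s *\<^sub>R c)"
    unfolding scaleR_diff_right by (rule Bochner_Integration.integral_diff[OF ig ic])
  have nz: "complex_of_real (a2 - a1) \<noteq> 0" "cmod (complex_of_real (a2 - a1)) = a2 - a1"
    using assms(1) by (simp_all del: of_real_diff)
  have eq: "(LINT s|lborel. indicator {a1<..<a2} s *\<^sub>R f s) / complex_of_real (a2 - a1) - c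
     = (LINT s|lborel. indicator {a1<..<a2} s *\<^sub>R (g s - c)) / complex_of_real (a2 - a1)"
    unfolding e1 e3 e2 using nz(1) by (simp add: diff_divide_distrib del: of_real_diff)
  have "cmod (LINT s|lborel. indicator {a1<..<a2} s *\<^sub>R (g s - c)) \<le> (LINT s|lborel. indicator {a1<..<a2} s *\<^sub>R B)"
  proof (rule order_trans[OF integral_norm_bound integral_mono])
    show "integrable lborel (\<lambda>s. norm (indicator {a1<..<a2} s *\<^sub>R (g s - c)))"
      unfolding scaleR_diff_right by (rule integrable_norm[OF Bochner_Integration.integrable_diff[OF ig ic]])
    show "norm (indicator {a1<..<a2} s *\<^sub>R (g s - c)) \<le> indicator {a1<..<a2} s *\<^sub>R B" for s
      using assms(3)[of s] by (cases "s \<in> {a1<..<a2}") auto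
  qed (rule ic)
  also have "\<dots> = (a2 - a1) * B" using assms(1) by simp
  finally show ?thesis unfolding eq norm_divide nz(2) using assms(1) by (simp add: pos_divide_le_eq mult.commute)
qed

text \<open>The marginal oscillates by at most (a2 - a1)^(1/2) ((k2 - k1) |W1|^2)^(1/2); division by
  the height k2 - k1 leaves the square root of width over height. A change of the base is thus cheap
  unless the rectangle is flat.\<close>

lemma avg_step:
  assumes r: "rect_deriv a1 a2 k1 k2 W0 W1" and k: "k1 < k2"
    and sub: "a1 \<le> b1" "b1 < b2" "b2 \<le> a2"
  shows "cmod (avg b1 b2 k1 k2 W0 - avg a1 a2 k1 k2 W0) \<le> sqrt ((a2 - a1) / (k2 - k1)) * sqrt (sqn lborel W1)"
proof -
  have a: "a1 < a2" using sub by linarith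
  define B where "B = sqrt (a2 - a1) * sqrt ((k2 - k1) * sqn lborel W1)"
  obtain g where g: "continuous_on UNIV g" "AE s in lborel. s \<in> {a1<..<a2} \<longrightarrow> mg k1 k2 W0 s = g s"
    "\<And>x y. cmod (g y - g x) \<le> sqrt \<bar>y - x\<bar> * sqrt ((k2 - k1) * sqn lborel W1)"
    using rect_deriv_rep[OF r a k] by blast
  have gB: "cmod (g x - g y) \<le> B" if "x \<in> {a1<..<a2}" "y \<in> {a1<..<a2}" for x y
  proof -
    have "sqrt \<bar>x - y\<bar> * sqrt ((k2 - k1) * sqn lborel W1) \<le> B"
      unfolding B_def using that k by (intro mult_right_mono) auto
    then show ?thesis using g(3)[of x y] by linarith
  qed
  have W0: "W0 \<in> borel_measurable borel" using r L2_measurable[of W0 lborel] by (auto simp: rect_deriv_def)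
  note mm = mg_measurable[OF W0, of k1 k2]
  define q where "q = (LINT s|lborel. indicator {b1<..<b2} s *\<^sub>R mg k1 k2 W0 s) / complex_of_real (b2 - b1)"
  \<comment> \<open>Averaging twice: first g over the smaller interval against a fixed g y, then
    over y in the larger interval against the resulting mean \<open>q\<close>.\<close>
  have "cmod (q - g y) \<le> B" if y: "y \<in> {a1<..<a2}" for y
    unfolding q_def
  proof (rule interval_average_bound[OF sub(2) g(1) _ _ mm])
    show "cmod (g x - g y) \<le> B" if "x \<in> {b1<..<b2}" for x using gB[OF _ y] that sub by auto
    show "AE s in lborel. s \<in> {b1<..<b2} \<longrightarrow> mg k1 k2 W0 s = g s" using g(2) by eventually_elim (use sub in auto)
  qed
  then have "cmod ((LINT s|lborel. indicator {a1<..<a2} s *\<^sub>R mg k1 k2 W0 s) / complex_of_real (a2 - a1) - q) \<le> B"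
    by (intro interval_average_bound[OF a g(1) _ g(2) mm]) (simp add: norm_minus_commute)
  then have "cmod (q - (LINT s|lborel. indicator {a1<..<a2} s *\<^sub>R mg k1 k2 W0 s) / complex_of_real (a2 - a1)) / (k2 - k1) \<le> B / (k2 - k1)"
    using k by (intro divide_right_mono) (auto simp: norm_minus_commute)
  moreover have "avg b1 b2 k1 k2 W0 - avg a1 a2 k1 k2 W0 = (q - (LINT s|lborel. indicator {a1<..<a2} s *\<^sub>R mg k1 k2 W0 s) / complex_of_real (a2 - a1)) / complex_of_real (k2 - k1)"
    by (simp add: avg_def q_def diff_divide_distrib)
  moreover have "B / (k2 - k1) = sqrt ((a2 - a1) / (k2 - k1)) * sqrt (sqn lborel W1)"
  proof -
    have "sqrt A * sqrt (r\<^sup>2 * S) / r\<^sup>2 = sqrt (A / r\<^sup>2) * sqrt S" if "r > 0" for A S r :: real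
      using that by (simp add: real_sqrt_mult real_sqrt_divide power2_eq_square field_simps)
    from this[of "sqrt (k2 - k1)" "a2 - a1" "sqn lborel W1"] show ?thesis using k by (simp add: B_def)
  qed
  ultimately show ?thesis using k by (simp add: norm_divide del: of_real_diff)
qed

lemma rect_deriv_sub:
  assumes "rect_deriv a1 a2 k1 k2 W0 W1" "a1 \<le> b1" "b2 \<le> a2" "k1 \<le> l1" "l2 \<le> k2"
  shows "rect_deriv b1 b2 l1 l2 W0 W1"
proof -
  have "{b1<..<b2} \<subseteq> {a1<..<a2}" "{l1<..<l2} \<subseteq> {k1<..<k2}" using assms by auto
  then show ?thesis using assms(1) test_mono unfolding rect_deriv_def by blast
qed

abbreviation "swp W \<equiv> (\<lambda>x. W (snd x, fst x))"

lemma swp_L2: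
  fixes W :: "real \<times> real \<Rightarrow> complex"
  assumes "W \<in> L2 lborel" shows "swp W \<in> L2 lborel" "sqn lborel (swp W) = sqn lborel W"
proof -
  have m: "W \<in> borel_measurable borel" using L2_measurable[OF assms] by simp
  define f where "f x = complex_of_real ((cmod (W x))\<^sup>2)" for x
  have fm: "f \<in> borel_measurable borel" unfolding f_def[abs_def] using m by measurable
  have fi: "integrable lborel f" unfolding f_def[abs_def] by (intro integrable_of_real L2_integrable assms)
  have "integrable lborel (\<lambda>x. Re (f (snd x, fst x)))" by (rule integrable_Re[OF swap_plane(3)[OF fm fi]])
  then have i: "integrable lborel (\<lambda>x. (cmod (swp W x))\<^sup>2)" by (simp add: f_def)
  then show "swp W \<in> L2 lborel" using swap_plane(1)[OF m] by (intro L2I) auto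
  have "complex_of_real (sqn lborel (swp W)) = (LINT x|lborel. f (snd x, fst x))"
    by (simp add: sqn_def f_def del: of_real_power)
  also have "\<dots> = (LINT x|lborel. f x)" by (rule swap_plane(2)[OF fm])
  also have "\<dots> = complex_of_real (sqn lborel W)" by (simp add: sqn_def f_def del: of_real_power)
  finally show "sqn lborel (swp W) = sqn lborel W" using of_real_eq_iff by blast
qed

lemma avg_plane:
  assumes "W \<in> L2 lborel"
  shows "avg a1 a2 k1 k2 W = (LINT x|lborel. complex_of_real (indicator {a1<..<a2} (fst x)) * complex_of_real (indicator {k1<..<k2} (snd x)) * W x)
     / complex_of_real ((a2 - a1) * (k2 - k1))"
  unfolding avg_def mg_integral(1)[OF assms indicator_Ioo_L2] by (simp add: scaleR_conv_of_real)

lemma avg_swap: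
  assumes "W \<in> L2 lborel" shows "avg a1 a2 k1 k2 (swp W) = avg k1 k2 a1 a2 W"
proof -
  have m: "W \<in> borel_measurable borel" using L2_measurable[OF assms] by simp
  let ?f = "\<lambda>x. complex_of_real (indicator {k1<..<k2} (fst x)) * complex_of_real (indicator {a1<..<a2} (snd x)) * W x"
  let ?k = "\<lambda>x::real. complex_of_real (indicator {k1<..<k2} x)" and ?a = "\<lambda>x::real. complex_of_real (indicator {a1<..<a2} x)"
  have "(\<lambda>x::real\<times>real. complex_of_real (indicator {k1<..<k2} (fst x))) \<in> borel_measurable borel"
    "(\<lambda>x::real\<times>real. complex_of_real (indicator {a1<..<a2} (snd x))) \<in> borel_measurable borel"
    using measurable_plane[where f = ?k and g = ?a] by simp_all
  then have fm: "?f \<in> borel_measurable borel" using m by (intro borel_measurable_times)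
  show ?thesis unfolding avg_plane[OF assms] avg_plane[OF swp_L2(1)[OF assms]]
    using swap_plane(2)[OF fm] by (simp add: mult.commute mult.left_commute)
qed

lemma avg_bound:
  assumes "W \<in> L2 lborel" "a1 < a2" "k1 < k2"
  shows "cmod (avg a1 a2 k1 k2 W) \<le> sqrt (sqn lborel W) / sqrt ((a2 - a1) * (k2 - k1))"
proof -
  have k: "k1 \<le> k2" using assms by simp
  have "cmod (LINT s|lborel. complex_of_real (indicator {a1<..<a2} s) * mg k1 k2 W s) \<le> sqrt (a2 - a1) * sqrt (sqn lborel (mg k1 k2 W))"
    using L2_Cauchy_Schwarz[OF indicator_Ioo_L2 mg_L2(1)[OF assms(1) k], of a1 a2] indicator_L2(2)[of "{a1<..<a2}"] assms(2) by simp
  also have "\<dots> \<le> sqrt (a2 - a1) * sqrt ((k2 - k1) * sqn lborel W)"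
    using assms(2) by (intro mult_left_mono real_sqrt_le_mono mg_L2(2)[OF assms(1) k]) auto
  finally have "cmod (LINT s|lborel. indicator {a1<..<a2} s *\<^sub>R mg k1 k2 W s) \<le> sqrt ((a2 - a1) * (k2 - k1)) * sqrt (sqn lborel W)"
    by (simp add: scaleR_conv_of_real real_sqrt_mult)
  then have "cmod (avg a1 a2 k1 k2 W) \<le> sqrt ((a2 - a1) * (k2 - k1)) * sqrt (sqn lborel W) / ((a2 - a1) * (k2 - k1))"
    using assms(2,3) by (simp add: avg_def norm_divide divide_right_mono norm_mult del: of_real_mult of_real_diff)
  also have "\<dots> = sqrt (sqn lborel W) / sqrt ((a2 - a1) * (k2 - k1))"
  proof -
    have "r * S / r\<^sup>2 = S / r" if "r > 0" for r S :: real using that by (simp add: power2_eq_square)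
    from this[of "sqrt ((a2 - a1) * (k2 - k1))" "sqrt (sqn lborel W)"] show ?thesis using assms(2,3) by simp
  qed
  finally show ?thesis .
qed

section \<open>From weak derivatives on planar domains to rectangles\<close>

lemma Basis_plane: "(Basis :: (real \<times> real) set) = {(1, 0), (0, 1)}"
  by (auto simp: Basis_prod_def)

lemma sum_Basis_plane: "(\<Sum>b\<in>(Basis :: (real \<times> real) set). f b) = f (1, 0) + f (0, 1)"
  by (simp add: Basis_plane)

lemma brep_inner:
  fixes u w :: "'a::euclidean_space \<Rightarrow> complex"
  assumes "brep \<Omega> u U" "brep \<Omega> w W" "\<Omega> \<in> sets borel"
  shows "L2_inner (lebesgue_on \<Omega>) u w = (LINT x|lborel. U x * cnj (W x))"
  unfolding L2_inner_def
proof (rule lebesgue_on_integral(2)[OF assms(3)])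
  show "(\<lambda>x. U x * cnj (W x)) \<in> borel_measurable borel" using brepD(1)[OF assms(1)] brepD(1)[OF assms(2)] by measurable
  show "(\<lambda>x. u x * cnj (w x)) \<in> borel_measurable (lebesgue_on \<Omega>)"
    using L2_measurable[OF brep_L2[OF assms(1,3)]] L2_measurable[OF brep_L2[OF assms(2,3)]] by measurable
  show "AE x in lborel. x \<in> \<Omega> \<longrightarrow> u x * cnj (w x) = U x * cnj (W x)"
    using brepD(4)[OF assms(1)] brepD(4)[OF assms(2)] by eventually_elim simp
qed (use brepD(3)[OF assms(1)] in simp)

lemma brep_zero: "brep \<Omega> u U \<Longrightarrow> \<forall>x. x \<notin> \<Omega> \<longrightarrow> U x = 0"
  by (simp add: brep_def)

lemma brep_weak_derivD:
  assumes "\<Omega> \<in> sets borel" "brep \<Omega> u U" "brep \<Omega> w W" "b \<in> Basis" "has_weak_deriv \<Omega> b u w" "\<phi> \<in> test_functions \<Omega>"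
  shows "(LINT x|lborel. U x * frechet_derivative \<phi> (at x) b) = - (LINT x|lborel. W x * \<phi> x)"
  using has_weak_deriv_brep[OF assms(1-4)] assms(5,6) by blast

lemma frechet_tensor:
  fixes \<phi> \<eta> :: "real \<Rightarrow> complex"
  assumes "\<phi> \<in> test_functions A" "\<eta> \<in> test_functions K"
  shows "frechet_derivative (\<lambda>x. \<phi> (fst x) * \<eta> (snd x)) (at x) (1, 0) = frechet_derivative \<phi> (at (fst x)) 1 * \<eta> (snd x)"
    "frechet_derivative (\<lambda>x. \<phi> (fst x) * \<eta> (snd x)) (at x) (0, 1) = \<phi> (fst x) * frechet_derivative \<eta> (at (snd x)) 1"
proof -
  have 1: "((\<lambda>x. \<phi> (fst x)) has_derivative (\<lambda>h. frechet_derivative \<phi> (at (fst x)) (fst h))) (at x)"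
    by (rule has_derivative_compose[OF has_derivative_fst[OF has_derivative_ident]])
       (rule frechet_derivative_works[THEN iffD1, OF test_differentiable[OF assms(1)]])
  have 2: "((\<lambda>x. \<eta> (snd x)) has_derivative (\<lambda>h. frechet_derivative \<eta> (at (snd x)) (snd h))) (at x)"
    by (rule has_derivative_compose[OF has_derivative_snd[OF has_derivative_ident]])
       (rule frechet_derivative_works[THEN iffD1, OF test_differentiable[OF assms(2)]])
  have 0: "frechet_derivative \<phi> (at s) 0 = 0" "frechet_derivative \<eta> (at s) 0 = 0" for s
    by (rule linear_0[OF linear_frechet_derivative[OF test_differentiable[OF assms(1)]]],
        rule linear_0[OF linear_frechet_derivative[OF test_differentiable[OF assms(2)]]])
  note d = frechet_derivative_eq[OF has_derivative_mult[OF 1 2]]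
  show "frechet_derivative (\<lambda>x. \<phi> (fst x) * \<eta> (snd x)) (at x) (1, 0) = frechet_derivative \<phi> (at (fst x)) 1 * \<eta> (snd x)"
    "frechet_derivative (\<lambda>x. \<phi> (fst x) * \<eta> (snd x)) (at x) (0, 1) = \<phi> (fst x) * frechet_derivative \<eta> (at (snd x)) 1"
    by (simp_all add: d 0)
qed

lemma mg_cnj: "mg k1 k2 (\<lambda>x. cnj (W x)) s = cnj (mg k1 k2 W s)"
proof -
  have "mg k1 k2 (\<lambda>x. cnj (W x)) s = (LINT t|lborel. cnj (indicator {k1<..<k2} t *\<^sub>R W (s, t)))"
    by (simp add: mg_def)
  then show ?thesis unfolding mg_def by (simp only: Bochner_Integration.integral_cnj)
qed

text \<open>Exchanging the coordinates turns the vertical derivative into one in the first variable,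
  so \<open>avg_step\<close> and \<open>rect_deriv_rep\<close> serve both directions.\<close>

lemma H1_rect_deriv:
  fixes w :: "real \<times> real \<Rightarrow> complex"
  assumes \<Omega>: "open \<Omega>" and w: "brep \<Omega> w W" and sub: "{a1<..<a2} \<times> {k1<..<k2} \<subseteq> \<Omega>"
  shows "brep \<Omega> w1 W1 \<Longrightarrow> has_weak_deriv \<Omega> (1, 0) w w1 \<Longrightarrow> rect_deriv a1 a2 k1 k2 W W1"
    and "brep \<Omega> w2 W2 \<Longrightarrow> has_weak_deriv \<Omega> (0, 1) w w2 \<Longrightarrow> rect_deriv k1 k2 a1 a2 (swp W) (swp W2)"
proof -
  have B: "\<Omega> \<in> sets borel" using \<Omega> by simp
  show "rect_deriv a1 a2 k1 k2 W W1" if W1: "brep \<Omega> w1 W1" and d: "has_weak_deriv \<Omega> (1, 0) w w1"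
    unfolding rect_deriv_def
  proof (intro conjI ballI)
    fix \<phi> \<eta> :: "real \<Rightarrow> complex" assume t: "\<phi> \<in> test_functions {a1<..<a2}" "\<eta> \<in> test_functions {k1<..<k2}"
    have b1: "(1, 0) \<in> (Basis :: (real \<times> real) set)" by (simp add: Basis_plane)
    from brep_weak_derivD[OF B w W1 b1 d test_tensor[OF t sub]]
    show "(LINT x|lborel. W x * (frechet_derivative \<phi> (at (fst x)) 1 * \<eta> (snd x))) = - (LINT x|lborel. W1 x * (\<phi> (fst x) * \<eta> (snd x)))"
      unfolding frechet_tensor(1)[OF t] .
  qed (use brepD(2)[OF w] brepD(2)[OF W1] in auto)
  show "rect_deriv k1 k2 a1 a2 (swp W) (swp W2)" if W2: "brep \<Omega> w2 W2" and d: "has_weak_deriv \<Omega> (0, 1) w w2"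
    unfolding rect_deriv_def
  proof (intro conjI ballI)
    fix \<phi> \<eta> :: "real \<Rightarrow> complex" assume t: "\<phi> \<in> test_functions {k1<..<k2}" "\<eta> \<in> test_functions {a1<..<a2}"
    have b2: "(0, 1) \<in> (Basis :: (real \<times> real) set)" by (simp add: Basis_plane)
    from brep_weak_derivD[OF B w W2 b2 d test_tensor[OF t(2,1) sub]]
    have e: "(LINT x|lborel. W x * (\<eta> (fst x) * frechet_derivative \<phi> (at (snd x)) 1)) = - (LINT x|lborel. W2 x * (\<eta> (fst x) * \<phi> (snd x)))"
      unfolding frechet_tensor(2)[OF t(2,1)] .
    note m = measurable_plane[OF test_borel[OF t(2)] test_borel[OF test_dv[OF t(1)]]] measurable_plane[OF test_borel[OF t(2)] test_borel[OF t(1)]]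
    have m1: "(\<lambda>x. W x * (\<eta> (fst x) * frechet_derivative \<phi> (at (snd x)) 1)) \<in> borel_measurable borel"
      by (intro borel_measurable_times brepD(1)[OF w] m)
    have m2: "(\<lambda>x. W2 x * (\<eta> (fst x) * \<phi> (snd x))) \<in> borel_measurable borel"
      by (intro borel_measurable_times brepD(1)[OF W2] m)
    show "(LINT x|lborel. swp W x * (frechet_derivative \<phi> (at (fst x)) 1 * \<eta> (snd x))) = - (LINT x|lborel. swp W2 x * (\<phi> (fst x) * \<eta> (snd x)))"
      using swap_plane(2)[OF m1] swap_plane(2)[OF m2] e by (simp add: mult.commute)
  qed (use swp_L2(1)[OF brepD(2)[OF w]] swp_L2(1)[OF brepD(2)[OF W2]] in auto)
qed

subsection \<open>The thin domain\<close>

text \<open>The last two inequalities say 2 d \<le> \<epsilon> and d \<le> b: squares of side d at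
  the two openings fit into the strip and into the room. They are the form in which the upper bounds
  for \<epsilon>0 enter.\<close>

locale room_problem = limit_problem +
  fixes \<alpha> \<beta> \<epsilon> :: real
  assumes \<alpha>: "0 < \<alpha>" and \<beta>: "0 < \<beta>" "\<beta> < 1/2" and \<epsilon>: "0 < \<epsilon>" "\<epsilon> \<le> \<delta>" "\<epsilon> < 1"
    and d_le_eps: "2 * (\<gamma> * \<epsilon> powr (\<alpha> + 1)) \<le> \<epsilon>" and d_le_b: "\<gamma> * \<epsilon> powr (\<alpha> + 1) \<le> \<epsilon> powr \<beta>"
begin

definition "d = \<gamma> * \<epsilon> powr (\<alpha> + 1)"
definition "h = \<epsilon> powr \<alpha>"
definition "b = \<epsilon> powr \<beta>"
abbreviation "\<Omega> \<equiv> Omega_eps lm lp \<alpha> \<beta> \<gamma> \<epsilon>"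
abbreviation "ME \<equiv> lebesgue_on \<Omega>"
abbreviation "S \<equiv> strip lm lp \<epsilon>"
abbreviation "P \<equiv> passage \<alpha> \<gamma> \<epsilon>"
abbreviation "R \<equiv> room \<alpha> \<beta> \<epsilon>"

lemma pos: "0 < d" "0 < h" "0 < b" "2 * d \<le> \<epsilon>" "d \<le> b" "h < 1" "b < 1"
proof -
  show "h < 1" "b < 1" unfolding h_def b_def using \<epsilon> \<alpha> \<beta> powr_less_mono2[of \<alpha> \<epsilon> 1] powr_less_mono2[of \<beta> \<epsilon> 1] by auto
qed (use \<gamma> \<epsilon> d_le_eps d_le_b in \<open>auto simp: d_def h_def b_def\<close>)

lemma S_eq: "S = I \<times> {-\<epsilon><..<0}" by (simp add: strip_def)
lemma P_eq: "P = {-d/2<..<d/2} \<times> {0<..<h}" by (simp add: passage_def d_def h_def Let_def)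
lemma R_eq: "R = {-b/2<..<b/2} \<times> {h<..<h+b}" by (simp add: room_def b_def h_def Let_def)

lemma opens: "open S" "open P" "open R" "open \<Omega>"
  unfolding S_eq P_eq R_eq by (auto intro: open_Times I_open simp: Omega_eps_def)

lemma borels: "S \<in> sets borel" "P \<in> sets borel" "R \<in> sets borel" "\<Omega> \<in> sets borel"
  using opens by auto

lemma parts_subset: "S \<subseteq> \<Omega>" "P \<subseteq> \<Omega>" "R \<subseteq> \<Omega>"
proof -
  have "S \<union> P \<union> R \<subseteq> \<Omega>"
    unfolding Omega_eps_def by (rule interior_maximal[OF closure_subset]) (intro open_Un opens)
  then show "S \<subseteq> \<Omega>" "P \<subseteq> \<Omega>" "R \<subseteq> \<Omega>" by blast+
qed

lemma interval_in_I: "{-\<epsilon>..\<epsilon>} \<subseteq> I"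
  using \<delta>_sub \<epsilon> by auto

lemma passage_in_I: "{-d/2..d/2} \<subseteq> I"
proof -
  have "{-d/2..d/2} \<subseteq> {-\<epsilon>..\<epsilon>}" using pos by auto
  then show ?thesis using interval_in_I by blast
qed

text \<open>The interior of the closure contains the two openings of the passage. Hence the mean of
  w over horizontal cross sections is one continuous function from the strip to the room, and its
  values at the openings make sense.\<close>

lemma channel_subset: "{-d/2<..<d/2} \<times> {-\<epsilon><..<h+b} \<subseteq> \<Omega>"
  unfolding Omega_eps_def
proof (rule interior_maximal)
  show "open ({-d/2<..<d/2} \<times> {-\<epsilon><..<h+b})" by (auto intro: open_Times)
  have S1: "{-d/2<..<d/2} \<times> {-\<epsilon><..<0} \<subseteq> S"
    unfolding S_eq using passage_in_I by (auto intro: subsetD)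
  have cS: "{-d/2..d/2} \<times> {-\<epsilon>..0} \<subseteq> closure S"
    using closure_mono[OF S1] pos \<epsilon> by (simp add: closure_Times)
  have cP: "{-d/2..d/2} \<times> {0..h} \<subseteq> closure P" unfolding P_eq using pos by (simp add: closure_Times)
  have cR: "{-b/2..b/2} \<times> {h..h+b} \<subseteq> closure R" unfolding R_eq using pos by (simp add: closure_Times)
  show "{-d/2<..<d/2} \<times> {-\<epsilon><..<h+b} \<subseteq> closure (S \<union> P \<union> R)"
  proof
    fix x assume x: "x \<in> {-d/2<..<d/2} \<times> {-\<epsilon><..<h+b}"
    consider "snd x \<le> 0" | "0 \<le> snd x" "snd x \<le> h" | "h \<le> snd x" by linarith
    then have "x \<in> closure S \<union> closure P \<union> closure R"
    proof cases
      case 1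
      have "x \<in> {-d/2..d/2} \<times> {-\<epsilon>..0}" using x 1 by (auto simp: mem_Times_iff)
      then show ?thesis using cS by blast
    next
      case 2
      have "x \<in> {-d/2..d/2} \<times> {0..h}" using x 2 by (auto simp: mem_Times_iff)
      then show ?thesis using cP by blast
    next
      case 3
      have "x \<in> {-b/2..b/2} \<times> {h..h+b}" using x 3 pos(5) by (auto simp: mem_Times_iff)
      then show ?thesis using cR by blast
    qed
    then show "x \<in> closure (S \<union> P \<union> R)" by simp
  qed
qed

text \<open>Passing to the interior of the closure adds only frontier points of the three parts, and
  frontiers of convex sets are null sets.\<close>

lemma AE_parts: "AE x in lborel. x \<in> \<Omega> \<longrightarrow> x \<in> S \<union> P \<union> R"
proof -
  have "convex I" using I_interval is_interval_convex by blast
  then have "convex S" "convex P" "convex R" unfolding S_eq P_eq R_eq by (auto intro: convex_Times)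
  then have "negligible (frontier S \<union> frontier P \<union> frontier R)"
    by (intro negligible_Un negligible_convex_frontier)
  then have "AE x in lborel. x \<notin> frontier S \<union> frontier P \<union> frontier R"
    by (intro AE_not_in) (auto simp: negligible_iff_null_sets null_sets_completion_iff)
  then show ?thesis
  proof eventually_elim
    case (elim x)
    show ?case
    proof
      assume "x \<in> \<Omega>"
      then have "x \<in> closure (S \<union> P \<union> R)" unfolding Omega_eps_def using interior_subset by blast
      then have "x \<in> closure S \<or> x \<in> closure P \<or> x \<in> closure R" by simp
      then show "x \<in> S \<union> P \<union> R" using elim opens by (auto simp: frontier_def interior_open)
    qed
  qed
qed

text \<open>The room may reach beyond I when the interval is short, but below height h only strip
  and passage are present. Their closures lie over the closure of I, and an open set over the
  closure of an open interval lies over the interval.\<close>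

lemma section_below: "(s, t) \<in> \<Omega> \<Longrightarrow> t < h \<Longrightarrow> s \<in> I"
proof -
  assume st: "(s, t) \<in> \<Omega>" "t < h"
  define U where "U = \<Omega> \<inter> (UNIV \<times> {..<h})"
  have "open U" unfolding U_def by (intro open_Int open_Times opens) auto
  moreover have "U \<subseteq> closure I \<times> UNIV"
  proof
    fix x assume x: "x \<in> U"
    then have "x \<in> closure (S \<union> P \<union> R)" unfolding U_def Omega_eps_def using interior_subset by blast
    then have "x \<in> closure S \<or> x \<in> closure P \<or> x \<in> closure R" by simp
    moreover have "x \<notin> closure R" using x pos unfolding R_eq U_def by (auto simp: closure_Times)
    moreover have "x \<in> closure P \<Longrightarrow> fst x \<in> closure I"
      unfolding P_eq using pos passage_in_I closure_subset[of I] by (auto simp: closure_Times)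
    moreover have "x \<in> closure S \<Longrightarrow> fst x \<in> closure I" unfolding S_eq by (auto simp: closure_Times)
    ultimately show "x \<in> closure I \<times> UNIV" by (auto simp: mem_Times_iff)
  qed
  ultimately have "U \<subseteq> interior (closure I \<times> UNIV)" by (intro interior_maximal)
  also have "\<dots> = interior (closure I) \<times> UNIV" by (simp add: interior_Times)
  also have "interior (closure I) = I"
    using convex_interior_closure[OF is_interval_convex[OF I_interval]] interior_open[OF I_open] by simp
  finally show "s \<in> I" using st unfolding U_def by auto
qed

lemma parts_disjoint: "S \<inter> R = {}" "S \<inter> P = {}" "P \<inter> R = {}"
  unfolding S_eq P_eq R_eq using pos by auto

lemma V_eps_facts:
  "V_eps lm lp V0 \<epsilon> \<in> borel_measurable ME"
  "AE x in ME. 0 \<le> V_eps lm lp V0 \<epsilon> x \<and> V_eps lm lp V0 \<epsilon> x \<le> C"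
proof -
  have "(\<lambda>x. indicator I x *\<^sub>R complex_of_real (V0 x)) \<in> borel_measurable lebesgue"
    using V0_measurable I_borel borel_measurable_restrict_space_iff[of I lebesgue "\<lambda>x. complex_of_real (V0 x)"] by auto
  then obtain g where g: "g \<in> borel_measurable borel" "AE x in lborel. indicator I x *\<^sub>R complex_of_real (V0 x) = g x"
    by (rule complex_completion_borel)
  have "(\<lambda>x. complex_of_real (V_eps lm lp V0 \<epsilon> x)) \<in> borel_measurable ME"
  proof (rule lebesgue_measurable_AE[OF _ _ borels(4)])
    show "(\<lambda>x. indicator S x *\<^sub>R g (fst x)) \<in> borel_measurable borel"
      using measurable_plane(1)[OF g(1) g(1)] borels(1) by simp
    show "AE x in lborel. x \<in> \<Omega> \<longrightarrow> indicator S x *\<^sub>R g (fst x) = complex_of_real (V_eps lm lp V0 \<epsilon> x)"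
      using AE_fst_plane[OF g(2)] by eventually_elim (auto simp: V_eps_def S_eq indicator_def)
  qed
  then have "(\<lambda>x. Re (complex_of_real (V_eps lm lp V0 \<epsilon> x))) \<in> borel_measurable ME" by measurable
  then show "V_eps lm lp V0 \<epsilon> \<in> borel_measurable ME" by simp
  have "AE s in lborel. s \<in> I \<longrightarrow> 0 \<le> V0 s \<and> V0 s \<le> C" using V0_bounds unfolding AE_lebesgue_on[OF I_borel] .
  from AE_fst_plane[OF this] have "AE x in lborel. x \<in> \<Omega> \<longrightarrow> 0 \<le> V_eps lm lp V0 \<epsilon> x \<and> V_eps lm lp V0 \<epsilon> x \<le> C"
    by eventually_elim (use C in \<open>auto simp: V_eps_def S_eq\<close>)
  then show "AE x in ME. 0 \<le> V_eps lm lp V0 \<epsilon> x \<and> V_eps lm lp V0 \<epsilon> x \<le> C" unfolding AE_lebesgue_on[OF borels(4)] .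
qed

sublocale E: schroedinger_form \<Omega> "V_eps lm lp V0 \<epsilon>" C 0 "\<lambda>_. 0" 0
  by unfold_locales (use V_eps_facts C opens in \<open>auto elim: eventually_mono\<close>)

lemma form_eps_eq:
  assumes "u \<in> H1 \<Omega>" "v \<in> H1 \<Omega>"
  shows "form_eps lm lp \<alpha> \<beta> \<gamma> V0 \<epsilon> u v = E.form u v"
proof -
  have i: "integrable ME (\<lambda>x. E.D b' u x * cnj (E.D b' v x))" if "b' \<in> Basis" for b'
    by (intro L2_inner_integrable weak_deriv_works(1) assms that)
  have iV: "integrable ME (\<lambda>x. complex_of_real (V_eps lm lp V0 \<epsilon> x) * u x * cnj (v x))"
    by (rule L2_inner_integrable[OF E.V_mult_L2[OF H1_L2[OF assms(1)]] H1_L2[OF assms(2)]])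
  have "form_eps lm lp \<alpha> \<beta> \<gamma> V0 \<epsilon> u v = (LINT x|ME. (\<Sum>b'\<in>Basis. E.D b' u x * cnj (E.D b' v x))) +
      (LINT x|ME. complex_of_real (V_eps lm lp V0 \<epsilon> x) * u x * cnj (v x))"
    unfolding form_eps_def Let_def by (intro Bochner_Integration.integral_add Bochner_Integration.integrable_sum i iV)
  also have "(LINT x|ME. (\<Sum>b'\<in>Basis. E.D b' u x * cnj (E.D b' v x))) = (\<Sum>b'\<in>Basis. L2_inner ME (E.D b' u) (E.D b' v))"
    unfolding L2_inner_def by (rule Bochner_Integration.integral_sum[OF i])
  finally show ?thesis by (simp add: E.form_def L2_inner_def)
qed

lemma A_eps_iff:
  assumes f: "f \<in> L2 ME"
  shows "(u, f - u) \<in> A_eps lm lp \<alpha> \<beta> \<gamma> V0 \<epsilon> \<longleftrightarrow> u \<in> H1 \<Omega> \<and> (\<forall>v\<in>H1 \<Omega>. E.form1 u v = L2_inner ME f v)"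
proof -
  have ip: "L2_inner ME (f - u) v = L2_inner ME f v - L2_inner ME u v" if "u \<in> H1 \<Omega>" "v \<in> H1 \<Omega>" for v
    using L2_inner_lc_left[OF f H1_L2[OF that(1)] H1_L2[OF that(2)], of "-1"] by (simp add: fun_diff_def)
  have "f - u \<in> L2 ME" if "u \<in> H1 \<Omega>" using L2_diff[OF f H1_L2[OF that]] by (simp add: fun_diff_def)
  then have "(u, f - u) \<in> A_eps lm lp \<alpha> \<beta> \<gamma> V0 \<epsilon> \<longleftrightarrow> u \<in> H1 \<Omega> \<and>
     (\<forall>v\<in>H1 \<Omega>. form_eps lm lp \<alpha> \<beta> \<gamma> V0 \<epsilon> u v = L2_inner ME (f - u) v)"
    unfolding A_eps_def form_operator_def H_eps_def ip_eps_def by auto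
  also have "\<dots> \<longleftrightarrow> u \<in> H1 \<Omega> \<and> (\<forall>v\<in>H1 \<Omega>. E.form1 u v = L2_inner ME f v)"
    by (intro conj_cong refl ball_cong) (simp add: form_eps_eq ip E.form1_def eq_diff_eq)
  finally show ?thesis .
qed

lemma R_eps_works:
  assumes f: "f \<in> L2 ME"
  shows "R_eps lm lp \<alpha> \<beta> \<gamma> V0 \<epsilon> f \<in> H1 \<Omega>"
    "v \<in> H1 \<Omega> \<Longrightarrow> E.form1 (R_eps lm lp \<alpha> \<beta> \<gamma> V0 \<epsilon> f) v = L2_inner ME f v"
proof -
  obtain u where "u \<in> H1 \<Omega>" "\<forall>v\<in>H1 \<Omega>. E.form1 u v = L2_inner ME f v"
    using E.resolvent_exists[OF f] by blast
  then have "\<exists>u. (u, f - u) \<in> A_eps lm lp \<alpha> \<beta> \<gamma> V0 \<epsilon>" unfolding A_eps_iff[OF f] by blast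
  from someI_ex[OF this] have "(R_eps lm lp \<alpha> \<beta> \<gamma> V0 \<epsilon> f, f - R_eps lm lp \<alpha> \<beta> \<gamma> V0 \<epsilon> f) \<in> A_eps lm lp \<alpha> \<beta> \<gamma> V0 \<epsilon>"
    unfolding R_eps_def resolvent_def .
  then show "R_eps lm lp \<alpha> \<beta> \<gamma> V0 \<epsilon> f \<in> H1 \<Omega>"
    "v \<in> H1 \<Omega> \<Longrightarrow> E.form1 (R_eps lm lp \<alpha> \<beta> \<gamma> V0 \<epsilon> f) v = L2_inner ME f v"
    unfolding A_eps_iff[OF f] by auto
qed

subsection \<open>The identification operators\<close>

definition "c1 = complex_of_real (\<epsilon> powr (-1/2))"
definition "c2 = complex_of_real (1 / \<epsilon> powr \<beta>)"
abbreviation "J \<equiv> J_eps lm lp \<alpha> \<beta> \<epsilon>"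
abbreviation "Jt \<equiv> Jt_eps \<alpha> \<beta> \<epsilon>"

text \<open>As F vanishes off I, the product form on the left, to which Fubini's theorem applies, is
  the restriction to the strip.\<close>

lemma strip_indicator:
  assumes "\<forall>s. s \<notin> I \<longrightarrow> F s = (0::complex)"
  shows "F (fst x) * complex_of_real (indicator {-\<epsilon><..<0} (snd x)) = complex_of_real (indicator S x) * F (fst x)"
  using assms[rule_format, of "fst x"] by (auto simp: S_eq indicator_def mem_Times_iff)

lemma R_finite: "emeasure lborel R < \<infinity>" "measure lborel R = b\<^sup>2"
proof -
  have "emeasure (lborel \<Otimes>\<^sub>M lborel) R = emeasure lborel {-b/2<..<b/2} * emeasure lborel {h<..<h+b}"
    unfolding R_eq by (intro lborel.emeasure_pair_measure_Times) auto
  also have "\<dots> = ennreal (b\<^sup>2)" using pos by (simp add: ennreal_mult[symmetric] power2_eq_square)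
  finally have "emeasure lborel R = ennreal (b\<^sup>2)" by (simp add: lborel_prod)
  then show "emeasure lborel R < \<infinity>" "measure lborel R = b\<^sup>2" by (auto simp: measure_def)
qed

lemma P_finite: "emeasure lborel P < \<infinity>" "measure lborel P = d * h"
proof -
  have "emeasure (lborel \<Otimes>\<^sub>M lborel) P = emeasure lborel {-d/2<..<d/2} * emeasure lborel {0<..<h}"
    unfolding P_eq by (intro lborel.emeasure_pair_measure_Times) auto
  also have "\<dots> = ennreal (d * h)" using pos by (simp add: ennreal_mult[symmetric])
  finally have "emeasure lborel P = ennreal (d * h)" by (simp add: lborel_prod)
  then show "emeasure lborel P < \<infinity>" "measure lborel P = d * h" using pos by (auto simp: measure_def)
qed

lemma J_brep:
  assumes F: "brep I (fst f) F"
  shows "brep \<Omega> (J f) (\<lambda>x. c1 * (F (fst x) * complex_of_real (indicator {-\<epsilon><..<0} (snd x))) + c2 * snd f * complex_of_real (indicator R x))"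
  unfolding brep_def
proof (intro conjI allI impI)
  let ?G = "\<lambda>x. c1 * (F (fst x) * complex_of_real (indicator {-\<epsilon><..<0} (snd x))) + c2 * snd f * complex_of_real (indicator R x)"
  have si: "F (fst x) * complex_of_real (indicator {-\<epsilon><..<0} (snd x)) = complex_of_real (indicator S x) * F (fst x)" for x
    by (rule strip_indicator[OF brep_zero[OF F]])
  show L: "?G \<in> L2 lborel"
    by (intro L2_lc L2_cmult tensor_L2[OF brepD(2)[OF F] indicator_Ioo_L2] indicator_L2(1) borels R_finite)
  show "?G \<in> borel_measurable borel" using L2_measurable[OF L] by simp
  show "?G x = 0" if "x \<notin> \<Omega>" for x using that parts_subset unfolding si by (auto simp: indicator_def)
  show "AE x in lborel. x \<in> \<Omega> \<longrightarrow> J f x = ?G x"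
    using AE_fst_plane[OF brepD(4)[OF F]]
  proof eventually_elim
    case (elim x)
    show ?case unfolding si using elim parts_disjoint
      by (auto simp: J_eps_def c1_def c2_def S_eq indicator_def)
  qed
qed

lemma J_L2: "f \<in> H_zero lm lp \<Longrightarrow> J f \<in> L2 ME"
  using brep_ex[OF I_borel, of "fst f"] brep_L2[OF J_brep borels(4)] by (auto simp: H_zero_def)

lemma Jt_brep:
  assumes W: "brep \<Omega> w W"
  shows "brep I (fst (Jt w)) (\<lambda>s. indicator I s *\<^sub>R (c1 * mg (-\<epsilon>) 0 W s))"
    and "snd (Jt w) = c2 * (LINT x|lborel. complex_of_real (indicator R x) * W x)"
proof -
  have e: "-\<epsilon> \<le> 0" using \<epsilon> by simp
  have mgL: "mg (-\<epsilon>) 0 W \<in> L2 lborel" by (rule mg_L2(1)[OF brepD(2)[OF W] e])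
  have mgB: "mg (-\<epsilon>) 0 W \<in> borel_measurable borel" by (rule mg_measurable[OF brepD(1)[OF W]])
  have "AE x in (lborel \<Otimes>\<^sub>M lborel). x \<in> \<Omega> \<longrightarrow> w x = W x" using brepD(4)[OF W] unfolding lborel_prod .
  then have "AE s in lborel. AE t in lborel. (s, t) \<in> \<Omega> \<longrightarrow> w (s, t) = W (s, t)" by (rule lborel_pair.AE_pair)
  then have ae: "AE s in lborel. s \<in> I \<longrightarrow> fst (Jt w) s = c1 * mg (-\<epsilon>) 0 W s"
  proof eventually_elim
    case (elim s)
    show ?case
    proof
      assume s: "s \<in> I"
      have K: "{-\<epsilon><..<0} \<in> sets borel" by simp
      have sm: "(\<lambda>t. W (s, t)) \<in> borel_measurable borel" by (rule section_measurable(1)[OF brepD(1)[OF W]])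
      have aeK: "AE t in lborel. t \<in> {-\<epsilon><..<0} \<longrightarrow> w (s, t) = W (s, t)"
        using elim
      proof eventually_elim
        case (elim t)
        show ?case
        proof
          assume "t \<in> {-\<epsilon><..<0}"
          then have "(s, t) \<in> S" using s by (simp add: S_eq)
          then show "w (s, t) = W (s, t)" using elim parts_subset(1) by blast
        qed
      qed
      have wm: "(\<lambda>t. w (s, t)) \<in> borel_measurable (lebesgue_on {-\<epsilon><..<0})"
        by (rule lebesgue_measurable_AE[OF sm _ K]) (use aeK in \<open>auto elim: eventually_mono\<close>)
      have "(LINT t|lebesgue_on {-\<epsilon><..<0}. w (s, t)) = (LINT t|lborel. indicator {-\<epsilon><..<0} t *\<^sub>R W (s, t))"
      proof (rule lebesgue_on_integral(2)[OF K _ wm])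
        show "(\<lambda>t. indicator {-\<epsilon><..<0} t *\<^sub>R W (s, t)) \<in> borel_measurable borel" using sm by simp
        show "AE t in lborel. t \<in> {-\<epsilon><..<0} \<longrightarrow> w (s, t) = indicator {-\<epsilon><..<0} t *\<^sub>R W (s, t)"
          using aeK by eventually_elim auto
      qed simp
      then show "fst (Jt w) s = c1 * mg (-\<epsilon>) 0 W s" by (simp add: Jt_eps_def c1_def mg_def)
    qed
  qed
  show "brep I (fst (Jt w)) (\<lambda>s. indicator I s *\<^sub>R (c1 * mg (-\<epsilon>) 0 W s))"
    unfolding brep_def
  proof (intro conjI allI impI)
    show "(\<lambda>s. indicator I s *\<^sub>R (c1 * mg (-\<epsilon>) 0 W s)) \<in> borel_measurable borel" using mgB I_borel by simp
    show "(\<lambda>s. indicator I s *\<^sub>R (c1 * mg (-\<epsilon>) 0 W s)) \<in> L2 lborel" by (rule L2_indicator_mult(1)[OF L2_cmult[OF mgL] I_borel])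
    show "AE s in lborel. s \<in> I \<longrightarrow> fst (Jt w) s = indicator I s *\<^sub>R (c1 * mg (-\<epsilon>) 0 W s)"
      using ae by eventually_elim simp
  qed simp
  have "(LINT x|lebesgue_on R. w x) = (LINT x|lborel. complex_of_real (indicator R x) * W x)"
  proof (rule lebesgue_on_integral(2)[OF borels(3)])
    show "(\<lambda>x. complex_of_real (indicator R x) * W x) \<in> borel_measurable borel" using brepD(1)[OF W] borels(3) by simp
    have aeR: "AE x in lborel. x \<in> R \<longrightarrow> W x = w x" using brepD(4)[OF W] by eventually_elim (use parts_subset(3) in auto)
    then show "w \<in> borel_measurable (lebesgue_on R)" by (rule lebesgue_measurable_AE[OF brepD(1)[OF W] _ borels(3)])
    show "AE x in lborel. x \<in> R \<longrightarrow> w x = complex_of_real (indicator R x) * W x" using aeR by eventually_elim auto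
  qed simp
  then show "snd (Jt w) = c2 * (LINT x|lborel. complex_of_real (indicator R x) * W x)"
    by (simp add: Jt_eps_def c2_def)
qed

lemma Jt_H: "w \<in> L2 ME \<Longrightarrow> Jt w \<in> H_zero lm lp"
  using brep_ex[OF borels(4), of w] brep_L2[OF Jt_brep(1) I_borel] by (auto simp: H_zero_def mem_Times_iff)

lemma strip_Fubini:
  assumes F: "F \<in> L2 lborel" "\<forall>s. s \<notin> I \<longrightarrow> F s = 0" and W: "W \<in> L2 lborel"
  shows "(LINT x|lborel. complex_of_real (indicator S x) * F (fst x) * cnj (W x)) = (LINT s|lborel. F s * cnj (mg (-\<epsilon>) 0 W s))"
    "integrable lborel (\<lambda>x. complex_of_real (indicator S x) * F (fst x) * cnj (W x))"
  using mg_integral[OF L2_cnj[OF W] F(1), of "-\<epsilon>" 0] unfolding strip_indicator[OF F(2)] mg_cnj by auto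

text \<open>By Fubini's theorem \<open>Jt\<close> is the adjoint of \<open>J\<close>. This is the
  source of the equality of the two norms, and it converts integrals over strip and room into inner
  products of the limit space.\<close>

lemma J_adjoint:
  assumes f: "f \<in> H_zero lm lp" and w: "w \<in> L2 ME"
  shows "L2_inner ME (J f) w = ip_zero lm lp f (Jt w)"
proof -
  have f1: "fst f \<in> L2 M0" using f by (auto simp: H_zero_def)
  obtain F where F: "brep I (fst f) F" using brep_ex[OF I_borel f1] by blast
  obtain W where W: "brep \<Omega> w W" using brep_ex[OF borels(4) w] by blast
  note sf = strip_Fubini[OF brepD(2)[OF F] brep_zero[OF F] brepD(2)[OF W]]
  have iR: "integrable lborel (\<lambda>x. complex_of_real (indicator R x) * cnj (W x))"
    by (rule L2_mult_integrable[OF indicator_L2(1)[OF borels(3) R_finite(1)] L2_cnj[OF brepD(2)[OF W]]])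
  have "L2_inner ME (J f) w = (LINT x|lborel. c1 * (complex_of_real (indicator S x) * F (fst x) * cnj (W x)) +
      c2 * snd f * (complex_of_real (indicator R x) * cnj (W x)))"
    unfolding brep_inner[OF J_brep[OF F] W borels(4)] strip_indicator[OF brep_zero[OF F]] by (simp add: algebra_simps)
  also have "\<dots> = c1 * (LINT s|lborel. F s * cnj (mg (-\<epsilon>) 0 W s)) + c2 * snd f * (LINT x|lborel. complex_of_real (indicator R x) * cnj (W x))"
    unfolding sf(1)[symmetric]
    by (subst Bochner_Integration.integral_add[OF integrable_mult_right[OF sf(2)] integrable_mult_right[OF iR]])
       (simp only: integral_mult_right_zero)
  also have "c1 * (LINT s|lborel. F s * cnj (mg (-\<epsilon>) 0 W s)) = L2_inner M0 (fst f) (fst (Jt w))"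
  proof -
    have "F s * cnj (indicator I s *\<^sub>R (c1 * mg (-\<epsilon>) 0 W s)) = c1 * (F s * cnj (mg (-\<epsilon>) 0 W s))" for s
      using brepD(3)[OF F, of s] by (cases "s \<in> I") (simp_all add: c1_def)
    then show ?thesis unfolding brep_inner[OF F Jt_brep(1)[OF W] I_borel] by (simp only: integral_mult_right_zero)
  qed
  also have "c2 * snd f * (LINT x|lborel. complex_of_real (indicator R x) * cnj (W x)) = snd f * cnj (snd (Jt w))"
  proof -
    have "cnj (LINT x|lborel. complex_of_real (indicator R x) * W x) = (LINT x|lborel. cnj (complex_of_real (indicator R x) * W x))"
      by (rule Bochner_Integration.integral_cnj[symmetric])
    then show ?thesis unfolding Jt_brep(2)[OF W] by (simp add: c2_def)
  qed
  finally show ?thesis by (simp add: ip_zero_def)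
qed

text \<open>Averaging over the thickness of the strip commutes with differentiation along it. Hence
  the first component of \<open>Jt w\<close> is an admissible test function for the limit
  equation.\<close>

lemma Jt_H1:
  assumes w: "w \<in> H1 \<Omega>" and W1: "brep \<Omega> (E.D (1, 0) w) W1"
  shows "fst (Jt w) \<in> H1 I" "brep I (D0 (fst (Jt w))) (\<lambda>s. indicator I s *\<^sub>R (c1 * mg (-\<epsilon>) 0 W1 s))"
proof -
  have b1: "(1, 0) \<in> (Basis :: (real \<times> real) set)" by (simp add: Basis_plane)
  obtain W where W: "brep \<Omega> w W" using brep_ex[OF borels(4) H1_L2[OF w]] by blast
  have e: "-\<epsilon> \<le> 0" using \<epsilon> by simp
  let ?m = "\<lambda>W s. indicator I s *\<^sub>R (c1 * mg (-\<epsilon>) 0 W s)"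
  have m1: "brep I (?m W1) (?m W1)"
    unfolding brep_def
    using mg_measurable[OF brepD(1)[OF W1], of "-\<epsilon>" 0] I_borel L2_indicator_mult(1)[OF L2_cmult[OF mg_L2(1)[OF brepD(2)[OF W1] e]] I_borel, of c1] by auto
  have "has_weak_deriv I 1 (fst (Jt w)) (?m W1)"
  proof (subst has_weak_deriv_brep[OF I_borel Jt_brep(1)[OF W] m1])
    show "\<forall>\<phi>\<in>test_functions I. (LINT x|lborel. ?m W x * frechet_derivative \<phi> (at x) 1) = - (LINT x|lborel. ?m W1 x * \<phi> x)"
    proof
      fix \<phi> :: "real \<Rightarrow> complex" assume \<phi>: "\<phi> \<in> test_functions I"
      have "(LINT s|lborel. mg (-\<epsilon>) 0 W s * frechet_derivative \<phi> (at s) 1) = - (LINT s|lborel. mg (-\<epsilon>) 0 W1 s * \<phi> s)"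
      proof (rule mg_weak_deriv[OF brepD(2)[OF W] brepD(2)[OF W1] _ \<phi>])
        fix \<psi> \<eta> :: "real \<Rightarrow> complex" assume t: "\<psi> \<in> test_functions I" "\<eta> \<in> test_functions {-\<epsilon><..<0}"
        have sub: "I \<times> {-\<epsilon><..<0} \<subseteq> \<Omega>" using parts_subset(1) by (simp add: S_eq)
        from brep_weak_derivD[OF borels(4) W W1 b1 weak_deriv_works(2)[OF w b1] test_tensor[OF t sub]]
        show "(LINT x|lborel. W x * (frechet_derivative \<psi> (at (fst x)) 1 * \<eta> (snd x))) = - (LINT x|lborel. W1 x * (\<psi> (fst x) * \<eta> (snd x)))"
          unfolding frechet_tensor(1)[OF t] .
      qed
      moreover have "?m W x * frechet_derivative \<phi> (at x) 1 = c1 * (mg (-\<epsilon>) 0 W x * frechet_derivative \<phi> (at x) 1)" for x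
        using test_outside[OF test_dv[OF \<phi>], of x] by (cases "x \<in> I") auto
      moreover have "?m W1 x * \<phi> x = c1 * (mg (-\<epsilon>) 0 W1 x * \<phi> x)" for x
        using test_outside[OF \<phi>, of x] by (cases "x \<in> I") auto
      ultimately show "(LINT x|lborel. ?m W x * frechet_derivative \<phi> (at x) 1) = - (LINT x|lborel. ?m W1 x * \<phi> x)"
        by (simp only: integral_mult_right_zero mult_minus_right)
    qed
  qed simp
  note wd = this
  have mL: "?m W1 \<in> L2 M0" by (rule brep_L2[OF m1 I_borel])
  show "fst (Jt w) \<in> H1 I" unfolding H1_def using wd mL brep_L2[OF Jt_brep(1)[OF W] I_borel] by auto
  show "brep I (D0 (fst (Jt w))) (?m W1)"
    unfolding brep_def
  proof (intro conjI)
    show "AE x in lborel. x \<in> I \<longrightarrow> D0 (fst (Jt w)) x = ?m W1 x"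
      using weak_deriv_AE(2)[OF I_open mL wd] by (simp add: AE_lebesgue_on[OF I_borel])
  qed (use brepD(1-3)[OF m1] in auto)
qed

end

subsection \<open>The flux through the passage\<close>

text \<open>(r / d)^(1/n) is the ratio of consecutive squares in a chain of n steps from side d to
  side r. The hypothesis on n is (\<alpha> + 1) / (2 n) \<le> \<beta>, so that d^(-1/(2n)) is at
  most a constant times \<epsilon>^(-\<beta>).\<close>

lemma powr_root_bound:
  fixes \<epsilon> \<gamma> \<alpha> \<beta> r :: real and n :: nat
  assumes \<epsilon>: "0 < \<epsilon>" "\<epsilon> < 1" and \<gamma>: "0 < \<gamma>" and n: "0 < n" and exps: "\<alpha> + 1 \<le> 2 * \<beta> * n"
    and r: "0 < r" "r \<le> 1"
  defines "d \<equiv> \<gamma> * \<epsilon> powr (\<alpha> + 1)"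
  shows "sqrt ((r / d) powr (1 / n)) \<le> max 1 (1 / \<gamma>) * \<epsilon> powr (-\<beta>)"
proof -
  have d: "d > 0" using \<epsilon> \<gamma> by (simp add: d_def)
  have "sqrt ((r / d) powr (1 / n)) = (r / d) powr (1 / (2 * n))"
    using d r by (simp add: powr_half_sqrt[symmetric] powr_powr mult.commute)
  also have "\<dots> \<le> (1 / d) powr (1 / (2 * n))"
    using r d by (intro powr_mono2) (auto intro: divide_right_mono)
  also have "1 / d = (1 / \<gamma>) * \<epsilon> powr (- (\<alpha> + 1))"
    by (simp only: d_def powr_minus_divide) simp
  also have "((1 / \<gamma>) * \<epsilon> powr (- (\<alpha> + 1))) powr (1 / (2 * n)) = (1 / \<gamma>) powr (1 / (2 * n)) * \<epsilon> powr (- (\<alpha> + 1) * (1 / (2 * n)))"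
    using \<gamma> \<epsilon> by (subst powr_mult) (simp_all only: powr_powr)
  also have "\<dots> \<le> max 1 (1 / \<gamma>) * \<epsilon> powr (-\<beta>)"
  proof (intro mult_mono)
    have "(1 / \<gamma>) powr (1 / (2 * n)) \<le> (max 1 (1 / \<gamma>)) powr (1 / (2 * n))"
      using \<gamma> by (intro powr_mono2) auto
    also have "\<dots> \<le> (max 1 (1 / \<gamma>)) powr 1"
      using n by (intro powr_mono) auto
    finally show "(1 / \<gamma>) powr (1 / (2 * n)) \<le> max 1 (1 / \<gamma>)" by simp
    have "-\<beta> \<le> - (\<alpha> + 1) * (1 / (2 * n))" using exps n by (simp add: field_simps)
    then show "\<epsilon> powr (- (\<alpha> + 1) * (1 / (2 * n))) \<le> \<epsilon> powr (-\<beta>)"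
      using \<epsilon> by (intro powr_mono') auto
  qed auto
  finally show ?thesis .
qed

context
  fixes \<Omega> :: "(real \<times> real) set" and w w1 w2 W W1 W2 :: "real \<times> real \<Rightarrow> complex" and U :: real
  assumes \<Omega>: "open \<Omega>" and W: "brep \<Omega> w W" and W1: "brep \<Omega> w1 W1" and W2: "brep \<Omega> w2 W2"
    and d1: "has_weak_deriv \<Omega> (1, 0) w w1" and d2: "has_weak_deriv \<Omega> (0, 1) w w2"
    and U1: "sqn lborel W1 \<le> U" and U2: "sqn lborel W2 \<le> U"
begin

text \<open>The passage between the squares goes through the rectangle of width r' and height r. The
  horizontal move costs the square root of r' / r; the vertical move, at full width r', costs only
  1.\<close>

lemma box_step:
  assumes r: "0 < r" "r \<le> r'" and k: "k2 - k1 = r" "k2' - k1' = r'" "k1' \<le> k1" "k2 \<le> k2'"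
    and sub: "{-r'/2<..<r'/2} \<times> {k1'<..<k2'} \<subseteq> \<Omega>"
  shows "cmod (avg (-r/2) (r/2) k1 k2 W - avg (-r'/2) (r'/2) k1' k2' W) \<le> 2 * sqrt (r' / r) * sqrt U"
proof -
  have U0: "0 \<le> U" using U1 sqn_nonneg[of lborel W1] by linarith
  have rr: "1 \<le> r' / r" using r by simp
  have "rect_deriv (-r'/2) (r'/2) k1' k2' W W1" by (rule H1_rect_deriv(1)[OF \<Omega> W sub W1 d1])
  then have h: "rect_deriv (-r'/2) (r'/2) k1 k2 W W1" by (rule rect_deriv_sub) (use k in auto)
  have "cmod (avg (-r/2) (r/2) k1 k2 W - avg (-r'/2) (r'/2) k1 k2 W) \<le> sqrt ((r'/2 - (-r'/2)) / (k2 - k1)) * sqrt (sqn lborel W1)"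
    by (rule avg_step[OF h]) (use r k in auto)
  also have "\<dots> \<le> sqrt (r' / r) * sqrt U" using k U1 rr by (intro mult_mono) auto
  finally have 1: "cmod (avg (-r/2) (r/2) k1 k2 W - avg (-r'/2) (r'/2) k1 k2 W) \<le> sqrt (r' / r) * sqrt U" .
  have v: "rect_deriv k1' k2' (-r'/2) (r'/2) (swp W) (swp W2)" by (rule H1_rect_deriv(2)[OF \<Omega> W sub W2 d2])
  have "cmod (avg k1 k2 (-r'/2) (r'/2) (swp W) - avg k1' k2' (-r'/2) (r'/2) (swp W)) \<le> sqrt ((k2' - k1') / (r'/2 - (-r'/2))) * sqrt (sqn lborel (swp W2))"
    by (rule avg_step[OF v]) (use r k in auto)
  also have "\<dots> = sqrt (sqn lborel W2)" using k r by (simp add: swp_L2(2)[OF brepD(2)[OF W2]])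
  also have "\<dots> \<le> 1 * sqrt U" using U2 by simp
  also have "\<dots> \<le> sqrt (r' / r) * sqrt U" using rr U0 by (intro mult_right_mono) auto
  finally have 2: "cmod (avg (-r'/2) (r'/2) k1 k2 W - avg (-r'/2) (r'/2) k1' k2' W) \<le> sqrt (r' / r) * sqrt U"
    by (simp add: avg_swap[OF brepD(2)[OF W]])
  show ?thesis using norm_triangle_ineq[of "avg (-r/2) (r/2) k1 k2 W - avg (-r'/2) (r'/2) k1 k2 W" "avg (-r'/2) (r'/2) k1 k2 W - avg (-r'/2) (r'/2) k1' k2' W"] 1 2
    by simp
qed

text \<open>Comparing the averages over squares of sides \<open>d\<close> and \<open>R\<close> in one step costs \<open>(R / d)\<^sup>1\<^sup>/\<^sup>2\<close>; going through
  \<open>n\<close> intermediate squares costs only \<open>n (R / d)\<^sup>1\<^sup>/\<^sup>(\<^sup>2\<^sup>n\<^sup>)\<close>. This replaces the usual logarithmic estimate,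
  since a loss of \<open>\<epsilon>\<^sup>-\<^sup>\<beta>\<close> is affordable.\<close>

lemma box_chain:
  fixes lo hi :: "real \<Rightarrow> real"
  assumes r: "0 < r" "1 \<le> \<rho>" and len: "\<And>s. hi s - lo s = s" and anti: "\<And>s t. s \<le> t \<Longrightarrow> lo t \<le> lo s" and mono: "\<And>s t. s \<le> t \<Longrightarrow> hi s \<le> hi t"
    and sub: "{-R/2<..<R/2} \<times> {lo R<..<hi R} \<subseteq> \<Omega>"
  shows "r * \<rho> ^ n \<le> R \<Longrightarrow> cmod (avg (-r/2) (r/2) (lo r) (hi r) W - avg (-(r * \<rho> ^ n)/2) ((r * \<rho> ^ n)/2) (lo (r * \<rho> ^ n)) (hi (r * \<rho> ^ n)) W)
    \<le> n * (2 * sqrt \<rho> * sqrt U)"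
proof (induction n)
  case 0 then show ?case by simp
next
  case (Suc n)
  let ?s = "r * \<rho> ^ n" and ?t = "r * \<rho> ^ Suc n"
  have s: "0 < ?s" using r by simp
  have st: "?s \<le> ?t" using r s by (simp add: mult_le_cancel_left1)
  have sub': "{-?t/2<..<?t/2} \<times> {lo ?t<..<hi ?t} \<subseteq> \<Omega>"
  proof -
    have "lo R \<le> lo ?t" "hi ?t \<le> hi R" using anti mono Suc.prems by blast+
    then have "{-?t/2<..<?t/2} \<times> {lo ?t<..<hi ?t} \<subseteq> {-R/2<..<R/2} \<times> {lo R<..<hi R}"
      using Suc.prems by (intro Sigma_mono) auto
    then show ?thesis using sub by blast
  qed
  have q: "?t / ?s = \<rho>" using s r by simp
  have "cmod (avg (-?s/2) (?s/2) (lo ?s) (hi ?s) W - avg (-?t/2) (?t/2) (lo ?t) (hi ?t) W) \<le> 2 * sqrt (?t / ?s) * sqrt U"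
    by (rule box_step[OF s st len len anti[OF st] mono[OF st] sub'])
  moreover have "cmod (avg (-r/2) (r/2) (lo r) (hi r) W - avg (-?s/2) (?s/2) (lo ?s) (hi ?s) W) \<le> n * (2 * sqrt \<rho> * sqrt U)"
    using Suc.IH Suc.prems st by linarith
  ultimately show ?case unfolding q
    using norm_triangle_ineq[of "avg (-r/2) (r/2) (lo r) (hi r) W - avg (-?s/2) (?s/2) (lo ?s) (hi ?s) W" "avg (-?s/2) (?s/2) (lo ?s) (hi ?s) W - avg (-?t/2) (?t/2) (lo ?t) (hi ?t) W"]
    by (simp add: algebra_simps)
qed

end

context room_problem
begin

lemma Jt_sqn:
  assumes "brep \<Omega> w W"
  shows "sqn lborel (\<lambda>s. indicator I s *\<^sub>R (c1 * mg (-\<epsilon>) 0 W s)) \<le> sqn lborel W"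
proof -
  have e: "-\<epsilon> \<le> 0" using \<epsilon> by simp
  have "sqn lborel (\<lambda>s. indicator I s *\<^sub>R (c1 * mg (-\<epsilon>) 0 W s)) \<le> sqn lborel (\<lambda>s. c1 * mg (-\<epsilon>) 0 W s)"
    by (rule L2_indicator_mult(2)[OF L2_cmult[OF mg_L2(1)[OF brepD(2)[OF assms] e]] I_borel])
  also have "\<dots> = (cmod c1)\<^sup>2 * sqn lborel (mg (-\<epsilon>) 0 W)" by (rule sqn_cmult)
  also have "\<dots> \<le> (cmod c1)\<^sup>2 * ((0 - -\<epsilon>) * sqn lborel W)"
    by (intro mult_left_mono mg_L2(2)[OF brepD(2)[OF assms] e]) simp
  also have "(cmod c1)\<^sup>2 = 1 / \<epsilon>"
    using \<epsilon> by (simp add: c1_def powr_minus_divide powr_half_sqrt norm_divide power_divide)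
  finally show ?thesis using \<epsilon> by simp
qed

text \<open>A square of side d adjacent to the cross section at height p is compared with that cross
  section. The marginal varies by at most d times the root of U over the length d, and normalisation
  by d removes the factor: no negative power of \<epsilon> arises here.\<close>

lemma trace_average:
  fixes \<mu> :: "real \<Rightarrow> complex"
  assumes W: "W \<in> L2 lborel" and cont: "continuous_on UNIV \<mu>" and l: "k2 - k1 = d" and p: "p = k1 \<or> p = k2"
    and ae: "AE t in lborel. t \<in> {k1<..<k2} \<longrightarrow> mg (-d/2) (d/2) (swp W) t = \<mu> t"
    and hoe: "\<And>x y. cmod (\<mu> y - \<mu> x) \<le> sqrt \<bar>y - x\<bar> * sqrt (d * U)" and U: "0 \<le> U"
  shows "cmod (avg (-d/2) (d/2) k1 k2 W - \<mu> p / complex_of_real d) \<le> sqrt U"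
proof -
  have k: "k1 < k2" using l pos by linarith
  have m: "mg (-d/2) (d/2) (swp W) \<in> borel_measurable borel"
    using mg_measurable L2_measurable[OF swp_L2(1)[OF W]] by simp
  have "cmod ((LINT t|lborel. indicator {k1<..<k2} t *\<^sub>R mg (-d/2) (d/2) (swp W) t) / complex_of_real (k2 - k1) - \<mu> p) \<le> d * sqrt U"
  proof (rule interval_average_bound[OF k cont _ ae m])
    fix x assume x: "x \<in> {k1<..<k2}"
    have "sqrt \<bar>x - p\<bar> * sqrt (d * U) \<le> sqrt d * sqrt (d * U)"
      using x p l U pos by (intro mult_right_mono) auto
    also have "\<dots> = d * sqrt U" using pos by (simp add: real_sqrt_mult)
    finally show "cmod (\<mu> x - \<mu> p) \<le> d * sqrt U" using hoe[of x p] by linarith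
  qed
  then have "cmod ((LINT t|lborel. indicator {k1<..<k2} t *\<^sub>R mg (-d/2) (d/2) (swp W) t) / complex_of_real d - \<mu> p) / d \<le> sqrt U"
    using pos by (simp add: l pos_divide_le_eq mult.commute)
  moreover have "avg (-d/2) (d/2) k1 k2 W - \<mu> p / complex_of_real d =
     ((LINT t|lborel. indicator {k1<..<k2} t *\<^sub>R mg (-d/2) (d/2) (swp W) t) / complex_of_real d - \<mu> p) / complex_of_real d"
    unfolding avg_swap[OF W, of k1 k2 "-d/2" "d/2", symmetric] unfolding avg_def l by (simp add: diff_divide_distrib)
  ultimately show ?thesis using pos by (simp add: norm_divide)
qed

lemma passage_integral:
  assumes W: "W \<in> L2 lborel"
  shows "(LINT t|lborel. indicator {0..h} t *\<^sub>R mg (-d/2) (d/2) (swp W) t) = (LINT x|lborel. complex_of_real (indicator P x) * W x)"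
proof -
  have "(LINT t|lborel. indicator {0..h} t *\<^sub>R mg (-d/2) (d/2) (swp W) t) = (LINT t|lborel. complex_of_real (indicator {0<..<h} t) * mg (-d/2) (d/2) (swp W) t)"
  proof (rule integral_cong_AE)
    show "AE t in lborel. indicator {0..h} t *\<^sub>R mg (-d/2) (d/2) (swp W) t = complex_of_real (indicator {0<..<h} t) * mg (-d/2) (d/2) (swp W) t"
      using AE_lborel_singleton[of 0] AE_lborel_singleton[of h] by eventually_elim (auto simp: indicator_def)
  qed (use mg_measurable L2_measurable[OF swp_L2(1)[OF W]] in simp_all)
  also have "\<dots> = (LINT x|lborel. complex_of_real (indicator {0<..<h} (fst x)) * complex_of_real (indicator {-d/2<..<d/2} (snd x)) * swp W x)"
    by (rule mg_integral(1)[OF swp_L2(1)[OF W] indicator_Ioo_L2, symmetric])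
  also have "\<dots> = (LINT x|lborel. (\<lambda>x. complex_of_real (indicator P x) * W x) (snd x, fst x))"
    by (intro Bochner_Integration.integral_cong refl) (auto simp: P_eq indicator_def)
  also have "\<dots> = (LINT x|lborel. complex_of_real (indicator P x) * W x)"
    by (rule swap_plane(2)) (use L2_measurable[OF W] borels(2) in simp)
  finally show ?thesis .
qed

text \<open>The integral of the vertical derivative over the passage is the difference of the
  cross-sectional integrals \<mu> at the openings, and d / h = \<gamma> \<epsilon>. With A the
  difference of the means plus \<epsilon>^(-1/2) m(0), the quantity to be bounded is \<gamma>
  \<epsilon> A, so a bound of order \<epsilon>^(-\<beta>) for A is enough.\<close>

theorem key_estimate:
  assumes w: "w \<in> H1 \<Omega>" and W2: "brep \<Omega> (E.D (0, 1) w) W2"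
    and U: "sqn ME w \<le> U" "sqn ME (E.D (1, 0) w) \<le> U" "sqn ME (E.D (0, 1) w) \<le> U"
    and n: "0 < n" "\<alpha> + 1 \<le> 2 * \<beta> * real n"
  shows "cmod ((LINT x|lborel. complex_of_real (indicator P x) * W2 x) / complex_of_real h + complex_of_real (\<gamma> * sqrt \<epsilon>) * point_value I (fst (Jt w)) 0)
     \<le> \<gamma> * (4 + 4 * real n * max 1 (1 / \<gamma>)) * \<epsilon> powr (1 - \<beta>) * sqrt U"
proof -
  have b1: "(1, 0) \<in> (Basis :: (real \<times> real) set)" and b2: "(0, 1) \<in> (Basis :: (real \<times> real) set)" by (simp_all add: Basis_plane)
  obtain W where W: "brep \<Omega> w W" using brep_ex[OF borels(4) H1_L2[OF w]] by blast
  obtain W1 where W1: "brep \<Omega> (E.D (1, 0) w) W1" using brep_ex[OF borels(4) weak_deriv_works(1)[OF w b1]] by blast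
  note wd1 = weak_deriv_works(2)[OF w b1] and wd2 = weak_deriv_works(2)[OF w b2]
  have U0: "0 \<le> U" using U(1) sqn_nonneg[of ME w] by linarith
  have UW: "sqn lborel W \<le> U" "sqn lborel W1 \<le> U" "sqn lborel W2 \<le> U"
    using U brep_sqn[OF W borels(4)] brep_sqn[OF W1 borels(4)] brep_sqn[OF W2 borels(4)] by auto
  \<comment> \<open>The cost of one chain of n steps, with the ratio already bounded by
    \<open>powr_root_bound\<close>.\<close>
  define X where "X = n * (2 * (max 1 (1 / \<gamma>) * \<epsilon> powr (-\<beta>)) * sqrt U)"
  \<comment> \<open>The functions \<open>lo\<close> and \<open>hi\<close> place the squares: hanging
    from height 0 into the strip, or standing on height h in the room.\<close>
  have chain: "cmod (avg (-d/2) (d/2) (lo d) (hi d) W - avg (-R/2) (R/2) (lo R) (hi R) W) \<le> X"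
    if R: "d \<le> R" "R \<le> 1" and lh: "\<And>s. hi s - lo s = s" "\<And>s t. s \<le> t \<Longrightarrow> lo t \<le> lo s" "\<And>s t. s \<le> t \<Longrightarrow> hi s \<le> hi t"
      and sub: "{-R/2<..<R/2} \<times> {lo R<..<hi R} \<subseteq> \<Omega>" for R and lo hi :: "real \<Rightarrow> real"
  proof -
    \<comment> \<open>The ratio for which n steps lead exactly from side d to side R.\<close>
    define \<rho> where "\<rho> = (R / d) powr (1 / n)"
    have R0: "0 < R" using R pos by linarith
    have \<rho>1: "1 \<le> \<rho>" unfolding \<rho>_def using R pos by (intro ge_one_powr_ge_zero) auto
    have dR: "d * \<rho> ^ n = R"
    proof -
      have "\<rho> ^ n = \<rho> powr real n" using \<rho>1 by (simp add: powr_realpow)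
      also have "\<dots> = R / d" unfolding \<rho>_def powr_powr using n R0 pos by simp
      finally show ?thesis using pos by simp
    qed
    have "cmod (avg (-d/2) (d/2) (lo d) (hi d) W - avg (-R/2) (R/2) (lo R) (hi R) W) \<le> n * (2 * sqrt \<rho> * sqrt U)"
      using box_chain[OF opens(4) W W1 W2 wd1 wd2 UW(2,3) pos(1) \<rho>1 lh sub, of n] unfolding dR by simp
    also have "\<dots> \<le> X" unfolding X_def
      using powr_root_bound[OF \<epsilon>(1,3) \<gamma> n(1) n(2) R0 R(2)] U0
      by (intro mult_left_mono mult_right_mono) (auto simp: \<rho>_def d_def)
    finally show ?thesis .
  qed
  have e1: "\<epsilon> \<le> 1" "b \<le> 1" "d \<le> \<epsilon>" using \<epsilon> pos by auto
  have subS: "{-\<epsilon>/2<..<\<epsilon>/2} \<times> {-\<epsilon><..<0} \<subseteq> \<Omega>"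
  proof -
    have "{-\<epsilon>/2<..<\<epsilon>/2} \<subseteq> {-\<epsilon>..\<epsilon>}" using \<epsilon> by auto
    then have "{-\<epsilon>/2<..<\<epsilon>/2} \<times> {-\<epsilon><..<0} \<subseteq> S" using interval_in_I unfolding S_eq by blast
    then show ?thesis using parts_subset(1) by blast
  qed
  have chainS: "cmod (avg (-d/2) (d/2) (-d) 0 W - avg (-\<epsilon>/2) (\<epsilon>/2) (-\<epsilon>) 0 W) \<le> X"
    by (rule chain[OF e1(3) e1(1), where lo = "\<lambda>s. -s" and hi = "\<lambda>s. 0"]) (use subS in auto)
  have subR: "{-b/2<..<b/2} \<times> {h<..<h+b} \<subseteq> \<Omega>" using parts_subset(3) by (simp add: R_eq)
  have chainR: "cmod (avg (-d/2) (d/2) h (h + d) W - avg (-b/2) (b/2) h (h + b) W) \<le> X"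
    by (rule chain[OF pos(5) e1(2), where lo = "\<lambda>s. h" and hi = "\<lambda>s. h + s"]) (use subR in auto)
  \<comment> \<open>The derivative is taken on the whole channel, so a single continuous \<mu>
    represents the cross sections in strip, passage and room at once.\<close>
  have rd: "rect_deriv (-\<epsilon>) (h + b) (-d/2) (d/2) (swp W) (swp W2)"
    by (rule H1_rect_deriv(2)[OF opens(4) W channel_subset W2 wd2])
  have len: "-\<epsilon> < h + b" "-d/2 < d/2" using pos \<epsilon> by linarith+
  have dl: "d/2 - (-d/2) = d" by simp
  obtain \<mu> where \<mu>: "continuous_on UNIV \<mu>" "AE s in lborel. s \<in> {-\<epsilon><..<h + b} \<longrightarrow> mg (-d/2) (d/2) (swp W) s = \<mu> s"
    "\<And>x y. x \<le> y \<Longrightarrow> \<mu> y - \<mu> x = (LINT t|lborel. indicator {x..y} t *\<^sub>R mg (-d/2) (d/2) (swp W2) t)"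
    "\<And>x y. cmod (\<mu> y - \<mu> x) \<le> sqrt \<bar>y - x\<bar> * sqrt ((d/2 - (-d/2)) * sqn lborel (swp W2))"
    using rect_deriv_rep[OF rd len] by blast
  have hoe: "cmod (\<mu> y - \<mu> x) \<le> sqrt \<bar>y - x\<bar> * sqrt (d * U)" for x y
  proof -
    have "sqrt \<bar>y - x\<bar> * sqrt ((d/2 - (-d/2)) * sqn lborel (swp W2)) \<le> sqrt \<bar>y - x\<bar> * sqrt (d * U)"
      unfolding dl swp_L2(2)[OF brepD(2)[OF W2]] using UW(3) pos by (intro mult_left_mono real_sqrt_le_mono) auto
    then show ?thesis using \<mu>(4)[of y x] by linarith
  qed
  have PE: "(LINT x|lborel. complex_of_real (indicator P x) * W2 x) = \<mu> h - \<mu> 0"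
    using \<mu>(3)[of 0 h] passage_integral[OF brepD(2)[OF W2]] pos by simp
  have trS: "cmod (avg (-d/2) (d/2) (-d) 0 W - \<mu> 0 / complex_of_real d) \<le> sqrt U"
    by (rule trace_average[OF brepD(2)[OF W] \<mu>(1) _ _ _ hoe U0]) (use \<mu>(2) pos in \<open>auto elim!: eventually_mono\<close>)
  have trR: "cmod (avg (-d/2) (d/2) h (h + d) W - \<mu> h / complex_of_real d) \<le> sqrt U"
    by (rule trace_average[OF brepD(2)[OF W] \<mu>(1) _ _ _ hoe U0]) (use \<mu>(2) pos \<epsilon> in \<open>auto elim!: eventually_mono\<close>)
  \<comment> \<open>Cauchy-Schwarz on a square of side b: the mean is at most the norm divided by b
    = \<epsilon>^\<beta>. This loss has the same order as that of the chains.\<close>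
  have room: "cmod (avg (-b/2) (b/2) h (h + b) W) \<le> \<epsilon> powr (-\<beta>) * sqrt U"
  proof -
    have "cmod (avg (-b/2) (b/2) h (h + b) W) \<le> sqrt (sqn lborel W) / sqrt ((b/2 - (-b/2)) * (h + b - h))"
      by (rule avg_bound[OF brepD(2)[OF W]]) (use pos in auto)
    also have "\<dots> = sqrt (sqn lborel W) / b" using pos by simp
    also have "\<dots> \<le> sqrt U / b" using UW(1) pos by (intro divide_right_mono) auto
    also have "\<dots> = \<epsilon> powr (-\<beta>) * sqrt U" by (simp add: b_def powr_minus_divide)
    finally show ?thesis .
  qed
  note m = Jt_H1[OF w W1]
  obtain g where g: "continuous_on UNIV g" "AE x in lborel. x \<in> I \<longrightarrow> fst (Jt w) x = g x" "point_value I (fst (Jt w)) 0 = g 0"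
    "\<And>x y. cmod (g y - g x) \<le> sqrt \<bar>y - x\<bar> * sqrt (sqn M0 (D0 (fst (Jt w))))"
    using H1_rep[OF m(1)] I_0 by blast
  have sD: "sqn M0 (D0 (fst (Jt w))) \<le> U"
    using Jt_sqn[OF W1] UW(2) brep_sqn[OF m(2) I_borel] by simp
  have c1e: "c1 = complex_of_real (1 / sqrt \<epsilon>)" using \<epsilon> by (simp add: c1_def powr_minus_divide powr_half_sqrt)
  \<comment> \<open>The mean over the square of side \<epsilon> is \<epsilon>^(-1/2) times the mean
    of the first component of \<open>Jt w\<close> over an interval of length \<epsilon>; Hoelder
    continuity of order 1/2 of that component compensates the factor.\<close>
  have strip: "cmod (avg (-\<epsilon>/2) (\<epsilon>/2) (-\<epsilon>) 0 W - g 0 / complex_of_real (sqrt \<epsilon>)) \<le> sqrt U"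
  proof -
    have e2: "-\<epsilon>/2 < \<epsilon>/2" using \<epsilon> by simp
    have "cmod ((LINT s|lborel. indicator {-\<epsilon>/2<..<\<epsilon>/2} s *\<^sub>R (c1 * mg (-\<epsilon>) 0 W s)) / complex_of_real (\<epsilon>/2 - (-\<epsilon>/2)) - g 0) \<le> sqrt \<epsilon> * sqrt U"
    proof (rule interval_average_bound[OF e2 g(1)])
      fix x assume x: "x \<in> {-\<epsilon>/2<..<\<epsilon>/2}"
      have "sqrt \<bar>x - 0\<bar> * sqrt (sqn M0 (D0 (fst (Jt w)))) \<le> sqrt \<epsilon> * sqrt U"
        using x sD \<epsilon> by (intro mult_mono) auto
      then show "cmod (g x - g 0) \<le> sqrt \<epsilon> * sqrt U" using g(4)[of x 0] by linarith
    next
      show "AE s in lborel. s \<in> {-\<epsilon>/2<..<\<epsilon>/2} \<longrightarrow> c1 * mg (-\<epsilon>) 0 W s = g s"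
        using g(2) brepD(4)[OF Jt_brep(1)[OF W]]
      proof eventually_elim
        case (elim s)
        show ?case
        proof
          assume "s \<in> {-\<epsilon>/2<..<\<epsilon>/2}"
          then have "s \<in> {-\<epsilon>..\<epsilon>}" using \<epsilon> by auto
          then have "s \<in> I" using interval_in_I by blast
          then show "c1 * mg (-\<epsilon>) 0 W s = g s" using elim by simp
        qed
      qed
      show "(\<lambda>s. c1 * mg (-\<epsilon>) 0 W s) \<in> borel_measurable borel" using mg_measurable[OF brepD(1)[OF W]] by simp
    qed
    moreover have "(LINT s|lborel. indicator {-\<epsilon>/2<..<\<epsilon>/2} s *\<^sub>R (c1 * mg (-\<epsilon>) 0 W s)) / complex_of_real (\<epsilon>/2 - (-\<epsilon>/2))
        = complex_of_real (sqrt \<epsilon>) * avg (-\<epsilon>/2) (\<epsilon>/2) (-\<epsilon>) 0 W"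
    proof -
      define Z where "Z = (LINT s|lborel. indicator {-\<epsilon>/2<..<\<epsilon>/2} s *\<^sub>R mg (-\<epsilon>) 0 W s)"
      have "(LINT s|lborel. indicator {-\<epsilon>/2<..<\<epsilon>/2} s *\<^sub>R (c1 * mg (-\<epsilon>) 0 W s)) = (LINT s|lborel. c1 * (indicator {-\<epsilon>/2<..<\<epsilon>/2} s *\<^sub>R mg (-\<epsilon>) 0 W s))"
        by simp
      also have "\<dots> = c1 * Z" unfolding Z_def by (simp only: integral_mult_right_zero)
      finally have "(LINT s|lborel. indicator {-\<epsilon>/2<..<\<epsilon>/2} s *\<^sub>R (c1 * mg (-\<epsilon>) 0 W s)) / complex_of_real (\<epsilon>/2 - (-\<epsilon>/2)) = c1 * Z / complex_of_real \<epsilon>" by simp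
      also have "\<dots> = complex_of_real (1 / sqrt \<epsilon> / \<epsilon>) * Z" by (simp add: c1e)
      also have "1 / sqrt \<epsilon> / \<epsilon> = sqrt \<epsilon> * (1 / (\<epsilon> * \<epsilon>))" using \<epsilon> by (simp add: field_simps)
      also have "complex_of_real (sqrt \<epsilon> * (1 / (\<epsilon> * \<epsilon>))) * Z = complex_of_real (sqrt \<epsilon>) * avg (-\<epsilon>/2) (\<epsilon>/2) (-\<epsilon>) 0 W"
        by (simp add: avg_def Z_def)
      finally show ?thesis .
    qed
    ultimately have *: "cmod (complex_of_real (sqrt \<epsilon>) * avg (-\<epsilon>/2) (\<epsilon>/2) (-\<epsilon>) 0 W - g 0) \<le> sqrt \<epsilon> * sqrt U" by simp
    have "complex_of_real (sqrt \<epsilon>) * avg (-\<epsilon>/2) (\<epsilon>/2) (-\<epsilon>) 0 W - g 0 = complex_of_real (sqrt \<epsilon>) * (avg (-\<epsilon>/2) (\<epsilon>/2) (-\<epsilon>) 0 W - g 0 / complex_of_real (sqrt \<epsilon>))"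
      using \<epsilon> by (simp add: field_simps)
    then have "sqrt \<epsilon> * cmod (avg (-\<epsilon>/2) (\<epsilon>/2) (-\<epsilon>) 0 W - g 0 / complex_of_real (sqrt \<epsilon>)) \<le> sqrt \<epsilon> * sqrt U"
      using * \<epsilon> by (simp add: norm_mult)
    then show ?thesis using \<epsilon> by simp
  qed
  define A where "A = \<mu> h / complex_of_real d - \<mu> 0 / complex_of_real d + g 0 / complex_of_real (sqrt \<epsilon>)"
  have "cmod A \<le> 3 * sqrt U + 2 * X + \<epsilon> powr (-\<beta>) * sqrt U"
  proof -
    have tri: "cmod (- x + y + z + u - v - t) \<le> cmod x + cmod y + cmod z + cmod u + cmod v + cmod t" for x y z u v t :: complex
      using norm_triangle_ineq4[of "- x + y + z + u - v" t] norm_triangle_ineq4[of "- x + y + z + u" v] norm_triangle_ineq[of "- x + y + z" u]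
        norm_triangle_ineq[of "- x + y" z] norm_triangle_ineq[of "- x" y] norm_minus_cancel[of x] by linarith
    let ?aS = "avg (-d/2) (d/2) (-d) 0 W" and ?aE = "avg (-\<epsilon>/2) (\<epsilon>/2) (-\<epsilon>) 0 W"
      and ?aR = "avg (-d/2) (d/2) h (h + d) W" and ?aB = "avg (-b/2) (b/2) h (h + b) W"
    \<comment> \<open>Telescoping from the upper opening through its square and the room, and from
      the lower opening through its square to the square of side \<epsilon> in the strip.\<close>
    have "A = - (?aR - \<mu> h / complex_of_real d) + (?aR - ?aB) + ?aB + (?aS - \<mu> 0 / complex_of_real d) - (?aS - ?aE) - (?aE - g 0 / complex_of_real (sqrt \<epsilon>))"
      by (simp add: A_def)
    then have "cmod A \<le> cmod (?aR - \<mu> h / complex_of_real d) + cmod (?aR - ?aB) + cmod ?aB + cmod (?aS - \<mu> 0 / complex_of_real d) + cmod (?aS - ?aE) + cmod (?aE - g 0 / complex_of_real (sqrt \<epsilon>))"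
      by (simp only: tri)
    also have "\<dots> \<le> sqrt U + X + \<epsilon> powr (-\<beta>) * sqrt U + sqrt U + X + sqrt U"
      by (rule add_mono[OF add_mono[OF add_mono[OF add_mono[OF add_mono[OF trR chainR] room] trS] chainS] strip])
    also have "\<dots> = 3 * sqrt U + 2 * X + \<epsilon> powr (-\<beta>) * sqrt U" by simp
    finally show ?thesis .
  qed
  also have "\<dots> \<le> (4 + 4 * real n * max 1 (1 / \<gamma>)) * \<epsilon> powr (-\<beta>) * sqrt U"
  proof -
    have "1 \<le> \<epsilon> powr (-\<beta>)" using \<epsilon> \<beta> by (simp add: powr_minus_divide powr_le1)
    then have "1 * sqrt U \<le> \<epsilon> powr (-\<beta>) * sqrt U" using U0 by (intro mult_right_mono) auto
    then have "3 * sqrt U + 2 * X + \<epsilon> powr (-\<beta>) * sqrt U \<le> 4 * (\<epsilon> powr (-\<beta>) * sqrt U) + 2 * X" by linarith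
    also have "\<dots> = (4 + 4 * real n * max 1 (1 / \<gamma>)) * \<epsilon> powr (-\<beta>) * sqrt U"
      unfolding X_def distrib_right by (simp only: mult.assoc mult.left_commute)
    finally show ?thesis .
  qed
  finally have A: "cmod A \<le> (4 + 4 * real n * max 1 (1 / \<gamma>)) * \<epsilon> powr (-\<beta>) * sqrt U" .
  \<comment> \<open>The scaling of the passage enters only through this ratio; it is why the
    strength of the limiting interaction is \<gamma>.\<close>
  have dh: "d / h = \<gamma> * \<epsilon>" using \<epsilon> by (simp add: d_def h_def powr_add)
  have "(\<mu> h - \<mu> 0) / complex_of_real h + complex_of_real (\<gamma> * sqrt \<epsilon>) * g 0 = complex_of_real (\<gamma> * \<epsilon>) * A"
  proof -
    have "complex_of_real (\<gamma> * \<epsilon>) * (\<mu> h / complex_of_real d - \<mu> 0 / complex_of_real d) = complex_of_real (d / h / d) * (\<mu> h - \<mu> 0)"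
      unfolding dh[symmetric] using pos by (simp add: diff_divide_distrib[symmetric])
    also have "d / h / d = 1 / h" using pos by simp
    finally have 1: "complex_of_real (\<gamma> * \<epsilon>) * (\<mu> h / complex_of_real d - \<mu> 0 / complex_of_real d) = (\<mu> h - \<mu> 0) / complex_of_real h" by simp
    have "complex_of_real (\<gamma> * \<epsilon>) * (g 0 / complex_of_real (sqrt \<epsilon>)) = complex_of_real (\<gamma> * \<epsilon> / sqrt \<epsilon>) * g 0" by simp
    also have "\<gamma> * \<epsilon> / sqrt \<epsilon> = \<gamma> * sqrt \<epsilon>" using real_div_sqrt[of \<epsilon>] \<epsilon> by (simp add: times_divide_eq_right[symmetric] del: times_divide_eq_right)
    finally show ?thesis using 1 unfolding A_def distrib_left by simp
  qed
  then have "cmod ((\<mu> h - \<mu> 0) / complex_of_real h + complex_of_real (\<gamma> * sqrt \<epsilon>) * g 0) = \<gamma> * \<epsilon> * cmod A"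
    using \<gamma> \<epsilon> by (simp add: norm_mult)
  also have "\<dots> \<le> \<gamma> * \<epsilon> * ((4 + 4 * real n * max 1 (1 / \<gamma>)) * \<epsilon> powr (-\<beta>) * sqrt U)"
    using A \<gamma> \<epsilon> by (intro mult_left_mono) auto
  also have "\<dots> = \<gamma> * (4 + 4 * real n * max 1 (1 / \<gamma>)) * (\<epsilon> powr 1 * \<epsilon> powr (-\<beta>)) * sqrt U" using \<epsilon> by simp
  also have "\<epsilon> powr 1 * \<epsilon> powr (-\<beta>) = \<epsilon> powr (1 - \<beta>)" by (simp only: powr_add[symmetric]) simp
  finally show ?thesis unfolding PE g(3) .
qed

end

lemma L2_dominated:
  assumes "f \<in> borel_measurable M" "H \<in> L2 M" "AE x in M. cmod (f x) \<le> cmod (H x)"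
  shows "f \<in> L2 M"
proof (rule L2I[OF assms(1)])
  show "integrable M (\<lambda>x. (cmod (f x))\<^sup>2)"
  proof (rule Bochner_Integration.integrable_bound[OF L2_integrable[OF assms(2)]])
    show "AE x in M. norm ((cmod (f x))\<^sup>2) \<le> norm ((cmod (H x))\<^sup>2)"
      using assms(3) by eventually_elim (auto intro: power_mono)
  qed (use assms(1) in simp)
qed

lemma frechet_section:
  fixes \<phi> :: "real \<times> real \<Rightarrow> complex"
  assumes "\<phi> \<in> test_functions \<Omega>"
  shows "frechet_derivative (\<lambda>s. \<phi> (s, t)) (at s) 1 = frechet_derivative \<phi> (at (s, t)) (1, 0)"
    "frechet_derivative (\<lambda>t. \<phi> (s, t)) (at t) 1 = frechet_derivative \<phi> (at (s, t)) (0, 1)"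
proof -
  have d: "(\<phi> has_derivative frechet_derivative \<phi> (at x)) (at x)" for x
    using test_differentiable[OF assms] frechet_derivative_works by blast
  have 1: "((\<lambda>s. (s, t)) has_derivative (\<lambda>h. (h, 0))) (at s)" by (auto intro!: derivative_eq_intros)
  have 2: "((\<lambda>t. (s, t)) has_derivative (\<lambda>h. (0, h))) (at t)" by (auto intro!: derivative_eq_intros)
  show "frechet_derivative (\<lambda>s. \<phi> (s, t)) (at s) 1 = frechet_derivative \<phi> (at (s, t)) (1, 0)"
    using frechet_derivative_eq[OF has_derivative_compose[OF 1 d]] by simp
  show "frechet_derivative (\<lambda>t. \<phi> (s, t)) (at t) 1 = frechet_derivative \<phi> (at (s, t)) (0, 1)"
    using frechet_derivative_eq[OF has_derivative_compose[OF 2 d]] by simp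
qed

context room_problem
begin

subsection \<open>The trial function\<close>

text \<open>The derivative of the profile \<open>cut\<close>, which is 1 up to height 0, linear
  across the passage and 0 from height h on. Defining \<open>cut\<close> as a primitive of this step
  function lets \<open>prim_by_parts\<close> supply its weak derivative without a discussion of the
  kinks.\<close>

definition slope :: "real \<Rightarrow> complex" where
  "slope t = complex_of_real (- 1 / h) * complex_of_real (indicator {0<..<h} t)"

definition cut :: "real \<Rightarrow> complex" where
  "cut t = 1 + prim slope 0 t"

lemma slope_L2: "slope \<in> L2 lborel" "slope \<in> borel_measurable borel"
proof -
  show L: "slope \<in> L2 lborel" unfolding slope_def[abs_def] by (rule L2_cmult[OF indicator_Ioo_L2])
  show "slope \<in> borel_measurable borel" using L2_measurable[OF L] by simp
qed

lemma cut_continuous: "continuous_on UNIV cut"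
  unfolding cut_def[abs_def] by (intro continuous_intros prim_continuous slope_L2)

lemma cut_diff: "x \<le> y \<Longrightarrow> cut y - cut x = (LINT t|lborel. indicator {x..y} t *\<^sub>R slope t)"
  using prim_diff[OF slope_L2(1), of x y 0] by (simp add: cut_def)

lemma cut_0: "cut 0 = 1" by (simp add: cut_def prim_def)

lemma cut_below: "t \<le> 0 \<Longrightarrow> cut t = 1"
proof -
  assume t: "t \<le> 0"
  have "(LINT s|lborel. indicator {t..0} s *\<^sub>R slope s) = integral\<^sup>L lborel (\<lambda>s::real. 0)"
    by (rule Bochner_Integration.integral_cong) (auto simp: slope_def indicator_def)
  then show ?thesis using cut_diff[OF t] cut_0 by simp
qed

lemma cut_middle:
  assumes "0 \<le> t" "t \<le> h" shows "cut t = complex_of_real (1 - t / h)"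
proof -
  have "(LINT s|lborel. indicator {0..t} s *\<^sub>R slope s) = (LINT s|lborel. complex_of_real (- 1 / h * indicator {0..t} s))"
  proof (rule integral_cong_AE)
    show "AE s in lborel. indicator {0..t} s *\<^sub>R slope s = complex_of_real (- 1 / h * indicator {0..t} s)"
      using AE_lborel_singleton[of 0] AE_lborel_singleton[of h]
      by eventually_elim (use assms in \<open>auto simp: slope_def indicator_def\<close>)
  qed (use slope_L2 in auto)
  also have "\<dots> = complex_of_real (LINT s|lborel. - 1 / h * indicator {0..t} s)"
    by (rule integral_complex_of_real)
  also have "(LINT s|lborel. - 1 / h * indicator {0..t} s) = - t / h" using assms by simp
  finally show ?thesis using cut_diff[OF assms(1)] cut_0 by (simp add: algebra_simps)
qed

lemma cut_above: "h \<le> t \<Longrightarrow> cut t = 0"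
proof -
  assume t: "h \<le> t"
  have "(LINT s|lborel. indicator {h..t} s *\<^sub>R slope s) = integral\<^sup>L lborel (\<lambda>s::real. 0)"
    by (rule Bochner_Integration.integral_cong) (auto simp: slope_def indicator_def)
  then have "cut t = cut h" using cut_diff[OF t] by simp
  also have "cut h = 0" using cut_middle[of h] pos by simp
  finally show ?thesis .
qed

lemma cut_bounds: "cmod (cut t) \<le> 1" "cmod (1 - cut t) \<le> 1"
proof -
  consider "t \<le> 0" | "0 \<le> t" "t \<le> h" | "h \<le> t" by linarith
  then have "cmod (cut t) \<le> 1 \<and> cmod (1 - cut t) \<le> 1"
  proof cases
    case 1 then show ?thesis by (simp add: cut_below)
  next
    case 2
    then have r: "0 \<le> t / h" "t / h \<le> 1" using pos by auto
    have "1 - cut t = complex_of_real (t / h)" using cut_middle[OF 2] by simp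
    then have "cmod (1 - cut t) = t / h" using r by (simp only: norm_of_real abs_of_nonneg)
    moreover have "cmod (cut t) = 1 - t / h" using r unfolding cut_middle[OF 2] by (simp only: norm_of_real abs_of_nonneg diff_ge_0_iff_ge)
    ultimately show ?thesis using r by simp
  next
    case 3 then show ?thesis by (simp add: cut_above)
  qed
  then show "cmod (cut t) \<le> 1" "cmod (1 - cut t) \<le> 1" by auto
qed

text \<open>The strip may have infinite area, so the constant k is square integrable only because q
  vanishes at heights t \<le> 0; the remaining support has finite area. The other summand inherits
  integrability from A, the heights being bounded.\<close>

lemma tensor_on_domain_L2:
  fixes A p q :: "real \<Rightarrow> complex"
  assumes A: "A \<in> L2 lborel" and m: "p \<in> borel_measurable borel" "q \<in> borel_measurable borel"
    and b: "\<And>t. cmod (p t) \<le> B" "\<And>t. cmod (q t) \<le> B" and z: "\<And>t. h \<le> t \<Longrightarrow> p t = 0" "\<And>t. t \<le> 0 \<Longrightarrow> q t = 0"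
  shows "(\<lambda>x. indicator \<Omega> x *\<^sub>R (A (fst x) * p (snd x) + k * q (snd x))) \<in> L2 lborel"
proof (rule L2_dominated)
  have Am: "A \<in> borel_measurable borel" using L2_measurable[OF A] by simp
  have AB: "(\<lambda>s. complex_of_real (B * cmod (A s))) \<in> L2 lborel"
  proof (rule L2_dominated[OF _ L2_cmult[OF A, of "complex_of_real B"]])
    show "(\<lambda>s. complex_of_real (B * cmod (A s))) \<in> borel_measurable lborel" using Am by simp
  qed (simp add: norm_mult)
  have PR: "P \<union> R \<in> sets borel" using borels by simp
  have fin: "emeasure lborel (P \<union> R) < \<infinity>"
  proof -
    have "emeasure lborel (P \<union> R) \<le> emeasure lborel P + emeasure lborel R"
      using borels by (intro emeasure_subadditive) auto
    also have "\<dots> < \<infinity>" using P_finite R_finite by simp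
    finally show ?thesis .
  qed
  show "(\<lambda>x. complex_of_real (B * cmod (A (fst x))) * complex_of_real (indicator {-\<epsilon><..<h} (snd x)) + complex_of_real (B * cmod k) * complex_of_real (indicator (P \<union> R) x)) \<in> L2 lborel"
    by (intro L2_lc tensor_L2[OF AB indicator_Ioo_L2] indicator_L2(1) PR fin)
  show "(\<lambda>x. indicator \<Omega> x *\<^sub>R (A (fst x) * p (snd x) + k * q (snd x))) \<in> borel_measurable lborel"
    using measurable_plane(1)[OF Am m(1)] measurable_plane(2)[OF Am m(1)] measurable_plane(2)[OF Am m(2)] borels(4) by simp
  have B0: "0 \<le> B" using b(1)[of 0] norm_ge_zero order_trans by blast
  show "AE x in lborel. cmod (indicator \<Omega> x *\<^sub>R (A (fst x) * p (snd x) + k * q (snd x)))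
    \<le> cmod (complex_of_real (B * cmod (A (fst x))) * complex_of_real (indicator {-\<epsilon><..<h} (snd x)) + complex_of_real (B * cmod k) * complex_of_real (indicator (P \<union> R) x))"
    using AE_parts
  proof eventually_elim
    case (elim x)
    have rhs: "cmod (complex_of_real (B * cmod (A (fst x))) * complex_of_real (indicator {-\<epsilon><..<h} (snd x)) + complex_of_real (B * cmod k) * complex_of_real (indicator (P \<union> R) x))
      = B * cmod (A (fst x)) * indicator {-\<epsilon><..<h} (snd x) + B * cmod k * indicator (P \<union> R) x"
      using B0 by (simp only: of_real_mult[symmetric] of_real_add[symmetric] norm_of_real) simp
    show ?case
    proof (cases "x \<in> \<Omega>")
      case False then show ?thesis by simp
    next
      case True
      have 1: "cmod (A (fst x) * p (snd x)) \<le> B * cmod (A (fst x)) * indicator {-\<epsilon><..<h} (snd x)"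
      proof (cases "snd x < h")
        case True
        have "-\<epsilon> < snd x" using elim \<open>x \<in> \<Omega>\<close> pos \<epsilon> by (auto simp: S_eq P_eq R_eq)
        then show ?thesis using True mult_left_mono[OF b(1)[of "snd x"], of "cmod (A (fst x))"] by (simp add: norm_mult mult.commute)
      next
        case False
        then show ?thesis using z(1)[of "snd x"] B0 by simp
      qed
      have 2: "cmod (k * q (snd x)) \<le> B * cmod k * indicator (P \<union> R) x"
      proof (cases "x \<in> P \<union> R")
        case True
        then show ?thesis using mult_left_mono[OF b(2)[of "snd x"], of "cmod k"] by (simp add: norm_mult mult.commute)
      next
        case False
        then have "snd x \<le> 0" using elim \<open>x \<in> \<Omega>\<close> by (auto simp: S_eq)
        then show ?thesis using z(2)[of "snd x"] B0 by simp
      qed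
      show ?thesis unfolding rhs using True norm_triangle_ineq[of "A (fst x) * p (snd x)" "k * q (snd x)"] 1 2 by simp
    qed
  qed
qed

lemma Omega_measurable_AE:
  fixes Z :: "real \<times> real \<Rightarrow> complex"
  assumes "(\<lambda>x. indicator \<Omega> x *\<^sub>R Z x) \<in> L2 lborel"
  shows "brep \<Omega> Z (\<lambda>x. indicator \<Omega> x *\<^sub>R Z x)"
  unfolding brep_def using assms L2_measurable[OF assms] by auto

text \<open>Both derivatives are verified on lines by Fubini's theorem: horizontally the profile is
  a constant factor, vertically G is one. G is extended by 0 outside I, which is harmless because
  \<open>cut\<close> vanishes wherever \<Omega> may extend beyond I.\<close>

lemma trial_function:
  fixes g2 :: complex
  assumes g: "g1 \<in> H1 I" and G: "brep I g1 G" and W: "brep I (D0 g1) W'"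
  defines "v \<equiv> \<lambda>x. c1 * G (fst x) * cut (snd x) + c2 * g2 * (1 - cut (snd x))"
  shows "v \<in> H1 \<Omega>" "brep \<Omega> v (\<lambda>x. indicator \<Omega> x *\<^sub>R v x)"
    "brep \<Omega> (E.D (1, 0) v) (\<lambda>x. indicator \<Omega> x *\<^sub>R (c1 * W' (fst x) * cut (snd x)))"
    "brep \<Omega> (E.D (0, 1) v) (\<lambda>x. indicator \<Omega> x *\<^sub>R (slope (snd x) * (c1 * G (fst x) - c2 * g2)))"
proof -
  have b: "(1::real) \<in> Basis" and b1: "(1, 0) \<in> (Basis :: (real \<times> real) set)" and b2: "(0, 1) \<in> (Basis :: (real \<times> real) set)"
    by (simp_all add: Basis_plane)
  have cm: "cut \<in> borel_measurable borel" by (rule borel_measurable_continuous_onI[OF cut_continuous])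
  have cm': "(\<lambda>t. 1 - cut t) \<in> borel_measurable borel" using cm by simp
  have sb: "cmod (slope t) \<le> 1 / h" for t using pos by (simp add: slope_def indicator_def norm_divide)
  have vL: "(\<lambda>x. indicator \<Omega> x *\<^sub>R v x) \<in> L2 lborel"
    using tensor_on_domain_L2[OF L2_cmult[OF brepD(2)[OF G], of c1] cm cm' cut_bounds cut_above, of "c2 * g2"] cut_below
    by (simp add: v_def)
  let ?v1 = "\<lambda>x. c1 * W' (fst x) * cut (snd x)" and ?v2 = "\<lambda>x. slope (snd x) * (c1 * G (fst x) - c2 * g2)"
  have v1L: "(\<lambda>x. indicator \<Omega> x *\<^sub>R ?v1 x) \<in> L2 lborel"
    using tensor_on_domain_L2[OF L2_cmult[OF brepD(2)[OF W], of c1] cm cm' cut_bounds cut_above, of 0] cut_below by simp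
  have v2L: "(\<lambda>x. indicator \<Omega> x *\<^sub>R ?v2 x) \<in> L2 lborel"
  proof -
    have "(\<lambda>x. indicator \<Omega> x *\<^sub>R (c1 * G (fst x) * slope (snd x) + - c2 * g2 * slope (snd x))) \<in> L2 lborel"
      by (rule tensor_on_domain_L2[OF L2_cmult[OF brepD(2)[OF G], of c1] slope_L2(2) slope_L2(2) sb sb]) (auto simp: slope_def)
    then show ?thesis by (simp add: algebra_simps)
  qed
  note vB = Omega_measurable_AE[OF vL] and v1B = Omega_measurable_AE[OF v1L] and v2B = Omega_measurable_AE[OF v2L]
  have wd1: "has_weak_deriv \<Omega> (1, 0) v ?v1"
  proof (subst has_weak_deriv_brep[OF borels(4) vB v1B b1], intro ballI)
    fix \<phi> :: "real \<times> real \<Rightarrow> complex" assume \<phi>: "\<phi> \<in> test_functions \<Omega>"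
    let ?d = "\<lambda>x. frechet_derivative \<phi> (at x) (1, 0)"
    note dt = test_deriv[OF \<phi> b1]
    have e0: "(indicator \<Omega> x *\<^sub>R v x) * ?d x = v x * ?d x" "(indicator \<Omega> x *\<^sub>R ?v1 x) * \<phi> x = ?v1 x * \<phi> x" for x
      using test_outside[OF dt, of x] test_outside[OF \<phi>, of x] by (cases "x \<in> \<Omega>"; simp)+
    have i0: "integrable lborel (\<lambda>x. v x * ?d x)" using L2_mult_integrable[OF vL test_L2_lborel[OF dt]] by (simp only: e0)
    have i1: "integrable lborel (\<lambda>x. ?v1 x * \<phi> x)" using L2_mult_integrable[OF v1L test_L2_lborel[OF \<phi>]] by (simp only: e0)
    have inner: "(LINT s|lborel. v (s, t) * ?d (s, t)) = (LINT s|lborel. - (?v1 (s, t) * \<phi> (s, t)))" for t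
    proof -
      let ?\<psi> = "\<lambda>s. \<phi> (s, t)"
      note \<psi> = test_section_fst[OF \<phi>, of t]
      have "(LINT s|lborel. v (s, t) * ?d (s, t)) = (LINT s|lborel. c1 * cut t * (G s * frechet_derivative ?\<psi> (at s) 1) + c2 * g2 * (1 - cut t) * frechet_derivative ?\<psi> (at s) 1)"
        by (simp add: v_def frechet_section(1)[OF \<phi>] algebra_simps)
      also have "\<dots> = (LINT s|lborel. c1 * cut t * (G s * frechet_derivative ?\<psi> (at s) 1)) + (LINT s|lborel. c2 * g2 * (1 - cut t) * frechet_derivative ?\<psi> (at s) 1)"
        by (rule Bochner_Integration.integral_add[OF integrable_mult_right[OF L2_mult_integrable[OF brepD(2)[OF G] test_L2_lborel[OF test_dv[OF \<psi>]]]]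
              continuous_test_integrable[OF continuous_on_const test_dv[OF \<psi>]]])
      also have "(LINT s|lborel. c2 * g2 * (1 - cut t) * frechet_derivative ?\<psi> (at s) 1) = 0"
        by (simp only: integral_mult_right_zero test_deriv_integral_zero[OF \<psi>] mult_zero_right)
      also have "(LINT s|lborel. c1 * cut t * (G s * frechet_derivative ?\<psi> (at s) 1)) = (LINT s|lborel. - (?v1 (s, t) * \<phi> (s, t)))"
      \<comment> \<open>Below h the section of \<Omega> lies in I, where G has the weak derivative
        W'. From h on the section may leave I, where G can jump, but there the factor
        \<open>cut t\<close> is 0.\<close>
      proof (cases "t < h")
        case True
        then have "{s. (s, t) \<in> \<Omega>} \<subseteq> I" using section_below by blast
        note \<psi>I = test_mono[OF \<psi> this]
        have "(LINT s|lborel. G s * frechet_derivative ?\<psi> (at s) 1) = - (LINT s|lborel. W' s * \<phi> (s, t))"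
          by (rule brep_weak_derivD[OF I_borel G W b weak_deriv_works(2)[OF g b] \<psi>I])
        then have "(LINT s|lborel. c1 * cut t * (G s * frechet_derivative ?\<psi> (at s) 1)) = - (c1 * cut t * (LINT s|lborel. W' s * \<phi> (s, t)))"
          by (simp only: integral_mult_right_zero mult_minus_right)
        also have "\<dots> = - (LINT s|lborel. c1 * cut t * (W' s * \<phi> (s, t)))" by (simp only: integral_mult_right_zero)
        also have "\<dots> = (LINT s|lborel. - (?v1 (s, t) * \<phi> (s, t)))"
          by (subst Bochner_Integration.integral_minus[symmetric]) (simp add: mult_ac)
        finally show ?thesis .
      next
        case False
        then show ?thesis by (simp add: cut_above)
      qed
      finally show ?thesis by simp
    qed
    have "(LINT x|lborel. v x * ?d x) = (LINT t|lborel. LINT s|lborel. - (?v1 (s, t) * \<phi> (s, t)))"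
      unfolding Fubini_plane(6)[OF i0] inner ..
    also have "\<dots> = - (LINT x|lborel. ?v1 x * \<phi> x)"
      unfolding Fubini_plane(6)[OF i1] by (simp only: Bochner_Integration.integral_minus)
    finally show "(LINT x|lborel. (indicator \<Omega> x *\<^sub>R v x) * ?d x) = - (LINT x|lborel. (indicator \<Omega> x *\<^sub>R ?v1 x) * \<phi> x)"
      by (simp only: e0)
  qed
  have wd2: "has_weak_deriv \<Omega> (0, 1) v ?v2"
  proof (subst has_weak_deriv_brep[OF borels(4) vB v2B b2], intro ballI)
    fix \<phi> :: "real \<times> real \<Rightarrow> complex" assume \<phi>: "\<phi> \<in> test_functions \<Omega>"
    let ?d = "\<lambda>x. frechet_derivative \<phi> (at x) (0, 1)"
    note dt = test_deriv[OF \<phi> b2]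
    have e0: "(indicator \<Omega> x *\<^sub>R v x) * ?d x = v x * ?d x" "(indicator \<Omega> x *\<^sub>R ?v2 x) * \<phi> x = ?v2 x * \<phi> x" for x
      using test_outside[OF dt, of x] test_outside[OF \<phi>, of x] by (cases "x \<in> \<Omega>"; simp)+
    have i0: "integrable lborel (\<lambda>x. v x * ?d x)" using L2_mult_integrable[OF vL test_L2_lborel[OF dt]] by (simp only: e0)
    have i1: "integrable lborel (\<lambda>x. ?v2 x * \<phi> x)" using L2_mult_integrable[OF v2L test_L2_lborel[OF \<phi>]] by (simp only: e0)
    have inner: "(LINT t|lborel. v (s, t) * ?d (s, t)) = (LINT t|lborel. - (?v2 (s, t) * \<phi> (s, t)))" for s
    proof -
      let ?\<psi> = "\<lambda>t. \<phi> (s, t)" and ?k = "c1 * G s - c2 * g2"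
      note \<psi> = test_section_snd[OF \<phi>, of s]
      have "(LINT t|lborel. v (s, t) * ?d (s, t)) = (LINT t|lborel. c1 * G s * frechet_derivative ?\<psi> (at t) 1 + ?k * (prim slope 0 t * frechet_derivative ?\<psi> (at t) 1))"
        by (simp add: v_def cut_def frechet_section(2)[OF \<phi>] algebra_simps)
      also have "\<dots> = (LINT t|lborel. c1 * G s * frechet_derivative ?\<psi> (at t) 1) + (LINT t|lborel. ?k * (prim slope 0 t * frechet_derivative ?\<psi> (at t) 1))"
        by (rule Bochner_Integration.integral_add[OF continuous_test_integrable[OF continuous_on_const test_dv[OF \<psi>]]
              integrable_mult_right[OF continuous_test_integrable[OF prim_continuous[OF slope_L2(1)] test_dv[OF \<psi>]]]])
      also have "(LINT t|lborel. c1 * G s * frechet_derivative ?\<psi> (at t) 1) = 0"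
        by (simp only: integral_mult_right_zero test_deriv_integral_zero[OF \<psi>] mult_zero_right)
      also have "(LINT t|lborel. ?k * (prim slope 0 t * frechet_derivative ?\<psi> (at t) 1)) = - (?k * (LINT t|lborel. slope t * \<phi> (s, t)))"
        by (simp only: integral_mult_right_zero prim_by_parts[OF slope_L2 \<psi>] mult_minus_right)
      also have "\<dots> = - (LINT t|lborel. ?k * (slope t * \<phi> (s, t)))" by (simp only: integral_mult_right_zero)
      also have "\<dots> = (LINT t|lborel. - (?v2 (s, t) * \<phi> (s, t)))"
        by (subst Bochner_Integration.integral_minus[symmetric]) (simp add: mult_ac)
      finally show ?thesis by simp
    qed
    have "(LINT x|lborel. v x * ?d x) = (LINT s|lborel. LINT t|lborel. - (?v2 (s, t) * \<phi> (s, t)))"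
      unfolding Fubini_plane(3)[OF i0] inner ..
    also have "\<dots> = - (LINT x|lborel. ?v2 x * \<phi> x)"
      unfolding Fubini_plane(3)[OF i1] by (simp only: Bochner_Integration.integral_minus)
    finally show "(LINT x|lborel. (indicator \<Omega> x *\<^sub>R v x) * ?d x) = - (LINT x|lborel. (indicator \<Omega> x *\<^sub>R ?v2 x) * \<phi> x)"
      by (simp only: e0)
  qed
  note L = brep_L2[OF v1B borels(4)] brep_L2[OF v2B borels(4)]
  show "brep \<Omega> v (\<lambda>x. indicator \<Omega> x *\<^sub>R v x)" by (rule vB)
  show "v \<in> H1 \<Omega>"
    unfolding H1_def Basis_plane using brep_L2[OF vB borels(4)] L wd1 wd2 by auto
  have tr: "brep \<Omega> z' Z" if "brep \<Omega> z Z" "AE x in ME. z' x = z x" for z z' Z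
    using that unfolding brep_def AE_lebesgue_on[OF borels(4)] by (auto elim: eventually_elim2)
  show "brep \<Omega> (E.D (1, 0) v) (\<lambda>x. indicator \<Omega> x *\<^sub>R ?v1 x)"
    by (rule tr[OF v1B weak_deriv_AE(2)[OF opens(4) L(1) wd1]])
  show "brep \<Omega> (E.D (0, 1) v) (\<lambda>x. indicator \<Omega> x *\<^sub>R ?v2 x)"
    by (rule tr[OF v2B weak_deriv_AE(2)[OF opens(4) L(2) wd2]])
qed

lemma indicator_P_L2: "Z \<in> L2 lborel \<Longrightarrow> (\<lambda>x. indicator P x *\<^sub>R Z x) \<in> L2 lborel"
  by (rule L2_indicator_mult(1)[OF _ borels(2)])

text \<open>A function that agrees with \<open>J f\<close> on strip and room differs from it only in
  the passage, up to null sets; by adjointness the agreeing part becomes an inner product of the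
  limit space. Each term of the form on the thin domain is treated this way.\<close>

lemma split_inner:
  assumes f: "f \<in> H_zero lm lp" and F: "brep I (fst f) F" and Z: "brep \<Omega> z Z" and W: "brep \<Omega> w W"
    and S: "\<And>x. x \<in> S \<Longrightarrow> Z x = c1 * F (fst x)" and R: "\<And>x. x \<in> R \<Longrightarrow> Z x = c2 * snd f"
  shows "L2_inner ME z w = ip_zero lm lp f (Jt w) + (LINT x|lborel. indicator P x *\<^sub>R Z x * cnj (W x))"
proof -
  let ?J = "\<lambda>x. c1 * (F (fst x) * complex_of_real (indicator {-\<epsilon><..<0} (snd x))) + c2 * snd f * complex_of_real (indicator R x)"
  note JB = J_brep[OF F]
  have i1: "integrable lborel (\<lambda>x. ?J x * cnj (W x))" by (rule L2_inner_integrable[OF brepD(2)[OF JB] brepD(2)[OF W]])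
  have i2: "integrable lborel (\<lambda>x. indicator P x *\<^sub>R Z x * cnj (W x))"
    by (rule L2_inner_integrable[OF indicator_P_L2[OF brepD(2)[OF Z]] brepD(2)[OF W]])
  have "(LINT x|lborel. Z x * cnj (W x)) = (LINT x|lborel. ?J x * cnj (W x) + indicator P x *\<^sub>R Z x * cnj (W x))"
  proof (rule integral_cong_AE)
    show "(\<lambda>x. Z x * cnj (W x)) \<in> borel_measurable lborel" using brepD(1)[OF Z] brepD(1)[OF W] by simp
    show "(\<lambda>x. ?J x * cnj (W x) + indicator P x *\<^sub>R Z x * cnj (W x)) \<in> borel_measurable lborel" using i1 i2 by (intro borel_measurable_add) auto
    show "AE x in lborel. Z x * cnj (W x) = ?J x * cnj (W x) + indicator P x *\<^sub>R Z x * cnj (W x)"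
      using AE_parts
    proof eventually_elim
      case (elim x)
      show ?case
      proof (cases "x \<in> \<Omega>")
        case False
        then show ?thesis using brepD(3)[OF W] by simp
      next
        case True
        have "Z x = ?J x + indicator P x *\<^sub>R Z x"
          unfolding strip_indicator[OF brep_zero[OF F]] using elim True S[of x] R[of x] parts_disjoint by (auto simp: indicator_def)
        then have "Z x * cnj (W x) = (?J x + indicator P x *\<^sub>R Z x) * cnj (W x)" by simp
        then show ?thesis by (simp only: distrib_right)
      qed
    qed
  qed
  also have "\<dots> = (LINT x|lborel. ?J x * cnj (W x)) + (LINT x|lborel. indicator P x *\<^sub>R Z x * cnj (W x))"
    by (rule Bochner_Integration.integral_add[OF i1 i2])
  also have "(LINT x|lborel. ?J x * cnj (W x)) = ip_zero lm lp f (Jt w)"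
    using brep_inner[OF JB W borels(4)] J_adjoint[OF f brep_L2[OF W borels(4)]] by simp
  finally show ?thesis using brep_inner[OF Z W borels(4)] by simp
qed

lemma passage_bound:
  assumes Z: "Z \<in> L2 lborel" and W: "W \<in> L2 lborel" and b: "AE x in lborel. x \<in> P \<longrightarrow> (cmod (Z x))\<^sup>2 \<le> B" and U: "sqn lborel W \<le> U"
  shows "cmod (LINT x|lborel. indicator P x *\<^sub>R Z x * cnj (W x)) \<le> sqrt (B * (d * h)) * sqrt U"
proof -
  note PL = indicator_P_L2[OF Z]
  have "sqn lborel (\<lambda>x. indicator P x *\<^sub>R Z x) \<le> (LINT x|lborel. B * indicator P x)"
    unfolding sqn_def
  proof (rule integral_mono_AE[OF L2_integrable[OF PL]])
    show "integrable lborel (\<lambda>x. B * indicator P x)" using borels(2) P_finite by simp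
    show "AE x in lborel. (cmod (indicator P x *\<^sub>R Z x))\<^sup>2 \<le> B * indicator P x" using b by eventually_elim (auto simp: indicator_def)
  qed
  also have "\<dots> = B * (d * h)" using P_finite by simp
  finally have s: "sqn lborel (\<lambda>x. indicator P x *\<^sub>R Z x) \<le> B * (d * h)" .
  have "cmod (LINT x|lborel. indicator P x *\<^sub>R Z x * cnj (W x)) \<le> sqrt (sqn lborel (\<lambda>x. indicator P x *\<^sub>R Z x)) * sqrt (sqn lborel (\<lambda>x. cnj (W x)))"
    by (rule L2_Cauchy_Schwarz[OF PL L2_cnj[OF W]])
  also have "\<dots> \<le> sqrt (B * (d * h)) * sqrt U"
    by (rule mult_mono) (use s U order_trans[OF sqn_nonneg s] in auto)
  finally show ?thesis .
qed

end

context room_problem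
begin

subsection \<open>The commutator\<close>

abbreviation "RE \<equiv> R_eps lm lp \<alpha> \<beta> \<gamma> V0 \<epsilon>"
abbreviation "RZ \<equiv> R_zero lm lp \<gamma> V0"

lemma RZ_H: "f \<in> H_zero lm lp \<Longrightarrow> RZ f \<in> H_zero lm lp"
  using H1_L2[OF R_zero_works(1)] by (auto simp: H_zero_def mem_Times_iff)

lemma RE_bounds:
  assumes u: "u \<in> L2 ME"
  shows "sqn ME (RE u) \<le> sqn ME u" "sqn ME (E.D (1, 0) (RE u)) \<le> sqn ME u" "sqn ME (E.D (0, 1) (RE u)) \<le> sqn ME u"
proof -
  have "sqn ME (RE u) + (sqn ME (E.D (1, 0) (RE u)) + sqn ME (E.D (0, 1) (RE u))) \<le> sqn ME u"
    using E.energy_estimate[OF u R_eps_works(1)[OF u] R_eps_works(2)[OF u R_eps_works(1)[OF u]]]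
    by (simp add: E.energy_def sum_Basis_plane)
  then show "sqn ME (RE u) \<le> sqn ME u" "sqn ME (E.D (1, 0) (RE u)) \<le> sqn ME u" "sqn ME (E.D (0, 1) (RE u)) \<le> sqn ME u"
    using sqn_nonneg[of ME "RE u"] sqn_nonneg[of ME "E.D (1, 0) (RE u)"] sqn_nonneg[of ME "E.D (0, 1) (RE u)"] by linarith+
qed

lemma RZ_bounds:
  assumes f: "f \<in> H_zero lm lp"
  shows "sqn M0 (D0 (fst (RZ f))) \<le> sqn M0 (fst f)" "\<gamma> * (cmod (point_value I (fst (RZ f)) 0))\<^sup>2 \<le> sqn M0 (fst f)"
proof -
  have f1: "fst f \<in> L2 M0" using f by (auto simp: H_zero_def)
  have *: "sqn M0 (fst (RZ f)) + sqn M0 (D0 (fst (RZ f))) + \<gamma> * (cmod (point_value I (fst (RZ f)) 0))\<^sup>2 \<le> sqn M0 (fst f)"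
    using energy_estimate[OF f1 R_zero_works(1)[OF f] R_zero_works(3)[OF f R_zero_works(1)[OF f]]]
    by (simp add: energy_def)
  have "0 \<le> \<gamma> * (cmod (point_value I (fst (RZ f)) 0))\<^sup>2" using \<gamma> by simp
  then show "sqn M0 (D0 (fst (RZ f))) \<le> sqn M0 (fst f)" "\<gamma> * (cmod (point_value I (fst (RZ f)) 0))\<^sup>2 \<le> sqn M0 (fst f)"
    using * sqn_nonneg[of M0 "fst (RZ f)"] sqn_nonneg[of M0 "D0 (fst (RZ f))"] by linarith+
qed

lemma Jt_deriv:
  assumes w: "w \<in> H1 \<Omega>"
  shows "AE x in M0. fst (Jt (E.D (1, 0) w)) x = D0 (fst (Jt w)) x"
proof -
  have b1: "(1, 0) \<in> (Basis :: (real \<times> real) set)" by (simp add: Basis_plane)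
  obtain W1 where W1: "brep \<Omega> (E.D (1, 0) w) W1" using brep_ex[OF borels(4) weak_deriv_works(1)[OF w b1]] by blast
  show ?thesis unfolding AE_lebesgue_on[OF I_borel]
    using brepD(4)[OF Jt_brep(1)[OF W1]] brepD(4)[OF Jt_H1(2)[OF w W1]] by eventually_elim simp
qed

text \<open>The term with \<open>J f\<close> is unfolded by the limit equation tested with the first
  component of \<open>Jt w\<close>, the term with \<open>J (RZ f)\<close> by the thin equation
  tested with v. The contributions of strip and room then coincide and cancel; the interaction and
  the passage integrals survive.\<close>

lemma commutator_inner:
  assumes f: "f \<in> H_zero lm lp" and u: "u \<in> L2 ME"
    and G: "brep I (fst (RZ f)) G" and G': "brep I (D0 (fst (RZ f))) G'"
    and U: "brep \<Omega> u U" and W: "brep \<Omega> (RE u) W" and W1: "brep \<Omega> (E.D (1, 0) (RE u)) W1" and W2: "brep \<Omega> (E.D (0, 1) (RE u)) W2"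
  defines "v \<equiv> \<lambda>x. c1 * G (fst x) * cut (snd x) + c2 * snd f * (1 - cut (snd x))"
  shows "L2_inner ME (J f) (RE u) - L2_inner ME (J (RZ f)) u =
    complex_of_real \<gamma> * point_value I (fst (RZ f)) 0 * cnj (point_value I (fst (Jt (RE u))) 0)
    - (LINT x|lborel. indicator P x *\<^sub>R (indicator \<Omega> x *\<^sub>R (c1 * G' (fst x) * cut (snd x))) * cnj (W1 x))
    - (LINT x|lborel. indicator P x *\<^sub>R (indicator \<Omega> x *\<^sub>R (slope (snd x) * (c1 * G (fst x) - c2 * snd f))) * cnj (W2 x))
    - (LINT x|lborel. indicator P x *\<^sub>R (indicator \<Omega> x *\<^sub>R v x) * cnj (W x))
    + (LINT x|lborel. indicator P x *\<^sub>R (indicator \<Omega> x *\<^sub>R v x) * cnj (U x))"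
    (is "_ = ?pv - ?i1 - ?i2 - ?i3 + ?i4")
proof -
  have b: "(1::real) \<in> Basis" and b1: "(1, 0) \<in> (Basis :: (real \<times> real) set)" by (simp_all add: Basis_plane)
  define w where "w = RE u"
  define g1 where "g1 = fst (RZ f)"
  define m where "m = fst (Jt w)"
  have w: "w \<in> H1 \<Omega>" unfolding w_def by (rule R_eps_works(1)[OF u])
  have g: "g1 \<in> H1 I" unfolding g1_def by (rule R_zero_works(1)[OF f])
  have sg: "snd (RZ f) = snd f" by (rule R_zero_works(2)[OF f])
  have RZ: "RZ f = (g1, snd f)" using sg by (simp add: g1_def prod_eq_iff)
  note tr = trial_function[OF R_zero_works(1)[OF f] G G', of "snd f"]
  have vH: "v \<in> H1 \<Omega>" and vB: "brep \<Omega> v (\<lambda>x. indicator \<Omega> x *\<^sub>R v x)" unfolding v_def by (rule tr(1), rule tr(2))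
  note v1B = tr(3)[folded v_def] and v2B = tr(4)[folded v_def]
  have mH: "m \<in> H1 I" unfolding m_def by (rule Jt_H1(1)[OF w W1[folded w_def]])
  have inS: "fst x \<in> I \<and> snd x < 0 \<and> x \<in> \<Omega>" if "x \<in> S" for x
    using that parts_subset(1) by (auto simp: S_eq)
  have inR: "h < snd x \<and> x \<in> \<Omega>" if "x \<in> R" for x
    using that parts_subset(3) by (auto simp: R_eq)
  have cuts: "x \<in> S \<Longrightarrow> x \<in> \<Omega>" "x \<in> S \<Longrightarrow> cut (snd x) = 1" "x \<in> R \<Longrightarrow> x \<in> \<Omega>" "x \<in> R \<Longrightarrow> cut (snd x) = 0" for x
    using inS[of x] inR[of x] cut_below[of "snd x"] cut_above[of "snd x"] by auto
  \<comment> \<open>The limit resolvent equation, tested with m.\<close>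
  have i: "L2_inner ME (J f) w = L2_inner M0 (D0 g1) (D0 m) + L2_inner M0 (\<lambda>x. complex_of_real (V0 x) * g1 x) m
     + complex_of_real \<gamma> * point_value I g1 0 * cnj (point_value I m 0) + L2_inner M0 g1 m + snd f * cnj (snd (Jt w))"
  proof -
    have "L2_inner ME (J f) w = L2_inner M0 (fst f) m + snd f * cnj (snd (Jt w))"
      unfolding J_adjoint[OF f H1_L2[OF w]] by (simp add: ip_zero_def m_def)
    also have "L2_inner M0 (fst f) m = form1 g1 m"
      unfolding g1_def by (rule R_zero_works(3)[OF f mH, symmetric])
    finally show ?thesis by (simp add: form1_def form_def)
  qed
  \<comment> \<open>The equation for w, tested with v; the form is Hermitian, so the arguments may
    be exchanged.\<close>
  have ii: "L2_inner ME v u = L2_inner ME (E.D (1, 0) v) (E.D (1, 0) w) + L2_inner ME (E.D (0, 1) v) (E.D (0, 1) w)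
     + L2_inner ME (\<lambda>x. complex_of_real (V_eps lm lp V0 \<epsilon> x) * v x) w + L2_inner ME v w"
  proof -
    have "E.form1 w v = L2_inner ME u v" unfolding w_def by (rule R_eps_works(2)[OF u vH])
    then have "L2_inner ME v u = E.form1 v w"
      using E.form1_hermitian[of v w] L2_inner_commute[of ME v u] by simp
    then show ?thesis by (simp add: E.form1_def E.form_def sum_Basis_plane)
  qed
  have a: "L2_inner ME v w = L2_inner M0 g1 m + snd f * cnj (snd (Jt w)) + ?i3"
  proof -
    have "L2_inner ME v w = ip_zero lm lp (RZ f) (Jt w) + ?i3"
      by (rule split_inner[OF RZ_H[OF f] G vB W[folded w_def]])
         (simp_all add: cuts v_def sg)
    then show ?thesis by (simp add: ip_zero_def RZ m_def)
  qed
  have e: "L2_inner ME v u = L2_inner ME (J (RZ f)) u + ?i4"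
    unfolding J_adjoint[OF RZ_H[OF f] u]
    by (rule split_inner[OF RZ_H[OF f] G vB U]) (simp_all add: cuts v_def sg)
  \<comment> \<open>The pair (D0 g1, 0) serves as an element of the limit space, since the
    horizontal derivative of v is \<open>c1 * G'\<close> in the strip and 0 in the room.\<close>
  have bb: "L2_inner ME (E.D (1, 0) v) (E.D (1, 0) w) = L2_inner M0 (D0 g1) (D0 m) + ?i1"
  proof -
    have B: "brep I (fst (D0 g1, 0::complex)) G'" using G' by (simp add: g1_def)
    have H: "(D0 g1, 0) \<in> H_zero lm lp" using weak_deriv_works(1)[OF g b] by (simp add: H_zero_def)
    have "L2_inner ME (E.D (1, 0) v) (E.D (1, 0) w) = ip_zero lm lp (D0 g1, 0) (Jt (E.D (1, 0) w)) + ?i1"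
      by (rule split_inner[OF H B v1B W1[folded w_def]]) (simp_all add: cuts)
    also have "ip_zero lm lp (D0 g1, 0) (Jt (E.D (1, 0) w)) = L2_inner M0 (D0 g1) (fst (Jt (E.D (1, 0) w)))"
      by (simp add: ip_zero_def)
    also have "\<dots> = L2_inner M0 (D0 g1) (D0 m)"
    proof (rule L2_inner_cong_AE)
      show "AE x in M0. fst (Jt (E.D (1, 0) w)) x = D0 m x" unfolding m_def by (rule Jt_deriv[OF w])
      have "Jt (E.D (1, 0) w) \<in> H_zero lm lp" by (rule Jt_H[OF weak_deriv_works(1)[OF w b1]])
      then show "fst (Jt (E.D (1, 0) w)) \<in> borel_measurable M0" by (auto simp: H_zero_def intro: L2_measurable)
    qed (use L2_measurable[OF weak_deriv_works(1)[OF g b]] L2_measurable[OF weak_deriv_works(1)[OF mH b]] in auto)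
    finally show ?thesis .
  qed
  \<comment> \<open>The vertical derivative of v lives in the passage only, so the comparison
    element of the limit space is 0.\<close>
  have c: "L2_inner ME (E.D (0, 1) v) (E.D (0, 1) w) = ?i2"
  proof -
    have H: "(\<lambda>x. 0, 0) \<in> H_zero lm lp" by (simp add: H_zero_def L2_zero)
    have B: "brep I (fst (\<lambda>x. 0, 0::complex)) (\<lambda>x. 0)" by (simp add: brep_def L2_zero)
    have "L2_inner ME (E.D (0, 1) v) (E.D (0, 1) w) = ip_zero lm lp (\<lambda>x. 0, 0) (Jt (E.D (0, 1) w)) + ?i2"
      by (rule split_inner[OF H B v2B W2[folded w_def]])
         (use inS inR in \<open>fastforce simp: slope_def\<close>)+
    then show ?thesis by (simp add: ip_zero_def L2_inner_def)
  qed
  \<comment> \<open>The potential vanishes in passage and room; no passage integral arises from this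
    term.\<close>
  have dd: "L2_inner ME (\<lambda>x. complex_of_real (V_eps lm lp V0 \<epsilon> x) * v x) w = L2_inner M0 (\<lambda>x. complex_of_real (V0 x) * g1 x) m"
  proof -
    have H: "(\<lambda>x. complex_of_real (V0 x) * g1 x, 0) \<in> H_zero lm lp" using V_mult_L2[OF H1_L2[OF g]] by (simp add: H_zero_def)
    have "L2_inner ME (\<lambda>x. complex_of_real (V_eps lm lp V0 \<epsilon> x) * v x) w = L2_inner ME (J (\<lambda>x. complex_of_real (V0 x) * g1 x, 0)) w"
    proof (rule L2_inner_cong_AE)
      show "AE x in ME. complex_of_real (V_eps lm lp V0 \<epsilon> x) * v x = J (\<lambda>x. complex_of_real (V0 x) * g1 x, 0) x"
        unfolding AE_lebesgue_on[OF borels(4)] using AE_fst_plane[OF brepD(4)[OF G]]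
      proof eventually_elim
        case (elim x)
        show ?case
        proof (cases "x \<in> S")
          case True
          then show ?thesis using elim inS[OF True] by (simp add: V_eps_def J_eps_def v_def cut_below g1_def c1_def)
        next
          case False
          then show ?thesis by (simp add: V_eps_def J_eps_def)
        qed
      qed
    qed (use L2_measurable[OF E.V_mult_L2[OF H1_L2[OF vH]]] L2_measurable[OF J_L2[OF H]] L2_measurable[OF H1_L2[OF w]] in auto)
    then show ?thesis using J_adjoint[OF H H1_L2[OF w]] by (simp add: ip_zero_def m_def)
  qed
  have "L2_inner ME (J f) w - L2_inner ME (J (RZ f)) u = complex_of_real \<gamma> * point_value I g1 0 * cnj (point_value I m 0) - ?i1 - ?i2 - ?i3 + ?i4"
    using i ii a e bb c dd by algebra
  then show ?thesis by (simp only: w_def g1_def m_def)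
qed

end

section \<open>Size of the terms in the commutator\<close>

text \<open>K is the constant of \<open>key_estimate\<close>. The summands belong, in order, to the
  cancelled flux, the flux against the value in the room, the error of freezing g at 0, the
  horizontal derivative, and the two integrals of v itself. The surrounding locale contains no
  \<epsilon>.\<close>

definition (in limit_problem) comm_const :: "nat \<Rightarrow> real" where
  "comm_const n = (let K = \<gamma> * (4 + 4 * real n * max 1 (1 / \<gamma>)) in
     K / sqrt \<gamma> + (K + \<gamma> * sqrt (2 * (2 / \<delta> + 2 * \<delta>))) + \<gamma> + sqrt (deriv_const * \<gamma>) + 2 * sqrt ((4 / \<gamma> + 6) * \<gamma>))"

context room_problem
begin

lemma c1_norm: "cmod c1 = \<epsilon> powr (-1/2)" "(cmod c1)\<^sup>2 = 1 / \<epsilon>" "c1 * complex_of_real (sqrt \<epsilon>) = 1"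
proof -
  have s: "\<epsilon> powr (-1/2) = 1 / sqrt \<epsilon>" using \<epsilon> by (simp add: powr_minus_divide powr_half_sqrt)
  show n: "cmod c1 = \<epsilon> powr (-1/2)" by (simp add: c1_def)
  show "(cmod c1)\<^sup>2 = 1 / \<epsilon>" unfolding n s using \<epsilon> by (simp add: power_divide)
  show "c1 * complex_of_real (sqrt \<epsilon>) = 1" unfolding c1_def s of_real_mult[symmetric] using \<epsilon> by simp
qed

lemma c2_norm: "cmod c2 = \<epsilon> powr (-\<beta>)" "(cmod c2)\<^sup>2 \<le> 1 / \<epsilon>"
proof -
  show n: "cmod c2 = \<epsilon> powr (-\<beta>)" by (simp add: c2_def powr_minus_divide norm_divide)
  have "cmod c2 \<le> cmod c1" unfolding n c1_norm using \<epsilon> \<beta> by (intro powr_mono') auto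
  then have "(cmod c2)\<^sup>2 \<le> (cmod c1)\<^sup>2" by (intro power_mono) auto
  then show "(cmod c2)\<^sup>2 \<le> 1 / \<epsilon>" unfolding c1_norm(2) .
qed

text \<open>A density of order 1 / \<epsilon> on a set of area \<gamma> \<epsilon>^(2\<alpha>+1) has
  L2 norm of order \<epsilon>^\<alpha>.\<close>

lemma passage_term:
  assumes Z: "Z \<in> L2 lborel" and W: "W \<in> L2 lborel" and b: "AE x in lborel. x \<in> P \<longrightarrow> (cmod (Z x))\<^sup>2 \<le> 1 / \<epsilon> * (k * F)"
    and U: "sqn lborel W \<le> N"
  shows "cmod (LINT x|lborel. indicator P x *\<^sub>R Z x * cnj (W x)) \<le> sqrt (k * \<gamma>) * \<epsilon> powr \<alpha> * (sqrt F * sqrt N)"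
proof -
  have "1 / \<epsilon> * (k * F) * (d * h) = (k * \<gamma>) * (\<epsilon> powr \<alpha>)\<^sup>2 * F"
    using \<epsilon> by (simp add: d_def h_def powr_add power2_eq_square field_simps)
  then have "sqrt (1 / \<epsilon> * (k * F) * (d * h)) = sqrt (k * \<gamma>) * \<epsilon> powr \<alpha> * sqrt F"
    by (simp only: real_sqrt_mult real_sqrt_abs) simp
  then show ?thesis using passage_bound[OF Z W b U] by (simp only: mult.assoc)
qed

text \<open>The energy controls \<gamma> |g(0)|^2 directly, and Hoelder continuity of order 1/2
  carries this over the width of the passage.\<close>

lemma near_origin:
  assumes f: "f \<in> H_zero lm lp" and G: "brep I (fst (RZ f)) G"
  shows "AE s in lborel. s \<in> {-d/2<..<d/2} \<longrightarrow> (cmod (G s - point_value I (fst (RZ f)) 0))\<^sup>2 \<le> d * sqn M0 (fst f)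
    \<and> (cmod (G s))\<^sup>2 \<le> (2 / \<gamma> + 2) * sqn M0 (fst f)"
proof -
  let ?p = "point_value I (fst (RZ f)) 0" and ?F = "sqn M0 (fst f)"
  obtain g where g: "AE x in lborel. x \<in> I \<longrightarrow> fst (RZ f) x = g x" "?p = g 0"
    "\<And>x y. cmod (g y - g x) \<le> sqrt \<bar>y - x\<bar> * sqrt (sqn M0 (D0 (fst (RZ f))))"
    using H1_rep[OF R_zero_works(1)[OF f]] I_0 by blast
  note bd = RZ_bounds[OF f]
  have p: "(cmod (g 0))\<^sup>2 \<le> ?F / \<gamma>" using bd(2) \<gamma> unfolding g(2) by (simp add: field_simps)
  have F0: "0 \<le> ?F" by simp
  show ?thesis using g(1) brepD(4)[OF G]
  proof eventually_elim
    case (elim s)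
    show ?case
    proof
      assume s: "s \<in> {-d/2<..<d/2}"
      then have "s \<in> I" using passage_in_I by auto
      then have Gs: "G s = g s" using elim by simp
      have sd: "\<bar>s\<bar> \<le> d" using s by auto
      have "(cmod (g s - g 0))\<^sup>2 \<le> (sqrt \<bar>s - 0\<bar> * sqrt (sqn M0 (D0 (fst (RZ f)))))\<^sup>2"
        by (rule power_mono[OF g(3)]) simp
      also have "\<dots> = \<bar>s\<bar> * sqn M0 (D0 (fst (RZ f)))" by (simp add: power_mult_distrib)
      also have "\<dots> \<le> d * ?F" by (rule mult_mono[OF sd bd(1)]) (use pos in auto)
      finally have 1: "(cmod (g s - g 0))\<^sup>2 \<le> d * ?F" .
      have "d * ?F \<le> 1 * ?F" by (rule mult_right_mono[OF _ F0]) (use pos in auto)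
      then have "2 * (cmod (g 0))\<^sup>2 + 2 * (cmod (g s - g 0))\<^sup>2 \<le> 2 * (?F / \<gamma>) + 2 * ?F" using 1 p by linarith
      moreover have "(cmod (g s))\<^sup>2 \<le> 2 * (cmod (g 0))\<^sup>2 + 2 * (cmod (g s - g 0))\<^sup>2"
        using cmod_sum_sq[of "g 0" "g s - g 0"] by simp
      ultimately have "(cmod (g s))\<^sup>2 \<le> (2 / \<gamma> + 2) * ?F" by (simp add: algebra_simps)
      then show "(cmod (G s - ?p))\<^sup>2 \<le> d * ?F \<and> (cmod (G s))\<^sup>2 \<le> (2 / \<gamma> + 2) * ?F" using 1 unfolding Gs g(2) by blast
    qed
  qed
qed

lemma Jt_point_value:
  assumes u: "u \<in> L2 ME"
  shows "cmod (point_value I (fst (Jt (RE u))) 0) \<le> sqrt (2 * (2 / \<delta> + 2 * \<delta>)) * sqrt (sqn ME u)"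
proof -
  have b1: "(1, 0) \<in> (Basis :: (real \<times> real) set)" by (simp add: Basis_plane)
  note w = R_eps_works(1)[OF u]
  obtain W where W: "brep \<Omega> (RE u) W" using brep_ex[OF borels(4) H1_L2[OF w]] by blast
  obtain W1 where W1: "brep \<Omega> (E.D (1, 0) (RE u)) W1" using brep_ex[OF borels(4) weak_deriv_works(1)[OF w b1]] by blast
  have "sqn M0 (fst (Jt (RE u))) \<le> sqn ME u"
    using Jt_sqn[OF W] brep_sqn[OF Jt_brep(1)[OF W] I_borel] brep_sqn[OF W borels(4)] RE_bounds(1)[OF u] by simp
  moreover have "sqn M0 (D0 (fst (Jt (RE u)))) \<le> sqn ME u"
    using Jt_sqn[OF W1] brep_sqn[OF Jt_H1(2)[OF w W1] I_borel] brep_sqn[OF W1 borels(4)] RE_bounds(2)[OF u] by simp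
  ultimately have "sqn M0 (fst (Jt (RE u))) + sqn M0 (D0 (fst (Jt (RE u)))) \<le> 2 * sqn ME u" by simp
  then have "(2 / \<delta> + 2 * \<delta>) * (sqn M0 (fst (Jt (RE u))) + sqn M0 (D0 (fst (Jt (RE u))))) \<le> (2 / \<delta> + 2 * \<delta>) * (2 * sqn ME u)"
    by (rule mult_left_mono) (use \<delta> in simp)
  then have "(cmod (point_value I (fst (Jt (RE u))) 0))\<^sup>2 \<le> 2 * (2 / \<delta> + 2 * \<delta>) * sqn ME u"
    using point_value_bound[OF Jt_H1(1)[OF w W1]] by (simp add: algebra_simps)
  then show ?thesis unfolding real_sqrt_mult[symmetric] by (rule real_le_rsqrt)
qed

theorem commutator_bound:
  assumes f: "f \<in> H_zero lm lp" and u: "u \<in> L2 ME" and n: "0 < n" "\<alpha> + 1 \<le> 2 * \<beta> * real n"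
  shows "cmod (L2_inner ME (J f) (RE u) - L2_inner ME (J (RZ f)) u)
    \<le> comm_const n * \<epsilon> powr (min \<alpha> (1/2 - \<beta>)) * (sqrt (sqn M0 (fst f) + (cmod (snd f))\<^sup>2) * sqrt (sqn ME u))"
proof -
  have b: "(1::real) \<in> Basis" and b1: "(1, 0) \<in> (Basis :: (real \<times> real) set)" and b2: "(0, 1) \<in> (Basis :: (real \<times> real) set)"
    by (simp_all add: Basis_plane)
  have f1: "fst f \<in> L2 M0" using f by (auto simp: H_zero_def)
  define F where "F = sqn M0 (fst f) + (cmod (snd f))\<^sup>2"
  define N where "N = sqn ME u"
  define p where "p = \<epsilon> powr (min \<alpha> (1/2 - \<beta>))"
  define X where "X = sqrt F * sqrt N"
  define K where "K = \<gamma> * (4 + 4 * real n * max 1 (1 / \<gamma>))"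
  define T where "T = sqrt (2 * (2 / \<delta> + 2 * \<delta>))"
  have F: "0 \<le> F" "sqn M0 (fst f) \<le> F" "(cmod (snd f))\<^sup>2 \<le> F" and N: "0 \<le> N" by (simp_all add: F_def N_def)
  have X: "0 \<le> X" using F N by (simp add: X_def)
  have KT: "0 \<le> K" "0 \<le> T" using \<gamma> \<delta> by (simp_all add: K_def T_def)
  \<comment> \<open>The minimum is at most \<alpha> and at most 1/2 - \<beta>; the third exponent is
    larger than 1/2, hence larger than 1/2 - \<beta>.\<close>
  have pp: "\<epsilon> powr \<alpha> \<le> p" "\<epsilon> powr (1/2 - \<beta>) \<le> p" "\<epsilon> powr ((\<alpha> + 1) / 2) \<le> p"
    unfolding p_def using \<epsilon> \<alpha> \<beta> by (auto intro!: powr_mono' simp: min_def)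
  define g0 where "g0 = point_value I (fst (RZ f)) 0"
  define m0 where "m0 = point_value I (fst (Jt (RE u))) 0"
  note g = R_zero_works(1)[OF f] and w = R_eps_works(1)[OF u]
  obtain G where G: "brep I (fst (RZ f)) G" using brep_ex[OF I_borel H1_L2[OF g]] by blast
  obtain G' where G': "brep I (D0 (fst (RZ f))) G'" using brep_ex[OF I_borel weak_deriv_works(1)[OF g b]] by blast
  obtain U where U: "brep \<Omega> u U" using brep_ex[OF borels(4) u] by blast
  obtain W where W: "brep \<Omega> (RE u) W" using brep_ex[OF borels(4) H1_L2[OF w]] by blast
  obtain W1 where W1: "brep \<Omega> (E.D (1, 0) (RE u)) W1" using brep_ex[OF borels(4) weak_deriv_works(1)[OF w b1]] by blast
  obtain W2 where W2: "brep \<Omega> (E.D (0, 1) (RE u)) W2" using brep_ex[OF borels(4) weak_deriv_works(1)[OF w b2]] by blast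
  have sN: "sqn lborel U \<le> N" "sqn lborel W \<le> N" "sqn lborel W1 \<le> N" "sqn lborel W2 \<le> N"
    using RE_bounds[OF u]
    unfolding brep_sqn[OF U borels(4)] brep_sqn[OF W borels(4)] brep_sqn[OF W1 borels(4)] brep_sqn[OF W2 borels(4)] N_def by auto
  define v where "v = (\<lambda>x. c1 * G (fst x) * cut (snd x) + c2 * snd f * (1 - cut (snd x)))"
  note tr = trial_function[OF g G G', of "snd f"]
  note Pfst = AE_fst_plane[OF near_origin[OF f G], folded g0_def]
  have inP: "fst x \<in> {-d/2<..<d/2} \<and> fst x \<in> I \<and> fst x \<in> {-\<delta><..<\<delta>} \<and> x \<in> \<Omega> \<and> snd x \<in> {0<..<h}" if "x \<in> P" for x
    using that parts_subset(2) passage_in_I pos \<epsilon> by (auto simp: P_eq)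
  have g0: "cmod g0 \<le> sqrt F / sqrt \<gamma>"
  proof -
    have "(cmod g0)\<^sup>2 \<le> F / \<gamma>" using RZ_bounds(2)[OF f] F(2) \<gamma> unfolding g0_def by (simp add: field_simps)
    then show ?thesis unfolding real_sqrt_divide[symmetric] by (rule real_le_rsqrt)
  qed
  have f2: "cmod (snd f) \<le> sqrt F" by (rule real_le_rsqrt[OF F(3)])

  let ?Z1 = "\<lambda>x. indicator \<Omega> x *\<^sub>R (c1 * G' (fst x) * cut (snd x))"
  let ?Z2 = "\<lambda>x. indicator \<Omega> x *\<^sub>R (slope (snd x) * (c1 * G (fst x) - c2 * snd f))"
  let ?Z3 = "\<lambda>x. indicator \<Omega> x *\<^sub>R v x"
  have i1: "cmod (LINT x|lborel. indicator P x *\<^sub>R ?Z1 x * cnj (W1 x)) \<le> sqrt (deriv_const * \<gamma>) * \<epsilon> powr \<alpha> * X"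
    unfolding X_def
  proof (rule passage_term[OF brepD(2)[OF tr(3)] brepD(2)[OF W1] _ sN(3)])
    have sd: "AE s in lborel. s \<in> {-\<delta><..<\<delta>} \<longrightarrow> (cmod (D0 (fst (RZ f)) s))\<^sup>2 \<le> deriv_const * sqn M0 (fst f)"
      by (rule solution_derivative_bound[OF f1 g R_zero_works(3)[OF f]])
    show "AE x in lborel. x \<in> P \<longrightarrow> (cmod (?Z1 x))\<^sup>2 \<le> 1 / \<epsilon> * (deriv_const * F)"
      using AE_fst_plane[OF sd] AE_fst_plane[OF brepD(4)[OF G']]
    proof eventually_elim
      case (elim x)
      show ?case
      proof
        assume "x \<in> P"
        note x = inP[OF this]
        have K0: "0 \<le> deriv_const" using \<delta> \<gamma> by (simp add: deriv_const_def)
        have "(cmod (G' (fst x)))\<^sup>2 \<le> deriv_const * sqn M0 (fst f)" using elim x by simp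
        also have "\<dots> \<le> deriv_const * F" by (rule mult_left_mono[OF F(2) K0])
        finally have 1: "(cmod (G' (fst x)))\<^sup>2 \<le> deriv_const * F" .
        have "(cmod (cut (snd x)))\<^sup>2 \<le> 1" using cut_bounds(1) by (simp add: power_le_one)
        then have "(cmod (G' (fst x)))\<^sup>2 * (cmod (cut (snd x)))\<^sup>2 \<le> (deriv_const * F) * 1"
          using 1 K0 F(1) by (intro mult_mono) auto
        then have "1 / \<epsilon> * ((cmod (G' (fst x)))\<^sup>2 * (cmod (cut (snd x)))\<^sup>2) \<le> 1 / \<epsilon> * (deriv_const * F)"
          using \<epsilon> by (intro mult_left_mono) auto
        moreover have "(cmod (?Z1 x))\<^sup>2 = 1 / \<epsilon> * ((cmod (G' (fst x)))\<^sup>2 * (cmod (cut (snd x)))\<^sup>2)"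
          using x unfolding c1_norm(2)[symmetric] by (simp add: norm_mult power_mult_distrib mult.assoc)
        ultimately show "(cmod (?Z1 x))\<^sup>2 \<le> 1 / \<epsilon> * (deriv_const * F)" by simp
      qed
    qed
  qed
  \<comment> \<open>The bound 1 / \<epsilon> also covers the constant in the room, because \<beta> <
    1/2 makes \<open>c2\<close> no larger than \<open>c1\<close>. The number 4/\<gamma> + 6 is 2
    (2/\<gamma> + 2) + 2.\<close>
  have vb: "AE x in lborel. x \<in> P \<longrightarrow> (cmod (?Z3 x))\<^sup>2 \<le> 1 / \<epsilon> * ((4 / \<gamma> + 6) * F)"
    using Pfst
  proof eventually_elim
    case (elim x)
    show ?case
    proof
      assume "x \<in> P"
      note x = inP[OF this]
      have "(cmod (G (fst x)))\<^sup>2 \<le> (2 / \<gamma> + 2) * sqn M0 (fst f)" using elim x by blast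
      also have "\<dots> \<le> (2 / \<gamma> + 2) * F" by (rule mult_left_mono[OF F(2)]) (use \<gamma> in simp)
      finally have 1: "(cmod (G (fst x)))\<^sup>2 \<le> (2 / \<gamma> + 2) * F" .
      have cc: "(cmod (cut (snd x)))\<^sup>2 \<le> 1" "(cmod (1 - cut (snd x)))\<^sup>2 \<le> 1" using cut_bounds by (simp_all add: power_le_one)
      have "(cmod (c1 * G (fst x) * cut (snd x)))\<^sup>2 = (1 / \<epsilon> * (cmod (G (fst x)))\<^sup>2) * (cmod (cut (snd x)))\<^sup>2"
        unfolding c1_norm(2)[symmetric] by (simp add: norm_mult power_mult_distrib)
      also have "\<dots> \<le> (1 / \<epsilon> * ((2 / \<gamma> + 2) * F)) * 1"
        using 1 cc \<epsilon> F(1) \<gamma> by (intro mult_mono mult_left_mono) auto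
      finally have 2: "(cmod (c1 * G (fst x) * cut (snd x)))\<^sup>2 \<le> 1 / \<epsilon> * ((2 / \<gamma> + 2) * F)" by simp
      have "(cmod (c2 * snd f * (1 - cut (snd x))))\<^sup>2 = ((cmod c2)\<^sup>2 * (cmod (snd f))\<^sup>2) * (cmod (1 - cut (snd x)))\<^sup>2"
        by (simp add: norm_mult power_mult_distrib)
      also have "\<dots> \<le> (1 / \<epsilon> * F) * 1" using cc F c2_norm(2) \<epsilon> by (intro mult_mono) auto
      finally have 3: "(cmod (c2 * snd f * (1 - cut (snd x))))\<^sup>2 \<le> 1 / \<epsilon> * F" by simp
      have "(cmod (?Z3 x))\<^sup>2 \<le> 2 * (cmod (c1 * G (fst x) * cut (snd x)))\<^sup>2 + 2 * (cmod (c2 * snd f * (1 - cut (snd x))))\<^sup>2"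
        using x cmod_sum_sq by (simp add: v_def)
      also have "\<dots> \<le> 2 * (1 / \<epsilon> * ((2 / \<gamma> + 2) * F)) + 2 * (1 / \<epsilon> * F)" using 2 3 by linarith
      also have "\<dots> = 1 / \<epsilon> * ((4 / \<gamma> + 6) * F)" by (simp add: algebra_simps)
      finally show "(cmod (?Z3 x))\<^sup>2 \<le> 1 / \<epsilon> * ((4 / \<gamma> + 6) * F)" .
    qed
  qed
  have Z3L: "?Z3 \<in> L2 lborel" unfolding v_def by (rule brepD(2)[OF tr(2)])
  have i3: "cmod (LINT x|lborel. indicator P x *\<^sub>R ?Z3 x * cnj (W x)) \<le> sqrt ((4 / \<gamma> + 6) * \<gamma>) * \<epsilon> powr \<alpha> * X"
    unfolding X_def by (rule passage_term[OF Z3L brepD(2)[OF W] vb sN(2)])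
  have i4: "cmod (LINT x|lborel. indicator P x *\<^sub>R ?Z3 x * cnj (U x)) \<le> sqrt ((4 / \<gamma> + 6) * \<gamma>) * \<epsilon> powr \<alpha> * X"
    unfolding X_def by (rule passage_term[OF Z3L brepD(2)[OF U] vb sN(1)])

  \<comment> \<open>With G frozen at its value at the origin, the trial function has the constant
    vertical slope \<kappa> / h in the passage; q below is the flux of w divided by h.\<close>
  define \<kappa> where "\<kappa> = c2 * snd f - c1 * g0"
  define q where "q = (LINT x|lborel. complex_of_real (indicator P x) * W2 x) / complex_of_real h"
  let ?Zb = "\<lambda>x. \<kappa> / complex_of_real h * complex_of_real (indicator P x)"
  let ?Ze = "\<lambda>x. ?Z2 x - ?Zb x"
  have ZbL: "?Zb \<in> L2 lborel" by (intro L2_cmult indicator_L2(1) borels P_finite)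
  have ZeL: "?Ze \<in> L2 lborel" by (rule L2_diff[OF brepD(2)[OF tr(4)] ZbL])
  \<comment> \<open>Freezing costs |G - g(0)|^2 \<le> d F, so the square of the norm is at most a
    multiple of d^2 / (h \<epsilon>), which is of order \<epsilon>^(\<alpha>+1).\<close>
  have e2: "cmod (LINT x|lborel. indicator P x *\<^sub>R ?Ze x * cnj (W2 x)) \<le> \<gamma> * \<epsilon> powr ((\<alpha> + 1) / 2) * X"
  proof -
    have "AE x in lborel. x \<in> P \<longrightarrow> (cmod (?Ze x))\<^sup>2 \<le> (1 / h)\<^sup>2 * (1 / \<epsilon>) * (d * F)"
      using Pfst
    proof eventually_elim
      case (elim x)
      show ?case
      proof
        assume xP: "x \<in> P"
        note x = inP[OF this]
        have "(cmod (G (fst x) - g0))\<^sup>2 \<le> d * sqn M0 (fst f)" using elim x by blast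
        also have "\<dots> \<le> d * F" by (rule mult_left_mono[OF F(2)]) (use pos in simp)
        finally have 1: "(cmod (G (fst x) - g0))\<^sup>2 \<le> d * F" .
        have "?Ze x = complex_of_real (- 1 / h) * (c1 * (G (fst x) - g0))"
          using x xP pos by (simp add: slope_def \<kappa>_def field_simps)
        then have "(cmod (?Ze x))\<^sup>2 = (1 / h)\<^sup>2 * (1 / \<epsilon>) * (cmod (G (fst x) - g0))\<^sup>2"
          unfolding c1_norm(2)[symmetric] using pos by (simp add: norm_mult norm_divide power_mult_distrib power_divide)
        also have "\<dots> \<le> (1 / h)\<^sup>2 * (1 / \<epsilon>) * (d * F)" by (rule mult_left_mono[OF 1]) (use \<epsilon> in simp)
        finally show "(cmod (?Ze x))\<^sup>2 \<le> (1 / h)\<^sup>2 * (1 / \<epsilon>) * (d * F)" .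
      qed
    qed
    from passage_bound[OF ZeL brepD(2)[OF W2] this sN(4)]
    have "cmod (LINT x|lborel. indicator P x *\<^sub>R ?Ze x * cnj (W2 x)) \<le> sqrt ((1 / h)\<^sup>2 * (1 / \<epsilon>) * (d * F) * (d * h)) * sqrt N" .
    also have "(1 / h)\<^sup>2 * (1 / \<epsilon>) * (d * F) * (d * h) = (\<gamma> * \<epsilon> powr ((\<alpha> + 1) / 2))\<^sup>2 * F"
    proof -
      have e: "(\<epsilon> powr ((\<alpha> + 1) / 2))\<^sup>2 = \<epsilon> powr \<alpha> * \<epsilon>"
        unfolding power2_eq_square powr_add[symmetric] using \<epsilon> by (simp add: powr_add)
      show ?thesis unfolding power_mult_distrib e using \<epsilon> by (simp add: d_def h_def powr_add power2_eq_square field_simps)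
    qed
    also have "sqrt ((\<gamma> * \<epsilon> powr ((\<alpha> + 1) / 2))\<^sup>2 * F) * sqrt N = \<gamma> * \<epsilon> powr ((\<alpha> + 1) / 2) * X"
      using \<gamma> by (simp add: real_sqrt_mult X_def)
    finally show ?thesis .
  qed
  have i2: "(LINT x|lborel. indicator P x *\<^sub>R ?Z2 x * cnj (W2 x)) = (LINT x|lborel. indicator P x *\<^sub>R ?Ze x * cnj (W2 x)) + \<kappa> * cnj q"
  proof -
    have ie: "integrable lborel (\<lambda>x. indicator P x *\<^sub>R ?Ze x * cnj (W2 x))"
      by (rule L2_inner_integrable[OF indicator_P_L2[OF ZeL] brepD(2)[OF W2]])
    have ib: "integrable lborel (\<lambda>x. ?Zb x * cnj (W2 x))"
      by (rule L2_inner_integrable[OF ZbL brepD(2)[OF W2]])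
    have "(LINT x|lborel. indicator P x *\<^sub>R ?Z2 x * cnj (W2 x)) = (LINT x|lborel. indicator P x *\<^sub>R ?Ze x * cnj (W2 x) + ?Zb x * cnj (W2 x))"
      by (rule Bochner_Integration.integral_cong) (auto simp: indicator_def algebra_simps)
    also have "\<dots> = (LINT x|lborel. indicator P x *\<^sub>R ?Ze x * cnj (W2 x)) + (LINT x|lborel. ?Zb x * cnj (W2 x))"
      by (rule Bochner_Integration.integral_add[OF ie ib])
    also have "(LINT x|lborel. ?Zb x * cnj (W2 x)) = \<kappa> * cnj q"
    proof -
      have "cnj (LINT x|lborel. complex_of_real (indicator P x) * W2 x) = (LINT x|lborel. cnj (complex_of_real (indicator P x) * W2 x))"
        by (rule Bochner_Integration.integral_cnj[symmetric])
      then show ?thesis unfolding q_def mult.assoc by (simp only: integral_mult_right_zero) simp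
    qed
    finally show ?thesis .
  qed
  \<comment> \<open>The combination of flux and point value that \<open>key_estimate\<close>
    bounds.\<close>
  define Y where "Y = q + complex_of_real (\<gamma> * sqrt \<epsilon>) * m0"
  have Y: "cmod Y \<le> K * \<epsilon> powr (1 - \<beta>) * sqrt N"
    unfolding Y_def q_def m0_def K_def N_def by (rule key_estimate[OF w W2 RE_bounds[OF u] n])
  have m0: "cmod m0 \<le> T * sqrt N" unfolding m0_def T_def N_def by (rule Jt_point_value[OF u])
  \<comment> \<open>Since \<open>c1\<close> times the root of \<epsilon> is 1, the point interaction
    has the same prefactor \<open>c1 * g0\<close> as the flux term, and the two merge into Y. Only
    the flux against the value in the room is left over.\<close>
  have main: "complex_of_real \<gamma> * g0 * cnj m0 - \<kappa> * cnj q = c1 * g0 * cnj Y - c2 * snd f * cnj q"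
  proof -
    have "c1 * g0 * cnj Y = c1 * g0 * cnj q + (c1 * complex_of_real (sqrt \<epsilon>)) * (complex_of_real \<gamma> * g0 * cnj m0)"
      by (simp add: Y_def algebra_simps)
    then show ?thesis unfolding c1_norm(3) \<kappa>_def by (simp add: algebra_simps)
  qed
  have j1: "cmod (c1 * g0 * cnj Y) \<le> K / sqrt \<gamma> * \<epsilon> powr (1/2 - \<beta>) * X"
  proof -
    have "cmod (c1 * g0 * cnj Y) \<le> \<epsilon> powr (-1/2) * (sqrt F / sqrt \<gamma>) * (K * \<epsilon> powr (1 - \<beta>) * sqrt N)"
      unfolding norm_mult c1_norm complex_mod_cnj using g0 Y F \<gamma> by (intro mult_mono) auto
    also have "\<dots> = K / sqrt \<gamma> * (\<epsilon> powr (-1/2) * \<epsilon> powr (1 - \<beta>)) * X" by (simp add: X_def)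
    also have "\<epsilon> powr (-1/2) * \<epsilon> powr (1 - \<beta>) = \<epsilon> powr (1/2 - \<beta>)" unfolding powr_add[symmetric] by simp
    finally show ?thesis .
  qed
  \<comment> \<open>Here nothing cancels, but q alone is of order \<epsilon>^(1/2): both Y and the
    point value with its factor \<epsilon>^(1/2) are that small. The factor \<open>c2\<close> costs
    \<epsilon>^(-\<beta>).\<close>
  have j2: "cmod (c2 * snd f * cnj q) \<le> (K + \<gamma> * T) * \<epsilon> powr (1/2 - \<beta>) * X"
  proof -
    have "q = Y - complex_of_real (\<gamma> * sqrt \<epsilon>) * m0" by (simp add: Y_def)
    then have "cmod q \<le> cmod Y + cmod (complex_of_real (\<gamma> * sqrt \<epsilon>) * m0)" using norm_triangle_ineq4 by simp
    also have "cmod (complex_of_real (\<gamma> * sqrt \<epsilon>) * m0) = \<gamma> * \<epsilon> powr (1/2) * cmod m0"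
      using \<gamma> \<epsilon> by (simp add: norm_mult powr_half_sqrt)
    also have "cmod Y + \<gamma> * \<epsilon> powr (1/2) * cmod m0 \<le> K * \<epsilon> powr (1/2) * sqrt N + \<gamma> * \<epsilon> powr (1/2) * (T * sqrt N)"
    proof (rule add_mono)
      have "\<epsilon> powr (1 - \<beta>) \<le> \<epsilon> powr (1/2)" using \<epsilon> \<beta> by (intro powr_mono') auto
      then have "K * \<epsilon> powr (1 - \<beta>) * sqrt N \<le> K * \<epsilon> powr (1/2) * sqrt N" using KT N by (intro mult_right_mono mult_left_mono) auto
      then show "cmod Y \<le> K * \<epsilon> powr (1/2) * sqrt N" using Y by linarith
      show "\<gamma> * \<epsilon> powr (1/2) * cmod m0 \<le> \<gamma> * \<epsilon> powr (1/2) * (T * sqrt N)" using \<gamma> by (intro mult_left_mono m0) auto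
    qed
    finally have q: "cmod q \<le> (K + \<gamma> * T) * \<epsilon> powr (1/2) * sqrt N" by (simp add: algebra_simps)
    have "cmod (c2 * snd f * cnj q) \<le> \<epsilon> powr (-\<beta>) * sqrt F * ((K + \<gamma> * T) * \<epsilon> powr (1/2) * sqrt N)"
      unfolding norm_mult c2_norm complex_mod_cnj using f2 q F by (intro mult_mono) auto
    also have "\<dots> = (K + \<gamma> * T) * (\<epsilon> powr (-\<beta>) * \<epsilon> powr (1/2)) * X" by (simp add: X_def)
    also have "\<epsilon> powr (-\<beta>) * \<epsilon> powr (1/2) = \<epsilon> powr (1/2 - \<beta>)" unfolding powr_add[symmetric] by simp
    finally show ?thesis .
  qed
  let ?E = "LINT x|lborel. indicator P x *\<^sub>R ?Ze x * cnj (W2 x)"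
  let ?i1 = "LINT x|lborel. indicator P x *\<^sub>R ?Z1 x * cnj (W1 x)"
  let ?i3 = "LINT x|lborel. indicator P x *\<^sub>R ?Z3 x * cnj (W x)"
  let ?i4 = "LINT x|lborel. indicator P x *\<^sub>R ?Z3 x * cnj (U x)"
  have eq: "L2_inner ME (J f) (RE u) - L2_inner ME (J (RZ f)) u = c1 * g0 * cnj Y - c2 * snd f * cnj q - ?E - ?i1 - ?i3 + ?i4"
  proof -
    have "L2_inner ME (J f) (RE u) - L2_inner ME (J (RZ f)) u
      = complex_of_real \<gamma> * g0 * cnj m0 - ?i1 - (?E + \<kappa> * cnj q) - ?i3 + ?i4"
      unfolding i2[symmetric] g0_def m0_def v_def by (rule commutator_inner[OF f u G G' U W W1 W2])
    moreover have "D = B - E - i1 - i3 + i4" if "D = A - i1 - (E + k) - i3 + i4" "A - k = B" for A B D E k i1 i3 i4 :: complex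
      using that by algebra
    ultimately show ?thesis using main by blast
  qed
  have tri: "cmod (a - b' - c - e - k + l) \<le> cmod a + cmod b' + cmod c + cmod e + cmod k + cmod l" for a b' c e k l
    using norm_triangle_ineq[of "a - b' - c - e - k" l] norm_triangle_ineq4[of "a - b' - c - e" k] norm_triangle_ineq4[of "a - b' - c" e]
      norm_triangle_ineq4[of "a - b'" c] norm_triangle_ineq4[of a b'] by linarith
  have up: "k * y * X \<le> k * p * X" if "0 \<le> k" "y \<le> p" for k y using that X by (intro mult_right_mono mult_left_mono) auto
  have "cmod (L2_inner ME (J f) (RE u) - L2_inner ME (J (RZ f)) u)
    \<le> cmod (c1 * g0 * cnj Y) + cmod (c2 * snd f * cnj q) + cmod ?E + cmod ?i1 + cmod ?i3 + cmod ?i4"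
    unfolding eq by (rule tri)
  also have "\<dots> \<le> K / sqrt \<gamma> * p * X + (K + \<gamma> * T) * p * X + \<gamma> * p * X + sqrt (deriv_const * \<gamma>) * p * X
      + sqrt ((4 / \<gamma> + 6) * \<gamma>) * p * X + sqrt ((4 / \<gamma> + 6) * \<gamma>) * p * X"
  proof (intro add_mono)
    have K0: "0 \<le> deriv_const" using \<delta> \<gamma> by (simp add: deriv_const_def)
    show "cmod (c1 * g0 * cnj Y) \<le> K / sqrt \<gamma> * p * X" by (rule order_trans[OF j1 up]) (use KT \<gamma> pp in auto)
    show "cmod (c2 * snd f * cnj q) \<le> (K + \<gamma> * T) * p * X" by (rule order_trans[OF j2 up]) (use KT \<gamma> pp in auto)
    show "cmod ?E \<le> \<gamma> * p * X" by (rule order_trans[OF e2 up]) (use \<gamma> pp in auto)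
    show "cmod ?i1 \<le> sqrt (deriv_const * \<gamma>) * p * X" by (rule order_trans[OF i1 up]) (use \<gamma> pp K0 in auto)
    show "cmod ?i3 \<le> sqrt ((4 / \<gamma> + 6) * \<gamma>) * p * X" by (rule order_trans[OF i3 up]) (use \<gamma> pp in auto)
    show "cmod ?i4 \<le> sqrt ((4 / \<gamma> + 6) * \<gamma>) * p * X" by (rule order_trans[OF i4 up]) (use \<gamma> pp in auto)
  qed
  also have "\<dots> = comm_const n * p * X"
    unfolding comm_const_def Let_def K_def[symmetric] T_def[symmetric] by algebra
  finally show ?thesis by (simp only: p_def X_def F_def N_def)
qed

lemma comm_const_pos: "0 < comm_const n"
  using \<gamma> \<delta> unfolding comm_const_def Let_def deriv_const_def
  by (intro add_pos_nonneg) (auto intro!: add_pos_nonneg divide_pos_pos mult_pos_pos add_nonneg_nonneg mult_nonneg_nonneg divide_nonneg_nonneg)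

end

subsection \<open>Norms of adjoint operators\<close>

text \<open>Only what duality of norms needs. \<open>unit_ex\<close> provides a vector of norm at
  most 1 that attains the norm, which also turns a bound on matrix elements into a bound on an
  operator.\<close>

locale ip_space =
  fixes H :: "'h set" and ip :: "'h \<Rightarrow> 'h \<Rightarrow> complex"
  assumes unit_ex: "x \<in> H \<Longrightarrow> \<exists>s\<in>H. ip_norm ip s \<le> 1 \<and> Re (ip x s) = ip_norm ip x"
    and Cauchy_Schwarz: "x \<in> H \<Longrightarrow> y \<in> H \<Longrightarrow> Re (ip x y) \<le> ip_norm ip x * ip_norm ip y"
    and Re_commute: "Re (ip x y) = Re (ip y x)"
    and nonneg: "0 \<le> Re (ip x x)"

text \<open>A vector u attaining the norm of T f is moved to the other side, where Cauchy-Schwarz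
  bounds the result by the norm of T' u. The two inclusions ensure that both norms are the suprema
  and not the value \<infinity> of the definition.\<close>

lemma operator_norm_le_adjoint:
  assumes H: "ip_space H ip" and K: "ip_space K ip'" and T: "T ` H \<subseteq> K" and T': "T' ` K \<subseteq> H"
    and adj: "\<And>f u. f \<in> H \<Longrightarrow> u \<in> K \<Longrightarrow> Re (ip' (T f) u) = Re (ip f (T' u))"
  shows "operator_norm H ip K ip' T \<le> operator_norm K ip' H ip T'"
proof -
  have "ennreal (ip_norm ip' (T f)) \<le> (SUP u\<in>{u \<in> K. ip_norm ip' u \<le> 1}. ennreal (ip_norm ip (T' u)))"
    if f: "f \<in> H" "ip_norm ip f \<le> 1" for f
  proof -
    obtain u where u: "u \<in> K" "ip_norm ip' u \<le> 1" "Re (ip' (T f) u) = ip_norm ip' (T f)"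
      using ip_space.unit_ex[OF K, of "T f"] T f by blast
    have T'u: "T' u \<in> H" using T' u by blast
    have nn: "0 \<le> ip_norm ip (T' u)" unfolding ip_norm_def by (rule real_sqrt_ge_zero[OF ip_space.nonneg[OF H]])
    have "ip_norm ip' (T f) = Re (ip f (T' u))" using adj[OF f(1) u(1)] u(3) by simp
    also have "\<dots> \<le> ip_norm ip f * ip_norm ip (T' u)" by (rule ip_space.Cauchy_Schwarz[OF H f(1) T'u])
    also have "\<dots> \<le> 1 * ip_norm ip (T' u)" by (rule mult_right_mono[OF f(2) nn])
    finally have "ennreal (ip_norm ip' (T f)) \<le> ennreal (ip_norm ip (T' u))" by (simp add: ennreal_leI)
    also have "\<dots> \<le> (SUP u\<in>{u \<in> K. ip_norm ip' u \<le> 1}. ennreal (ip_norm ip (T' u)))"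
      by (rule SUP_upper) (use u in simp)
    finally show ?thesis .
  qed
  then show ?thesis using T T' by (auto simp: operator_norm_def intro!: SUP_least)
qed

lemma operator_norm_adjoint:
  assumes H: "ip_space H ip" and K: "ip_space K ip'" and T: "T ` H \<subseteq> K" and T': "T' ` K \<subseteq> H"
    and adj: "\<And>f u. f \<in> H \<Longrightarrow> u \<in> K \<Longrightarrow> ip' (T f) u = ip f (T' u)"
  shows "operator_norm H ip K ip' T = operator_norm K ip' H ip T'"
proof (rule antisym)
  show "operator_norm H ip K ip' T \<le> operator_norm K ip' H ip T'"
    by (rule operator_norm_le_adjoint[OF H K T T']) (simp add: adj)
  have "Re (ip (T' u) f) = Re (ip' u (T f))" if "u \<in> K" "f \<in> H" for u f
    using adj[OF that(2,1)] ip_space.Re_commute[OF H, of "T' u" f] ip_space.Re_commute[OF K, of u "T f"] by simp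
  then show "operator_norm K ip' H ip T' \<le> operator_norm H ip K ip' T"
    by (intro operator_norm_le_adjoint[OF K H T' T]) auto
qed

lemma operator_norm_le:
  assumes H: "ip_space H ip" and K: "ip_space K ip'" and T: "T ` H \<subseteq> K" and C: "0 \<le> C"
    and b: "\<And>f u. f \<in> H \<Longrightarrow> u \<in> K \<Longrightarrow> cmod (ip' (T f) u) \<le> C * (ip_norm ip f * ip_norm ip' u)"
  shows "operator_norm H ip K ip' T \<le> ennreal C"
proof -
  have nn: "0 \<le> ip_norm ip f" "0 \<le> ip_norm ip' u" for f u
    using ip_space.nonneg[OF H] ip_space.nonneg[OF K] by (simp_all add: ip_norm_def)
  have "ip_norm ip' (T f) \<le> C" if f: "f \<in> H" "ip_norm ip f \<le> 1" for f
  proof -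
    obtain u where u: "u \<in> K" "ip_norm ip' u \<le> 1" "Re (ip' (T f) u) = ip_norm ip' (T f)"
      using ip_space.unit_ex[OF K, of "T f"] T f by blast
    have "ip_norm ip' (T f) \<le> cmod (ip' (T f) u)" using complex_Re_le_cmod[of "ip' (T f) u"] u(3) by simp
    also have "\<dots> \<le> C * (ip_norm ip f * ip_norm ip' u)" by (rule b[OF f(1) u(1)])
    also have "\<dots> \<le> C * (1 * 1)" by (intro mult_left_mono[OF _ C] mult_mono f u nn) simp
    finally show ?thesis by simp
  qed
  then show ?thesis using T by (auto simp: operator_norm_def intro!: SUP_least ennreal_leI)
qed

lemma L2_norm: "ip_norm (L2_inner M) f = sqrt (sqn M f)"
  by (simp add: ip_norm_def L2_inner_self)

lemma L2_ip_space: "ip_space (L2 M) (L2_inner M)"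
proof
  fix x assume x: "x \<in> L2 M"
  \<comment> \<open>If x has norm 0, division by zero gives k = 0, and the zero vector has the
    required properties.\<close>
  define k where "k = 1 / sqrt (sqn M x)"
  have "L2_inner M x (\<lambda>t. complex_of_real k * x t) = complex_of_real (k * sqn M x)"
  proof -
    have "L2_inner M x (\<lambda>t. complex_of_real k * x t) = (LINT t|M. complex_of_real k * (x t * cnj (x t)))"
      by (simp add: L2_inner_def mult_ac)
    also have "\<dots> = complex_of_real k * L2_inner M x x" by (simp only: L2_inner_def integral_mult_right_zero)
    finally show ?thesis by (simp add: L2_inner_self)
  qed
  moreover have "k * sqn M x = sqrt (sqn M x)" by (simp add: k_def real_div_sqrt)
  moreover have "ip_norm (L2_inner M) (\<lambda>t. complex_of_real k * x t) \<le> 1"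
    unfolding L2_norm sqn_cmult by (simp add: k_def norm_divide power_divide)
  ultimately show "\<exists>s\<in>L2 M. ip_norm (L2_inner M) s \<le> 1 \<and> Re (L2_inner M x s) = ip_norm (L2_inner M) x"
    using L2_cmult[OF x] by (intro bexI[of _ "\<lambda>t. complex_of_real k * x t"]) (auto simp: L2_norm)
next
  show "Re (L2_inner M x y) \<le> ip_norm (L2_inner M) x * ip_norm (L2_inner M) y" if "x \<in> L2 M" "y \<in> L2 M" for x y
    using L2_inner_bound[OF that] complex_Re_le_cmod[of "L2_inner M x y"] unfolding L2_norm by linarith
  show "Re (L2_inner M x y) = Re (L2_inner M y x)" for x y by (simp add: L2_inner_commute[of M y x])
qed (simp add: L2_inner_self)

lemma ip_zero_self: "ip_zero lm lp f f = complex_of_real (sqn (lebesgue_on (Omega0 lm lp)) (fst f) + (cmod (snd f))\<^sup>2)"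
  by (simp add: ip_zero_def L2_inner_self complex_norm_square[symmetric])

lemma ip_zero_norm: "ip_norm (ip_zero lm lp) f = sqrt (sqn (lebesgue_on (Omega0 lm lp)) (fst f) + (cmod (snd f))\<^sup>2)"
  unfolding ip_norm_def ip_zero_self by simp

lemma ip_zero_space: "ip_space (H_zero lm lp) (ip_zero lm lp)"
proof
  let ?M = "lebesgue_on (Omega0 lm lp)" and ?n = "ip_norm (ip_zero lm lp)"
  fix x assume x: "x \<in> H_zero lm lp"
  define q where "q = sqn ?M (fst x) + (cmod (snd x))\<^sup>2"
  \<comment> \<open>As before, k = 0 by the convention for division when x has norm 0.\<close>
  define k where "k = 1 / sqrt q"
  have q0: "0 \<le> q" by (simp add: q_def)
  let ?s = "(\<lambda>t. complex_of_real k * fst x t, complex_of_real k * snd x)"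
  have "ip_zero lm lp x ?s = complex_of_real k * ip_zero lm lp x x"
  proof -
    have "L2_inner ?M (fst x) (\<lambda>t. complex_of_real k * fst x t) = (LINT t|?M. complex_of_real k * (fst x t * cnj (fst x t)))"
      by (simp add: L2_inner_def mult_ac)
    also have "\<dots> = complex_of_real k * L2_inner ?M (fst x) (fst x)" by (simp only: L2_inner_def integral_mult_right_zero)
    finally show ?thesis by (simp add: ip_zero_def algebra_simps)
  qed
  then have "Re (ip_zero lm lp x ?s) = k * q" unfolding ip_zero_self q_def by simp
  moreover have "k * q = sqrt q" using q0 by (simp add: k_def real_div_sqrt)
  moreover have "?n ?s \<le> 1"
  proof -
    have "sqn ?M (fst ?s) + (cmod (snd ?s))\<^sup>2 = k\<^sup>2 * q"
      by (simp add: sqn_cmult norm_mult power_mult_distrib q_def distrib_left)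
    then show ?thesis unfolding ip_zero_norm using q0 by (simp add: k_def power_divide)
  qed
  moreover have "?s \<in> H_zero lm lp" using x by (auto simp: H_zero_def L2_cmult)
  ultimately show "\<exists>s\<in>H_zero lm lp. ?n s \<le> 1 \<and> Re (ip_zero lm lp x s) = ?n x"
    by (intro bexI[of _ ?s]) (auto simp: ip_zero_norm q_def)
next
  let ?M = "lebesgue_on (Omega0 lm lp)" and ?n = "ip_norm (ip_zero lm lp)"
  show "Re (ip_zero lm lp x y) \<le> ?n x * ?n y" if "x \<in> H_zero lm lp" "y \<in> H_zero lm lp" for x y
  proof -
    let ?a = "sqrt (sqn ?M (fst x))" and ?b = "sqrt (sqn ?M (fst y))" and ?c = "cmod (snd x)" and ?d = "cmod (snd y)"
    have "cmod (L2_inner ?M (fst x) (fst y)) \<le> ?a * ?b"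
      by (rule L2_inner_bound) (use that in \<open>auto simp: H_zero_def\<close>)
    moreover have "cmod (snd x * cnj (snd y)) = ?c * ?d" by (simp add: norm_mult)
    ultimately have "Re (ip_zero lm lp x y) \<le> ?a * ?b + ?c * ?d"
      using complex_Re_le_cmod[of "ip_zero lm lp x y"] norm_triangle_ineq[of "L2_inner ?M (fst x) (fst y)" "snd x * cnj (snd y)"]
      unfolding ip_zero_def by linarith
    also have "\<dots> \<le> sqrt (?a\<^sup>2 + ?c\<^sup>2) * sqrt (?b\<^sup>2 + ?d\<^sup>2)"
      using Cauchy_Schwarz_ineq2[of "(?a, ?c)" "(?b, ?d)"] by (simp add: inner_prod_def norm_Pair abs_if split: if_splits)
    finally show ?thesis by (simp add: ip_zero_norm)
  qed
  show "Re (ip_zero lm lp x y) = Re (ip_zero lm lp y x)" for x y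
    by (simp add: ip_zero_def L2_inner_commute[of ?M "fst y" "fst x"])
  show "0 \<le> Re (ip_zero lm lp x x)" for x unfolding ip_zero_self by simp
qed

context room_problem
begin

lemma RE_symmetric:
  assumes "a \<in> L2 ME" "b' \<in> L2 ME"
  shows "L2_inner ME (RE a) b' = L2_inner ME a (RE b')"
  using R_eps_works(2)[OF assms(1) R_eps_works(1)[OF assms(2)]] R_eps_works(2)[OF assms(2) R_eps_works(1)[OF assms(1)]]
    E.form1_hermitian[of "RE a" "RE b'"] L2_inner_commute[of ME "RE a" b'] by simp

lemma RZ_symmetric:
  assumes "f \<in> H_zero lm lp" "g \<in> H_zero lm lp"
  shows "ip_zero lm lp (RZ f) g = ip_zero lm lp f (RZ g)"
  using R_zero_works(3)[OF assms(1) R_zero_works(1)[OF assms(2)]] R_zero_works(3)[OF assms(2) R_zero_works(1)[OF assms(1)]]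
    form1_hermitian[of "fst (RZ f)" "fst (RZ g)"] L2_inner_commute[of M0 "fst (RZ f)" "fst g"]
    R_zero_works(2)[OF assms(1)] R_zero_works(2)[OF assms(2)] by (simp add: ip_zero_def)

lemma RE_L2: "u \<in> L2 ME \<Longrightarrow> RE u \<in> L2 ME"
  by (rule H1_L2[OF R_eps_works(1)])

lemma resolvent_difference_inner:
  assumes f: "f \<in> H_zero lm lp" and u: "u \<in> L2 ME"
  shows "L2_inner ME (RE (J f) - J (RZ f)) u = L2_inner ME (J f) (RE u) - L2_inner ME (J (RZ f)) u"
  using L2_inner_lc_left[OF RE_L2[OF J_L2[OF f]] J_L2[OF RZ_H[OF f]] u, of "-1"] RE_symmetric[OF J_L2[OF f] u]
  by (simp add: fun_diff_def)

text \<open>Both resolvents are symmetric and \<open>Jt\<close> is the adjoint of \<open>J\<close>,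
  so each product changes its order when it is moved across the inner product.\<close>

lemma resolvent_difference_adjoint:
  assumes f: "f \<in> H_zero lm lp" and u: "u \<in> L2 ME"
  shows "L2_inner ME (RE (J f) - J (RZ f)) u = ip_zero lm lp f (Jt (RE u) - RZ (Jt u))"
proof -
  have L: "fst f \<in> L2 M0" "fst (Jt (RE u)) \<in> L2 M0" "fst (RZ (Jt u)) \<in> L2 M0"
    using f Jt_H[OF RE_L2[OF u]] RZ_H[OF Jt_H[OF u]] by (auto simp: H_zero_def)
  have "L2_inner M0 (fst f) (fst (Jt (RE u) - RZ (Jt u))) = L2_inner M0 (fst f) (fst (Jt (RE u))) - L2_inner M0 (fst f) (fst (RZ (Jt u)))"
    using L2_inner_lc_left[OF L(2,3,1), of "-1"] by (simp add: L2_inner_commute[of M0 "fst f"] fun_diff_def)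
  then have "ip_zero lm lp f (Jt (RE u) - RZ (Jt u)) = ip_zero lm lp f (Jt (RE u)) - ip_zero lm lp f (RZ (Jt u))"
    by (simp add: ip_zero_def algebra_simps)
  then show ?thesis
    unfolding resolvent_difference_inner[OF f u] J_adjoint[OF f RE_L2[OF u]] J_adjoint[OF RZ_H[OF f] u] RZ_symmetric[OF f Jt_H[OF u]] by simp
qed

theorem resolvent_difference:
  assumes n: "0 < n" "\<alpha> + 1 \<le> 2 * \<beta> * real n"
  shows "operator_norm (H_zero lm lp) (ip_zero lm lp) (H_eps lm lp \<alpha> \<beta> \<gamma> \<epsilon>) (ip_eps lm lp \<alpha> \<beta> \<gamma> \<epsilon>) (\<lambda>f. RE (J f) - J (RZ f))
      = operator_norm (H_eps lm lp \<alpha> \<beta> \<gamma> \<epsilon>) (ip_eps lm lp \<alpha> \<beta> \<gamma> \<epsilon>) (H_zero lm lp) (ip_zero lm lp) (\<lambda>u. Jt (RE u) - RZ (Jt u))"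
    and "operator_norm (H_zero lm lp) (ip_zero lm lp) (H_eps lm lp \<alpha> \<beta> \<gamma> \<epsilon>) (ip_eps lm lp \<alpha> \<beta> \<gamma> \<epsilon>) (\<lambda>f. RE (J f) - J (RZ f))
      \<le> ennreal (comm_const n * \<epsilon> powr (min \<alpha> (1/2 - \<beta>)))"
proof -
  have T: "(\<lambda>f. RE (J f) - J (RZ f)) ` H_zero lm lp \<subseteq> L2 ME"
    using L2_diff[OF RE_L2[OF J_L2] J_L2[OF RZ_H]] by (auto simp: fun_diff_def)
  have T': "(\<lambda>u. Jt (RE u) - RZ (Jt u)) ` L2 ME \<subseteq> H_zero lm lp"
  proof (intro image_subsetI)
    fix u assume u: "u \<in> L2 ME"
    have "fst (Jt (RE u)) \<in> L2 M0" "fst (RZ (Jt u)) \<in> L2 M0"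
      using Jt_H[OF RE_L2[OF u]] RZ_H[OF Jt_H[OF u]] by (auto simp: H_zero_def)
    from L2_diff[OF this] show "Jt (RE u) - RZ (Jt u) \<in> H_zero lm lp"
      by (simp add: H_zero_def mem_Times_iff fun_diff_def)
  qed
  show "operator_norm (H_zero lm lp) (ip_zero lm lp) (H_eps lm lp \<alpha> \<beta> \<gamma> \<epsilon>) (ip_eps lm lp \<alpha> \<beta> \<gamma> \<epsilon>) (\<lambda>f. RE (J f) - J (RZ f))
      = operator_norm (H_eps lm lp \<alpha> \<beta> \<gamma> \<epsilon>) (ip_eps lm lp \<alpha> \<beta> \<gamma> \<epsilon>) (H_zero lm lp) (ip_zero lm lp) (\<lambda>u. Jt (RE u) - RZ (Jt u))"
    unfolding H_eps_def ip_eps_def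
    by (rule operator_norm_adjoint[OF ip_zero_space L2_ip_space T T']) (rule resolvent_difference_adjoint)
  show "operator_norm (H_zero lm lp) (ip_zero lm lp) (H_eps lm lp \<alpha> \<beta> \<gamma> \<epsilon>) (ip_eps lm lp \<alpha> \<beta> \<gamma> \<epsilon>) (\<lambda>f. RE (J f) - J (RZ f))
      \<le> ennreal (comm_const n * \<epsilon> powr (min \<alpha> (1/2 - \<beta>)))"
    unfolding H_eps_def ip_eps_def
  proof (rule operator_norm_le[OF ip_zero_space L2_ip_space T])
    show "0 \<le> comm_const n * \<epsilon> powr (min \<alpha> (1/2 - \<beta>))" using comm_const_pos[of n] by simp
    show "cmod (L2_inner ME (RE (J f) - J (RZ f)) u) \<le> comm_const n * \<epsilon> powr (min \<alpha> (1/2 - \<beta>)) * (ip_norm (ip_zero lm lp) f * ip_norm (L2_inner ME) u)"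
      if "f \<in> H_zero lm lp" "u \<in> L2 ME" for f u
      unfolding resolvent_difference_inner[OF that] ip_zero_norm L2_norm by (rule commutator_bound[OF that n])
  qed
qed

end

text \<open>It remains to derive the geometric inequalities of \<open>room_problem\<close> from the
  bounds on \<epsilon>0 and to choose the number of chain steps once for all \<epsilon>. Taking
  \<delta> = \<epsilon>0 keeps the constant within the fixed data.\<close>

theorem theorem2p1:
  fixes lm lp :: ereal and \<alpha> \<beta> \<gamma> \<epsilon>0 :: real and V0 :: "real \<Rightarrow> real"
  assumes "lm < 0" and "0 < lp"
    and "\<alpha> > 0" and "0 < \<beta>" and "\<beta> < 1/2" and "\<gamma> > 0"
    and "V0 \<in> Linf (lebesgue_on (Omega0 lm lp))"
    and "AE x in lebesgue_on (Omega0 lm lp). 0 \<le> V0 x"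
    and "\<epsilon>0 > 0"
    and "\<epsilon>0 < (2 * \<gamma>) powr (-1 / \<alpha>)" and "ereal \<epsilon>0 < \<bar>lm\<bar>" and "ereal \<epsilon>0 < lp"
    and "\<epsilon>0 < \<gamma> powr (-1 / (\<alpha> + 1 - \<beta>))"
    and "\<epsilon>0 < min \<gamma> (1 / \<gamma>)"
  shows "\<exists>C1>0. \<forall>\<epsilon>\<in>{0<..\<epsilon>0}.
    operator_norm (H_zero lm lp) (ip_zero lm lp)
        (H_eps lm lp \<alpha> \<beta> \<gamma> \<epsilon>) (ip_eps lm lp \<alpha> \<beta> \<gamma> \<epsilon>)
        (\<lambda>f. R_eps lm lp \<alpha> \<beta> \<gamma> V0 \<epsilon> (J_eps lm lp \<alpha> \<beta> \<epsilon> f)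
             - J_eps lm lp \<alpha> \<beta> \<epsilon> (R_zero lm lp \<gamma> V0 f))
      = operator_norm (H_eps lm lp \<alpha> \<beta> \<gamma> \<epsilon>) (ip_eps lm lp \<alpha> \<beta> \<gamma> \<epsilon>)
          (H_zero lm lp) (ip_zero lm lp)
          (\<lambda>u. Jt_eps \<alpha> \<beta> \<epsilon> (R_eps lm lp \<alpha> \<beta> \<gamma> V0 \<epsilon> u)
               - R_zero lm lp \<gamma> V0 (Jt_eps \<alpha> \<beta> \<epsilon> u))
    \<and> operator_norm (H_zero lm lp) (ip_zero lm lp)
        (H_eps lm lp \<alpha> \<beta> \<gamma> \<epsilon>) (ip_eps lm lp \<alpha> \<beta> \<gamma> \<epsilon>)
        (\<lambda>f. R_eps lm lp \<alpha> \<beta> \<gamma> V0 \<epsilon> (J_eps lm lp \<alpha> \<beta> \<epsilon> f)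
             - J_eps lm lp \<alpha> \<beta> \<epsilon> (R_zero lm lp \<gamma> V0 f))
      \<le> ennreal (C1 * \<epsilon> powr (min \<alpha> (1/2 - \<beta>)))"
proof -
  note a = assms
  obtain C where C: "AE x in lebesgue_on (Omega0 lm lp). \<bar>V0 x\<bar> \<le> C" and V0: "V0 \<in> borel_measurable (lebesgue_on (Omega0 lm lp))"
    using a(7) by (auto simp: Linf_def)
  have sub: "{-\<epsilon>0..\<epsilon>0} \<subseteq> Omega0 lm lp"
  proof
    fix x assume x: "x \<in> {-\<epsilon>0..\<epsilon>0}"
    have "lm < ereal (-\<epsilon>0)" using a(1,11) by (cases lm) auto
    also have "\<dots> \<le> ereal x" using x by simp
    finally have "lm < ereal x" .
    moreover have "ereal x < lp" using le_less_trans[OF _ a(12), of "ereal x"] x by simp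
    ultimately show "x \<in> Omega0 lm lp" by (simp add: Omega0_def)
  qed
  have L: "limit_problem lm lp V0 (max 0 C) \<gamma> \<epsilon>0"
  proof
    show "AE x in lebesgue_on (Omega0 lm lp). 0 \<le> V0 x \<and> V0 x \<le> max 0 C"
      using C a(8) by eventually_elim auto
  qed (use a V0 sub in auto)
  \<comment> \<open>The least number of steps with (\<alpha> + 1) / (2 n) \<le> \<beta>; it depends
    on \<alpha> and \<beta> only.\<close>
  define n where "n = nat \<lceil>(\<alpha> + 1) / (2 * \<beta>)\<rceil>"
  have q: "0 < (\<alpha> + 1) / (2 * \<beta>)" using a by simp
  have n: "0 < n" using q by (simp add: n_def)
  have "(\<alpha> + 1) / (2 * \<beta>) \<le> real n" unfolding n_def by (rule of_nat_ceiling)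
  then have n2: "\<alpha> + 1 \<le> 2 * \<beta> * real n" using a(4) by (simp add: field_simps)
  define C1 where "C1 = limit_problem.comm_const (max 0 C) \<gamma> \<epsilon>0 n"
  \<comment> \<open>One of \<gamma> and 1 / \<gamma> is at most 1.\<close>
  have \<epsilon>1: "\<epsilon>0 < 1"
  proof (cases "\<gamma> \<le> 1")
    case False
    then have "1 / \<gamma> < 1" by simp
    then show ?thesis using a(14) by simp
  qed (use a(14) in simp)
  have R: "room_problem lm lp V0 (max 0 C) \<gamma> \<epsilon>0 \<alpha> \<beta> \<epsilon>" if e: "\<epsilon> \<in> {0<..\<epsilon>0}" for \<epsilon>
  proof -
    \<comment> \<open>The bound (2 \<gamma>)^(-1/\<alpha>) gives 2 d \<le> \<epsilon>.\<close>
    have "\<epsilon> powr \<alpha> \<le> ((2 * \<gamma>) powr (-1 / \<alpha>)) powr \<alpha>"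
      by (rule powr_mono2) (use a e in auto)
    also have "\<dots> = 1 / (2 * \<gamma>)" unfolding powr_powr using a by (simp add: powr_minus_divide)
    finally have "2 * \<gamma> * \<epsilon> powr \<alpha> \<le> 1" using a(6) by (simp add: field_simps)
    then have "2 * \<gamma> * \<epsilon> powr \<alpha> * \<epsilon> \<le> 1 * \<epsilon>" by (rule mult_right_mono) (use e in simp)
    then have 1: "2 * (\<gamma> * \<epsilon> powr (\<alpha> + 1)) \<le> \<epsilon>" using e by (simp add: powr_add)
    \<comment> \<open>The bound \<gamma>^(-1/(\<alpha>+1-\<beta>)) gives d \<le> b.\<close>
    have "\<epsilon> powr (\<alpha> + 1 - \<beta>) \<le> (\<gamma> powr (-1 / (\<alpha> + 1 - \<beta>))) powr (\<alpha> + 1 - \<beta>)"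
      by (rule powr_mono2) (use a e in auto)
    also have "\<dots> = 1 / \<gamma>" unfolding powr_powr using a by (simp add: powr_minus_divide)
    finally have "\<gamma> * \<epsilon> powr (\<alpha> + 1 - \<beta>) \<le> 1" using a(6) by (simp add: field_simps)
    then have "\<gamma> * \<epsilon> powr (\<alpha> + 1 - \<beta>) * \<epsilon> powr \<beta> \<le> 1 * \<epsilon> powr \<beta>" by (rule mult_right_mono) simp
    then have 2: "\<gamma> * \<epsilon> powr (\<alpha> + 1) \<le> \<epsilon> powr \<beta>" unfolding mult.assoc powr_add[symmetric] by simp
    show ?thesis
      by (intro room_problem.intro L room_problem_axioms.intro) (use a e 1 2 \<epsilon>1 in auto)
  qed
  have "0 < C1" unfolding C1_def by (rule room_problem.comm_const_pos[OF R[of \<epsilon>0]]) (use a(9) in simp)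
  then show ?thesis
    by (intro exI[of _ C1] conjI ballI)
       (assumption | rule room_problem.resolvent_difference[OF R n n2, folded C1_def])+
qed

end
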